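(* Let $1<p<\infty$, $\lambda_\pm>0$, and let $u$ be a local minimizer of $J_{\mathrm{TP}}$ in the open set $D\subset\mathbb{R}^n$. Then the following hold on the free boundary $F(u)$. (A) Suppose that $Q$ is a comparison function that touches $u$ from below at $x_0$. (A.1) If $x_0\in\Gamma_{\mathrm{OP}}^+$, then $|\nabla Q^+(x_0)|\le\lambda_+$. (A.2) If $x_0\in\Gamma_{\mathrm{OP}}^-$, then $Q^+\equiv0$ in a neighborhood of $x_0$ and $|\nabla Q^-(x_0)|\ge\lambda_-$. (A.3) If $x_0\in\Gamma_{\mathrm{TP}}$, then $|\nabla Q^-(x_0)|\ge\lambda_-$ and $|\nabla Q^+(x_0)|^p-|\nabla Q^-(x_0)|^p\le\lambda_+^p-\lambda_-^p$. (B) Suppose that $Q$ is a comparison function that touches $u$ from above at $x_0$. (B.1) If $x_0\in\Gamma_{\mathrm{OP}}^+$, then $Q^-\equiv0$ in a neighborhood of $x_0$ and $|\nabla Q^+(x_0)|\ge\lambda_+$. (B.2) If $x_0\in\Gamma_{\mathrm{OP}}^-$, then $|\nabla Q^-(x_0)|\le\lambda_-$. (B.3) If $x_0\in\Gamma_{\mathrm{TP}}$, then $|\nabla Q^+(x_0)|\ge\lambda_+$ and $|\nabla Q^+(x_0)|^p-|\nabla Q^-(x_0)|^p\ge\lambda_+^p-\lambda_-^p$.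
   Context: $$J_{\mathrm{TP}}(v,D)=\int_D|\nabla v|^p+(p-1)\lambda_+^p\chi_{\{v>0\}}+(p-1)\lambda_-^p\chi_{\{v<0\}}\,dx.$$ $u$ is a local minimizer in $D$ if on every bounded smooth open $D'\Subset D$ it satisfies $J_{\mathrm{TP}}(u,D')\le J_{\mathrm{TP}}(v,D')$ for all $v\in u+W_0^{1,p}(D')$; $u$ is identified with its continuous representative. Notation: $u^\pm=\max\{\pm u,0\}$ (same for $Q^\pm$); $\Omega_u^\pm=\{x\in D:\pm u(x)>0\}$; $F(u)=(\partial\Omega_u^+\cup\partial\Omega_u^-)\cap D$; $\Gamma_{\mathrm{TP}}=\partial\Omega_u^+\cap\partial\Omega_u^-\cap D$; $\Gamma_{\mathrm{OP}}^+=(\partial\Omega_u^+\setminus\partial\Omega_u^-)\cap D$; $\Gamma_{\mathrm{OP}}^-=(\partial\Omega_u^-\setminus\partial\Omega_u^+)\cap D$. A function $Q:D\to\mathbb{R}$ touches $w:D\to\mathbb{R}$ from below (resp. above) at $x_0\in D$ if $Q(x_0)=w(x_0)$ and $Q-w\le0$ (resp. $Q-w\ge0$) in a neighborhood of $x_0$. A function $Q$ is a comparison function in $D$ if (a) $Q\in C^1(\overline{\{Q>0\}}\cap D)\cap C^1(\overline{\{Q<0\}}\cap D)$; (b) $Q\in C^2(\{Q>0\}\cap D)\cap C^2(\{Q<0\}\cap D)$; (c) $\partial\{Q>0\}$ and $\partial\{Q<0\}$ are smooth manifolds in $D$. At a zero $x_0$ of $Q$, $\nabla Q^\pm(x_0)$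 denotes the gradient of $Q^\pm$ at $x_0$ taken from within $\overline{\{\pm Q>0\}}$ (and is $0$ if $Q^\pm\equiv0$ near $x_0$). *)

theory Defs
  imports "HOL-Analysis.Analysis"
begin

section \<open>Classical differentiability\<close>

definition gradient :: "('a::euclidean_space \<Rightarrow> real) \<Rightarrow> 'a \<Rightarrow> 'a" where
  "gradient f x = (THE g. GDERIV f x :> g)"

(* Only meaningful on open S. All first directional derivatives are required to be of class
   C^k, which in finite dimension is the usual notion of C^(k+1). *)
primrec has_Ck_derivs ::
  "nat \<Rightarrow> ('a::euclidean_space \<Rightarrow> 'b::real_normed_vector) \<Rightarrow> 'a set \<Rightarrow> bool" where
  "has_Ck_derivs 0 f S = continuous_on S f"
| "has_Ck_derivs (Suc k) f S =
     ((\<forall>x\<in>S. f differentiable (at x)) \<and>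
      (\<forall>h. has_Ck_derivs k (\<lambda>x. frechet_derivative f (at x) h) S))"

definition Ck_on ::
  "nat \<Rightarrow> ('a::euclidean_space \<Rightarrow> 'b::real_normed_vector) \<Rightarrow> 'a set \<Rightarrow> bool" where
  "Ck_on k f S \<longleftrightarrow> open S \<and> has_Ck_derivs k f S"

definition Cinf_on ::
  "('a::euclidean_space \<Rightarrow> 'b::real_normed_vector) \<Rightarrow> 'a set \<Rightarrow> bool" where
  "Cinf_on f S \<longleftrightarrow> (\<forall>k. Ck_on k f S)"

(* C^1(closure A \<inter> D) for A open in D: f is C^1 in A, and f and its gradient extend
   continuously (f by its own values) to closure A \<inter> D. *)
definition C1_up_to_boundary ::
  "('a::euclidean_space \<Rightarrow> real) \<Rightarrow> 'a set \<Rightarrow> 'a set \<Rightarrow> bool" where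
  "C1_up_to_boundary f A D \<longleftrightarrow>
     continuous_on (closure A \<inter> D) f \<and>
     (\<exists>G. continuous_on (closure A \<inter> D) G \<and> (\<forall>x\<in>A. GDERIV f x :> G x))"

definition smooth_chart ::
  "'a::euclidean_space set \<Rightarrow> 'a set \<Rightarrow> ('a \<Rightarrow> 'a) \<Rightarrow> ('a \<Rightarrow> 'a) \<Rightarrow> bool" where
  "smooth_chart U V \<phi> \<psi> \<longleftrightarrow>
     homeomorphism U V \<phi> \<psi> \<and> Cinf_on \<phi> U \<and> Cinf_on \<psi> V"

(* Embedded smooth submanifold (without boundary). The dimension is not prescribed. *)
definition smooth_submanifold :: "'a::euclidean_space set \<Rightarrow> bool" where
  "smooth_submanifold M \<longleftrightarrow>
     (\<forall>x\<in>M. \<exists>U V \<phi> \<psi> L. x \<in> U \<and> smooth_chart U V \<phi> \<psi> \<and> subspace L \<and>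
        \<phi> ` (M \<inter> U) = L \<inter> V)"

(* Open set with smooth boundary, lying locally on one side of it. *)
definition smooth_open_set :: "'a::euclidean_space set \<Rightarrow> bool" where
  "smooth_open_set \<Omega> \<longleftrightarrow> open \<Omega> \<and>
     (\<forall>x\<in>frontier \<Omega>. \<exists>U V \<phi> \<psi>. \<exists>b\<in>Basis. x \<in> U \<and> smooth_chart U V \<phi> \<psi> \<and>
        \<phi> x \<bullet> b = 0 \<and> \<phi> ` (\<Omega> \<inter> U) = {y\<in>V. y \<bullet> b > 0})"


section \<open>Sobolev spaces\<close>

definition test_function :: "'a::euclidean_space set \<Rightarrow> ('a \<Rightarrow> real) \<Rightarrow> bool" where
  "test_function \<Omega> \<eta> \<longleftrightarrow> Cinf_on \<eta> UNIV \<and>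
     compact (closure {x. \<eta> x \<noteq> 0}) \<and> closure {x. \<eta> x \<noteq> 0} \<subseteq> \<Omega>"

definition locally_integrable ::
  "'a::euclidean_space set \<Rightarrow> ('a \<Rightarrow> 'b::euclidean_space) \<Rightarrow> bool" where
  "locally_integrable \<Omega> f \<longleftrightarrow> (\<forall>K. compact K \<and> K \<subseteq> \<Omega> \<longrightarrow> set_integrable lebesgue K f)"

definition has_weak_gradient ::
  "'a::euclidean_space set \<Rightarrow> ('a \<Rightarrow> real) \<Rightarrow> ('a \<Rightarrow> 'a) \<Rightarrow> bool" where
  "has_weak_gradient \<Omega> v g \<longleftrightarrow> locally_integrable \<Omega> v \<and> locally_integrable \<Omega> g \<and>
     (\<forall>\<eta>. test_function \<Omega> \<eta> \<longrightarrow>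
        (LINT x:\<Omega>|lebesgue. v x *\<^sub>R gradient \<eta> x) = - (LINT x:\<Omega>|lebesgue. \<eta> x *\<^sub>R g x))"

(* Determined up to a Lebesgue null set, whenever a weak gradient exists. *)
definition weak_gradient ::
  "'a::euclidean_space set \<Rightarrow> ('a \<Rightarrow> real) \<Rightarrow> 'a \<Rightarrow> 'a" where
  "weak_gradient \<Omega> v = (SOME g. has_weak_gradient \<Omega> v g)"

definition in_Lp ::
  "real \<Rightarrow> 'a::euclidean_space set \<Rightarrow> ('a \<Rightarrow> 'b::euclidean_space) \<Rightarrow> bool" where
  "in_Lp p \<Omega> f \<longleftrightarrow> set_borel_measurable lebesgue \<Omega> f \<and>
     set_integrable lebesgue \<Omega> (\<lambda>x. norm (f x) powr p)"

definition W1p :: "real \<Rightarrow> 'a::euclidean_space set \<Rightarrow> ('a \<Rightarrow> real) set" where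
  "W1p p \<Omega> = {v. in_Lp p \<Omega> v \<and> (\<exists>g. has_weak_gradient \<Omega> v g \<and> in_Lp p \<Omega> g)}"

definition W1p_norm :: "real \<Rightarrow> 'a::euclidean_space set \<Rightarrow> ('a \<Rightarrow> real) \<Rightarrow> real" where
  "W1p_norm p \<Omega> v =
     ((LINT x:\<Omega>|lebesgue. \<bar>v x\<bar> powr p) +
      (LINT x:\<Omega>|lebesgue. norm (weak_gradient \<Omega> v x) powr p)) powr (1 / p)"

(* Closure of the test functions in W1p. *)
definition W1p_zero :: "real \<Rightarrow> 'a::euclidean_space set \<Rightarrow> ('a \<Rightarrow> real) set" where
  "W1p_zero p \<Omega> = {v \<in> W1p p \<Omega>. \<exists>\<eta>. (\<forall>k. test_function \<Omega> (\<eta> k)) \<and>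
     (\<lambda>k. W1p_norm p \<Omega> (\<lambda>x. v x - \<eta> k x)) \<longlonglongrightarrow> 0}"


section \<open>The two-phase functional and its local minimizers\<close>

definition J_TP ::
  "real \<Rightarrow> real \<Rightarrow> real \<Rightarrow> ('a::euclidean_space \<Rightarrow> real) \<Rightarrow> 'a set \<Rightarrow> real" where
  "J_TP p lam_pos lam_neg v \<Omega> =
     (LINT x:\<Omega>|lebesgue. norm (weak_gradient \<Omega> v x) powr p
        + (p - 1) * lam_pos powr p * indicator {x. v x > 0} x
        + (p - 1) * lam_neg powr p * indicator {x. v x < 0} x)"

(* Membership of u in W1p on every admissible subdomain makes J_TP u finite there;
   continuity expresses that u is its continuous representative. *)
definition local_minimizer ::
  "real \<Rightarrow> real \<Rightarrow> real \<Rightarrow> 'a::euclidean_space set \<Rightarrow> ('a \<Rightarrow> real) \<Rightarrow> bool" where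
  "local_minimizer p lam_pos lam_neg D u \<longleftrightarrow> continuous_on D u \<and>
     (\<forall>D'. bounded D' \<and> smooth_open_set D' \<and> closure D' \<subseteq> D \<longrightarrow>
        u \<in> W1p p D' \<and>
        (\<forall>v. (\<lambda>x. v x - u x) \<in> W1p_zero p D' \<longrightarrow>
           J_TP p lam_pos lam_neg u D' \<le> J_TP p lam_pos lam_neg v D'))"


section \<open>Phases and free boundaries\<close>

definition pos_phase :: "'a set \<Rightarrow> ('a \<Rightarrow> real) \<Rightarrow> 'a set" where
  "pos_phase D u = {x \<in> D. u x > 0}"

definition neg_phase :: "'a set \<Rightarrow> ('a \<Rightarrow> real) \<Rightarrow> 'a set" where
  "neg_phase D u = {x \<in> D. u x < 0}"

definition free_boundary :: "'a::euclidean_space set \<Rightarrow> ('a \<Rightarrow> real) \<Rightarrow> 'a set" where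
  "free_boundary D u = (frontier (pos_phase D u) \<union> frontier (neg_phase D u)) \<inter> D"

definition Gamma_TP :: "'a::euclidean_space set \<Rightarrow> ('a \<Rightarrow> real) \<Rightarrow> 'a set" where
  "Gamma_TP D u = frontier (pos_phase D u) \<inter> frontier (neg_phase D u) \<inter> D"

definition Gamma_OP_pos :: "'a::euclidean_space set \<Rightarrow> ('a \<Rightarrow> real) \<Rightarrow> 'a set" where
  "Gamma_OP_pos D u = (frontier (pos_phase D u) - frontier (neg_phase D u)) \<inter> D"

definition Gamma_OP_neg :: "'a::euclidean_space set \<Rightarrow> ('a \<Rightarrow> real) \<Rightarrow> 'a set" where
  "Gamma_OP_neg D u = (frontier (neg_phase D u) - frontier (pos_phase D u)) \<inter> D"


section \<open>Comparison functions\<close>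

definition touches_from_below ::
  "'a::euclidean_space set \<Rightarrow> ('a \<Rightarrow> real) \<Rightarrow> ('a \<Rightarrow> real) \<Rightarrow> 'a \<Rightarrow> bool" where
  "touches_from_below D Q w x0 \<longleftrightarrow>
     x0 \<in> D \<and> Q x0 = w x0 \<and> (\<forall>\<^sub>F x in nhds x0. Q x - w x \<le> 0)"

definition touches_from_above ::
  "'a::euclidean_space set \<Rightarrow> ('a \<Rightarrow> real) \<Rightarrow> ('a \<Rightarrow> real) \<Rightarrow> 'a \<Rightarrow> bool" where
  "touches_from_above D Q w x0 \<longleftrightarrow>
     x0 \<in> D \<and> Q x0 = w x0 \<and> (\<forall>\<^sub>F x in nhds x0. Q x - w x \<ge> 0)"

(* Class C^2 on a phase includes that the phase is open; together with C^1 regularity up to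
   the boundary this makes Q continuous in D. *)
definition comparison_function :: "'a::euclidean_space set \<Rightarrow> ('a \<Rightarrow> real) \<Rightarrow> bool" where
  "comparison_function D Q \<longleftrightarrow>
     C1_up_to_boundary Q (pos_phase D Q) D \<and> C1_up_to_boundary Q (neg_phase D Q) D \<and>
     Ck_on 2 Q (pos_phase D Q) \<and> Ck_on 2 Q (neg_phase D Q) \<and>
     smooth_submanifold (frontier (pos_phase D Q) \<inter> D) \<and>
     smooth_submanifold (frontier (neg_phase D Q) \<inter> D)"

definition pos_part :: "('a \<Rightarrow> real) \<Rightarrow> 'a \<Rightarrow> real" where
  "pos_part f x = max (f x) 0"

definition neg_part :: "('a \<Rightarrow> real) \<Rightarrow> 'a \<Rightarrow> real" where
  "neg_part f x = max (- f x) 0"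

(* For w the positive or negative part of a comparison function and x0 a zero of w:
   the value at x0 of the continuous extension of the gradient from {w > 0} to its closure,
   and 0 if w vanishes near x0. *)
definition inner_gradient ::
  "'a::euclidean_space set \<Rightarrow> ('a \<Rightarrow> real) \<Rightarrow> 'a \<Rightarrow> 'a" where
  "inner_gradient D w x0 =
     (if \<forall>\<^sub>F x in nhds x0. w x = 0 then 0
      else Lim (at x0 within pos_phase D w) (gradient w))"

end

theory Submission
  imports Defs
begin

text \<open>No blow-up is needed. The first-order expansion of a comparison function that violates one of the inequalities
  yields near \<open>x0\<close> an explicit radial barrier \<open>w\<close>, a strict subsolution whose slope on its zero sphere
  violates the same inequality strictly; it lies below \<open>u\<close> near the boundary of a small ball
  but not at all points of the ball, so that \<open>max u w\<close> is an admissible competitor. A vector field of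
  signed divergence on either side of the zero sphere, equal to \<open>\<bar>\<nabla>w\<bar> powr (p - 2) *\<^sub>R \<nabla>w\<close> in the respective phase of
  \<open>w\<close>, calibrates the comparison: convexity of \<open>\<bar>\<xi>\<bar> powr p\<close> where the phases of \<open>u\<close> and \<open>w\<close> agree
  and Young's inequality where they differ show that \<open>max u w\<close> has strictly smaller energy than \<open>u\<close>.
  Statements about touching from above follow by passing to \<open>- u\<close>.\<close>

section \<open>Smooth functions\<close>

text \<open>The inequalities of the theorem come from the points where the phases of
  \<open>u\<close> and of the barrier \<open>w\<close> differ. The flux F = |\<nabla>w|^(p-2)
  \<nabla>w satisfies |F|^(p/(p-1)) = |\<nabla>w|^p, and Young's inequality yields the same factor p
  - 1 that weights the phases in the functional. Thus w > 0 = u asks for a positive slope of at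
  least l1, w > 0 > u for a difference of the p-th powers of the two slopes of at least l1^p - l2^p,
  and w = 0 > u, on a set of positive measure, for a negative slope below l2. One smooth field
  cannot carry two slopes, so the positive and the negative parts of \<open>u\<close> and
  \<open>w\<close> are tested against separate fields, each smooth across the zero sphere. All
  quantities scale with the radius r of the ball. The constants are fixed first; then r is taken so
  small that the o(r) error of the expansion is beaten by the curvature of the zero sphere near the
  equator and by the gap between slopes elsewhere. A vanishing negative slope gives no direction in
  which to place the sphere, hence a separate barrier centred at \<open>x0\<close>.\<close>

lemma has_Ck_derivs_cong:
  assumes "open S" "\<And>x. x \<in> S \<Longrightarrow> f x = g x" "has_Ck_derivs k f S"
  shows "has_Ck_derivs k g S"
  using assms(2,3)
proof (induction k arbitrary: f g)
  case 0
  then show ?case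
    by (metis continuous_on_cong has_Ck_derivs.simps(1))
next
  case (Suc k)
  have D: "(g has_derivative frechet_derivative f (at x)) (at x)" if "x \<in> S" for x
  proof -
    have "(f has_derivative frechet_derivative f (at x)) (at x)"
      using Suc.prems(2) that frechet_derivative_works by auto
    then show ?thesis
      by (rule has_derivative_transform_within_open[OF _ \<open>open S\<close> that]) (use Suc.prems(1) in auto)
  qed
  have E: "frechet_derivative f (at x) = frechet_derivative g (at x)" if "x \<in> S" for x
    using frechet_derivative_at[OF D[OF that]] by simp
  show ?case
  proof (simp, intro conjI ballI allI)
    show "g differentiable at x" if "x \<in> S" for x
      using D[OF that] differentiable_def by blast
    show "has_Ck_derivs k (\<lambda>x. frechet_derivative g (at x) h) S" for h
      by (rule Suc.IH[of "\<lambda>x. frechet_derivative f (at x) h"]) (use E Suc.prems in auto)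
  qed
qed

lemma has_Ck_derivs_SucI:
  assumes "open S" "\<And>x. x \<in> S \<Longrightarrow> (f has_derivative f' x) (at x)"
    "\<And>h. has_Ck_derivs k (\<lambda>x. f' x h) S"
  shows "has_Ck_derivs (Suc k) f S"
proof -
  have E: "frechet_derivative f (at x) = f' x" if "x \<in> S" for x
    using frechet_derivative_at[OF assms(2)[OF that]] by simp
  show ?thesis
  proof (simp, intro conjI ballI allI)
    show "f differentiable at x" if "x \<in> S" for x
      using assms(2)[OF that] differentiable_def by blast
    show "has_Ck_derivs k (\<lambda>x. frechet_derivative f (at x) h) S" for h
      by (rule has_Ck_derivs_cong[OF \<open>open S\<close> _ assms(3)[of h]]) (use E in auto)
  qed
qed

lemma has_Ck_derivs_SucD:
  assumes "has_Ck_derivs (Suc k) f S"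
  shows "\<And>x. x \<in> S \<Longrightarrow> (f has_derivative frechet_derivative f (at x)) (at x)"
    "\<And>h. has_Ck_derivs k (\<lambda>x. frechet_derivative f (at x) h) S"
  using assms frechet_derivative_works by auto

lemma has_Ck_derivs_pred: "has_Ck_derivs (Suc k) f S \<Longrightarrow> has_Ck_derivs k f S"
proof (induction k arbitrary: f)
  case 0
  then show ?case
    by (auto intro!: differentiable_imp_continuous_on simp: differentiable_on_def
        differentiable_at_withinI)
next
  case (Suc k)
  then show ?case by auto
qed

lemma has_Ck_derivs_const: "open S \<Longrightarrow> has_Ck_derivs k (\<lambda>x. c) S"
proof (induction k arbitrary: c)
  case (Suc k)
  then show ?case
    by (intro has_Ck_derivs_SucI[where f' = "\<lambda>x h. 0"]) auto
qed auto

lemma has_Ck_derivs_bounded_linear: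
  assumes "bounded_linear L" "open S"
  shows "has_Ck_derivs k L S"
proof (cases k)
  case 0
  then show ?thesis
    by (simp add: assms linear_continuous_on)
next
  case (Suc j)
  show ?thesis unfolding Suc
    by (rule has_Ck_derivs_SucI[where f' = "\<lambda>x h. L h"])
      (use assms bounded_linear_imp_has_derivative has_Ck_derivs_const in auto)
qed

lemma has_Ck_derivs_linear_compose:
  assumes "bounded_linear L" "open S" "has_Ck_derivs k f S"
  shows "has_Ck_derivs k (\<lambda>x. L (f x)) S"
  using assms(3)
proof (induction k arbitrary: f)
  case 0
  then show ?case
    using assms(1) by (simp add: bounded_linear.continuous_on)
next
  case (Suc k)
  show ?case
  proof (rule has_Ck_derivs_SucI[OF \<open>open S\<close>, where f' = "\<lambda>x h. L (frechet_derivative f (at x) h)"])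
    show "((\<lambda>x. L (f x)) has_derivative (\<lambda>h. L (frechet_derivative f (at x) h))) (at x)" if "x \<in> S" for x
      by (rule bounded_linear.has_derivative[OF assms(1) has_Ck_derivs_SucD(1)[OF Suc.prems that]])
  qed (use Suc.IH has_Ck_derivs_SucD(2)[OF Suc.prems] in blast)
qed

lemma has_Ck_derivs_add:
  assumes "open S" "has_Ck_derivs k f S" "has_Ck_derivs k g S"
  shows "has_Ck_derivs k (\<lambda>x. f x + g x) S"
  using assms(2,3)
proof (induction k arbitrary: f g)
  case 0
  then show ?case by (simp add: continuous_on_add)
next
  case (Suc k)
  show ?case
    by (rule has_Ck_derivs_SucI[OF \<open>open S\<close>,
          where f' = "\<lambda>x h. frechet_derivative f (at x) h + frechet_derivative g (at x) h"])
      (use Suc has_Ck_derivs_SucD[OF Suc.prems(1)] has_Ck_derivs_SucD[OF Suc.prems(2)] has_derivative_add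
        in \<open>auto simp del: has_Ck_derivs.simps\<close>)
qed

lemma has_Ck_derivs_sum:
  assumes "open S" "finite I" "\<And>i. i \<in> I \<Longrightarrow> has_Ck_derivs k (f i) S"
  shows "has_Ck_derivs k (\<lambda>x. \<Sum>i\<in>I. f i x) S"
  using assms(2,3)
proof (induction I rule: finite_induct)
  case empty
  then show ?case using has_Ck_derivs_const[OF \<open>open S\<close>] by simp
next
  case (insert i I)
  then show ?case by (simp add: has_Ck_derivs_add[OF \<open>open S\<close>])
qed

lemma has_Ck_derivs_bilinear:
  assumes B: "bounded_bilinear B" and "open S" "has_Ck_derivs k f S" "has_Ck_derivs k g S"
  shows "has_Ck_derivs k (\<lambda>x. B (f x) (g x)) S"
  using assms(3,4)
proof (induction k arbitrary: f g)
  case 0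
  then show ?case
    by (simp add: B bounded_bilinear.continuous_on)
next
  case (Suc k)
  show ?case
  proof (rule has_Ck_derivs_SucI[OF \<open>open S\<close>,
        where f' = "\<lambda>x h. B (f x) (frechet_derivative g (at x) h) + B (frechet_derivative f (at x) h) (g x)"])
    show "((\<lambda>x. B (f x) (g x)) has_derivative
        (\<lambda>h. B (f x) (frechet_derivative g (at x) h) + B (frechet_derivative f (at x) h) (g x))) (at x)"
      if "x \<in> S" for x
      by (rule bounded_bilinear.FDERIV[OF B]) (use that has_Ck_derivs_SucD Suc.prems in blast)+
    show "has_Ck_derivs k (\<lambda>x. B (f x) (frechet_derivative g (at x) h) + B (frechet_derivative f (at x) h) (g x)) S" for h
      by (intro has_Ck_derivs_add[OF \<open>open S\<close>] Suc.IH)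
        (use Suc.prems has_Ck_derivs_pred has_Ck_derivs_SucD in blast)+
  qed
qed

lemma has_Ck_derivs_compose:
  fixes f :: "'a::euclidean_space \<Rightarrow> 'b::euclidean_space" and g :: "'b \<Rightarrow> 'c::real_normed_vector"
  assumes "open S" "open T" "\<And>x. x \<in> S \<Longrightarrow> f x \<in> T"
    "has_Ck_derivs k f S" "has_Ck_derivs k g T"
  shows "has_Ck_derivs k (\<lambda>x. g (f x)) S"
  using assms(4,5)
proof (induction k arbitrary: g)
  case 0
  then show ?case
    using assms(3) by (auto intro: continuous_on_compose2)
next
  case (Suc k)
  let ?f' = "\<lambda>x. frechet_derivative f (at x)" and ?g' = "\<lambda>x. frechet_derivative g (at x)"
  \<comment> \<open>The definition controls \<open>?g' z h\<close> only for a fixed direction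
    \<open>h\<close>, whereas the chain rule applies \<open>?g'\<close> in the moving direction
    \<open>?f' x h\<close>. Expanding that direction in the basis leaves fixed directions with
    scalar coefficients, to which the induction applies.\<close>
  show ?case
  proof (rule has_Ck_derivs_SucI[OF \<open>open S\<close>, where f' = "\<lambda>x h. \<Sum>b\<in>Basis. (?f' x h \<bullet> b) *\<^sub>R ?g' (f x) b"])
    show "((\<lambda>x. g (f x)) has_derivative (\<lambda>h. \<Sum>b\<in>Basis. (?f' x h \<bullet> b) *\<^sub>R ?g' (f x) b)) (at x)"
      if "x \<in> S" for x
    proof -
      have f: "(f has_derivative ?f' x) (at x)" and g: "(g has_derivative ?g' (f x)) (at (f x))"
        using has_Ck_derivs_SucD(1) Suc.prems that assms(3) by blast+
      have "((\<lambda>x. g (f x)) has_derivative (\<lambda>h. ?g' (f x) (?f' x h))) (at x)"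
        using has_derivative_compose[OF f g] .
      moreover have "?g' (f x) (?f' x h) = (\<Sum>b\<in>Basis. (?f' x h \<bullet> b) *\<^sub>R ?g' (f x) b)" for h
      proof -
        have L: "linear (?g' (f x))"
          using g has_derivative_linear by blast
        have "?g' (f x) (\<Sum>b\<in>Basis. (?f' x h \<bullet> b) *\<^sub>R b) = (\<Sum>b\<in>Basis. (?f' x h \<bullet> b) *\<^sub>R ?g' (f x) b)"
          by (simp add: linear_sum[OF L] linear_cmul[OF L])
        then show ?thesis by (simp add: euclidean_representation)
      qed
      ultimately show ?thesis by simp
    qed
    show "has_Ck_derivs k (\<lambda>x. \<Sum>b\<in>Basis. (?f' x h \<bullet> b) *\<^sub>R ?g' (f x) b) S" for h
    proof (intro has_Ck_derivs_sum[OF \<open>open S\<close>] has_Ck_derivs_bilinear[OF bounded_bilinear_scaleR \<open>open S\<close>])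
      show "has_Ck_derivs k (\<lambda>x. ?f' x h \<bullet> b) S" for b
        by (rule has_Ck_derivs_linear_compose[OF bounded_linear_inner_left \<open>open S\<close>])
          (use has_Ck_derivs_SucD Suc.prems in blast)
      show "has_Ck_derivs k (\<lambda>x. ?g' (f x) b) S" for b
        by (rule Suc.IH[of "\<lambda>z. ?g' z b"])
         (use has_Ck_derivs_SucD Suc.prems has_Ck_derivs_pred in blast)+
    qed auto
  qed
qed

lemma has_Ck_derivs_subset: "has_Ck_derivs k f S \<Longrightarrow> T \<subseteq> S \<Longrightarrow> has_Ck_derivs k f T"
  by (induction k arbitrary: f) (auto intro: continuous_on_subset)

lemma has_Ck_derivs_Un:
  assumes "open S" "open T" "has_Ck_derivs k f S" "has_Ck_derivs k f T"
  shows "has_Ck_derivs k f (S \<union> T)"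
  using assms(3,4)
proof (induction k arbitrary: f)
  case 0
  then show ?case using assms(1,2) by (simp add: continuous_on_open_Un)
qed auto

lemma Cinf_on_open: "Cinf_on f S \<Longrightarrow> open S"
  by (simp add: Cinf_on_def Ck_on_def)

lemma Cinf_onI: "open S \<Longrightarrow> (\<And>k. has_Ck_derivs k f S) \<Longrightarrow> Cinf_on f S"
  by (simp add: Cinf_on_def Ck_on_def)

lemma Cinf_onD: "Cinf_on f S \<Longrightarrow> has_Ck_derivs k f S"
  by (simp add: Cinf_on_def Ck_on_def)

lemma Cinf_on_cong:
  assumes "Cinf_on f S" "\<And>x. x \<in> S \<Longrightarrow> f x = g x"
  shows "Cinf_on g S"
  by (rule Cinf_onI) (use assms Cinf_on_open Cinf_onD has_Ck_derivs_cong in blast)+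

lemma Cinf_on_subset: "Cinf_on f S \<Longrightarrow> open T \<Longrightarrow> T \<subseteq> S \<Longrightarrow> Cinf_on f T"
  by (meson Cinf_onD Cinf_onI has_Ck_derivs_subset)

lemma Cinf_on_Un: "Cinf_on f S \<Longrightarrow> Cinf_on f T \<Longrightarrow> Cinf_on f (S \<union> T)"
  by (meson Cinf_onD Cinf_onI Cinf_on_open has_Ck_derivs_Un open_Un)

lemma Cinf_on_const: "open S \<Longrightarrow> Cinf_on (\<lambda>x. c) S"
  by (simp add: Cinf_onI has_Ck_derivs_const)

lemma Cinf_on_linear: "open S \<Longrightarrow> bounded_linear L \<Longrightarrow> Cinf_on L S"
  by (simp add: Cinf_onI has_Ck_derivs_bounded_linear)

lemma Cinf_on_ident: "open S \<Longrightarrow> Cinf_on (\<lambda>x. x) S"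
  by (simp add: Cinf_on_linear bounded_linear_ident)

lemma Cinf_on_linear_compose:
  "bounded_linear L \<Longrightarrow> Cinf_on f S \<Longrightarrow> Cinf_on (\<lambda>x. L (f x)) S"
  by (rule Cinf_onI[OF Cinf_on_open], assumption, rule has_Ck_derivs_linear_compose[OF _ Cinf_on_open Cinf_onD])

lemma Cinf_on_add: "Cinf_on f S \<Longrightarrow> Cinf_on g S \<Longrightarrow> Cinf_on (\<lambda>x. f x + g x) S"
  by (rule Cinf_onI[OF Cinf_on_open], assumption, rule has_Ck_derivs_add[OF Cinf_on_open Cinf_onD Cinf_onD])

lemma Cinf_on_minus: "Cinf_on f S \<Longrightarrow> Cinf_on (\<lambda>x. - f x) S"
  by (rule Cinf_on_linear_compose[OF bounded_linear_minus[OF bounded_linear_ident]])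

lemma Cinf_on_diff: "Cinf_on f S \<Longrightarrow> Cinf_on g S \<Longrightarrow> Cinf_on (\<lambda>x. f x - g x) S"
  using Cinf_on_add[OF _ Cinf_on_minus] by fastforce

lemma Cinf_on_bilinear:
  "bounded_bilinear B \<Longrightarrow> Cinf_on f S \<Longrightarrow> Cinf_on g S \<Longrightarrow> Cinf_on (\<lambda>x. B (f x) (g x)) S"
  by (rule Cinf_onI[OF Cinf_on_open], assumption, rule has_Ck_derivs_bilinear[OF _ Cinf_on_open Cinf_onD Cinf_onD])

lemmas Cinf_on_mult = Cinf_on_bilinear[OF bounded_bilinear_mult]
lemmas Cinf_on_scaleR = Cinf_on_bilinear[OF bounded_bilinear_scaleR]
lemmas Cinf_on_inner = Cinf_on_bilinear[OF bounded_bilinear_inner]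

lemma Cinf_on_compose:
  fixes f :: "'a::euclidean_space \<Rightarrow> 'b::euclidean_space" and g :: "'b \<Rightarrow> 'c::real_normed_vector"
  shows "Cinf_on f S \<Longrightarrow> Cinf_on g T \<Longrightarrow> (\<And>x. x \<in> S \<Longrightarrow> f x \<in> T) \<Longrightarrow> Cinf_on (\<lambda>x. g (f x)) S"
  by (rule Cinf_onI[OF Cinf_on_open], assumption, rule has_Ck_derivs_compose[OF Cinf_on_open Cinf_on_open _ Cinf_onD Cinf_onD])

lemma Cinf_on_has_derivative:
  "Cinf_on f S \<Longrightarrow> x \<in> S \<Longrightarrow> (f has_derivative frechet_derivative f (at x)) (at x)"
  using Cinf_onD[of f S "Suc 0"] has_Ck_derivs_SucD(1) by blast

lemma Cinf_on_frechet:
  "Cinf_on f S \<Longrightarrow> Cinf_on (\<lambda>x. frechet_derivative f (at x) h) S"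
  by (rule Cinf_onI[OF Cinf_on_open], assumption, rule has_Ck_derivs_SucD(2)[OF Cinf_onD])

lemma Cinf_on_continuous: "Cinf_on f S \<Longrightarrow> continuous_on S f"
  using Cinf_onD[of f S 0] by simp

text \<open>A family closed under differentiation up to linear combinations is smooth: the induction
  on the order runs over all members at once, so higher derivatives never have to be written
  out.\<close>

lemma Cinf_on_real_family:
  fixes F :: "'i \<Rightarrow> real \<Rightarrow> real"
  assumes "open S"
    and "\<And>i. \<exists>a j b l. \<forall>t\<in>S. (F i has_real_derivative a * F j t + b * F l t) (at t)"
  shows "Cinf_on (F i) S"
proof (rule Cinf_onI[OF \<open>open S\<close>])
  fix k
  show "has_Ck_derivs k (F i) S"
  proof (induction k arbitrary: i)
    case 0
    obtain a j b l where D: "\<forall>t\<in>S. (F i has_real_derivative a * F j t + b * F l t) (at t)"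
      using assms(2) by blast
    then have "\<forall>t\<in>S. isCont (F i) t"
      using DERIV_isCont by blast
    then show ?case
      by (simp add: continuous_at_imp_continuous_on)
  next
    case (Suc k)
    obtain a j b l where D: "\<forall>t\<in>S. (F i has_real_derivative a * F j t + b * F l t) (at t)"
      using assms(2) by blast
    show ?case
    proof (rule has_Ck_derivs_SucI[OF \<open>open S\<close>, where f' = "\<lambda>t h. h * (a * F j t + b * F l t)"])
      show "(F i has_derivative (\<lambda>h. h * (a * F j t + b * F l t))) (at t)" if "t \<in> S" for t
        using D that by (simp add: has_field_derivative_def mult.commute[of _ "a * F j t + b * F l t"])
      show "has_Ck_derivs k (\<lambda>t. h * (a * F j t + b * F l t)) S" for h
        by (intro has_Ck_derivs_linear_compose[OF bounded_linear_mult_right \<open>open S\<close>]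
            has_Ck_derivs_add[OF \<open>open S\<close>] Suc.IH)
    qed
  qed
qed

section \<open>Powers, bump functions and cutoffs\<close>

lemma Cinf_on_powr: "Cinf_on (\<lambda>t::real. t powr a) {0<..}"
proof -
  have "Cinf_on ((\<lambda>a t::real. t powr a) a) {0<..}"
  proof (rule Cinf_on_real_family)
    fix a :: real
    have "\<forall>t\<in>{0<..}. ((\<lambda>t. t powr a) has_real_derivative a * t powr (a - 1) + 0 * t powr a) (at t)"
      by (auto intro!: derivative_eq_intros)
    then show "\<exists>c j b l. \<forall>t\<in>{0<..}. ((\<lambda>t. t powr a) has_real_derivative c * t powr j + b * t powr l) (at t)"
      by blast
  qed auto
  then show ?thesis by simp
qed

text \<open>The derivatives of these functions are linear combinations of functions of the same family; hence
  the flat function \<open>exp_family 0\<close> is smooth.\<close>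

definition exp_family :: "nat \<Rightarrow> real \<Rightarrow> real" where
  "exp_family m t = (if t > 0 then exp (- inverse t) * inverse t ^ m else 0)"

lemma exp_family_tendsto: "(exp_family m \<longlongrightarrow> 0) (at 0)"
proof -
  have R: "((\<lambda>t. exp (- inverse t) * inverse t ^ m) \<longlongrightarrow> 0) (at_right (0::real))"
  proof -
    have "((\<lambda>s::real. s ^ m / exp s) \<longlongrightarrow> 0) at_top"
      by (rule tendsto_power_div_exp_0)
    then have "((\<lambda>t::real. inverse t ^ m / exp (inverse t)) \<longlongrightarrow> 0) (at_right 0)"
      by (rule filterlim_compose[OF _ filterlim_inverse_at_top_right])
    then show ?thesis by (simp add: exp_minus field_simps)
  qed
  have "((exp_family m) \<longlongrightarrow> 0) (at_right 0)"
    by (rule Lim_transform_eventually[OF R])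
      (auto simp: exp_family_def eventually_at_right_field intro: exI[of _ 1])
  moreover have "((exp_family m) \<longlongrightarrow> 0) (at_left 0)"
    by (rule Lim_transform_eventually[OF tendsto_const])
      (auto simp: exp_family_def eventually_at_left_field intro: exI[of _ "-1"])
  ultimately show ?thesis by (simp add: filterlim_split_at)
qed

lemma exp_family_deriv:
  "(exp_family m has_real_derivative (- real m) * exp_family (Suc m) t + 1 * exp_family (m + 2) t) (at t)"
proof -
  consider "t > 0" | "t < 0" | "t = 0" by linarith
  then show ?thesis
  proof cases
    case 1
    have "((\<lambda>t. exp (- inverse t) * inverse t ^ m) has_real_derivative
       (- real m) * exp_family (Suc m) t + 1 * exp_family (m + 2) t) (at t)"
    proof -
      have "((\<lambda>t. exp (- inverse t) * inverse t ^ m) has_real_derivative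
         exp (- inverse t) * (inverse t)\<^sup>2 * inverse t ^ m
          + exp (- inverse t) * (real m * inverse t ^ (m - 1) * (- (inverse t)\<^sup>2))) (at t)"
        using 1 by (auto intro!: derivative_eq_intros simp: power2_eq_square)
      moreover have "real m * inverse t ^ (m - 1) * (inverse t)\<^sup>2 = real m * inverse t ^ (Suc m)"
        by (cases m) (auto simp: power2_eq_square)
      ultimately show ?thesis
        using 1 by (cases m) (simp_all add: exp_family_def power2_eq_square algebra_simps)
    qed
    then show ?thesis
      by (rule has_field_derivative_transform_within_open[where S = "{0<..}"])
        (use 1 in \<open>auto simp: exp_family_def\<close>)
  next
    case 2
    have "((\<lambda>t. 0) has_real_derivative (- real m) * exp_family (Suc m) t + 1 * exp_family (m + 2) t) (at t)"
      using 2 by (simp add: exp_family_def)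
    then show ?thesis
      by (rule has_field_derivative_transform_within_open[where S = "{..<0}"])
        (use 2 in \<open>auto simp: exp_family_def\<close>)
  next
    case 3
    \<comment> \<open>The difference quotient at 0 is itself the next member
      \<open>exp_family (Suc m)\<close>, which tends to 0.\<close>
    have "((\<lambda>y. (exp_family m y - exp_family m 0) / (y - 0)) \<longlongrightarrow> 0) (at 0)"
      by (rule Lim_transform_eventually[OF exp_family_tendsto[of "Suc m"]])
        (auto simp: exp_family_def field_simps)
    then show ?thesis
      using 3 by (simp add: has_field_derivative_iff exp_family_def)
  qed
qed

lemma Cinf_on_exp_family: "Cinf_on (exp_family m) UNIV"
  by (rule Cinf_on_real_family) (use exp_family_deriv in blast)+

text \<open>The squared distance, as an inner product, keeps the argument polynomial in
  \<open>x\<close>, so that smoothness holds at the centre too.\<close>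

definition bump :: "'a::euclidean_space \<Rightarrow> real \<Rightarrow> 'a \<Rightarrow> real" where
  "bump c r x = exp_family 0 (r\<^sup>2 - (x - c) \<bullet> (x - c))"

lemma Cinf_on_bump: "Cinf_on (bump c r) UNIV"
  unfolding bump_def
  by (intro Cinf_on_compose[OF _ Cinf_on_exp_family] Cinf_on_diff Cinf_on_const Cinf_on_inner Cinf_on_ident)
    auto

lemma bump_pos_iff: "r > 0 \<Longrightarrow> bump c r x > 0 \<longleftrightarrow> dist x c < r"
  by (auto simp: bump_def exp_family_def dist_norm power2_norm_eq_inner[symmetric]
      power_strict_mono dest: power2_less_imp_less)
    
lemma bump_nonneg: "bump c r x \<ge> 0"
  by (auto simp: bump_def exp_family_def)

definition smooth_step :: "real \<Rightarrow> real" where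
  "smooth_step t = exp_family 0 t / (exp_family 0 t + exp_family 0 (1 - t))"

lemma exp_family_nonneg: "exp_family m t \<ge> 0"
  by (auto simp: exp_family_def)

lemma exp_family_sum_pos: "exp_family 0 t + exp_family 0 (1 - t) > 0"
proof (cases "t > 0")
  case True
  then have "exp_family 0 t > 0" by (simp add: exp_family_def)
  then show ?thesis using exp_family_nonneg[of 0 "1 - t"] by linarith
next
  case False
  then have "exp_family 0 (1 - t) > 0" by (simp add: exp_family_def)
  then show ?thesis using exp_family_nonneg[of 0 t] by linarith
qed

lemma smooth_step_simps:
  "t \<le> 0 \<Longrightarrow> smooth_step t = 0" "t \<ge> 1 \<Longrightarrow> smooth_step t = 1"
  "0 \<le> smooth_step t" "smooth_step t \<le> 1"
proof -
  show "t \<le> 0 \<Longrightarrow> smooth_step t = 0" "t \<ge> 1 \<Longrightarrow> smooth_step t = 1"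
    by (auto simp: smooth_step_def exp_family_def)
  show "0 \<le> smooth_step t" "smooth_step t \<le> 1"
    using exp_family_sum_pos[of t] exp_family_nonneg[of 0 t] exp_family_nonneg[of 0 "1 - t"]
    by (simp_all add: smooth_step_def)
qed

lemma Cinf_on_smooth_step: "Cinf_on smooth_step UNIV"
proof -
  have "Cinf_on (\<lambda>t. exp_family 0 t * (exp_family 0 t + exp_family 0 (1 - t)) powr (-1)) UNIV"
  proof (intro Cinf_on_mult Cinf_on_exp_family Cinf_on_compose[OF _ Cinf_on_powr] Cinf_on_add
      Cinf_on_compose[OF _ Cinf_on_exp_family] Cinf_on_diff Cinf_on_const Cinf_on_ident)
    show "exp_family 0 t + exp_family 0 (1 - t) \<in> {0<..}" for t
      using exp_family_sum_pos[of t] by simp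
  qed auto
  then show ?thesis
  proof (rule Cinf_on_cong)
    show "exp_family 0 t * (exp_family 0 t + exp_family 0 (1 - t)) powr (-1) = smooth_step t" for t
      using exp_family_sum_pos[of t] by (simp add: smooth_step_def powr_minus_divide)
  qed
qed

lemma smooth_cutoff_exists:
  fixes c :: "'a::euclidean_space"
  assumes "0 \<le> a" "a < b"
  obtains \<zeta> :: "'a \<Rightarrow> real" where "Cinf_on \<zeta> UNIV" "\<And>x. dist x c \<le> a \<Longrightarrow> \<zeta> x = 1"
    "\<And>x. dist x c \<ge> b \<Longrightarrow> \<zeta> x = 0" "\<And>x. 0 \<le> \<zeta> x \<and> \<zeta> x \<le> 1"
proof
  define \<zeta> where "\<zeta> = (\<lambda>x::'a. smooth_step ((b\<^sup>2 - (x - c) \<bullet> (x - c)) * inverse (b\<^sup>2 - a\<^sup>2)))"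
  have ab: "b\<^sup>2 - a\<^sup>2 > 0"
    using assms by (simp add: power_strict_mono)
  have d: "(x - c) \<bullet> (x - c) = (dist x c)\<^sup>2" for x
    by (simp add: dist_norm power2_norm_eq_inner)
  show "Cinf_on \<zeta> UNIV" unfolding \<zeta>_def
    by (intro Cinf_on_compose[OF _ Cinf_on_smooth_step] Cinf_on_mult Cinf_on_diff Cinf_on_const
        Cinf_on_inner Cinf_on_ident) auto
  show "\<zeta> x = 1" if "dist x c \<le> a" for x
  proof -
    have "(dist x c)\<^sup>2 \<le> a\<^sup>2" using that by (simp add: power_mono)
    then show ?thesis unfolding \<zeta>_def d
      by (intro smooth_step_simps(2)) (use ab in \<open>simp add: field_simps\<close>)
  qed
  show "\<zeta> x = 0" if "dist x c \<ge> b" for x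
  proof -
    have "(dist x c)\<^sup>2 \<ge> b\<^sup>2" using that assms by (simp add: power_mono)
    then show ?thesis unfolding \<zeta>_def d
      by (intro smooth_step_simps(1)) (use ab in \<open>simp add: mult_le_0_iff\<close>)
  qed
  show "0 \<le> \<zeta> x \<and> \<zeta> x \<le> 1" for x
    by (simp add: \<zeta>_def smooth_step_simps)
qed

section \<open>Gradients of smooth functions\<close>

lemma gradient_eq: "GDERIV f x :> g \<Longrightarrow> gradient f x = g"
proof -
  assume g: "GDERIV f x :> g"
  have "h = g" if h: "GDERIV f x :> h" for h
  proof -
    have "(\<lambda>v. v \<bullet> h) = (\<lambda>v. v \<bullet> g)"
      using g h unfolding gderiv_def by (rule has_derivative_unique[rotated])
    then have "v \<bullet> h = v \<bullet> g" for v by meson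
    then show ?thesis by (metis inner_commute vector_eq_rdot)
  qed
  with g show ?thesis unfolding gradient_def by blast
qed

lemma has_derivative_GDERIV:
  assumes "(f has_derivative f') (at x)"
  shows "GDERIV f x :> (\<Sum>b\<in>Basis. f' b *\<^sub>R b)"
proof -
  interpret linear f' using assms has_derivative_linear by blast
  have "h \<bullet> (\<Sum>b\<in>Basis. f' b *\<^sub>R b) = f' h" for h
  proof -
    have "f' h = f' (\<Sum>b\<in>Basis. (h \<bullet> b) *\<^sub>R b)" by (simp add: euclidean_representation)
    also have "\<dots> = (\<Sum>b\<in>Basis. (h \<bullet> b) * f' b)" by (simp add: sum scale)
    finally show ?thesis by (simp add: inner_sum_right mult.commute)
  qed
  with assms show ?thesis unfolding gderiv_def by presburger
qed

lemma Cinf_on_GDERIV: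
  fixes f :: "'a::euclidean_space \<Rightarrow> real"
  shows "Cinf_on f S \<Longrightarrow> x \<in> S \<Longrightarrow> GDERIV f x :> gradient f x"
  by (metis Cinf_on_has_derivative gradient_eq has_derivative_GDERIV)

lemma Cinf_on_gradient:
  fixes f :: "'a::euclidean_space \<Rightarrow> real"
  assumes "Cinf_on f S"
  shows "Cinf_on (gradient f) S"
proof (rule Cinf_on_cong)
  show "Cinf_on (\<lambda>x. \<Sum>b\<in>Basis. frechet_derivative f (at x) b *\<^sub>R b) S"
    by (intro Cinf_onI[OF Cinf_on_open[OF assms]] has_Ck_derivs_sum has_Ck_derivs_bilinear[OF bounded_bilinear_scaleR]
        has_Ck_derivs_const Cinf_onD[OF Cinf_on_frechet[OF assms]] Cinf_on_open[OF assms]) auto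
  show "(\<Sum>b\<in>Basis. frechet_derivative f (at x) b *\<^sub>R b) = gradient f x" if "x \<in> S" for x
    using gradient_eq[OF has_derivative_GDERIV[OF Cinf_on_has_derivative[OF assms that]]] by simp
qed

lemma continuous_on_GDERIV:
  "(\<And>x. x \<in> S \<Longrightarrow> GDERIV f x :> G x) \<Longrightarrow> continuous_on S f"
  unfolding gderiv_def
  by (meson continuous_at_imp_continuous_on has_derivative_continuous)

lemma GDERIV_transform_open:
  assumes "GDERIV f x :> g" "open S" "x \<in> S" "\<And>y. y \<in> S \<Longrightarrow> f y = h y"
  shows "GDERIV h x :> g"
  using assms unfolding gderiv_def by (rule has_derivative_transform_within_open) 

section \<open>Balls are smooth open sets\<close>

text \<open>Balls are the subdomains on which minimality will be tested. Near \<open>x\<close> it is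
  enough to change one coordinate, in a direction \<open>b\<close> with nonzero component of
  \<open>x - c\<close>: it is replaced by r^2 - |y - c|^2, which is positive exactly inside the
  ball.\<close>

lemma smooth_open_set_ball:
  fixes c :: "'a::euclidean_space"
  assumes "r > 0"
  shows "smooth_open_set (ball c r)"
  unfolding smooth_open_set_def
proof (intro conjI ballI)
  show "open (ball c r)" by simp
next
  fix x assume "x \<in> frontier (ball c r)"
  then have xr: "dist c x = r" using assms by (simp add: frontier_ball)
  then have "x - c \<noteq> 0" using assms by auto
  then obtain b where b: "b \<in> Basis" "(x - c) \<bullet> b \<noteq> 0"
    by (metis euclidean_all_zero_iff)
  have bb: "b \<bullet> b = 1" using b by simp
  \<comment> \<open>The side of the hyperplane through \<open>c\<close> orthogonal to
    \<open>b\<close> on which \<open>x\<close> lies. Inverting the chart means solving a quadratic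
    equation for the \<open>b\<close>-coordinate, and \<sigma> selects the root.\<close>
  define \<sigma> where "\<sigma> = sgn ((x - c) \<bullet> b)"
  have sg: "\<sigma> * \<sigma> = 1" using b by (auto simp: \<sigma>_def sgn_if)
  define U where "U = {y. \<sigma> * ((y - c) \<bullet> b) > 0}"
  \<comment> \<open>Squared distance from the axis through \<open>c\<close> in direction
    \<open>b\<close>. It is unchanged by shifts along \<open>b\<close>, hence by \<phi> and \<psi>,
    and this lets \<psi> recover the lost coordinate.\<close>
  define q where "q = (\<lambda>y. (y - c) \<bullet> (y - c) - ((y - c) \<bullet> b) * ((y - c) \<bullet> b))"
  \<comment> \<open>The points where the square root in \<psi> has a positive argument, away from
    its singularity.\<close>
  define V where "V = {z. r\<^sup>2 - z \<bullet> b - q z > 0}"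
  define \<phi> where "\<phi> = (\<lambda>y. y + (r\<^sup>2 - (y - c) \<bullet> (y - c) - y \<bullet> b) *\<^sub>R b)"
  define \<psi> where "\<psi> = (\<lambda>z. z + (c \<bullet> b + \<sigma> * (r\<^sup>2 - z \<bullet> b - q z) powr (1/2) - z \<bullet> b) *\<^sub>R b)"
  have Cq: "Cinf_on q S" if "open S" for S unfolding q_def
    by (intro Cinf_on_diff Cinf_on_inner Cinf_on_mult Cinf_on_ident Cinf_on_const that)
  have oU: "open U" unfolding U_def
    by (intro open_Collect_less continuous_intros)
  have oV: "open V" unfolding V_def
    by (intro open_Collect_less continuous_intros Cinf_on_continuous[OF Cq]) auto
  have C\<phi>: "Cinf_on \<phi> U" unfolding \<phi>_def
    by (intro Cinf_on_add Cinf_on_scaleR Cinf_on_diff Cinf_on_inner Cinf_on_ident Cinf_on_const oU)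
  have C\<psi>: "Cinf_on \<psi> V" unfolding \<psi>_def
    by (intro Cinf_on_add Cinf_on_scaleR Cinf_on_diff Cinf_on_inner Cinf_on_ident Cinf_on_const oV
        Cinf_on_mult Cinf_on_compose[OF _ Cinf_on_powr] Cq) (simp add: V_def)
  have qshift: "q (y + s *\<^sub>R b) = q y" for y s
    by (simp add: q_def inner_diff_left inner_diff_right inner_add_left inner_add_right bb inner_commute algebra_simps)
  have \<phi>b: "\<phi> y \<bullet> b = r\<^sup>2 - (y - c) \<bullet> (y - c)" for y
    by (simp add: \<phi>_def inner_add_left bb)
  have q\<phi>: "q (\<phi> y) = q y" for y by (simp add: \<phi>_def qshift)
  have root: "r\<^sup>2 - \<phi> y \<bullet> b - q (\<phi> y) = ((y - c) \<bullet> b)\<^sup>2" for y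
    unfolding q\<phi> \<phi>b by (simp add: q_def power2_eq_square)
  have pw: "(t\<^sup>2) powr (1/2) = \<bar>t\<bar>" for t :: real
    by (simp add: powr_half_sqrt)
  have \<phi>V: "\<phi> y \<in> V" if "y \<in> U" for y
    unfolding V_def mem_Collect_eq root using that by (auto simp: U_def)
  have \<psi>\<phi>: "\<psi> (\<phi> y) = y" if "y \<in> U" for y
  proof -
    have "\<sigma> * \<bar>(y - c) \<bullet> b\<bar> = (y - c) \<bullet> b"
      using that b unfolding U_def \<sigma>_def by (auto simp: sgn_if split: if_splits)
    then have "\<psi> (\<phi> y) = \<phi> y + (c \<bullet> b + (y - c) \<bullet> b - \<phi> y \<bullet> b) *\<^sub>R b"
      unfolding \<psi>_def root pw by simp
    then show ?thesis
      unfolding \<phi>b by (simp add: \<phi>_def inner_diff_left algebra_simps)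
  qed
  have \<psi>b: "(\<psi> z - c) \<bullet> b = \<sigma> * (r\<^sup>2 - z \<bullet> b - q z) powr (1/2)" for z
    by (simp add: \<psi>_def inner_diff_left inner_add_left bb)
  have \<psi>U: "\<psi> z \<in> U" if "z \<in> V" for z
    using that sg unfolding U_def mem_Collect_eq \<psi>b by (simp add: V_def mult.assoc[symmetric])
  have \<phi>\<psi>: "\<phi> (\<psi> z) = z" if "z \<in> V" for z
  proof -
    define s where "s = (r\<^sup>2 - z \<bullet> b - q z) powr (1/2)"
    have s2: "s * s = r\<^sup>2 - z \<bullet> b - q z"
      using that by (simp add: s_def V_def flip: powr_add)
    have "q (\<psi> z) = q z" by (simp add: \<psi>_def qshift)
    then have "(\<psi> z - c) \<bullet> (\<psi> z - c) = q z + (\<sigma> * s) * (\<sigma> * s)"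
      using \<psi>b[of z] unfolding s_def q_def by (simp add: inner_commute)
    also have "\<dots> = r\<^sup>2 - z \<bullet> b"
    proof -
      have "(\<sigma> * s) * (\<sigma> * s) = (\<sigma> * \<sigma>) * (s * s)" by simp
      then show ?thesis unfolding sg s2 by simp
    qed
    finally have 1: "(\<psi> z - c) \<bullet> (\<psi> z - c) = r\<^sup>2 - z \<bullet> b" .
    have 2: "\<psi> z \<bullet> b = c \<bullet> b + \<sigma> * s"
      using \<psi>b[of z] by (simp add: s_def inner_diff_left)
    have "\<phi> (\<psi> z) = \<psi> z + (z \<bullet> b - (c \<bullet> b + \<sigma> * s)) *\<^sub>R b"
      unfolding \<phi>_def 1 2 by simp
    also have "\<dots> = z"
      unfolding \<psi>_def s_def[symmetric] by (simp add: algebra_simps)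
    finally show ?thesis .
  qed
  have "\<phi> ` U = V"
    using \<phi>V \<psi>U \<phi>\<psi> unfolding set_eq_iff image_iff by metis
  moreover have "\<psi> ` V = U"
    using \<phi>V \<psi>U \<psi>\<phi> unfolding set_eq_iff image_iff by metis
  ultimately have "homeomorphism U V \<phi> \<psi>"
    using \<phi>\<psi> \<psi>\<phi> Cinf_on_continuous[OF C\<phi>] Cinf_on_continuous[OF C\<psi>]
    by (simp add: homeomorphism_def)
  then have chart: "smooth_chart U V \<phi> \<psi>"
    by (simp add: smooth_chart_def C\<phi> C\<psi>)
  have inb: "y \<in> ball c r \<longleftrightarrow> \<phi> y \<bullet> b > 0" for y
  proof -
    have "y \<in> ball c r \<longleftrightarrow> (dist c y)\<^sup>2 < r\<^sup>2"
      using assms by (auto simp: power_strict_mono dest: power2_less_imp_less)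
    also have "(dist c y)\<^sup>2 = (y - c) \<bullet> (y - c)"
      by (metis dist_commute dist_norm power2_norm_eq_inner)
    finally show ?thesis unfolding \<phi>b by auto
  qed
  have "\<phi> ` (ball c r \<inter> U) = {y \<in> V. y \<bullet> b > 0}"
  proof
    show "\<phi> ` (ball c r \<inter> U) \<subseteq> {y \<in> V. y \<bullet> b > 0}" using \<phi>V inb by auto
    show "{y \<in> V. y \<bullet> b > 0} \<subseteq> \<phi> ` (ball c r \<inter> U)"
    proof
      fix z assume "z \<in> {y \<in> V. y \<bullet> b > 0}"
      then have z: "z \<in> V" "z \<bullet> b > 0" by auto
      then have "\<psi> z \<in> ball c r \<inter> U" using \<psi>U inb[of "\<psi> z"] \<phi>\<psi> by auto
      then show "z \<in> \<phi> ` (ball c r \<inter> U)" using \<phi>\<psi>[OF z(1)] by (metis image_eqI)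
    qed
  qed
  moreover have "\<phi> x \<bullet> b = 0"
    unfolding \<phi>b using xr by (simp add: dist_norm norm_minus_commute power2_norm_eq_inner[symmetric])
  moreover have "x \<in> U"
    using b by (auto simp: U_def \<sigma>_def sgn_if)
  ultimately show "\<exists>U V \<phi> \<psi>. \<exists>b\<in>Basis. x \<in> U \<and> smooth_chart U V \<phi> \<psi> \<and>
        \<phi> x \<bullet> b = 0 \<and> \<phi> ` (ball c r \<inter> U) = {y\<in>V. y \<bullet> b > 0}"
    using chart b(1) by blast
qed

section \<open>Integration of compactly supported functions\<close>

lemma integrable_compact_support:
  fixes f :: "'a::euclidean_space \<Rightarrow> 'b::euclidean_space"
  assumes "continuous_on UNIV f" "compact K" "\<And>x. x \<notin> K \<Longrightarrow> f x = 0"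
  shows "integrable lborel f" "integrable lebesgue f"
proof -
  have "integrable lborel (\<lambda>x. indicator K x *\<^sub>R f x)"
    using assms by (intro borel_integrable_compact) (auto intro: continuous_on_subset)
  moreover have "(\<lambda>x. indicator K x *\<^sub>R f x) = f"
    using assms(3) by (auto simp: indicator_def fun_eq_iff)
  ultimately show "integrable lborel f" by simp
  then show "integrable lebesgue f"
    by (intro integrable_completion[THEN iffD2]) (use borel_measurable_integrable in auto)
qed

text \<open>Difference quotients of \<open>f\<close> have integral 0 because Lebesgue measure is
  translation invariant. They are bounded by \<open>M\<close> and, the shifts having length at most
  1, supported in the ball of radius \<open>B + 1\<close>, so dominated convergence passes to the
  derivative.\<close>

lemma integral_gradient_compact_support:
  fixes f :: "'a::euclidean_space \<Rightarrow> real"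
  assumes G: "\<And>x. GDERIV f x :> G x" and cG: "continuous_on UNIV G"
    and K: "compact K" "\<And>x. x \<notin> K \<Longrightarrow> f x = 0"
  shows "integral\<^sup>L lebesgue G = 0"
proof -
  have cf: "continuous_on UNIV f" using G by (blast intro: continuous_on_GDERIV)
  have G0: "G x = 0" if "x \<notin> K" for x
  proof -
    have "GDERIV f x :> 0"
      by (rule GDERIV_transform_open[where f = "\<lambda>_. 0" and S = "- K"])
        (use that K compact_imp_closed in \<open>auto simp: open_Compl GDERIV_const\<close>)
    then show ?thesis using G[of x] gradient_eq by metis
  qed
  have iG: "integrable lborel G" by (rule integrable_compact_support[OF cG K(1) G0])
  obtain B0 where B0: "\<And>x. x \<in> K \<Longrightarrow> norm x \<le> B0"
    using compact_imp_bounded[OF K(1)] unfolding bounded_iff by blast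
  define B where "B = max B0 0"
  have B: "norm x \<le> B" if "x \<in> K" for x using B0[OF that] by (simp add: B_def)
  have "bounded (G ` K)"
    using K(1) cG by (meson compact_continuous_image compact_imp_bounded continuous_on_subset subset_UNIV)
  then obtain M0 where M0: "\<And>x. x \<in> K \<Longrightarrow> norm (G x) \<le> M0"
    unfolding bounded_iff by blast
  define M where "M = max M0 0"
  have M: "norm (G x) \<le> M" for x using M0[of x] G0[of x] by (cases "x \<in> K") (auto simp: M_def)
  have "integral\<^sup>L lborel G \<bullet> b = 0" if b: "b \<in> Basis" for b
  proof -
    define s where "s = (\<lambda>k x. (f (x + inverse (real (Suc k)) *\<^sub>R b) - f x) / inverse (real (Suc k)))"
    have cs: "continuous_on UNIV (s k)" for k
      unfolding s_def by (intro continuous_intros continuous_on_compose2[OF cf]) auto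
    have sb: "norm (s k x) \<le> M * indicator (cball 0 (B + 1)) x" for k x
    proof (cases "x \<in> cball 0 (B + 1)")
      case True
      let ?t = "inverse (real (Suc k))"
      have "norm (f (x + ?t *\<^sub>R b) - f x) \<le> M * norm (x + ?t *\<^sub>R b - x)"
      proof (rule differentiable_bound[where S = UNIV and f' = "\<lambda>x h. h \<bullet> G x"])
        show "(f has_derivative (\<lambda>h. h \<bullet> G y)) (at y within UNIV)" for y
          using G[of y] by (simp add: gderiv_def)
        show "onorm (\<lambda>h. h \<bullet> G y) \<le> M" for y
          using M[of y] Cauchy_Schwarz_ineq2[of _ "G y"]
          by (intro onorm_le) (smt (verit) mult.commute mult_left_mono norm_ge_zero real_norm_def)
      qed auto
      moreover have "norm (x + ?t *\<^sub>R b - x) = ?t" using b by simp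
      ultimately have "norm (f (x + ?t *\<^sub>R b) - f x) \<le> M * ?t" by simp
      then show ?thesis using True by (simp add: s_def divide_simps abs_mult)
    next
      case False
      then have "x \<notin> K" using B by force
      moreover have "x + inverse (real (Suc k)) *\<^sub>R b \<notin> K"
      proof
        assume "x + inverse (real (Suc k)) *\<^sub>R b \<in> K"
        then have "norm (x + inverse (real (Suc k)) *\<^sub>R b) \<le> B" by (rule B)
        moreover have "norm (inverse (real (Suc k)) *\<^sub>R b) \<le> 1" using b by (simp add: divide_simps)
        moreover have "norm x \<le> norm (x + inverse (real (Suc k)) *\<^sub>R b) + norm (inverse (real (Suc k)) *\<^sub>R b)"
          by (metis add_diff_cancel_right' norm_triangle_ineq4)
        ultimately show False using False by simp
      qed
      ultimately show ?thesis using K(2) by (simp add: s_def indicator_def M_def)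
    qed
    have lim: "(\<lambda>k. s k x) \<longlonglongrightarrow> G x \<bullet> b" for x
    proof -
      have "((\<lambda>t. f (x + t *\<^sub>R b)) has_derivative (\<lambda>t. (t *\<^sub>R b) \<bullet> G x)) (at 0)"
        by (rule has_derivative_compose[where f = "\<lambda>t. x + t *\<^sub>R b" and g = f and g' = "\<lambda>h. h \<bullet> G x"])
          (use G[of x] in \<open>auto simp: gderiv_def intro!: derivative_eq_intros\<close>)
      then have "((\<lambda>t. f (x + t *\<^sub>R b)) has_real_derivative (G x \<bullet> b)) (at 0)"
        by (simp add: has_field_derivative_def inner_commute mult_commute_abs)
      then have "((\<lambda>t. (f (x + t *\<^sub>R b) - f x) / t) \<longlongrightarrow> G x \<bullet> b) (at 0)"
        by (simp add: has_field_derivative_iff)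
      moreover have "filterlim (\<lambda>k. inverse (real (Suc k))) (at 0) sequentially"
        using LIMSEQ_inverse_real_of_nat by (auto simp: filterlim_at)
      ultimately show ?thesis unfolding s_def
        by (rule filterlim_compose)
    qed
    have "(\<lambda>k. integral\<^sup>L lborel (s k)) \<longlonglongrightarrow> integral\<^sup>L lborel (\<lambda>x. G x \<bullet> b)"
    proof (rule integral_dominated_convergence[where w = "\<lambda>x. M * indicator (cball 0 (B + 1)) x"])
      show "integrable lborel (\<lambda>x. M * indicator (cball 0 (B + 1)) x :: real)"
        by (intro integrable_mult_right integrable_real_indicator) (use emeasure_bounded_finite[OF bounded_cball] in auto)
      show "(\<lambda>x. G x \<bullet> b) \<in> borel_measurable lborel"
        using iG by auto
      show "s k \<in> borel_measurable lborel" for k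
        using borel_measurable_continuous_onI[OF cs] by simp
    qed (use lim sb in auto)
    moreover have "integral\<^sup>L lborel (s k) = 0" for k
    proof -
      let ?c = "inverse (real (Suc k)) *\<^sub>R b"
      have i1: "integrable lborel f" by (rule integrable_compact_support[OF cf K(1) K(2)])
      have d: "distr lborel borel ((+) ?c) = lborel" by (rule lborel_distr_plus)
      have "integrable (distr lborel borel ((+) ?c)) f" unfolding d by (rule i1)
      then have i2: "integrable lborel (\<lambda>x. f (?c + x))"
        by (subst (asm) integrable_distr_eq) (use i1 in auto)
      have "integral\<^sup>L lborel f = integral\<^sup>L (distr lborel borel ((+) ?c)) f" unfolding d ..
      also have "\<dots> = integral\<^sup>L lborel (\<lambda>x. f (?c + x))"
        by (subst integral_distr) (use i1 in auto)
      finally have "integral\<^sup>L lborel (\<lambda>x. f (?c + x)) - integral\<^sup>L lborel f = 0" by simp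
      then have "integral\<^sup>L lborel (\<lambda>x. f (?c + x) - f x) = 0"
        by (subst Bochner_Integration.integral_diff[OF i2 i1])
      then show ?thesis by (simp add: s_def add.commute)
    qed
    ultimately have "integral\<^sup>L lborel (\<lambda>x. G x \<bullet> b) = 0"
      by (simp add: LIMSEQ_const_iff)
    then show ?thesis using iG by simp
  qed
  then have "integral\<^sup>L lborel G = 0"
    by (metis euclidean_all_zero_iff)
  then show ?thesis
    using iG by (simp add: integral_completion)
qed

section \<open>Mollification\<close>

lemma lborel_distr_reflect:
  fixes x :: "'a::euclidean_space"
  shows "distr lborel borel (\<lambda>y. x - y) = lborel"
proof -
  have "lborel = density (distr lborel borel (\<lambda>y. x + (-1) *\<^sub>R y)) (\<lambda>_. \<bar>- 1 :: real\<bar> ^ DIM('a))"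
    by (rule lborel_affine) simp
  then show ?thesis by (simp add: density_1)
qed

lemma integral_reflect_lborel:
  fixes x :: "'a::euclidean_space" and g :: "'a \<Rightarrow> 'b::euclidean_space"
  assumes "g \<in> borel_measurable borel"
  shows "(\<integral>y. g (x - y) \<partial>lborel) = (\<integral>y. g y \<partial>lborel)"
proof -
  have "(\<integral>y. g y \<partial>lborel) = (\<integral>y. g y \<partial>distr lborel borel (\<lambda>y. x - y))"
    by (simp add: lborel_distr_reflect)
  also have "\<dots> = (\<integral>y. g (x - y) \<partial>lborel)"
    by (rule integral_distr) (use assms in auto)
  finally show ?thesis ..
qed

lemma diff_mem_cball_0: "(x::'a::euclidean_space) - y \<in> cball 0 \<delta> \<longleftrightarrow> y \<in> cball x \<delta>"
  by (simp only: mem_cball dist_norm, simp add: norm_minus_commute)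

definition mollifier :: "real \<Rightarrow> ('a::euclidean_space \<Rightarrow> real) \<Rightarrow> bool" where
  "mollifier \<delta> \<rho> \<longleftrightarrow> Cinf_on \<rho> UNIV \<and> (\<forall>x. 0 \<le> \<rho> x) \<and> (\<forall>x. x \<notin> cball 0 \<delta> \<longrightarrow> \<rho> x = 0)
     \<and> integral\<^sup>L lborel \<rho> = 1"

lemma mollifier_exists:
  assumes "\<delta> > 0"
  shows "\<exists>\<rho> :: 'a::euclidean_space \<Rightarrow> real. mollifier \<delta> \<rho>"
proof -
  let ?b = "bump (0::'a) \<delta>"
  have c: "continuous_on UNIV ?b" by (rule Cinf_on_continuous[OF Cinf_on_bump])
  have z: "?b x = 0" if "x \<notin> cball 0 \<delta>" for x
    using bump_pos_iff[OF assms, of 0 x] bump_nonneg[of 0 \<delta> x] that by auto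
  have i: "integrable lborel ?b"
    by (rule integrable_compact_support[OF c compact_cball z])
  have "integral\<^sup>L lborel ?b \<noteq> 0"
  proof
    assume "integral\<^sup>L lborel ?b = 0"
    then have "AE x in lborel. ?b x = 0"
      using integral_nonneg_eq_0_iff_AE[OF i] bump_nonneg by blast
    then have "AE x in lborel. x \<notin> ball (0::'a) \<delta>"
      by eventually_elim (metis assms bump_pos_iff dist_commute less_irrefl mem_ball)
    then have "ball (0::'a) \<delta> \<in> null_sets lborel"
      by (subst (asm) AE_iff_null_sets[symmetric]) auto
    then have "negligible (ball (0::'a) \<delta>)"
      by (simp add: negligible_iff_null_sets null_sets_completionI)
    then show False
      using open_not_negligible[of "ball (0::'a) \<delta>"] assms by auto
  qed
  moreover have "integral\<^sup>L lborel ?b \<ge> 0" by (simp add: bump_nonneg)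
  ultimately have pos: "integral\<^sup>L lborel ?b > 0" by linarith
  have "mollifier \<delta> (\<lambda>x. ?b x * inverse (integral\<^sup>L lborel ?b))"
    unfolding mollifier_def
    using pos z bump_nonneg
    by (auto intro!: Cinf_on_mult Cinf_on_bump Cinf_on_const mult_nonneg_nonneg)
  then show ?thesis by blast
qed

definition mollify :: "('a::euclidean_space \<Rightarrow> real) \<Rightarrow> ('a \<Rightarrow> 'b::euclidean_space) \<Rightarrow> 'a \<Rightarrow> 'b" where
  "mollify \<rho> f x = (\<integral>y. \<rho> (x - y) *\<^sub>R f y \<partial>lebesgue)"

lemma compact_support_bounded:
  fixes f :: "'a::euclidean_space \<Rightarrow> 'b::real_normed_vector"
  assumes "continuous_on UNIV f" "compact K" "\<And>x. x \<notin> K \<Longrightarrow> f x = 0"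
  obtains M where "M \<ge> 0" "\<And>x. norm (f x) \<le> M"
proof -
  have "bounded (f ` K)"
    using assms by (meson compact_continuous_image compact_imp_bounded continuous_on_subset subset_UNIV)
  then obtain M0 where M0: "\<And>x. x \<in> K \<Longrightarrow> norm (f x) \<le> M0"
    unfolding bounded_iff by blast
  have "norm (f x) \<le> max M0 0" for x
    using M0[of x] assms(3)[of x] by (cases "x \<in> K") auto
  then show ?thesis using that[of "max M0 0"] by auto
qed

lemma compact_support_uniformly_continuous:
  fixes f :: "'a::euclidean_space \<Rightarrow> 'b::real_normed_vector"
  assumes "continuous_on UNIV f" "\<And>x. x \<notin> cball 0 R \<Longrightarrow> f x = 0" "e > 0"
  obtains d where "d > 0" "\<And>x y. dist x y < d \<Longrightarrow> dist (f x) (f y) < e"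
proof -
  have "uniformly_continuous_on (cball 0 (R + 1)) f"
    using assms(1) by (intro compact_uniformly_continuous) (auto intro: continuous_on_subset)
  then obtain d where d: "d > 0" "\<And>x y. x \<in> cball 0 (R+1) \<Longrightarrow> y \<in> cball 0 (R+1) \<Longrightarrow> dist y x < d \<Longrightarrow> dist (f y) (f x) < e"
    unfolding uniformly_continuous_on_def using \<open>e > 0\<close> by metis
  \<comment> \<open>Uniform continuity is available on the larger ball only. If one of two points
    closer than 1 lies outside it, both lie outside the ball of radius \<open>R\<close>, where
    \<open>f\<close> vanishes.\<close>
  have "dist (f x) (f y) < e" if "dist x y < min d 1" for x y
  proof (cases "x \<in> cball 0 (R+1) \<and> y \<in> cball 0 (R+1)")
    case True
    then show ?thesis using d(2)[of y x] that by auto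
  next
    case False
    have "x \<notin> cball 0 R" "y \<notin> cball 0 R"
      using False that dist_triangle[of 0 x y] dist_triangle[of 0 y x] by (auto simp: dist_commute)
    then show ?thesis using assms(2,3) by simp
  qed
  then show ?thesis using that[of "min d 1"] d(1) by auto
qed

lemma continuous_compose_reflect:
  fixes f :: "'a::euclidean_space \<Rightarrow> 'b::topological_space"
  shows "continuous_on UNIV f \<Longrightarrow> continuous_on UNIV (\<lambda>y. f (x - y))"
  by (rule continuous_on_compose2[of UNIV f]) (auto intro!: continuous_intros)

lemma measurable_lebesgue_continuous:
  fixes f :: "'a::euclidean_space \<Rightarrow> 'b::euclidean_space"
  shows "continuous_on UNIV f \<Longrightarrow> f \<in> borel_measurable lebesgue"
  by (intro measurable_completion) (simp add: borel_measurable_continuous_onI)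

lemma mollify_integrable:
  fixes f :: "'a::euclidean_space \<Rightarrow> 'b::euclidean_space"
  assumes "continuous_on UNIV \<rho>" "\<And>x. x \<notin> cball 0 R \<Longrightarrow> \<rho> x = 0" "integrable lebesgue f"
  shows "integrable lebesgue (\<lambda>y. \<rho> (x - y) *\<^sub>R f y)"
proof -
  obtain M where M: "M \<ge> 0" "\<And>x. norm (\<rho> x) \<le> M"
    using compact_support_bounded[OF assms(1) compact_cball] assms(2) by metis
  have [measurable]: "(\<lambda>y. \<rho> (x - y)) \<in> borel_measurable lebesgue" "f \<in> borel_measurable lebesgue"
    using measurable_lebesgue_continuous[OF continuous_compose_reflect[OF assms(1)]] assms(3) by auto
  show ?thesis
  proof (rule Bochner_Integration.integrable_bound)
    show "integrable lebesgue (\<lambda>y. M * norm (f y))"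
      using assms(3) by simp
    show "AE y in lebesgue. norm (\<rho> (x - y) *\<^sub>R f y) \<le> norm (M * norm (f y))"
      using M by (auto intro!: mult_right_mono)
  qed measurable
qed

text \<open>All regularity sits in the kernel: its gradient is uniformly continuous, so the
  first-order remainder of \<rho> is at most e' * |h| uniformly in the base point. Integrating this
  against \<open>f\<close> needs integrability of \<open>f\<close> only.\<close>

lemma mollify_has_derivative:
  fixes f :: "'a::euclidean_space \<Rightarrow> 'b::euclidean_space" and \<rho> :: "'a \<Rightarrow> real"
  assumes C: "Cinf_on \<rho> UNIV" and z: "\<And>x. x \<notin> cball 0 R \<Longrightarrow> \<rho> x = 0" and f: "integrable lebesgue f"
  shows "(mollify \<rho> f has_derivative (\<lambda>h. mollify (\<lambda>z. h \<bullet> gradient \<rho> z) f x)) (at x)"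
proof -
  let ?G = "gradient \<rho>"
  have cG: "continuous_on UNIV ?G" by (rule Cinf_on_continuous[OF Cinf_on_gradient[OF C]])
  have D: "GDERIV \<rho> z :> ?G z" for z using Cinf_on_GDERIV[OF C] by simp
  have zG: "?G x = 0" if "x \<notin> cball 0 R" for x
    by (rule gradient_eq, rule GDERIV_transform_open[where f = "\<lambda>_. 0" and S = "- cball 0 R"])
      (use that z in \<open>auto simp: GDERIV_const open_Compl\<close>)
  have chG: "continuous_on UNIV (\<lambda>z. h \<bullet> ?G z)" for h by (intro continuous_intros cG)
  have zhG: "h \<bullet> ?G x = 0" if "x \<notin> cball 0 R" for x h using zG[OF that] by simp
  have i1: "integrable lebesgue (\<lambda>y. \<rho> (x - y) *\<^sub>R f y)" for x
    by (rule mollify_integrable[OF Cinf_on_continuous[OF C] z f])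
  have i2: "integrable lebesgue (\<lambda>y. (h \<bullet> ?G (x - y)) *\<^sub>R f y)" for x h
    by (rule mollify_integrable[OF chG zhG f])
  define N where "N = (\<integral>y. norm (f y) \<partial>lebesgue)"
  have N: "N \<ge> 0" by (simp add: N_def)
  obtain M where M: "M \<ge> 0" "\<And>x. norm (?G x) \<le> M"
    using compact_support_bounded[OF cG compact_cball zG] by metis
  have nb: "norm (\<integral>y. k y *\<^sub>R f y \<partial>lebesgue) \<le> c * N"
    if "integrable lebesgue (\<lambda>y. k y *\<^sub>R f y)" "\<And>y. \<bar>k y\<bar> \<le> c" for k :: "'a \<Rightarrow> real" and c
  proof -
    have "norm (\<integral>y. k y *\<^sub>R f y \<partial>lebesgue) \<le> (\<integral>y. c * norm (f y) \<partial>lebesgue)"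
      by (rule Bochner_Integration.integral_norm_bound_integral[OF that(1)])
        (use f that(2) in \<open>auto intro!: mult_right_mono\<close>)
    then show ?thesis by (simp add: N_def)
  qed
  have bl: "bounded_linear (\<lambda>h. mollify (\<lambda>z. h \<bullet> ?G z) f x)"
  proof (rule bounded_linear_intro[where K = "M * N"])
    fix h h' r
    show "mollify (\<lambda>z. (h + h') \<bullet> ?G z) f x = mollify (\<lambda>z. h \<bullet> ?G z) f x + mollify (\<lambda>z. h' \<bullet> ?G z) f x"
      unfolding mollify_def inner_add_left scaleR_add_left by (rule Bochner_Integration.integral_add[OF i2 i2])
    show "mollify (\<lambda>z. (r *\<^sub>R h) \<bullet> ?G z) f x = r *\<^sub>R mollify (\<lambda>z. h \<bullet> ?G z) f x"
      unfolding mollify_def inner_scaleR_left scaleR_scaleR[symmetric] by (rule integral_scaleR_right)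
    have "norm (mollify (\<lambda>z. h \<bullet> ?G z) f x) \<le> (norm h * M) * N"
      unfolding mollify_def
      by (rule nb[OF i2]) (meson Cauchy_Schwarz_ineq2 M(2) mult_left_mono norm_ge_zero order_trans)
    then show "norm (mollify (\<lambda>z. h \<bullet> ?G z) f x) \<le> norm h * (M * N)" by (simp add: mult.assoc)
  qed
  show ?thesis
    unfolding has_derivative_at_alt
  proof (intro conjI allI impI)
    fix e :: real assume "e > 0"
    \<comment> \<open>The 1 in the denominator covers \<open>N = 0\<close>.\<close>
    define e' where "e' = e / (N + 1)"
    have e': "e' > 0" using N \<open>e > 0\<close> by (simp add: e'_def)
    obtain d where d: "d > 0" "\<And>x y. dist x y < d \<Longrightarrow> dist (?G x) (?G y) < e'"
      using compact_support_uniformly_continuous[OF cG zG e'] by metis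
    have tay: "\<bar>\<rho> (z + h) - \<rho> z - h \<bullet> ?G z\<bar> \<le> e' * norm h" if h: "norm h < d" for z h
    proof -
      have "norm ((\<rho> (z + h) - (z + h) \<bullet> ?G z) - (\<rho> z - z \<bullet> ?G z)) \<le> e' * norm (z + h - z)"
      proof (rule differentiable_bound[where S = "ball z d" and f' = "\<lambda>y v. v \<bullet> ?G y - v \<bullet> ?G z"])
        show "((\<lambda>y. \<rho> y - y \<bullet> ?G z) has_derivative (\<lambda>v. v \<bullet> ?G y - v \<bullet> ?G z)) (at y within ball z d)" for y
          by (rule has_derivative_diff[OF has_derivative_at_withinI[OF D[of y, unfolded gderiv_def]]
                bounded_linear_imp_has_derivative[OF bounded_linear_inner_left]])
        show "onorm (\<lambda>v. v \<bullet> ?G y - v \<bullet> ?G z) \<le> e'" if "y \<in> ball z d" for y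
        proof (rule onorm_le)
          fix v
          have "norm (v \<bullet> ?G y - v \<bullet> ?G z) = \<bar>v \<bullet> (?G y - ?G z)\<bar>" by (simp add: inner_diff_right)
          also have "\<dots> \<le> norm v * norm (?G y - ?G z)" by (rule Cauchy_Schwarz_ineq2)
          also have "\<dots> \<le> norm v * e'"
            using d(2)[of y z] that by (intro mult_left_mono) (auto simp: dist_norm norm_minus_commute)
          finally show "norm (v \<bullet> ?G y - v \<bullet> ?G z) \<le> e' * norm v" by (simp add: mult.commute)
        qed
      qed (use h d in \<open>auto simp: dist_norm\<close>)
      then show ?thesis by (simp add: inner_add_left algebra_simps)
    qed
    have "norm (mollify \<rho> f y - mollify \<rho> f x - mollify (\<lambda>z. (y - x) \<bullet> ?G z) f x) \<le> e * norm (y - x)"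
      if y: "norm (y - x) < d" for y
    proof -
      have i3: "integrable lebesgue (\<lambda>z. (\<rho> (y - z) - \<rho> (x - z) - (y - x) \<bullet> ?G (x - z)) *\<^sub>R f z)"
        unfolding scaleR_diff_left by (intro Bochner_Integration.integrable_diff i1 i2)
      have "mollify \<rho> f y - mollify \<rho> f x - mollify (\<lambda>z. (y - x) \<bullet> ?G z) f x
        = (\<integral>z. (\<rho> (y - z) - \<rho> (x - z) - (y - x) \<bullet> ?G (x - z)) *\<^sub>R f z \<partial>lebesgue)"
        unfolding scaleR_diff_left mollify_def
          by (subst Bochner_Integration.integral_diff[OF Bochner_Integration.integrable_diff[OF i1 i1] i2],
            subst Bochner_Integration.integral_diff[OF i1 i1]) (rule refl)
      also have "norm \<dots> \<le> (e' * norm (y - x)) * N"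
        using tay[OF y, of "x - z" for z] by (intro nb i3) (simp add: algebra_simps)
      also have "\<dots> \<le> e * norm (y - x)"
      proof -
        have "e' * N \<le> e" using N \<open>e > 0\<close> by (simp add: e'_def field_simps)
        then have "(e' * N) * norm (y - x) \<le> e * norm (y - x)" by (intro mult_right_mono) auto
        then show ?thesis by (simp add: mult_ac)
      qed
      finally show ?thesis .
    qed
    with d(1) show "\<exists>d>0. \<forall>y. norm (y - x) < d \<longrightarrow>
        norm (mollify \<rho> f y - mollify \<rho> f x - mollify (\<lambda>z. (y - x) \<bullet> ?G z) f x) \<le> e * norm (y - x)"
      by blast
  qed (rule bl)
qed

lemma gradient_zero_outside_cball:
  assumes "\<And>x. x \<notin> cball 0 R \<Longrightarrow> \<rho> x = 0" "x \<notin> cball 0 R"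
  shows "gradient \<rho> x = 0"
  by (rule gradient_eq, rule GDERIV_transform_open[where f = "\<lambda>_. 0" and S = "- cball 0 R"])
    (use assms in \<open>auto simp: GDERIV_const open_Compl\<close>)

text \<open>The derivative in direction \<open>h\<close> is again a mollification, with kernel
  \<open>h \<bullet> gradient \<rho>\<close>. That kernel is no longer nonnegative or normalised, so
  the induction runs over all smooth compactly supported kernels.\<close>

lemma Cinf_on_mollify:
  fixes f :: "'a::euclidean_space \<Rightarrow> 'b::euclidean_space" and \<rho> :: "'a \<Rightarrow> real"
  assumes "Cinf_on \<rho> UNIV" "\<And>x. x \<notin> cball 0 R \<Longrightarrow> \<rho> x = 0" "integrable lebesgue f"
  shows "Cinf_on (mollify \<rho> f) UNIV"
proof (rule Cinf_onI)
  fix k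
  show "has_Ck_derivs k (mollify \<rho> f) UNIV"
    using assms(1,2)
  proof (induction k arbitrary: \<rho>)
    case 0
    have "continuous_on UNIV (mollify \<rho> f)"
      by (rule has_derivative_continuous_on, rule has_derivative_at_withinI,
          rule mollify_has_derivative[OF 0 assms(3)])
    then show ?case by simp
  next
    case (Suc k)
    show ?case
    proof (rule has_Ck_derivs_SucI[OF open_UNIV])
      show "(mollify \<rho> f has_derivative (\<lambda>h. mollify (\<lambda>z. h \<bullet> gradient \<rho> z) f x)) (at x)" for x
        by (rule mollify_has_derivative[OF Suc.prems assms(3)])
      show "has_Ck_derivs k (mollify (\<lambda>z. h \<bullet> gradient \<rho> z) f) UNIV" for h
      proof (rule Suc.IH)
        show "Cinf_on (\<lambda>z. h \<bullet> gradient \<rho> z) UNIV"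
          by (intro Cinf_on_inner Cinf_on_const Cinf_on_gradient Suc.prems) simp
        show "h \<bullet> gradient \<rho> x = 0" if "x \<notin> cball 0 R" for x
          using gradient_zero_outside_cball[OF Suc.prems(2) that] by simp
      qed
    qed
  qed
qed simp

lemma mollifier_integral_reflect:
  assumes "mollifier \<delta> \<rho>"
  shows "integrable lebesgue (\<lambda>y. \<rho> (x - y))" "(\<integral>y. \<rho> (x - y) \<partial>lebesgue) = 1"
    "integrable lborel (\<lambda>y. \<rho> (x - y))" "(\<integral>y. \<rho> (x - y) \<partial>lborel) = 1"
proof -
  have c: "continuous_on UNIV \<rho>" using assms Cinf_on_continuous by (auto simp: mollifier_def)
  note c' = continuous_compose_reflect[OF c, of x]
  show "integrable lebesgue (\<lambda>y. \<rho> (x - y))" "integrable lborel (\<lambda>y. \<rho> (x - y))"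
    by (rule integrable_compact_support[OF c' compact_cball[of x \<delta>]],
      use assms in \<open>simp add: mollifier_def diff_mem_cball_0 del: mem_cball mem_cball_0\<close>)+
  show 1: "(\<integral>y. \<rho> (x - y) \<partial>lborel) = 1"
    using integral_reflect_lborel[of \<rho> x] borel_measurable_continuous_onI[OF c] assms
    by (simp add: mollifier_def)
  show "(\<integral>y. \<rho> (x - y) \<partial>lebesgue) = 1"
    using borel_measurable_continuous_onI[OF c'] by (subst integral_completion) (use 1 in auto)
qed

text \<open>A mollification is an average over \<open>cball x \<delta>\<close>. With
  \<open>c = 0\<close> this transfers bounds, with \<open>c\<close> the value at \<open>x\<close> it
  gives convergence.\<close>

lemma mollify_close:
  fixes f :: "'a::euclidean_space \<Rightarrow> 'b::euclidean_space"
  assumes m: "mollifier \<delta> \<rho>" and f: "integrable lebesgue f"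
    and e: "\<And>y. y \<in> cball x \<delta> \<Longrightarrow> norm (f y - c) \<le> e"
  shows "norm (mollify \<rho> f x - c) \<le> e"
proof -
  have c: "continuous_on UNIV \<rho>" and z: "\<And>x. x \<notin> cball 0 \<delta> \<Longrightarrow> \<rho> x = 0" and nn: "\<And>x. \<rho> x \<ge> 0"
    using m Cinf_on_continuous by (auto simp: mollifier_def)
  have i1: "integrable lebesgue (\<lambda>y. \<rho> (x - y) *\<^sub>R f y)"
    by (rule mollify_integrable[OF c z f])
  have i2: "integrable lebesgue (\<lambda>y. \<rho> (x - y) *\<^sub>R c)"
    using mollifier_integral_reflect(1)[OF m] by simp
  have "mollify \<rho> f x - c = (\<integral>y. \<rho> (x - y) *\<^sub>R f y \<partial>lebesgue) - (\<integral>y. \<rho> (x - y) *\<^sub>R c \<partial>lebesgue)"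
    using mollifier_integral_reflect(1,2)[OF m, of x] by (simp add: mollify_def)
  also have "\<dots> = (\<integral>y. \<rho> (x - y) *\<^sub>R (f y - c) \<partial>lebesgue)"
    using Bochner_Integration.integral_diff[OF i1 i2] by (simp add: scaleR_diff_right)
  also have "norm \<dots> \<le> (\<integral>y. \<rho> (x - y) * e \<partial>lebesgue)"
  proof (rule Bochner_Integration.integral_norm_bound_integral)
    show "integrable lebesgue (\<lambda>y. \<rho> (x - y) *\<^sub>R (f y - c))"
      using Bochner_Integration.integrable_diff[OF i1 i2] by (simp add: scaleR_diff_right)
    show "integrable lebesgue (\<lambda>y. \<rho> (x - y) * e)"
      using mollifier_integral_reflect(1)[OF m] by simp
    show "norm (\<rho> (x - y) *\<^sub>R (f y - c)) \<le> \<rho> (x - y) * e" for y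
    proof (cases "y \<in> cball x \<delta>")
      case True
      then show ?thesis using e[OF True] nn[of "x - y"] by (simp add: mult_left_mono)
    next
      case False
      then have "\<rho> (x - y) = 0" by (intro z) (simp add: diff_mem_cball_0 del: mem_cball mem_cball_0)
      then show ?thesis by simp
    qed
  qed
  also have "\<dots> = e" using mollifier_integral_reflect(2)[OF m, of x] by simp
  finally show ?thesis .
qed

lemma mollify_eq_0:
  fixes f :: "'a::euclidean_space \<Rightarrow> 'b::euclidean_space"
  assumes "\<And>x. x \<notin> cball 0 \<delta> \<Longrightarrow> \<rho> x = 0" "\<And>y. y \<in> cball x \<delta> \<Longrightarrow> f y = 0"
  shows "mollify \<rho> f x = 0"
proof -
  have "\<rho> (x - y) *\<^sub>R f y = 0" for y
    using assms(1)[of "x - y"] assms(2)[of y] unfolding diff_mem_cball_0 by (cases "y \<in> cball x \<delta>") auto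
  then show ?thesis unfolding mollify_def by (simp del: scaleR_eq_0_iff)
qed

section \<open>Approximation in Lp\<close>

lemma powr_tangent:
  fixes s t p :: real
  assumes "1 \<le> p" "0 \<le> s" "0 < t"
  shows "t powr p + p * t powr (p - 1) * (s - t) \<le> s powr p"
proof (cases "s = 0")
  case True
  have "t powr p = t powr (p - 1) * t"
    using assms by (simp add: powr_diff)
  then have "t powr p + p * t powr (p - 1) * (0 - t) = (1 - p) * t powr p"
    by (simp add: algebra_simps)
  also have "\<dots> \<le> 0" using assms by (simp add: mult_nonpos_nonneg)
  finally show ?thesis using True assms by simp
next
  case False
  have "s powr p - t powr p \<ge> (p * t powr (p - 1)) * (s - t)"
  proof (rule convex_on_imp_above_tangent[where A = "{0<..}"])
    show "((\<lambda>x. x powr p) has_real_derivative p * t powr (p - 1)) (at t within {0<..})"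
      using assms by (auto intro!: derivative_eq_intros)
  qed (use assms False powr_convex in \<open>auto simp: interior_open\<close>)
  then show ?thesis by simp
qed

text \<open>Cauchy-Schwarz reduces the subgradient inequality of |.|^p to the tangent line of t^p.
  It serves twice, for Jensen's inequality under mollification and for the calibration where two
  phases agree. At \<open>w = 0\<close> the linear term vanishes.\<close>

lemma norm_powr_tangent:
  fixes w z :: "'a::real_inner"
  assumes "1 \<le> p"
  shows "norm w powr p + p * norm w powr (p - 2) * (w \<bullet> (z - w)) \<le> norm z powr p"
proof (cases "w = 0")
  case False
  have e: "norm w powr (p - 2) * (norm w * norm w) = norm w powr p"
    "norm w powr (p - 2) * norm w = norm w powr (p - 1)"
    using False powr_add[of "norm w" "p - 2" 2] powr_add[of "norm w" "p - 2" 1]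
    by (auto simp: power2_eq_square)
  have "w \<bullet> (z - w) \<le> norm w * norm z - norm w * norm w"
    using norm_cauchy_schwarz[of w z]
    by (simp add: inner_diff_right power2_norm_eq_inner[symmetric] power2_eq_square)
  then have "p * norm w powr (p - 2) * (w \<bullet> (z - w)) \<le> p * norm w powr (p - 2) * (norm w * norm z - norm w * norm w)"
    using assms by (intro mult_left_mono) auto
  also have "\<dots> = p * (norm w powr (p - 2) * norm w) * (norm z - norm w)"
    by (simp add: algebra_simps)
  also have "\<dots> = p * norm w powr (p - 1) * (norm z - norm w)" by (simp only: e)
  finally show ?thesis
    using powr_tangent[OF assms norm_ge_zero, of "norm w" z] False by simp
qed auto

text \<open>A crude substitute for Minkowski's inequality: bound the sum by twice the larger norm.
  Only smallness and finiteness of integrals are at stake, so the constant does not matter.\<close>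

lemma norm_add_powr_le:
  fixes a b :: "'a::real_normed_vector"
  assumes "0 \<le> p"
  shows "norm (a + b) powr p \<le> 2 powr p * (norm a powr p + norm b powr p)"
proof -
  let ?m = "max (norm a) (norm b)"
  have "norm (a + b) \<le> 2 * ?m" using norm_triangle_ineq[of a b] by linarith
  then have "norm (a + b) powr p \<le> (2 * ?m) powr p" using assms by (intro powr_mono2) auto
  also have "\<dots> = 2 powr p * ?m powr p" by (simp add: powr_mult)
  also have "\<dots> \<le> 2 powr p * (norm a powr p + norm b powr p)"
    by (intro mult_left_mono) (auto simp: max_def)
  finally show ?thesis .
qed

lemma norm_le_powr_bound:
  assumes "1 \<le> p" "0 \<le> (s::real)"
  shows "s \<le> 1 + s powr p"
proof (cases "s \<le> 1")
  case True
  then show ?thesis using powr_ge_zero[of s p] by linarith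
next
  case False
  then have "s powr 1 \<le> s powr p" using assms by (intro powr_mono) auto
  then show ?thesis using assms False by simp
qed

lemma integrable_of_Lp_bounded_support:
  fixes f :: "'a::euclidean_space \<Rightarrow> 'b::euclidean_space"
  assumes "1 \<le> p" "f \<in> borel_measurable lebesgue" "integrable lebesgue (\<lambda>x. norm (f x) powr p)"
    "\<And>x. x \<notin> cball 0 R \<Longrightarrow> f x = 0"
  shows "integrable lebesgue f"
proof (rule Bochner_Integration.integrable_bound)
  have "integrable lebesgue (indicator (cball 0 R) :: 'a \<Rightarrow> real)"
    using lmeasurable_cball[of 0 R] by (intro integrable_real_indicator) (auto simp: fmeasurable_def)
  then show "integrable lebesgue (\<lambda>x. indicator (cball 0 R) x + norm (f x) powr p)"
    using assms(3) by (rule Bochner_Integration.integrable_add)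
  show "AE x in lebesgue. norm (f x) \<le> norm (indicator (cball 0 R) x + norm (f x) powr p)"
  proof (intro AE_I2)
    fix x
    show "norm (f x) \<le> norm (indicator (cball 0 R) x + norm (f x) powr p)"
      using norm_le_powr_bound[OF assms(1) norm_ge_zero, of "f x"] assms(4)[of x]
      by (cases "x \<in> cball 0 R") auto
  qed
qed (rule assms(2))

lemma mollifier_integrable:
  fixes f :: "'a::euclidean_space \<Rightarrow> 'b::euclidean_space"
  assumes "mollifier \<delta> \<rho>" "integrable lebesgue f"
  shows "integrable lebesgue (\<lambda>y. \<rho> (x - y) *\<^sub>R f y)"
proof (rule mollify_integrable[OF _ _ assms(2)])
  show "continuous_on UNIV \<rho>" using assms(1) Cinf_on_continuous by (auto simp: mollifier_def)
  show "\<rho> x = 0" if "x \<notin> cball 0 \<delta>" for x using assms(1) that by (auto simp: mollifier_def)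
qed

lemma mollify_diff:
  fixes f g :: "'a::euclidean_space \<Rightarrow> 'b::euclidean_space"
  assumes "mollifier \<delta> \<rho>" "integrable lebesgue f" "integrable lebesgue g"
  shows "mollify \<rho> (\<lambda>x. f x - g x) x = mollify \<rho> f x - mollify \<rho> g x"
  unfolding mollify_def scaleR_diff_right
  by (intro Bochner_Integration.integral_diff mollifier_integrable[OF assms(1)] assms(2,3))

text \<open>Jensen's inequality for the probability density y \<mapsto> \<rho> (x - y): integrate
  the tangent inequality at the mean \<open>?w\<close>; the linear term has integral 0.\<close>

lemma mollify_powr_le:
  fixes f :: "'a::euclidean_space \<Rightarrow> 'b::euclidean_space"
  assumes p: "1 \<le> p" and m: "mollifier \<delta> \<rho>" and f: "integrable lebesgue f"
    and fp: "integrable lebesgue (\<lambda>x. norm (f x) powr p)"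
  shows "norm (mollify \<rho> f x) powr p \<le> (\<integral>y. \<rho> (x - y) * norm (f y) powr p \<partial>lebesgue)"
proof -
  have nn: "\<And>x. \<rho> x \<ge> 0"
    using m by (auto simp: mollifier_def)
  let ?w = "mollify \<rho> f x"
  let ?k = "p * norm ?w powr (p - 2)"
  note i1 = mollifier_integrable[OF m f, of x]
  note i2 = mollifier_integral_reflect(1)[OF m, of x]
  have i3: "integrable lebesgue (\<lambda>y. \<rho> (x - y) * norm (f y) powr p)"
    using mollifier_integrable[OF m fp, of x] by simp
  have i4: "integrable lebesgue (\<lambda>y. ?w \<bullet> (\<rho> (x - y) *\<^sub>R f y))"
    by (rule integrable_inner_right[OF i1])
  have "(\<integral>y. \<rho> (x - y) * (norm ?w powr p - ?k * (?w \<bullet> ?w)) + ?k * (?w \<bullet> (\<rho> (x - y) *\<^sub>R f y)) \<partial>lebesgue)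
      \<le> (\<integral>y. \<rho> (x - y) * norm (f y) powr p \<partial>lebesgue)"
  proof (rule integral_mono)
    show "integrable lebesgue (\<lambda>y. \<rho> (x - y) * (norm ?w powr p - ?k * (?w \<bullet> ?w)) + ?k * (?w \<bullet> (\<rho> (x - y) *\<^sub>R f y)))"
      by (intro Bochner_Integration.integrable_add integrable_mult_left integrable_mult_right i2 i4)
    fix y
    have "\<rho> (x - y) * (norm ?w powr p + ?k * (?w \<bullet> (f y - ?w))) \<le> \<rho> (x - y) * norm (f y) powr p"
      by (intro mult_left_mono nn norm_powr_tangent p)
    then show "\<rho> (x - y) * (norm ?w powr p - ?k * (?w \<bullet> ?w)) + ?k * (?w \<bullet> (\<rho> (x - y) *\<^sub>R f y))
        \<le> \<rho> (x - y) * norm (f y) powr p"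
      by (simp add: inner_diff_right algebra_simps)
  qed (rule i3)
  also have "(\<integral>y. \<rho> (x - y) * (norm ?w powr p - ?k * (?w \<bullet> ?w)) + ?k * (?w \<bullet> (\<rho> (x - y) *\<^sub>R f y)) \<partial>lebesgue)
    = (\<integral>y. \<rho> (x - y) * (norm ?w powr p - ?k * (?w \<bullet> ?w)) \<partial>lebesgue) + (\<integral>y. ?k * (?w \<bullet> (\<rho> (x - y) *\<^sub>R f y)) \<partial>lebesgue)"
    by (intro Bochner_Integration.integral_add integrable_mult_left integrable_mult_right i2 i4)
  also have "(\<integral>y. \<rho> (x - y) * (norm ?w powr p - ?k * (?w \<bullet> ?w)) \<partial>lebesgue) = norm ?w powr p - ?k * (?w \<bullet> ?w)"
    using mollifier_integral_reflect(2)[OF m, of x] by simp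
  also have "(\<integral>y. ?k * (?w \<bullet> (\<rho> (x - y) *\<^sub>R f y)) \<partial>lebesgue) = ?k * (?w \<bullet> ?w)"
  proof -
    have "(\<integral>y. ?w \<bullet> (\<rho> (x - y) *\<^sub>R f y) \<partial>lebesgue) = ?w \<bullet> ?w"
      using integral_inner_right[of ?w lebesgue "\<lambda>y. \<rho> (x - y) *\<^sub>R f y"] i1 by (simp add: mollify_def)
    then show ?thesis by (simp only: integral_mult_right_zero)
  qed
  finally show ?thesis by simp
qed

lemma mollify_measurable:
  fixes f :: "'a::euclidean_space \<Rightarrow> 'b::euclidean_space"
  assumes "mollifier \<delta> \<rho>" "integrable lebesgue f"
  shows "continuous_on UNIV (mollify \<rho> f)"
proof (rule Cinf_on_continuous[OF Cinf_on_mollify[OF _ _ assms(2)]])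
  show "Cinf_on \<rho> UNIV" using assms(1) by (simp add: mollifier_def)
  show "\<rho> x = 0" if "x \<notin> cball 0 \<delta>" for x using assms(1) that by (auto simp: mollifier_def)
qed

text \<open>Passing to a Borel representative of \<open>norm f powr p\<close> makes Tonelli's theorem on
  \<^const>\<open>lborel\<close> applicable.\<close>

lemma mollify_Lp_le:
  fixes f :: "'a::euclidean_space \<Rightarrow> 'b::euclidean_space"
  assumes p: "1 \<le> p" and m: "mollifier \<delta> \<rho>" and f: "integrable lebesgue f"
    and fp: "integrable lebesgue (\<lambda>x. norm (f x) powr p)"
  shows "integrable lebesgue (\<lambda>x. norm (mollify \<rho> f x) powr p)"
    "(\<integral>x. norm (mollify \<rho> f x) powr p \<partial>lebesgue) \<le> (\<integral>x. norm (f x) powr p \<partial>lebesgue)"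
proof -
  have c: "continuous_on UNIV \<rho>" and z: "\<And>x. x \<notin> cball 0 \<delta> \<Longrightarrow> \<rho> x = 0" and nn: "\<And>x. \<rho> x \<ge> 0"
    using m Cinf_on_continuous by (auto simp: mollifier_def)
  have \<rho>m[measurable]: "\<rho> \<in> borel_measurable borel" by (rule borel_measurable_continuous_onI[OF c])
  obtain g where g[measurable]: "g \<in> borel_measurable lborel" and ae: "AE x in lborel. norm (f x) powr p = g x"
    using completion_ex_borel_measurable_real[OF borel_measurable_integrable[OF fp]] by blast
  have cm: "continuous_on UNIV (mollify \<rho> f)" using mollify_measurable[OF m f] .
  have mm[measurable]: "(\<lambda>x. norm (mollify \<rho> f x) powr p) \<in> borel_measurable borel"
    using borel_measurable_continuous_onI[OF cm] by measurable
  have ae': "AE x in lebesgue. norm (f x) powr p = g x" using ae by (rule AE_completion)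
  have "(\<integral>\<^sup>+x. ennreal (norm (mollify \<rho> f x) powr p) \<partial>lborel)
     \<le> (\<integral>\<^sup>+x. (\<integral>\<^sup>+y. ennreal (\<rho> (x - y)) * ennreal (g y) \<partial>lborel) \<partial>lborel)"
  proof (rule nn_integral_mono)
    fix x
    have i3: "integrable lebesgue (\<lambda>y. \<rho> (x - y) * norm (f y) powr p)"
      using mollifier_integrable[OF m fp, of x] by simp
    have "ennreal (norm (mollify \<rho> f x) powr p) \<le> ennreal (\<integral>y. \<rho> (x - y) * norm (f y) powr p \<partial>lebesgue)"
      by (rule ennreal_leI[OF mollify_powr_le[OF p m f fp]])
    also have "\<dots> = (\<integral>\<^sup>+y. ennreal (\<rho> (x - y) * norm (f y) powr p) \<partial>lebesgue)"
      using nn by (intro nn_integral_eq_integral[symmetric] i3) auto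
    also have "\<dots> = (\<integral>\<^sup>+y. ennreal (\<rho> (x - y)) * ennreal (g y) \<partial>lebesgue)"
      using ae' nn by (intro nn_integral_cong_AE) (auto simp: ennreal_mult' elim: eventually_mono)
    also have "\<dots> = (\<integral>\<^sup>+y. ennreal (\<rho> (x - y)) * ennreal (g y) \<partial>lborel)"
      by (rule nn_integral_completion)
    finally show "ennreal (norm (mollify \<rho> f x) powr p) \<le> (\<integral>\<^sup>+y. ennreal (\<rho> (x - y)) * ennreal (g y) \<partial>lborel)" .
  qed
  also have "\<dots> = (\<integral>\<^sup>+y. (\<integral>\<^sup>+x. ennreal (\<rho> (x - y)) * ennreal (g y) \<partial>lborel) \<partial>lborel)"
    by (rule lborel_pair.Fubini') measurable
  also have "\<dots> = (\<integral>\<^sup>+y. ennreal (g y) \<partial>lborel)"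
  proof (rule nn_integral_cong)
    fix y
    have "(\<integral>\<^sup>+x. ennreal (\<rho> (x - y)) \<partial>lborel) = (\<integral>\<^sup>+x. ennreal (\<rho> x) \<partial>lborel)"
    proof -
      have "(\<integral>\<^sup>+x. ennreal (\<rho> x) \<partial>lborel) = (\<integral>\<^sup>+x. ennreal (\<rho> x) \<partial>distr lborel borel ((+) (- y)))"
        by (simp add: lborel_distr_plus)
      also have "\<dots> = (\<integral>\<^sup>+x. ennreal (\<rho> (- y + x)) \<partial>lborel)"
        by (rule nn_integral_distr) auto
      finally show ?thesis by simp
    qed
    also have "\<dots> = ennreal (integral\<^sup>L lborel \<rho>)"
      using nn by (intro nn_integral_eq_integral integrable_compact_support(1)[OF c compact_cball, of 0 \<delta>] z) auto
    finally have "(\<integral>\<^sup>+x. ennreal (\<rho> (x - y)) \<partial>lborel) = 1" using m by (simp add: mollifier_def)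
    then show "(\<integral>\<^sup>+x. ennreal (\<rho> (x - y)) * ennreal (g y) \<partial>lborel) = ennreal (g y)"
      by (simp add: nn_integral_multc)
  qed
  also have "\<dots> = (\<integral>\<^sup>+y. ennreal (norm (f y) powr p) \<partial>lborel)"
    using ae by (intro nn_integral_cong_AE) (auto elim: eventually_mono)
  also have "\<dots> = (\<integral>\<^sup>+y. ennreal (norm (f y) powr p) \<partial>lebesgue)"
    by (simp add: nn_integral_completion)
  also have "\<dots> = ennreal (\<integral>x. norm (f x) powr p \<partial>lebesgue)"
    by (rule nn_integral_eq_integral[OF fp]) simp
  finally have le: "(\<integral>\<^sup>+x. ennreal (norm (mollify \<rho> f x) powr p) \<partial>lborel)
    \<le> ennreal (\<integral>x. norm (f x) powr p \<partial>lebesgue)" .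
  have i: "integrable lborel (\<lambda>x. norm (mollify \<rho> f x) powr p)"
    by (rule integrableI_bounded) (use le in \<open>auto simp: less_top[symmetric] top_unique\<close>)
  then show "integrable lebesgue (\<lambda>x. norm (mollify \<rho> f x) powr p)"
    by (subst integrable_completion) auto
  have "ennreal (\<integral>x. norm (mollify \<rho> f x) powr p \<partial>lborel) \<le> ennreal (\<integral>x. norm (f x) powr p \<partial>lebesgue)"
    using le by (subst nn_integral_eq_integral[symmetric, OF i]) auto
  then have "(\<integral>x. norm (mollify \<rho> f x) powr p \<partial>lborel) \<le> (\<integral>x. norm (f x) powr p \<partial>lebesgue)"
    by (subst (asm) ennreal_le_iff) auto
  then show "(\<integral>x. norm (mollify \<rho> f x) powr p \<partial>lebesgue) \<le> (\<integral>x. norm (f x) powr p \<partial>lebesgue)"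
    by (subst integral_completion) auto
qed

text \<open>Two approximations in a row: truncation of the values, then almost everywhere
  convergence of continuous functions. The truncation and a spatial cutoff supply the integrable
  bound for the second limit.\<close>

lemma Lp_dense_continuous:
  fixes f :: "'a::euclidean_space \<Rightarrow> 'b::euclidean_space"
  assumes p: "1 \<le> p" and fm[measurable]: "f \<in> borel_measurable lebesgue"
    and fp: "integrable lebesgue (\<lambda>x. norm (f x) powr p)"
    and R: "\<And>x. x \<notin> cball 0 R \<Longrightarrow> f x = 0" and "e > 0" and "R \<ge> 0"
  obtains h where "continuous_on UNIV h" "\<And>x. x \<notin> cball 0 (R + 1) \<Longrightarrow> h x = 0"
    "integrable lebesgue (\<lambda>x. norm (f x - h x) powr p)"
    "(\<integral>x. norm (f x - h x) powr p \<partial>lebesgue) < e"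
proof -
  define e' where "e' = e / (2 * 2 powr p)"
  have e': "e' > 0" using \<open>e > 0\<close> by (simp add: e'_def)
  \<comment> \<open>Nearest-point projection onto the ball of radius \<open>N\<close>: a truncation
    for vector values that is continuous, so it may be composed with continuous approximants, and
    fixes 0.\<close>
  define cl where "cl N v = closest_point (cball (0::'b) (real N)) v" for N v
  have cl_cont: "continuous_on UNIV (cl N)" for N
    unfolding cl_def by (rule continuous_on_closest_point) auto
  have cl_b: "norm (cl N v) \<le> real N" for N v
    using closest_point_in_set[of "cball (0::'b) (real N)" v] by (simp add: cl_def)
  have cl_id: "cl N v = v" if "norm v \<le> real N" for N v
    using closest_point_self[of v "cball 0 (real N)"] that by (simp add: cl_def)
  have cl_le: "norm (v - cl N v) \<le> norm v" for N v
    using closest_point_le[of "cball (0::'b) (real N)" 0 v] by (simp add: cl_def dist_norm)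
  have clm[measurable]: "cl N \<in> borel_measurable borel" for N
    by (rule borel_measurable_continuous_onI[OF cl_cont])
  have "(\<lambda>N. \<integral>x. norm (f x - cl N (f x)) powr p \<partial>lebesgue) \<longlonglongrightarrow> (\<integral>x. 0 \<partial>(lebesgue :: 'a measure))"
  proof (rule integral_dominated_convergence[OF _ _ fp])
    show "AE x in lebesgue. (\<lambda>N. norm (f x - cl N (f x)) powr p) \<longlonglongrightarrow> 0"
    proof (intro AE_I2 tendsto_eventually)
      fix x
      obtain N0 where "norm (f x) \<le> real N0" using real_arch_simple by blast
      then show "\<forall>\<^sub>F N in sequentially. norm (f x - cl N (f x)) powr p = 0"
        by (intro eventually_sequentiallyI[of N0]) (simp add: cl_id)
    qed
    show "AE x in lebesgue. norm (norm (f x - cl N (f x)) powr p) \<le> norm (f x) powr p" for N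
      using p cl_le by (auto intro!: powr_mono2)
  qed measurable
  then have "\<forall>\<^sub>F N in sequentially. (\<integral>x. norm (f x - cl N (f x)) powr p \<partial>lebesgue) < e'"
    using e' by (intro order_tendstoD(2)) auto
  then obtain N where N: "(\<integral>x. norm (f x - cl N (f x)) powr p \<partial>lebesgue) < e'"
    by (auto simp: eventually_sequentially)
  have iN: "integrable lebesgue (\<lambda>x. norm (f x - cl N (f x)) powr p)"
  proof (rule Bochner_Integration.integrable_bound[OF fp])
    show "AE x in lebesgue. norm (norm (f x - cl N (f x)) powr p) \<le> norm (norm (f x) powr p)"
      using p cl_le by (auto intro!: powr_mono2)
  qed measurable
  \<comment> \<open>This notion of measurability provides continuous functions converging to
    \<open>f\<close> off a negligible set.\<close>
  have "f measurable_on UNIV"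
    by (subst measurable_on_iff_borel_measurable) auto
  then obtain S g where S: "negligible S" and gc: "\<And>n. continuous_on UNIV (g n)"
    and gl: "\<And>x. x \<notin> S \<Longrightarrow> (\<lambda>n. g n x) \<longlonglongrightarrow> f x"
    unfolding measurable_on_def by auto
  obtain \<zeta> :: "'a \<Rightarrow> real" where \<zeta>: "Cinf_on \<zeta> UNIV" "\<And>x::'a. dist x 0 \<le> R \<Longrightarrow> \<zeta> x = 1"
    "\<And>x::'a. dist x 0 \<ge> R + 1 \<Longrightarrow> \<zeta> x = 0" "\<And>x. 0 \<le> \<zeta> x \<and> \<zeta> x \<le> 1"
    using smooth_cutoff_exists[OF \<open>0 \<le> R\<close> less_add_one, of "0::'a"] by blast
  define h where "h n x = \<zeta> x *\<^sub>R cl N (g n x)" for n x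
  have hc: "continuous_on UNIV (h n)" for n
    unfolding h_def
    by (intro continuous_intros Cinf_on_continuous[OF \<zeta>(1)] continuous_on_compose2[OF cl_cont gc]) auto
  have hz: "h n x = 0" if "x \<notin> cball 0 (R + 1)" for n x
    using \<zeta>(3)[of x] that by (simp add: h_def)
  have hm[measurable]: "h n \<in> borel_measurable lebesgue" for n
    by (rule measurable_lebesgue_continuous[OF hc])
  let ?B = "\<lambda>x::'a. (2 * real N) powr p * indicator (cball 0 (R + 1)) x :: real"
  have iB: "integrable lebesgue ?B"
    using lmeasurable_cball[of "0::'a" "R + 1"]
    by (intro integrable_mult_right integrable_real_indicator) (auto simp: fmeasurable_def)
  have hb: "norm (norm (cl N (f x) - h n x) powr p) \<le> ?B x" for n x
  proof (cases "x \<in> cball 0 (R + 1)")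
    case True
    have "norm (h n x) \<le> 1 * real N"
      unfolding h_def norm_scaleR using \<zeta>(4)[of x] cl_b by (intro mult_mono) auto
    then have "norm (cl N (f x) - h n x) \<le> 2 * real N"
      using norm_triangle_ineq4[of "cl N (f x)" "h n x"] cl_b[of N "f x"] by linarith
    then show ?thesis using True p by (auto intro!: powr_mono2)
  next
    case False
    then have "f x = 0" "h n x = 0" using R[of x] hz by auto
    moreover have "cl N 0 = 0" by (rule cl_id) simp
    ultimately show ?thesis by simp
  qed
  have "(\<lambda>n. \<integral>x. norm (cl N (f x) - h n x) powr p \<partial>lebesgue) \<longlonglongrightarrow> (\<integral>x. 0 \<partial>(lebesgue :: 'a measure))"
  proof (rule integral_dominated_convergence[OF _ _ iB])
    have "AE x in lebesgue. x \<notin> S"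
      using S by (metis AE_not_in negligible_iff_null_sets)
    then show "AE x in lebesgue. (\<lambda>n. norm (cl N (f x) - h n x) powr p) \<longlonglongrightarrow> 0"
    proof eventually_elim
      case (elim x)
      have "(\<lambda>n. cl N (g n x)) \<longlonglongrightarrow> cl N (f x)"
        using continuous_on_tendsto_compose[OF cl_cont gl[OF elim]] by auto
      then have "(\<lambda>n. h n x) \<longlonglongrightarrow> \<zeta> x *\<^sub>R cl N (f x)"
        unfolding h_def by (intro tendsto_intros)
      moreover have "\<zeta> x *\<^sub>R cl N (f x) = cl N (f x)"
      proof (cases "x \<in> cball 0 R")
        case True
        then show ?thesis using \<zeta>(2)[of x] by simp
      next
        case False
        then show ?thesis using R[OF False] cl_id[of 0 N] by simp
      qed
      ultimately have "(\<lambda>n. h n x) \<longlonglongrightarrow> cl N (f x)" by simp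
      then have "(\<lambda>n. norm (cl N (f x) - h n x)) \<longlonglongrightarrow> norm (cl N (f x) - cl N (f x))"
        by (intro tendsto_intros)
      then have "(\<lambda>n. norm (cl N (f x) - h n x)) \<longlonglongrightarrow> 0" by simp
      then show ?case
        using p by (intro tendsto_zero_powrI[OF _ tendsto_const]) auto
    qed
    show "AE x in lebesgue. norm (norm (cl N (f x) - h n x) powr p) \<le> ?B x" for n
      using hb by blast
  qed measurable
  then have "\<forall>\<^sub>F n in sequentially. (\<integral>x. norm (cl N (f x) - h n x) powr p \<partial>lebesgue) < e'"
    using e' by (intro order_tendstoD(2)) auto
  then obtain n where n: "(\<integral>x. norm (cl N (f x) - h n x) powr p \<partial>lebesgue) < e'"
    by (auto simp: eventually_sequentially)
  have in': "integrable lebesgue (\<lambda>x. norm (cl N (f x) - h n x) powr p)"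
  proof (rule Bochner_Integration.integrable_bound[OF iB])
    show "AE x in lebesgue. norm (norm (cl N (f x) - h n x) powr p) \<le> norm (?B x)"
      using order_trans[OF hb abs_ge_self] by simp
  qed measurable
  let ?S = "\<lambda>x. 2 powr p * (norm (f x - cl N (f x)) powr p + norm (cl N (f x) - h n x) powr p)"
  have iS: "integrable lebesgue ?S" by (intro integrable_mult_right Bochner_Integration.integrable_add iN in')
  have le: "norm (f x - h n x) powr p \<le> ?S x" for x
    using norm_add_powr_le[of p "f x - cl N (f x)" "cl N (f x) - h n x"] p by simp
  have i: "integrable lebesgue (\<lambda>x. norm (f x - h n x) powr p)"
  proof (rule Bochner_Integration.integrable_bound[OF iS])
    show "AE x in lebesgue. norm (norm (f x - h n x) powr p) \<le> norm (?S x)"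
      using order_trans[OF le abs_ge_self] by simp
  qed measurable
  have "(\<integral>x. norm (f x - h n x) powr p \<partial>lebesgue) \<le> (\<integral>x. ?S x \<partial>lebesgue)"
    by (rule integral_mono[OF i iS le])
  also have "\<dots> = 2 powr p * ((\<integral>x. norm (f x - cl N (f x)) powr p \<partial>lebesgue)
      + (\<integral>x. norm (cl N (f x) - h n x) powr p \<partial>lebesgue))"
    by (subst integral_mult_right_zero, subst Bochner_Integration.integral_add[OF iN in']) (rule refl)
  also have "\<dots> < 2 powr p * (e' + e')" using N n by (intro mult_strict_left_mono) auto
  also have "\<dots> = e" by (simp add: e'_def)
  finally show ?thesis using that[OF hc hz i] by blast
qed

text \<open>Split through a continuous \<open>h\<close>: mollification does not increase the norm of
  \<open>f - h\<close>, and \<open>h\<close> is uniformly continuous. The threshold \<open>d\<close>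
  is uniform over all mollifiers, which later allows the same one for a function and for its
  gradient.\<close>

lemma mollify_tendsto_Lp:
  fixes f :: "'a::euclidean_space \<Rightarrow> 'b::euclidean_space"
  assumes p: "1 \<le> p" and fm[measurable]: "f \<in> borel_measurable lebesgue"
    and fp: "integrable lebesgue (\<lambda>x. norm (f x) powr p)"
    and R: "\<And>x. x \<notin> cball 0 R \<Longrightarrow> f x = 0" and "e > 0" and "R \<ge> 0"
  obtains d where "d > 0"
    "\<And>\<delta> \<rho>. mollifier \<delta> \<rho> \<Longrightarrow> \<delta> < d \<Longrightarrow> integrable lebesgue (\<lambda>x. norm (mollify \<rho> f x - f x) powr p)"
    "\<And>\<delta> \<rho>. mollifier \<delta> \<rho> \<Longrightarrow> \<delta> < d \<Longrightarrow> (\<integral>x. norm (mollify \<rho> f x - f x) powr p \<partial>lebesgue) < e"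
proof -
  \<comment> \<open>Collects the constants of two applications of \<open>norm_add_powr_le\<close>.
    The three contributions of size e' add up to 3/2 * C * e' = 3/4 * e.\<close>
  define C where "C = 2 powr p * (2 powr p * 2)"
  have C: "C > 0" by (simp add: C_def)
  define e' where "e' = e / (2 * C)"
  have e': "e' > 0" using \<open>e > 0\<close> C by (simp add: e'_def)
  obtain h where hc: "continuous_on UNIV h" and hz: "\<And>x. x \<notin> cball 0 (R + 1) \<Longrightarrow> h x = 0"
    and hi: "integrable lebesgue (\<lambda>x. norm (f x - h x) powr p)"
    and he: "(\<integral>x. norm (f x - h x) powr p \<partial>lebesgue) < e'"
    using Lp_dense_continuous[OF p fm fp R e' \<open>R \<ge> 0\<close>] by blast
  have hm[measurable]: "h \<in> borel_measurable lebesgue" by (rule measurable_lebesgue_continuous[OF hc])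
  have if': "integrable lebesgue f" by (rule integrable_of_Lp_bounded_support[OF p fm fp R])
  have ih: "integrable lebesgue h" by (rule integrable_compact_support[OF hc compact_cball hz])
  define V where "V = measure lebesgue (cball (0::'a) (R + 2))"
  have V: "V \<ge> 0" by (simp add: V_def)
  \<comment> \<open>A uniform error \<open>t\<close> on a ball of volume \<open>V\<close>
    contributes at most e' to the integral of the p-th power.\<close>
  define t where "t = (e' / (V + 1)) powr (1 / p)"
  have t: "t > 0" using e' V by (simp add: t_def)
  have tp: "t powr p = e' / (V + 1)" using p e' V by (simp add: t_def powr_powr)
  obtain d where d: "d > 0" "\<And>x y. dist x y < d \<Longrightarrow> dist (h x) (h y) < t"
    using compact_support_uniformly_continuous[OF hc hz t] by metis
  have main: "integrable lebesgue (\<lambda>x. norm (mollify \<rho> f x - f x) powr p) \<and>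
      (\<integral>x. norm (mollify \<rho> f x - f x) powr p \<partial>lebesgue) < e"
    if m: "mollifier \<delta> \<rho>" and \<delta>: "\<delta> < min d 1" for \<delta> \<rho>
  proof -
    have z: "\<And>x. x \<notin> cball 0 \<delta> \<Longrightarrow> \<rho> x = 0" using m by (auto simp: mollifier_def)
    let ?g = "\<lambda>x. f x - h x"
    have ig: "integrable lebesgue ?g" using if' ih by simp
    note Y = mollify_Lp_le[OF p m ig hi]
    have mf: "mollify \<rho> f x - f x = mollify \<rho> ?g x + ((mollify \<rho> h x - h x) - ?g x)" for x
      by (simp add: mollify_diff[OF m if' ih])
    let ?B = "\<lambda>x::'a. t powr p * indicator (cball 0 (R + 2)) x :: real"
    have iB: "integrable lebesgue ?B"
      using lmeasurable_cball[of "0::'a" "R + 2"]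
      by (intro integrable_mult_right integrable_real_indicator) (auto simp: fmeasurable_def)
    have B: "norm (mollify \<rho> h x - h x) powr p \<le> ?B x" for x
    proof (cases "x \<in> cball 0 (R + 2)")
      case True
      have "norm (mollify \<rho> h x - h x) \<le> t"
      proof (rule mollify_close[OF m ih])
        fix y assume "y \<in> cball x \<delta>"
        then have "dist y x < d" using \<delta> by (simp add: dist_commute)
        from d(2)[OF this] show "norm (h y - h x) \<le> t" by (simp add: dist_norm)
      qed
      then show ?thesis using True p by (auto intro!: powr_mono2)
    next
      case False
      have "h y = 0" if "y \<in> cball x \<delta>" for y
      proof (rule hz)
        show "y \<notin> cball 0 (R + 1)"
          using False that \<delta> dist_triangle[of 0 x y] by (auto simp: dist_commute)
      qed
      then have "mollify \<rho> h x = 0" by (intro mollify_eq_0[OF z]) auto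
      moreover have "h x = 0" using False by (intro hz) auto
      ultimately show ?thesis by simp
    qed
    let ?S = "\<lambda>x. 2 powr p * (norm (mollify \<rho> ?g x) powr p + 2 powr p * (?B x + norm (?g x) powr p))"
    have iS: "integrable lebesgue ?S"
      by (intro integrable_mult_right Bochner_Integration.integrable_add Y(1) iB hi)
    have le: "norm (mollify \<rho> f x - f x) powr p \<le> ?S x" for x
    proof -
      have "norm (mollify \<rho> f x - f x) powr p
         \<le> 2 powr p * (norm (mollify \<rho> ?g x) powr p + norm ((mollify \<rho> h x - h x) + - ?g x) powr p)"
        unfolding mf using norm_add_powr_le[of p] p by simp
      also have "norm ((mollify \<rho> h x - h x) + - ?g x) powr p
         \<le> 2 powr p * (norm (mollify \<rho> h x - h x) powr p + norm (- ?g x) powr p)"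
        by (rule norm_add_powr_le) (use p in simp)
      also have "norm (mollify \<rho> h x - h x) powr p \<le> ?B x" by (rule B)
      finally show ?thesis by (simp add: norm_minus_commute)
    qed
    have mm[measurable]: "mollify \<rho> f \<in> borel_measurable lebesgue"
      by (rule measurable_lebesgue_continuous[OF mollify_measurable[OF m if']])
    have i: "integrable lebesgue (\<lambda>x. norm (mollify \<rho> f x - f x) powr p)"
    proof (rule Bochner_Integration.integrable_bound[OF iS])
      show "AE x in lebesgue. norm (norm (mollify \<rho> f x - f x) powr p) \<le> norm (?S x)"
        using order_trans[OF le abs_ge_self] by simp
    qed measurable
    have "(\<integral>x. norm (mollify \<rho> f x - f x) powr p \<partial>lebesgue) \<le> (\<integral>x. ?S x \<partial>lebesgue)"
      by (rule integral_mono[OF i iS le])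
    also have "\<dots> = 2 powr p * ((\<integral>x. norm (mollify \<rho> ?g x) powr p \<partial>lebesgue)
       + 2 powr p * ((\<integral>x. ?B x \<partial>lebesgue) + (\<integral>x. norm (?g x) powr p \<partial>lebesgue)))"
      by (subst integral_mult_right_zero, subst Bochner_Integration.integral_add,
          rule Y(1), intro integrable_mult_right Bochner_Integration.integrable_add iB hi,
          subst integral_mult_right_zero, subst Bochner_Integration.integral_add[OF iB hi]) (rule refl)
    also have "(\<integral>x. ?B x \<partial>lebesgue) = t powr p * V"
      by (simp add: V_def)
    also have "2 powr p * ((\<integral>x. norm (mollify \<rho> ?g x) powr p \<partial>lebesgue)
       + 2 powr p * (t powr p * V + (\<integral>x. norm (?g x) powr p \<partial>lebesgue)))
       < 2 powr p * (2 powr p * e' + 2 powr p * (e' + e'))"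
    proof -
      have 1: "(\<integral>x. norm (mollify \<rho> ?g x) powr p \<partial>lebesgue) < 1 * e'" using Y(2) he by linarith
      also have "1 * e' \<le> 2 powr p * e'" using p e' by (intro mult_right_mono) (auto intro: ge_one_powr_ge_zero)
      finally have 1: "(\<integral>x. norm (mollify \<rho> ?g x) powr p \<partial>lebesgue) < 2 powr p * e'" .
      have "t powr p * V \<le> e'"
        unfolding tp using V e' by (simp add: field_simps)
      then have "2 powr p * (t powr p * V + (\<integral>x. norm (?g x) powr p \<partial>lebesgue)) \<le> 2 powr p * (e' + e')"
        using he by (intro mult_left_mono) auto
      then show ?thesis using 1 by (intro mult_strict_left_mono add_less_le_mono) auto
    qed
    also have "\<dots> = 3 / 2 * (C * e')" by (simp add: C_def algebra_simps)
    also have "C * e' = e / 2" using C by (simp add: e'_def)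
    finally show ?thesis using i \<open>e > 0\<close> by simp
  qed
  show ?thesis
    by (rule that[of "min d 1"]) (use d(1) main in auto)
qed

section \<open>Weak gradients\<close>

lemma lebesgue_open: "open K \<Longrightarrow> K \<in> sets (lebesgue :: 'a::euclidean_space measure)"
  by (simp add: borel_open)

lemma locally_integrable_mult:
  fixes v :: "'a::euclidean_space \<Rightarrow> 'b::euclidean_space" and k :: "'a \<Rightarrow> real"
  assumes "locally_integrable \<Omega> v" "compact K" "K \<subseteq> \<Omega>" "\<And>x. x \<notin> K \<Longrightarrow> k x = 0"
    "k \<in> borel_measurable lebesgue" "\<And>x. \<bar>k x\<bar> \<le> M"
  shows "integrable lebesgue (\<lambda>x. k x *\<^sub>R v x)"
proof -
  have i: "integrable lebesgue (\<lambda>x. indicator K x *\<^sub>R v x)"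
    using assms(1-3) by (auto simp: locally_integrable_def set_integrable_def)
  have "k x *\<^sub>R v x = k x *\<^sub>R (indicator K x *\<^sub>R v x)" for x
    using assms(4) by (cases "x \<in> K") auto
  moreover have "integrable lebesgue (\<lambda>x. k x *\<^sub>R (indicator K x *\<^sub>R v x))"
  proof (rule Bochner_Integration.integrable_bound)
    show "integrable lebesgue (\<lambda>x. M * norm (indicator K x *\<^sub>R v x))"
      by (intro integrable_mult_right integrable_norm i)
    show "(\<lambda>x. k x *\<^sub>R (indicator K x *\<^sub>R v x)) \<in> borel_measurable lebesgue"
      by (rule borel_measurable_scaleR[OF assms(5) borel_measurable_integrable[OF i]])
    show "AE x in lebesgue. norm (k x *\<^sub>R (indicator K x *\<^sub>R v x)) \<le> norm (M * norm (indicator K x *\<^sub>R v x))"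
    proof (intro AE_I2)
      fix x
      have "norm (k x *\<^sub>R (indicator K x *\<^sub>R v x)) \<le> M * norm (indicator K x *\<^sub>R v x)"
        unfolding norm_scaleR[of "k x"] using assms(6) by (intro mult_right_mono) auto
      then show "norm (k x *\<^sub>R (indicator K x *\<^sub>R v x)) \<le> norm (M * norm (indicator K x *\<^sub>R v x))"
        by simp
    qed
  qed
  ultimately show ?thesis by presburger
qed

lemma locally_integrable_mult_continuous:
  fixes v :: "'a::euclidean_space \<Rightarrow> 'b::euclidean_space" and k :: "'a \<Rightarrow> real"
  assumes "locally_integrable \<Omega> v" "compact K" "K \<subseteq> \<Omega>" "\<And>x. x \<notin> K \<Longrightarrow> k x = 0"
    "continuous_on UNIV k"
  shows "integrable lebesgue (\<lambda>x. k x *\<^sub>R v x)"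
proof -
  obtain M where "\<And>x. norm (k x) \<le> M"
    using compact_support_bounded[OF assms(5,2,4)] by blast
  then show ?thesis
    using measurable_lebesgue_continuous[OF assms(5)]
    by (intro locally_integrable_mult[OF assms(1-4), where M = M]) auto
qed

lemma gradient_zero_outside:
  assumes "closed K" "\<And>x. x \<notin> K \<Longrightarrow> \<eta> x = 0" "x \<notin> K"
  shows "gradient \<eta> x = 0"
  by (rule gradient_eq, rule GDERIV_transform_open[where f = "\<lambda>_. 0" and S = "- K"])
    (use assms in \<open>auto simp: GDERIV_const open_Compl\<close>)

lemma continuous_gradient:
  fixes \<eta> :: "'a::euclidean_space \<Rightarrow> real"
  shows "Cinf_on \<eta> UNIV \<Longrightarrow> continuous_on UNIV (gradient \<eta>)"
  by (rule Cinf_on_continuous[OF Cinf_on_gradient])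

lemma set_integral_support:
  fixes f :: "'a::euclidean_space \<Rightarrow> 'b::euclidean_space"
  assumes "K \<subseteq> \<Omega>" "\<And>x. x \<notin> K \<Longrightarrow> f x = 0"
  shows "(LINT x:\<Omega>|lebesgue. f x) = (\<integral>x. f x \<partial>lebesgue)"
proof -
  have "indicator \<Omega> x *\<^sub>R f x = f x" for x
    using assms by (cases "x \<in> \<Omega>") auto
  then show ?thesis by (simp add: set_lebesgue_integral_def)
qed

lemma weak_gradient_test:
  fixes v :: "'a::euclidean_space \<Rightarrow> real"
  assumes w: "has_weak_gradient \<Omega> v g" and \<eta>: "Cinf_on \<eta> UNIV"
    and K: "compact K" "K \<subseteq> \<Omega>" "\<And>x. x \<notin> K \<Longrightarrow> \<eta> x = 0"
  shows "(\<integral>x. v x *\<^sub>R gradient \<eta> x \<partial>lebesgue) = - (\<integral>x. \<eta> x *\<^sub>R g x \<partial>lebesgue)"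
proof -
  have cl: "closure {x. \<eta> x \<noteq> 0} \<subseteq> K"
    by (rule closure_minimal) (use K compact_imp_closed in auto)
  then have "compact (closure {x. \<eta> x \<noteq> 0})"
    using compact_Int_closed[OF K(1), of "closure {x. \<eta> x \<noteq> 0}"] by (simp add: Int_absorb1)
  then have "test_function \<Omega> \<eta>"
    unfolding test_function_def using \<eta> K(2) cl by auto
  then have "(LINT x:\<Omega>|lebesgue. v x *\<^sub>R gradient \<eta> x) = - (LINT x:\<Omega>|lebesgue. \<eta> x *\<^sub>R g x)"
    using w by (simp add: has_weak_gradient_def)
  moreover have "(LINT x:\<Omega>|lebesgue. v x *\<^sub>R gradient \<eta> x) = (\<integral>x. v x *\<^sub>R gradient \<eta> x \<partial>lebesgue)"
  proof (rule set_integral_support[OF K(2)])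
    show "v x *\<^sub>R gradient \<eta> x = 0" if "x \<notin> K" for x
      using gradient_zero_outside[OF compact_imp_closed[OF K(1)] K(3) that] by simp
  qed
  moreover have "(LINT x:\<Omega>|lebesgue. \<eta> x *\<^sub>R g x) = (\<integral>x. \<eta> x *\<^sub>R g x \<partial>lebesgue)"
    by (rule set_integral_support[OF K(2)]) (simp add: K(3))
  ultimately show ?thesis by simp
qed

text \<open>Replaces test functions and set integrals by integrals over the whole space with a
  compact set \<open>K\<close> carrying both \<eta> and its gradient.\<close>

lemma has_weak_gradientI:
  fixes v :: "'a::euclidean_space \<Rightarrow> real"
  assumes "locally_integrable \<Omega> v" "locally_integrable \<Omega> g"
    and *: "\<And>\<eta> K. Cinf_on \<eta> UNIV \<Longrightarrow> compact K \<Longrightarrow> K \<subseteq> \<Omega> \<Longrightarrow> (\<And>x. x \<notin> K \<Longrightarrow> \<eta> x = 0) \<Longrightarrow>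
      (\<And>x. x \<notin> K \<Longrightarrow> gradient \<eta> x = 0) \<Longrightarrow>
      (\<integral>x. v x *\<^sub>R gradient \<eta> x \<partial>lebesgue) = - (\<integral>x. \<eta> x *\<^sub>R g x \<partial>lebesgue)"
  shows "has_weak_gradient \<Omega> v g"
  unfolding has_weak_gradient_def
proof (intro conjI allI impI)
  show "locally_integrable \<Omega> v" "locally_integrable \<Omega> g" by (fact assms)+
  fix \<eta> :: "'a \<Rightarrow> real" assume t: "test_function \<Omega> \<eta>"
  obtain K where K: "compact K" "K \<subseteq> \<Omega>" and K3: "\<forall>x. x \<notin> K \<longrightarrow> \<eta> x = 0"
  proof
    show "\<forall>x. x \<notin> closure {x. \<eta> x \<noteq> 0} \<longrightarrow> \<eta> x = 0"
      using closure_subset[of "{x. \<eta> x \<noteq> 0}"] by blast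
  qed (use t in \<open>auto simp: test_function_def\<close>)
  have \<eta>z: "\<And>x. x \<notin> K \<Longrightarrow> \<eta> x = 0" using K3 by blast
  have gz: "\<And>x. x \<notin> K \<Longrightarrow> gradient \<eta> x = 0"
    by (rule gradient_zero_outside[OF compact_imp_closed[OF K(1)]]) (use K3 in auto)
  have 1: "(LINT x:\<Omega>|lebesgue. v x *\<^sub>R gradient \<eta> x) = (\<integral>x. v x *\<^sub>R gradient \<eta> x \<partial>lebesgue)"
    by (rule set_integral_support[OF K(2)]) (simp add: gz)
  have 2: "(LINT x:\<Omega>|lebesgue. \<eta> x *\<^sub>R g x) = (\<integral>x. \<eta> x *\<^sub>R g x \<partial>lebesgue)"
    by (rule set_integral_support[OF K(2)]) (simp add: K3)
  have "Cinf_on \<eta> UNIV" using t by (simp add: test_function_def)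
  from *[OF this K \<eta>z gz] show "(LINT x:\<Omega>|lebesgue. v x *\<^sub>R gradient \<eta> x) = - (LINT x:\<Omega>|lebesgue. \<eta> x *\<^sub>R g x)"
    unfolding 1 2 by blast
qed

lemma has_weak_gradient_integrable:
  fixes v :: "'a::euclidean_space \<Rightarrow> real"
  assumes w: "has_weak_gradient \<Omega> v g" and \<eta>: "Cinf_on \<eta> UNIV"
    and K: "compact K" "K \<subseteq> \<Omega>" "\<And>x. x \<notin> K \<Longrightarrow> \<eta> x = 0"
  shows "integrable lebesgue (\<lambda>x. v x *\<^sub>R gradient \<eta> x)" "integrable lebesgue (\<lambda>x. \<eta> x *\<^sub>R g x)"
proof -
  have l: "locally_integrable \<Omega> v" "locally_integrable \<Omega> g" using w by (auto simp: has_weak_gradient_def)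
  show "integrable lebesgue (\<lambda>x. \<eta> x *\<^sub>R g x)"
    by (rule locally_integrable_mult_continuous[OF l(2) K Cinf_on_continuous[OF \<eta>]])
  have "integrable lebesgue (\<lambda>x. (gradient \<eta> x \<bullet> b) *\<^sub>R v x)" for b
  proof (rule locally_integrable_mult_continuous[OF l(1) K(1,2)])
    show "gradient \<eta> x \<bullet> b = 0" if "x \<notin> K" for x
      by (simp add: gradient_zero_outside[OF compact_imp_closed[OF K(1)] K(3) that])
    show "continuous_on UNIV (\<lambda>x. gradient \<eta> x \<bullet> b)"
      by (intro continuous_intros continuous_gradient[OF \<eta>])
  qed
  then have "integrable lebesgue (\<lambda>x. \<Sum>b\<in>Basis. ((gradient \<eta> x \<bullet> b) *\<^sub>R v x) *\<^sub>R b)"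
    by (intro Bochner_Integration.integrable_sum integrable_scaleR_left)
  moreover have "(\<Sum>b\<in>Basis. ((gradient \<eta> x \<bullet> b) *\<^sub>R v x) *\<^sub>R b) = v x *\<^sub>R gradient \<eta> x" for x
  proof -
    have "(\<Sum>b\<in>Basis. ((gradient \<eta> x \<bullet> b) *\<^sub>R v x) *\<^sub>R b) = v x *\<^sub>R (\<Sum>b\<in>Basis. (gradient \<eta> x \<bullet> b) *\<^sub>R b)"
      unfolding scaleR_sum_right by (intro sum.cong) (auto simp: mult.commute)
    then show ?thesis by (simp add: euclidean_representation)
  qed
  ultimately show "integrable lebesgue (\<lambda>x. v x *\<^sub>R gradient \<eta> x)" by simp
qed

lemma locally_integrable_combination:
  fixes v w :: "'a::euclidean_space \<Rightarrow> 'b::euclidean_space"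
  assumes "locally_integrable \<Omega> v" "locally_integrable \<Omega> w"
  shows "locally_integrable \<Omega> (\<lambda>x. a *\<^sub>R v x + b *\<^sub>R w x)"
  using assms unfolding locally_integrable_def
  by (auto intro!: set_integral_add set_integrable_scaleR_right)

lemma integral_combination:
  fixes f g :: "'a \<Rightarrow> 'b::euclidean_space"
  assumes "integrable M f" "integrable M g"
  shows "(\<integral>x. a *\<^sub>R f x + b *\<^sub>R g x \<partial>M) = a *\<^sub>R (\<integral>x. f x \<partial>M) + b *\<^sub>R (\<integral>x. g x \<partial>M)"
  using assms by simp

lemma has_weak_gradient_combination:
  fixes v w :: "'a::euclidean_space \<Rightarrow> real"
  assumes v: "has_weak_gradient \<Omega> v g" and w: "has_weak_gradient \<Omega> w h"
  shows "has_weak_gradient \<Omega> (\<lambda>x. a * v x + b * w x) (\<lambda>x. a *\<^sub>R g x + b *\<^sub>R h x)"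
proof (rule has_weak_gradientI)
  show "locally_integrable \<Omega> (\<lambda>x. a * v x + b * w x)"
    using locally_integrable_combination[of \<Omega> v w a b] assms by (simp add: has_weak_gradient_def)
  show "locally_integrable \<Omega> (\<lambda>x. a *\<^sub>R g x + b *\<^sub>R h x)"
    using locally_integrable_combination[of \<Omega> g h a b] assms by (simp add: has_weak_gradient_def)
  fix \<eta> :: "'a \<Rightarrow> real" and K
  assume \<eta>: "Cinf_on \<eta> UNIV" "compact K" "K \<subseteq> \<Omega>" "\<And>x. x \<notin> K \<Longrightarrow> \<eta> x = 0"
  note iv = has_weak_gradient_integrable[OF v \<eta>] and iw = has_weak_gradient_integrable[OF w \<eta>]
  have "(\<integral>x. (a * v x + b * w x) *\<^sub>R gradient \<eta> x \<partial>lebesgue)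
    = (\<integral>x. a *\<^sub>R (v x *\<^sub>R gradient \<eta> x) + b *\<^sub>R (w x *\<^sub>R gradient \<eta> x) \<partial>lebesgue)"
    by (simp add: scaleR_add_left)
  also have "\<dots> = a *\<^sub>R (\<integral>x. v x *\<^sub>R gradient \<eta> x \<partial>lebesgue) + b *\<^sub>R (\<integral>x. w x *\<^sub>R gradient \<eta> x \<partial>lebesgue)"
    by (rule integral_combination[OF iv(1) iw(1)])
  also have "\<dots> = - (a *\<^sub>R (\<integral>x. \<eta> x *\<^sub>R g x \<partial>lebesgue) + b *\<^sub>R (\<integral>x. \<eta> x *\<^sub>R h x \<partial>lebesgue))"
    using weak_gradient_test[OF v \<eta>] weak_gradient_test[OF w \<eta>] by simp
  also have "a *\<^sub>R (\<integral>x. \<eta> x *\<^sub>R g x \<partial>lebesgue) + b *\<^sub>R (\<integral>x. \<eta> x *\<^sub>R h x \<partial>lebesgue)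
    = (\<integral>x. a *\<^sub>R (\<eta> x *\<^sub>R g x) + b *\<^sub>R (\<eta> x *\<^sub>R h x) \<partial>lebesgue)"
    by (rule integral_combination[OF iv(2) iw(2), symmetric])
  also have "\<dots> = (\<integral>x. \<eta> x *\<^sub>R (a *\<^sub>R g x + b *\<^sub>R h x) \<partial>lebesgue)"
    by (simp add: scaleR_add_right mult.commute)
  finally show "(\<integral>x. (a * v x + b * w x) *\<^sub>R gradient \<eta> x \<partial>lebesgue)
      = - (\<integral>x. \<eta> x *\<^sub>R (a *\<^sub>R g x + b *\<^sub>R h x) \<partial>lebesgue)" .
qed

lemma has_weak_gradient_diff:
  "has_weak_gradient \<Omega> v g \<Longrightarrow> has_weak_gradient \<Omega> w h \<Longrightarrow>
    has_weak_gradient \<Omega> (\<lambda>x. v x - w x) (\<lambda>x. g x - h x)"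
  using has_weak_gradient_combination[of \<Omega> v g w h 1 "-1"] by simp

lemma has_weak_gradient_add:
  "has_weak_gradient \<Omega> v g \<Longrightarrow> has_weak_gradient \<Omega> w h \<Longrightarrow>
    has_weak_gradient \<Omega> (\<lambda>x. v x + w x) (\<lambda>x. g x + h x)"
  using has_weak_gradient_combination[of \<Omega> v g w h 1 1] by simp

lemma has_weak_gradient_scale:
  "has_weak_gradient \<Omega> v g \<Longrightarrow> has_weak_gradient \<Omega> (\<lambda>x. a * v x) (\<lambda>x. a *\<^sub>R g x)"
  using has_weak_gradient_combination[of \<Omega> v g v g a 0] by simp

lemma has_weak_gradient_minus:
  "has_weak_gradient \<Omega> v g \<Longrightarrow> has_weak_gradient \<Omega> (\<lambda>x. - v x) (\<lambda>x. - g x)"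
  using has_weak_gradient_scale[of \<Omega> v g "-1"] by simp

lemma continuous_on_locally_integrable:
  fixes f :: "'a::euclidean_space \<Rightarrow> 'b::euclidean_space"
  assumes "continuous_on \<Omega> f"
  shows "locally_integrable \<Omega> f"
  unfolding locally_integrable_def set_integrable_def
proof (intro allI impI, elim conjE)
  fix K assume K: "compact K" "K \<subseteq> \<Omega>"
  have i: "integrable lborel (\<lambda>x. indicator K x *\<^sub>R f x)"
    using K assms continuous_on_subset by (intro borel_integrable_compact) auto
  then show "integrable lebesgue (\<lambda>x. indicator K x *\<^sub>R f x)"
    by (subst integrable_completion) auto
qed

text \<open>The product f * \<eta>, which vanishes off \<open>K\<close>, is C^1 on the whole space
  because \<Omega> and the complement of \<open>K\<close> are open and cover it. Its gradient
  therefore has integral 0.\<close>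

lemma has_weak_gradient_classical:
  fixes f :: "'a::euclidean_space \<Rightarrow> real"
  assumes "open \<Omega>" and f: "\<And>x. x \<in> \<Omega> \<Longrightarrow> GDERIV f x :> G x" and G: "continuous_on \<Omega> G"
  shows "has_weak_gradient \<Omega> f G"
proof (rule has_weak_gradientI)
  have cf: "continuous_on \<Omega> f" using f by (rule continuous_on_GDERIV)
  show lf: "locally_integrable \<Omega> f" and lG: "locally_integrable \<Omega> G"
    using cf G continuous_on_locally_integrable by auto
  fix \<eta> :: "'a \<Rightarrow> real" and K
  assume \<eta>: "Cinf_on \<eta> UNIV" and K: "compact K" "K \<subseteq> \<Omega>" "\<And>x. x \<notin> K \<Longrightarrow> \<eta> x = 0"
    and gz: "\<And>x. x \<notin> K \<Longrightarrow> gradient \<eta> x = 0"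
  have oK: "open (- K)" using K(1) compact_imp_closed by auto
  have U: "UNIV = \<Omega> \<union> - K" using K(2) by auto
  let ?H = "\<lambda>x. f x *\<^sub>R gradient \<eta> x + \<eta> x *\<^sub>R G x"
  have c\<eta>: "continuous_on UNIV \<eta>" by (rule Cinf_on_continuous[OF \<eta>])
  have cH: "continuous_on UNIV ?H"
    unfolding U
  proof (rule continuous_on_open_Un[OF assms(1) oK])
    show "continuous_on \<Omega> ?H"
      by (intro continuous_intros cf G continuous_on_subset[OF c\<eta>] continuous_on_subset[OF continuous_gradient[OF \<eta>]]) auto
    have "continuous_on (- K) (\<lambda>x. 0 :: 'a)" by simp
    then show "continuous_on (- K) ?H"
      by (rule continuous_on_eq) (simp add: K(3) gz)
  qed
  have D: "GDERIV (\<lambda>x. f x * \<eta> x) x :> ?H x" for x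
  proof (cases "x \<in> \<Omega>")
    case True
    then show ?thesis using GDERIV_mult[OF f[OF True] Cinf_on_GDERIV[OF \<eta>, of x]] by simp
  next
    case False
    then have "x \<in> - K" using K(2) by auto
    then have H0: "?H x = 0" by (simp add: K(3) gz)
    show ?thesis unfolding H0
      by (rule GDERIV_transform_open[OF GDERIV_const oK \<open>x \<in> - K\<close>, of 0]) (simp add: K(3))
  qed
  have "integral\<^sup>L lebesgue ?H = 0"
    by (rule integral_gradient_compact_support[OF D cH K(1)]) (simp add: K(3))
  moreover have "integrable lebesgue (\<lambda>x. \<eta> x *\<^sub>R G x)"
    by (rule locally_integrable_mult_continuous[OF lG K c\<eta>])
  moreover have "integrable lebesgue (\<lambda>x. f x *\<^sub>R gradient \<eta> x)"
  proof -
    have "integrable lebesgue ?H"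
      by (rule integrable_compact_support[OF cH K(1)]) (simp add: K(3) gz)
    then have "integrable lebesgue (\<lambda>x. ?H x - \<eta> x *\<^sub>R G x)"
      using \<open>integrable lebesgue (\<lambda>x. \<eta> x *\<^sub>R G x)\<close> by (rule Bochner_Integration.integrable_diff)
    then show ?thesis by simp
  qed
  ultimately show "(\<integral>x. f x *\<^sub>R gradient \<eta> x \<partial>lebesgue) = - (\<integral>x. \<eta> x *\<^sub>R G x \<partial>lebesgue)"
    by (subst (asm) Bochner_Integration.integral_add) (auto simp: eq_neg_iff_add_eq_0)
qed

lemma GDERIV_reflect:
  assumes "GDERIV \<rho> (x - y) :> g"
  shows "GDERIV (\<lambda>y. \<rho> (x - y)) y :> - g"
proof -
  have "((\<lambda>y. x - y) has_derivative (\<lambda>h. - h)) (at y)" by (auto intro!: derivative_eq_intros)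
  from has_derivative_compose[OF this, of \<rho> "\<lambda>h. h \<bullet> g"] assms
  show ?thesis by (simp add: gderiv_def)
qed

text \<open>The reflected kernel y \<mapsto> \<rho> (x - y) is itself a test function, since its
  support \<open>cball x \<delta>\<close> lies in \<open>K\<close>; the sign from the reflection
  cancels the one in the weak gradient. The indicator of \<open>K\<close> makes \<open>f\<close> and
  \<open>g\<close> globally integrable.\<close>

lemma GDERIV_mollify:
  fixes f :: "'a::euclidean_space \<Rightarrow> real"
  assumes w: "has_weak_gradient \<Omega> f g" and K: "compact K" "K \<subseteq> \<Omega>"
    and m: "mollifier \<delta> \<rho>" and x: "cball x \<delta> \<subseteq> K"
  shows "GDERIV (mollify \<rho> (\<lambda>y. indicator K y *\<^sub>R f y)) x :> mollify \<rho> (\<lambda>y. indicator K y *\<^sub>R g y) x"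
proof -
  let ?f = "\<lambda>y. indicator K y *\<^sub>R f y" and ?g = "\<lambda>y. indicator K y *\<^sub>R g y"
  have if': "integrable lebesgue ?f" and ig: "integrable lebesgue ?g"
    using w K by (auto simp: has_weak_gradient_def locally_integrable_def set_integrable_def)
  have C: "Cinf_on \<rho> UNIV" and z: "\<And>x. x \<notin> cball 0 \<delta> \<Longrightarrow> \<rho> x = 0" using m by (auto simp: mollifier_def)
  let ?\<eta> = "\<lambda>y. \<rho> (x - y)"
  have C\<eta>: "Cinf_on ?\<eta> UNIV"
    by (rule Cinf_on_compose[OF _ C]) (auto intro!: Cinf_on_diff Cinf_on_const Cinf_on_ident)
  have z\<eta>: "?\<eta> y = 0" if "y \<notin> cball x \<delta>" for y
    using z[of "x - y"] that unfolding diff_mem_cball_0 by blast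
  have g\<eta>: "gradient ?\<eta> y = - gradient \<rho> (x - y)" for y
    by (rule gradient_eq[OF GDERIV_reflect[OF Cinf_on_GDERIV[OF C]]]) simp
  have T: "(\<integral>y. f y *\<^sub>R gradient ?\<eta> y \<partial>lebesgue) = - (\<integral>y. ?\<eta> y *\<^sub>R g y \<partial>lebesgue)"
    by (rule weak_gradient_test[OF w C\<eta> compact_cball _ z\<eta>]) (use x K(2) in auto)
  have iT: "integrable lebesgue (\<lambda>y. f y *\<^sub>R gradient ?\<eta> y)"
    by (rule has_weak_gradient_integrable(1)[OF w C\<eta> compact_cball _ z\<eta>]) (use x K(2) in auto)
  have gz: "gradient ?\<eta> y = 0" if "y \<notin> cball x \<delta>" for y
    by (rule gradient_zero_outside[OF closed_cball z\<eta> that])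
  have e: "\<rho> (x - y) *\<^sub>R ?g y = ?\<eta> y *\<^sub>R g y" for y
    using z\<eta>[of y] x by (cases "y \<in> cball x \<delta>") auto
  have M: "mollify \<rho> ?g x = (\<integral>y. ?\<eta> y *\<^sub>R g y \<partial>lebesgue)" unfolding mollify_def e ..
  have "(mollify \<rho> ?f has_derivative (\<lambda>h. mollify (\<lambda>z. h \<bullet> gradient \<rho> z) ?f x)) (at x)"
    by (rule mollify_has_derivative[OF C z if'])
  moreover have "mollify (\<lambda>z. h \<bullet> gradient \<rho> z) ?f x = h \<bullet> mollify \<rho> ?g x" for h
  proof -
    have "(h \<bullet> gradient \<rho> (x - y)) *\<^sub>R ?f y = - (h \<bullet> (f y *\<^sub>R gradient ?\<eta> y))" for y
      using gz[of y] x unfolding g\<eta> by (cases "y \<in> cball x \<delta>") auto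
    then have "mollify (\<lambda>z. h \<bullet> gradient \<rho> z) ?f x = - (\<integral>y. h \<bullet> (f y *\<^sub>R gradient ?\<eta> y) \<partial>lebesgue)"
      by (simp add: mollify_def)
    also have "\<dots> = - (h \<bullet> (\<integral>y. f y *\<^sub>R gradient ?\<eta> y \<partial>lebesgue))"
      using iT integral_inner_right[of h lebesgue "\<lambda>y. f y *\<^sub>R gradient ?\<eta> y"] by metis
    finally show ?thesis unfolding T M by simp
  qed
  ultimately show ?thesis by (simp add: gderiv_def)
qed

lemma mollify_tendsto_L1:
  fixes f :: "'a::euclidean_space \<Rightarrow> 'b::euclidean_space"
  assumes f: "integrable lebesgue f" and K: "compact K" "\<And>x. x \<notin> K \<Longrightarrow> f x = 0" and "e > 0"
  obtains d where "d > 0"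
    "\<And>\<delta> \<rho>. mollifier \<delta> \<rho> \<Longrightarrow> \<delta> < d \<Longrightarrow> (\<integral>x. norm (mollify \<rho> f x - f x) \<partial>lebesgue) < e"
proof -
  obtain R0 where R0: "\<forall>x\<in>K. norm x \<le> R0" using compact_imp_bounded[OF K(1)] unfolding bounded_iff by blast
  have z: "f x = 0" if "x \<notin> cball 0 (max R0 0)" for x
    using that R0 K(2)[of x] by force
  show ?thesis
  proof (rule mollify_tendsto_Lp[where R = "max R0 0" and f = f and p = 1 and e = e])
    fix d
    assume "d > 0" and "\<And>\<delta> \<rho>. mollifier \<delta> \<rho> \<Longrightarrow> \<delta> < d \<Longrightarrow> (\<integral>x. norm (mollify \<rho> f x - f x) powr 1 \<partial>lebesgue) < e"
    then show thesis by (intro that[of d]) auto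
  qed (use f z \<open>e > 0\<close> in auto)
qed

text \<open>The difference \<open>k\<close> is a weak gradient of 0, so on the smaller ball its
  mollifications are gradients of 0. They converge to \<open>k\<close> in L1.\<close>

lemma weak_gradient_unique_cball:
  fixes v :: "'a::euclidean_space \<Rightarrow> real"
  assumes "has_weak_gradient \<Omega> v g" "has_weak_gradient \<Omega> v h"
    and r: "cball c r' \<subseteq> \<Omega>" "r < r'"
  shows "AE x in lebesgue. x \<in> cball c r \<longrightarrow> g x = h x"
proof -
  define k where "k = (\<lambda>x. g x - h x)"
  have w: "has_weak_gradient \<Omega> (\<lambda>x. 0) k"
    using has_weak_gradient_diff[OF assms(1,2)] by (simp add: k_def)
  let ?K = "cball c r'"
  let ?k = "\<lambda>x. indicator ?K x *\<^sub>R k x"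
  have ik: "integrable lebesgue ?k"
    using w r by (auto simp: has_weak_gradient_def locally_integrable_def set_integrable_def)
  have zk: "?k x = 0" if "x \<notin> ?K" for x using that by simp
  let ?n = "\<lambda>x. indicator (cball c r) x * norm (k x)"
  have in': "integrable lebesgue (\<lambda>x. indicator (cball c r) x *\<^sub>R norm (?k x))"
    by (rule integrable_mult_indicator[OF _ integrable_norm[OF ik]]) simp
  have neq: "indicator (cball c r) x *\<^sub>R norm (?k x) = ?n x" for x
    using r(2) by (auto simp: indicator_def)
  have in2: "integrable lebesgue ?n" using in' unfolding neq .
  have "(\<integral>x. ?n x \<partial>lebesgue) \<le> e" if e: "e > 0" for e
  proof -
    obtain d where d: "d > 0" "\<And>\<delta> \<rho>. mollifier \<delta> \<rho> \<Longrightarrow> \<delta> < d \<Longrightarrow> (\<integral>x. norm (mollify \<rho> ?k x - ?k x) \<partial>lebesgue) < e"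
      using mollify_tendsto_L1[OF ik compact_cball zk e] by blast
    define \<delta> where "\<delta> = min d (r' - r) / 2"
    have \<delta>: "\<delta> > 0" "\<delta> < d" "r + \<delta> \<le> r'" using d(1) r(2) by (auto simp: \<delta>_def min_def field_simps)
    obtain \<rho> :: "'a \<Rightarrow> real" where m: "mollifier \<delta> \<rho>" using mollifier_exists[OF \<delta>(1)] by blast
    have z: "mollify \<rho> ?k x = 0" if x: "x \<in> cball c r" for x
    proof -
      have sub: "cball x \<delta> \<subseteq> ?K"
        using x \<delta>(3) by (intro subsetI) (metis add_mono dist_triangle mem_cball order_trans)
      have "GDERIV (mollify \<rho> (\<lambda>y. indicator ?K y *\<^sub>R (0::real))) x :> mollify \<rho> ?k x"
        by (rule GDERIV_mollify[OF w compact_cball r(1) m sub])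
      moreover have "mollify \<rho> (\<lambda>y. indicator ?K y *\<^sub>R (0::real)) = (\<lambda>x. 0)" by (auto simp: mollify_def)
      ultimately have "GDERIV (\<lambda>x. 0) x :> mollify \<rho> ?k x" by simp
      then show ?thesis using gradient_eq GDERIV_const by metis
    qed
    have im: "integrable lebesgue (\<lambda>x. norm (mollify \<rho> ?k x - ?k x))"
    proof -
      have "integrable lebesgue (\<lambda>x. norm (?k x) powr 1)" using integrable_norm[OF ik] by simp
      note * = mollify_Lp_le(1)[OF order_refl m ik this]
      have "mollify \<rho> ?k \<in> borel_measurable lebesgue"
        by (rule measurable_lebesgue_continuous[OF mollify_measurable[OF m ik]])
      then have "integrable lebesgue (mollify \<rho> ?k)"
        using * by (subst integrable_norm_iff[symmetric]) simp_all
      then show ?thesis by (rule integrable_norm[OF Bochner_Integration.integrable_diff[OF _ ik]])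
    qed
    have "(\<integral>x. ?n x \<partial>lebesgue) \<le> (\<integral>x. norm (mollify \<rho> ?k x - ?k x) \<partial>lebesgue)"
    proof (rule integral_mono[OF in2 im])
      fix x show "?n x \<le> norm (mollify \<rho> ?k x - ?k x)"
        using z[of x] r(2) by (cases "x \<in> cball c r") auto
    qed
    also have "\<dots> < e" by (rule d(2)[OF m \<delta>(2)])
    finally show ?thesis by simp
  qed
  then have "(\<integral>x. ?n x \<partial>lebesgue) \<le> 0" by (rule field_le_epsilon) simp
  moreover have "(\<integral>x. ?n x \<partial>lebesgue) \<ge> 0" by simp
  ultimately have "(\<integral>x. ?n x \<partial>lebesgue) = 0" by linarith
  then have "AE x in lebesgue. ?n x = 0"
    by (subst (asm) integral_nonneg_eq_0_iff_AE[OF in2]) auto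
  then show ?thesis by eventually_elim (auto simp: k_def indicator_def)
qed

text \<open>\<open>weak_gradient\<close> is an arbitrary choice, so almost everywhere uniqueness is
  what lets the functional be computed with a concrete gradient. A countable cover by balls makes
  the local statement global.\<close>

lemma weak_gradient_unique:
  fixes v :: "'a::euclidean_space \<Rightarrow> real"
  assumes "open \<Omega>" "has_weak_gradient \<Omega> v g" "has_weak_gradient \<Omega> v h"
  shows "AE x in lebesgue. x \<in> \<Omega> \<longrightarrow> g x = h x"
proof -
  define \<F> where "\<F> = {ball c r | c r. cball c (2 * r) \<subseteq> \<Omega> \<and> r > 0}"
  obtain \<F>' where F: "\<F>' \<subseteq> \<F>" "countable \<F>'" "\<Union>\<F>' = \<Union>\<F>"
    by (rule Lindelof[of \<F>]) (auto simp: \<F>_def)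
  have "\<Union>\<F> = \<Omega>"
  proof
    show "\<Union>\<F> \<subseteq> \<Omega>" unfolding \<F>_def by force
    show "\<Omega> \<subseteq> \<Union>\<F>"
    proof
      fix x assume "x \<in> \<Omega>"
      then obtain e where "e > 0" "cball x e \<subseteq> \<Omega>" using \<open>open \<Omega>\<close> open_contains_cball by blast
      then have "ball x (e/2) \<in> \<F>" unfolding \<F>_def by (intro CollectI exI[of _ x] exI[of _ "e/2"]) auto
      then show "x \<in> \<Union>\<F>" using \<open>e > 0\<close> by (intro UnionI[of "ball x (e/2)"]) auto
    qed
  qed
  have "AE x in lebesgue. \<forall>B\<in>\<F>'. x \<in> B \<longrightarrow> g x = h x"
  proof (rule AE_ball_countable')
    fix B assume "B \<in> \<F>'"
    then obtain c r where B: "B = ball c r" "cball c (2 * r) \<subseteq> \<Omega>" "r > 0" using F(1) by (auto simp: \<F>_def)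
    have "AE x in lebesgue. x \<in> cball c r \<longrightarrow> g x = h x"
      by (rule weak_gradient_unique_cball[OF assms(2,3) B(2)]) (use B(3) in auto)
    then show "AE x in lebesgue. x \<in> B \<longrightarrow> g x = h x"
      by eventually_elim (auto simp: B(1))
  qed (rule F(2))
  then show ?thesis
    by eventually_elim (use F(3) \<open>\<Union>\<F> = \<Omega>\<close> in blast)
qed

lemma has_weak_gradient_weak_gradient:
  "has_weak_gradient \<Omega> v g \<Longrightarrow> has_weak_gradient \<Omega> v (weak_gradient \<Omega> v)"
  unfolding weak_gradient_def by (rule someI[where P = "has_weak_gradient \<Omega> v"])

lemma compact_neighbourhood:
  fixes K \<Omega> :: "'a::euclidean_space set"
  assumes "compact K" "open \<Omega>" "K \<subseteq> \<Omega>"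
  obtains \<epsilon> where "\<epsilon> > 0" "\<And>t. t \<le> \<epsilon> \<Longrightarrow> (\<Union>x\<in>K. cball x t) \<subseteq> \<Omega>" "\<And>t. compact (\<Union>x\<in>K. cball x t)"
proof -
  obtain \<epsilon> where \<epsilon>: "\<epsilon> > 0" "(\<Union>x\<in>K. cball x \<epsilon>) \<subseteq> \<Omega>"
    using compact_subset_open_imp_cball_epsilon_subset[OF assms] by blast
  have "compact (\<Union>x\<in>K. cball x t)" for t
  proof -
    \<comment> \<open>A closed collar is the Minkowski sum of \<open>K\<close> and a closed ball,
      hence compact.\<close>
    have "(\<Union>x\<in>K. cball x t) = {x + y | x y. x \<in> K \<and> y \<in> cball 0 t}"
    proof (intro set_eqI iffI)
      fix z assume "z \<in> (\<Union>x\<in>K. cball x t)"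
      then obtain x where "x \<in> K" "dist x z \<le> t" by auto
      then show "z \<in> {x + y | x y. x \<in> K \<and> y \<in> cball 0 t}"
        by (intro CollectI exI[of _ x] exI[of _ "z - x"]) (auto simp: dist_norm norm_minus_commute)
    next
      fix z assume "z \<in> {x + y | x y. x \<in> K \<and> y \<in> cball 0 t}"
      then show "z \<in> (\<Union>x\<in>K. cball x t)" by (auto simp: dist_norm intro: bexI[rotated])
    qed
    then show ?thesis using compact_sums[OF assms(1) compact_cball[of 0 t]] by simp
  qed
  moreover have "(\<Union>x\<in>K. cball x t) \<subseteq> \<Omega>" if "t \<le> \<epsilon>" for t
    using \<epsilon>(2) that by force
  ultimately show ?thesis using that \<epsilon>(1) by blast
qed

section \<open>Chain rule and truncation\<close>

lemma locally_integrable_mult_continuous_on: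
  fixes g :: "'a::euclidean_space \<Rightarrow> 'b::euclidean_space" and k :: "'a \<Rightarrow> real"
  assumes g: "locally_integrable \<Omega> g" and k: "continuous_on \<Omega> k"
  shows "locally_integrable \<Omega> (\<lambda>x. k x *\<^sub>R g x)"
  unfolding locally_integrable_def set_integrable_def
proof (intro allI impI, elim conjE)
  fix K assume K: "compact K" "K \<subseteq> \<Omega>"
  have ck: "continuous_on K k" using k K(2) continuous_on_subset by blast
  obtain M where M: "\<forall>x\<in>K. norm (k x) \<le> M"
    using compact_imp_bounded[OF compact_continuous_image[OF ck K(1)]] by (auto simp: bounded_iff)
  have "integrable lebesgue (\<lambda>x. (indicator K x *\<^sub>R k x) *\<^sub>R g x)"
  proof (rule locally_integrable_mult[OF g K, where M = "max M 0"])
    have "(\<lambda>x. indicator K x *\<^sub>R k x) \<in> borel_measurable borel"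
      using K(1) ck by (intro borel_measurable_continuous_on_indicator) (auto simp: compact_imp_closed)
    then show "(\<lambda>x. indicator K x *\<^sub>R k x) \<in> borel_measurable lebesgue"
      by (intro measurable_completion) simp
    show "\<bar>indicator K x *\<^sub>R k x\<bar> \<le> max M 0" for x
      using M by (cases "x \<in> K") auto
  qed auto
  then show "integrable lebesgue (\<lambda>x. indicator K x *\<^sub>R (k x *\<^sub>R g x))" by simp
qed

lemma locally_integrable_indicator:
  fixes g :: "'a::euclidean_space \<Rightarrow> 'b::euclidean_space"
  assumes "locally_integrable \<Omega> g" "S \<in> sets lebesgue"
  shows "locally_integrable \<Omega> (\<lambda>x. indicator S x *\<^sub>R g x)"
  unfolding locally_integrable_def set_integrable_def
proof (intro allI impI, elim conjE)
  fix K assume K: "compact K" "K \<subseteq> \<Omega>"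
  then have "integrable lebesgue (\<lambda>x. indicator K x *\<^sub>R g x)"
    using assms(1) by (auto simp: locally_integrable_def set_integrable_def)
  then have "integrable lebesgue (\<lambda>x. indicator S x *\<^sub>R (indicator K x *\<^sub>R g x))"
    by (rule integrable_mult_indicator[OF assms(2)])
  then show "integrable lebesgue (\<lambda>x. indicator K x *\<^sub>R (indicator S x *\<^sub>R g x))"
    by (simp add: mult.commute)
qed

text \<open>Mollifications obey the classical chain rule. As \<open>f\<close> is continuous, its
  values on a compact collar of the support stay in an interval on which \<Phi> and \<Phi>' are
  bounded; F n tends to f pointwise and G n to g in L1.\<close>

lemma has_weak_gradient_chain:
  fixes f :: "'a::euclidean_space \<Rightarrow> real"
  assumes \<Omega>: "open \<Omega>" and cf: "continuous_on \<Omega> f" and w: "has_weak_gradient \<Omega> f g"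
    and \<Phi>: "\<And>t. (\<Phi> has_real_derivative \<Phi>' t) (at t)" and c\<Phi>': "continuous_on UNIV \<Phi>'"
  shows "has_weak_gradient \<Omega> (\<lambda>x. \<Phi> (f x)) (\<lambda>x. \<Phi>' (f x) *\<^sub>R g x)"
proof (rule has_weak_gradientI)
  have c\<Phi>: "continuous_on UNIV \<Phi>" using \<Phi> by (auto intro!: continuous_at_imp_continuous_on DERIV_isCont)
  have lf: "locally_integrable \<Omega> f" and lg: "locally_integrable \<Omega> g" using w by (auto simp: has_weak_gradient_def)
  have c\<Phi>f: "continuous_on \<Omega> (\<lambda>x. \<Phi> (f x))" and c\<Phi>'f: "continuous_on \<Omega> (\<lambda>x. \<Phi>' (f x))"
    using continuous_on_compose2[OF c\<Phi> cf] continuous_on_compose2[OF c\<Phi>' cf] by auto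
  show "locally_integrable \<Omega> (\<lambda>x. \<Phi> (f x))" by (rule continuous_on_locally_integrable[OF c\<Phi>f])
  show lg': "locally_integrable \<Omega> (\<lambda>x. \<Phi>' (f x) *\<^sub>R g x)"
    by (rule locally_integrable_mult_continuous_on[OF lg c\<Phi>'f])
  fix \<eta> :: "'a \<Rightarrow> real" and K
  assume \<eta>: "Cinf_on \<eta> UNIV" and K: "compact K" "K \<subseteq> \<Omega>" and \<eta>z: "\<And>x. x \<notin> K \<Longrightarrow> \<eta> x = 0"
    and gz: "\<And>x. x \<notin> K \<Longrightarrow> gradient \<eta> x = 0"
  have c\<eta>: "continuous_on UNIV \<eta>" by (rule Cinf_on_continuous[OF \<eta>])
  obtain E where E: "E \<ge> 0" "\<And>x. norm (\<eta> x) \<le> E" using compact_support_bounded[OF c\<eta> K(1) \<eta>z] by blast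
  obtain \<epsilon> where \<epsilon>: "\<epsilon> > 0" "\<And>t. t \<le> \<epsilon> \<Longrightarrow> (\<Union>x\<in>K. cball x t) \<subseteq> \<Omega>" "\<And>t. compact (\<Union>x\<in>K. cball x t)"
    using compact_neighbourhood[OF K(1) \<Omega> K(2)] by blast
  define L where "L = (\<Union>x\<in>K. cball x \<epsilon>)"
  have L: "compact L" "L \<subseteq> \<Omega>" using \<epsilon> by (auto simp: L_def)
  have LK: "cball x t \<subseteq> L" if "x \<in> K" "t \<le> \<epsilon>" for x t using that by (force simp: L_def)
  define ft where "ft = (\<lambda>y. indicator L y *\<^sub>R f y)"
  define gt where "gt = (\<lambda>y. indicator L y *\<^sub>R g y)"
  have ift: "integrable lebesgue ft" and igt: "integrable lebesgue gt"
    using lf lg L by (auto simp: locally_integrable_def set_integrable_def ft_def gt_def)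
  have gtz: "gt x = 0" if "x \<notin> L" for x using that by (simp add: gt_def)
  obtain M0 where M0: "\<forall>x\<in>L. norm (f x) \<le> M0"
    using compact_imp_bounded[OF compact_continuous_image[OF continuous_on_subset[OF cf L(2)] L(1)]]
    by (auto simp: bounded_iff)
  define M where "M = max M0 0"
  have M: "\<bar>f x\<bar> \<le> M" if "x \<in> L" for x using M0 that by (force simp: M_def)
  have M': "M \<ge> 0" by (simp add: M_def)
  obtain C0 where C0: "\<forall>t\<in>{-M..M}. norm (\<Phi> t) \<le> C0"
    using compact_imp_bounded[OF compact_continuous_image[OF continuous_on_subset[OF c\<Phi>] compact_Icc[of "-M" M]]]
    by (auto simp: bounded_iff)
  obtain C1 where C1: "\<forall>t\<in>{-M..M}. norm (\<Phi>' t) \<le> C1"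
    using compact_imp_bounded[OF compact_continuous_image[OF continuous_on_subset[OF c\<Phi>'] compact_Icc[of "-M" M]]]
    by (auto simp: bounded_iff)
  have C1': "C1 \<ge> 0" using C1 M' by (metis abs_ge_zero atLeastAtMost_iff neg_le_0_iff_le order_trans real_norm_def)
  \<comment> \<open>At most \<epsilon>, so every mollification ball around a point of
    \<open>K\<close> stays in the collar \<open>L\<close>.\<close>
  define \<delta> where "\<delta> n = \<epsilon> / real (Suc n)" for n
  have \<delta>: "\<delta> n > 0" "\<delta> n \<le> \<epsilon>" for n using \<epsilon>(1) by (auto simp: \<delta>_def divide_simps)
  have \<delta>lim: "\<delta> \<longlonglongrightarrow> 0" unfolding \<delta>_def by (rule tendsto_divide_0[OF tendsto_const]) (rule filterlim_at_top_imp_at_infinity, rule filterlim_compose[OF filterlim_real_sequentially filterlim_Suc])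
  obtain \<rho> :: "nat \<Rightarrow> 'a \<Rightarrow> real" where m: "\<And>n. mollifier (\<delta> n) (\<rho> n)"
    using mollifier_exists[OF \<delta>(1)] by metis
  define F where "F n = mollify (\<rho> n) ft" for n
  define G where "G n = mollify (\<rho> n) gt" for n
  have CF: "Cinf_on (F n) UNIV" for n
    unfolding F_def by (rule Cinf_on_mollify[where R = "\<delta> n"]) (use m[of n] ift in \<open>auto simp: mollifier_def\<close>)
  have cF: "continuous_on UNIV (F n)" for n by (rule Cinf_on_continuous[OF CF])
  have cG: "continuous_on UNIV (G n)" for n unfolding G_def by (rule mollify_measurable[OF m igt])
  have FM: "\<bar>F n x\<bar> \<le> M" if x: "x \<in> K" for n x
  proof -
    have "norm (F n x - 0) \<le> M"
      unfolding F_def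
    proof (rule mollify_close[OF m ift])
      fix y assume "y \<in> cball x (\<delta> n)"
      then have "y \<in> L" using LK[OF x \<delta>(2)] by blast
      then show "norm (ft y - 0) \<le> M" using M by (simp add: ft_def)
    qed
    then show ?thesis by simp
  qed
  have fM: "\<bar>f x\<bar> \<le> M" if x: "x \<in> K" for x using M LK[OF x order_refl] \<epsilon>(1) by (meson centre_in_cball less_eq_real_def subsetD)
  have Flim: "(\<lambda>n. F n x) \<longlonglongrightarrow> f x" if x: "x \<in> K" for x
  proof (rule LIMSEQ_I)
    fix r :: real assume r: "r > 0"
    have "isCont f x" using cf \<Omega> x K(2) by (simp add: continuous_on_eq_continuous_at subset_iff)
    then obtain d where d: "d > 0" "\<And>y. dist y x < d \<Longrightarrow> dist (f y) (f x) < r / 2"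
      using r unfolding continuous_at_eps_delta by (metis half_gt_zero)
    obtain N where N: "\<And>n. n \<ge> N \<Longrightarrow> \<delta> n < d"
      using order_tendstoD(2)[OF \<delta>lim d(1)] by (auto simp: eventually_sequentially)
    have "norm (F n x - f x) < r" if "n \<ge> N" for n
    proof -
      have "norm (F n x - f x) \<le> r / 2"
        unfolding F_def
      proof (rule mollify_close[OF m ift])
        fix y assume y: "y \<in> cball x (\<delta> n)"
        then have "y \<in> L" using LK[OF x \<delta>(2)] by blast
        moreover have "dist y x < d" using y N[OF that] by (simp add: dist_commute)
        ultimately show "norm (ft y - f x) \<le> r / 2" using d(2)[of y] by (simp add: ft_def dist_norm)
      qed
      then show ?thesis using r by linarith
    qed
    then show "\<exists>N. \<forall>n\<ge>N. norm (F n x - f x) < r" by blast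
  qed
  have GF: "gradient (F n) x = G n x" if "x \<in> K" for n x
    unfolding F_def G_def ft_def gt_def
    by (rule gradient_eq[OF GDERIV_mollify[OF w L m LK[OF that \<delta>(2)]]])
  have id: "(\<integral>x. \<Phi> (F n x) *\<^sub>R gradient \<eta> x \<partial>lebesgue) = - (\<integral>x. (\<eta> x * \<Phi>' (F n x)) *\<^sub>R G n x \<partial>lebesgue)" for n
  proof -
    have "has_weak_gradient UNIV (\<lambda>x. \<Phi> (F n x)) (\<lambda>x. \<Phi>' (F n x) *\<^sub>R gradient (F n) x)"
    proof (rule has_weak_gradient_classical[OF open_UNIV])
      show "GDERIV (\<lambda>x. \<Phi> (F n x)) x :> \<Phi>' (F n x) *\<^sub>R gradient (F n) x" for x
        by (rule GDERIV_DERIV_compose[OF Cinf_on_GDERIV[OF CF] \<Phi>]) simp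
      show "continuous_on UNIV (\<lambda>x. \<Phi>' (F n x) *\<^sub>R gradient (F n) x)"
        by (intro continuous_intros continuous_on_compose2[OF c\<Phi>' cF] continuous_gradient[OF CF]) simp
    qed
    from weak_gradient_test[OF this \<eta> K(1) _ \<eta>z]
    have 1: "(\<integral>x. \<Phi> (F n x) *\<^sub>R gradient \<eta> x \<partial>lebesgue)
       = - (\<integral>x. \<eta> x *\<^sub>R (\<Phi>' (F n x) *\<^sub>R gradient (F n) x) \<partial>lebesgue)" by simp
    have 2: "\<eta> x *\<^sub>R (\<Phi>' (F n x) *\<^sub>R gradient (F n) x) = (\<eta> x * \<Phi>' (F n x)) *\<^sub>R G n x" for x
      using GF[of x n] \<eta>z[of x] by (cases "x \<in> K") auto
    show ?thesis using 1 unfolding 2 .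
  qed
  have lhs: "(\<lambda>n. \<integral>x. \<Phi> (F n x) *\<^sub>R gradient \<eta> x \<partial>lebesgue) \<longlonglongrightarrow> (\<integral>x. \<Phi> (f x) *\<^sub>R gradient \<eta> x \<partial>lebesgue)"
  proof (rule integral_dominated_convergence[where w = "\<lambda>x. C0 * norm (gradient \<eta> x)"])
    have s: "continuous_on UNIV (\<lambda>x. \<Phi> (F n x) *\<^sub>R gradient \<eta> x)" for n
      by (intro continuous_intros continuous_on_compose2[OF c\<Phi> cF] continuous_gradient[OF \<eta>]) simp
    show sm: "(\<lambda>x. \<Phi> (F n x) *\<^sub>R gradient \<eta> x) \<in> borel_measurable lebesgue" for n
      by (rule measurable_lebesgue_continuous[OF s])
    have lim: "(\<lambda>n. \<Phi> (F n x) *\<^sub>R gradient \<eta> x) \<longlonglongrightarrow> \<Phi> (f x) *\<^sub>R gradient \<eta> x" for x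
    proof (cases "x \<in> K")
      case True
      have "(\<lambda>n. \<Phi> (F n x)) \<longlonglongrightarrow> \<Phi> (f x)"
        using continuous_on_tendsto_compose[OF c\<Phi> Flim[OF True]] by auto
      then show ?thesis by (intro tendsto_intros)
    next
      case False
      then show ?thesis by (simp add: gz)
    qed
    then show "AE x in lebesgue. (\<lambda>n. \<Phi> (F n x) *\<^sub>R gradient \<eta> x) \<longlonglongrightarrow> \<Phi> (f x) *\<^sub>R gradient \<eta> x" by simp
    show "(\<lambda>x. \<Phi> (f x) *\<^sub>R gradient \<eta> x) \<in> borel_measurable lebesgue"
      by (rule borel_measurable_LIMSEQ_metric[OF sm lim])
    show "integrable lebesgue (\<lambda>x. C0 * norm (gradient \<eta> x))"
      by (intro integrable_mult_right integrable_norm integrable_compact_support[OF continuous_gradient[OF \<eta>] K(1) gz])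
    show "AE x in lebesgue. norm (\<Phi> (F n x) *\<^sub>R gradient \<eta> x) \<le> C0 * norm (gradient \<eta> x)" for n
    proof (rule AE_I2)
      fix x
      show "norm (\<Phi> (F n x) *\<^sub>R gradient \<eta> x) \<le> C0 * norm (gradient \<eta> x)"
      proof (cases "x \<in> K")
        case True
        then have "norm (\<Phi> (F n x)) \<le> C0" using C0 FM[OF True, of n] by (auto simp: abs_le_iff)
        then show ?thesis unfolding norm_scaleR by (intro mult_right_mono) auto
      qed (simp add: gz)
    qed
  qed
  have k1: "integrable lebesgue (\<lambda>x. (\<eta> x * \<Phi>' (f x)) *\<^sub>R gt x)"
  proof -
    have "integrable lebesgue (\<lambda>x. \<eta> x *\<^sub>R (\<Phi>' (f x) *\<^sub>R g x))"
      by (rule locally_integrable_mult_continuous[OF lg' K \<eta>z c\<eta>])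
    moreover have e: "(\<eta> x * \<Phi>' (f x)) *\<^sub>R gt x = \<eta> x *\<^sub>R (\<Phi>' (f x) *\<^sub>R g x)" for x
      using LK[of x 0] \<epsilon>(1) \<eta>z[of x] by (cases "x \<in> K") (auto simp: gt_def)
    ultimately show ?thesis unfolding e by blast
  qed
  have cc: "continuous_on UNIV (\<lambda>x. \<eta> x * \<Phi>' (F n x))" for n
    by (intro continuous_intros c\<eta> continuous_on_compose2[OF c\<Phi>' cF]) simp
  have bd: "\<bar>\<eta> x * \<Phi>' (F n x)\<bar> \<le> E * C1" for n x
  proof (cases "x \<in> K")
    case True
    then have "\<bar>\<Phi>' (F n x)\<bar> \<le> C1" using C1 FM[OF True, of n] by (auto simp: abs_le_iff)
    then show ?thesis unfolding abs_mult using E by (intro mult_mono) auto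
  qed (use E C1' in \<open>simp add: \<eta>z\<close>)
  have bd2: "\<bar>\<eta> x * \<Phi>' (f x)\<bar> \<le> E * C1" for x
  proof (cases "x \<in> K")
    case True
    then have "\<bar>\<Phi>' (f x)\<bar> \<le> C1" using C1 fM[OF True] by (auto simp: abs_le_iff)
    then show ?thesis unfolding abs_mult using E by (intro mult_mono) auto
  qed (use E C1' in \<open>simp add: \<eta>z\<close>)
  have k2: "integrable lebesgue (\<lambda>x. (\<eta> x * \<Phi>' (F n x)) *\<^sub>R gt x)" for n
  proof -
    have "integrable lebesgue (\<lambda>x. (\<eta> x * \<Phi>' (F n x)) *\<^sub>R g x)"
      by (rule locally_integrable_mult_continuous[OF lg K _ cc]) (simp add: \<eta>z)
    moreover have e: "(\<eta> x * \<Phi>' (F n x)) *\<^sub>R gt x = (\<eta> x * \<Phi>' (F n x)) *\<^sub>R g x" for x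
      using LK[of x 0] \<epsilon>(1) \<eta>z[of x] by (cases "x \<in> K") (auto simp: gt_def)
    ultimately show ?thesis unfolding e by blast
  qed
  have cGn: "continuous_on UNIV (\<lambda>x. (\<eta> x * \<Phi>' (F n x)) *\<^sub>R G n x)" for n
    by (intro continuous_intros cc cG)
  have k3: "integrable lebesgue (\<lambda>x. (\<eta> x * \<Phi>' (F n x)) *\<^sub>R G n x)" for n
    by (rule integrable_compact_support[OF cGn K(1)]) (simp add: \<eta>z)
  \<comment> \<open>Both factors depend on n. First only \<Phi>' (F n) moves, against the fixed
    integrable \<open>gt\<close>, by domination; then \<open>dist2\<close> replaces
    \<open>gt\<close> by \<open>G n\<close>, where the L1 difference is small and the other factor
    is at most E * C1.\<close>
  have dist1: "(\<lambda>n. (\<integral>x. (\<eta> x * \<Phi>' (F n x)) *\<^sub>R gt x \<partial>lebesgue)) \<longlonglongrightarrow> (\<integral>x. (\<eta> x * \<Phi>' (f x)) *\<^sub>R gt x \<partial>lebesgue)"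
  proof (rule integral_dominated_convergence[where w = "\<lambda>x. (E * C1) * norm (gt x)"])
    show "(\<lambda>x. (\<eta> x * \<Phi>' (f x)) *\<^sub>R gt x) \<in> borel_measurable lebesgue" using k1 by (rule borel_measurable_integrable)
    show "(\<lambda>x. (\<eta> x * \<Phi>' (F n x)) *\<^sub>R gt x) \<in> borel_measurable lebesgue" for n using k2 by (rule borel_measurable_integrable)
    show "integrable lebesgue (\<lambda>x. E * C1 * norm (gt x))" by (intro integrable_mult_right integrable_norm igt)
    have "(\<lambda>n. (\<eta> x * \<Phi>' (F n x)) *\<^sub>R gt x) \<longlonglongrightarrow> (\<eta> x * \<Phi>' (f x)) *\<^sub>R gt x" for x
    proof (cases "x \<in> K")
      case True
      have "(\<lambda>n. \<Phi>' (F n x)) \<longlonglongrightarrow> \<Phi>' (f x)"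
        using continuous_on_tendsto_compose[OF c\<Phi>' Flim[OF True]] by auto
      then show ?thesis by (intro tendsto_intros)
    qed (simp add: \<eta>z)
    then show "AE x in lebesgue. (\<lambda>n. (\<eta> x * \<Phi>' (F n x)) *\<^sub>R gt x) \<longlonglongrightarrow> (\<eta> x * \<Phi>' (f x)) *\<^sub>R gt x" by simp
    show "AE x in lebesgue. norm ((\<eta> x * \<Phi>' (F n x)) *\<^sub>R gt x) \<le> E * C1 * norm (gt x)" for n
      using bd[of _ n] by (auto intro!: AE_I2 mult_right_mono simp: abs_mult[symmetric])
  qed
  have dist2: "(\<lambda>n. (\<integral>x. (\<eta> x * \<Phi>' (F n x)) *\<^sub>R G n x \<partial>lebesgue) - (\<integral>x. (\<eta> x * \<Phi>' (F n x)) *\<^sub>R gt x \<partial>lebesgue)) \<longlonglongrightarrow> 0"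
  proof (rule LIMSEQ_I)
    fix r :: real assume r: "r > 0"
    define r' where "r' = r / (E * C1 + 1)"
    have EC: "E * C1 \<ge> 0" using E C1' by simp
    have r': "r' > 0" using r EC by (simp add: r'_def)
    obtain d where d: "d > 0" "\<And>\<delta> \<rho>. mollifier \<delta> \<rho> \<Longrightarrow> \<delta> < d \<Longrightarrow> (\<integral>x. norm (mollify \<rho> gt x - gt x) \<partial>lebesgue) < r'"
      using mollify_tendsto_L1[OF igt L(1) gtz r'] by blast
    obtain N where N: "\<And>n. n \<ge> N \<Longrightarrow> \<delta> n < d"
      using order_tendstoD(2)[OF \<delta>lim d(1)] by (auto simp: eventually_sequentially)
    have "norm ((\<integral>x. (\<eta> x * \<Phi>' (F n x)) *\<^sub>R G n x \<partial>lebesgue) - (\<integral>x. (\<eta> x * \<Phi>' (F n x)) *\<^sub>R gt x \<partial>lebesgue)) < r"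
      if n: "n \<ge> N" for n
    proof -
      have iG: "integrable lebesgue (\<lambda>x. norm (G n x - gt x))"
      proof -
        have "integrable lebesgue (\<lambda>x. norm (gt x) powr 1)" using integrable_norm[OF igt] by simp
        note * = mollify_Lp_le(1)[OF order_refl m[of n] igt this]
        have "integrable lebesgue (G n)"
          using * measurable_lebesgue_continuous[OF cG] unfolding G_def
          by (subst integrable_norm_iff[symmetric]) simp_all
        then show ?thesis by (rule integrable_norm[OF Bochner_Integration.integrable_diff[OF _ igt]])
      qed
      have "(\<integral>x. (\<eta> x * \<Phi>' (F n x)) *\<^sub>R G n x \<partial>lebesgue) - (\<integral>x. (\<eta> x * \<Phi>' (F n x)) *\<^sub>R gt x \<partial>lebesgue)
        = (\<integral>x. (\<eta> x * \<Phi>' (F n x)) *\<^sub>R (G n x - gt x) \<partial>lebesgue)"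
        unfolding scaleR_diff_right by (rule Bochner_Integration.integral_diff[OF k3 k2, symmetric])
      also have "norm \<dots> \<le> (\<integral>x. (E * C1) * norm (G n x - gt x) \<partial>lebesgue)"
      proof (rule Bochner_Integration.integral_norm_bound_integral)
        show "integrable lebesgue (\<lambda>x. (\<eta> x * \<Phi>' (F n x)) *\<^sub>R (G n x - gt x))"
          unfolding scaleR_diff_right by (rule Bochner_Integration.integrable_diff[OF k3 k2])
        show "integrable lebesgue (\<lambda>x. E * C1 * norm (G n x - gt x))" by (rule integrable_mult_right[OF iG])
        show "norm ((\<eta> x * \<Phi>' (F n x)) *\<^sub>R (G n x - gt x)) \<le> E * C1 * norm (G n x - gt x)" for x
          using bd[of x n] unfolding norm_scaleR by (intro mult_right_mono) auto
      qed
      also have "\<dots> = (E * C1) * (\<integral>x. norm (G n x - gt x) \<partial>lebesgue)" by simp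
      also have "\<dots> \<le> (E * C1) * r'"
        using d(2)[OF m[of n] N[OF n]] EC unfolding G_def by (intro mult_left_mono) auto
      also have "\<dots> < r" using r EC by (simp add: r'_def field_simps)
      finally show ?thesis .
    qed
    then show "\<exists>no. \<forall>n\<ge>no. norm ((\<integral>x. (\<eta> x * \<Phi>' (F n x)) *\<^sub>R G n x \<partial>lebesgue) - (\<integral>x. (\<eta> x * \<Phi>' (F n x)) *\<^sub>R gt x \<partial>lebesgue) - 0) < r"
      by (intro exI[of _ N]) simp
  qed
  from tendsto_add[OF dist2 dist1]
  have "(\<lambda>n. \<integral>x. (\<eta> x * \<Phi>' (F n x)) *\<^sub>R G n x \<partial>lebesgue) \<longlonglongrightarrow> (\<integral>x. (\<eta> x * \<Phi>' (f x)) *\<^sub>R gt x \<partial>lebesgue)"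
    by simp
  then have "(\<lambda>n. \<integral>x. \<Phi> (F n x) *\<^sub>R gradient \<eta> x \<partial>lebesgue) \<longlonglongrightarrow> - (\<integral>x. (\<eta> x * \<Phi>' (f x)) *\<^sub>R gt x \<partial>lebesgue)"
    unfolding id by (rule tendsto_minus)
  from LIMSEQ_unique[OF lhs this]
  have "(\<integral>x. \<Phi> (f x) *\<^sub>R gradient \<eta> x \<partial>lebesgue) = - (\<integral>x. (\<eta> x * \<Phi>' (f x)) *\<^sub>R gt x \<partial>lebesgue)" .
  moreover have e: "(\<eta> x * \<Phi>' (f x)) *\<^sub>R gt x = \<eta> x *\<^sub>R (\<Phi>' (f x) *\<^sub>R g x)" for x
    using LK[of x 0] \<epsilon>(1) \<eta>z[of x] by (cases "x \<in> K") (auto simp: gt_def)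
  ultimately show "(\<integral>x. \<Phi> (f x) *\<^sub>R gradient \<eta> x \<partial>lebesgue) = - (\<integral>x. \<eta> x *\<^sub>R (\<Phi>' (f x) *\<^sub>R g x) \<partial>lebesgue)"
    unfolding e by blast
qed

text \<open>A C^1 approximation of the positive part whose derivative lies in [0, 1) and vanishes
  for all t \<le> 0, including t = 0. As e tends to 0 the derivative tends to the indicator of t >
  0.\<close>

definition smooth_pos :: "real \<Rightarrow> real \<Rightarrow> real" where
  "smooth_pos e t = (max t 0)\<^sup>2 / (max t 0 + e)"

lemma smooth_pos_deriv:
  assumes "e > 0"
  shows "(smooth_pos e has_real_derivative 1 - (e / (max t 0 + e))\<^sup>2) (at t)"
proof -
  consider "t > 0" | "t < 0" | "t = 0" by linarith
  then show ?thesis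
  proof cases
    case 1
    have "((\<lambda>t. t\<^sup>2 / (t + e)) has_real_derivative 1 - (e / (max t 0 + e))\<^sup>2) (at t)"
      using 1 assms by (auto intro!: derivative_eq_intros simp: divide_simps) (simp add: power2_eq_square algebra_simps)
    then show ?thesis
      by (rule has_field_derivative_transform_within_open[where S = "{0<..}"])
        (use 1 in \<open>auto simp: smooth_pos_def\<close>)
  next
    case 2
    have "((\<lambda>t. 0) has_real_derivative 1 - (e / (max t 0 + e))\<^sup>2) (at t)"
      using 2 assms by simp
    then show ?thesis
      by (rule has_field_derivative_transform_within_open[where S = "{..<0}"])
        (use 2 in \<open>auto simp: smooth_pos_def\<close>)
  next
    case 3
    have "((\<lambda>y. (smooth_pos e y - smooth_pos e 0) / (y - 0)) \<longlongrightarrow> 0) (at 0)"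
    proof (rule Lim_transform_eventually)
      have "((\<lambda>y::real. max y 0 / (max y 0 + e)) \<longlongrightarrow> max 0 0 / (max 0 0 + e)) (at 0)"
        by (intro tendsto_intros) (use assms in auto)
      then show "((\<lambda>y::real. max y 0 / (max y 0 + e)) \<longlongrightarrow> 0) (at 0)" by simp
      show "\<forall>\<^sub>F y in at 0. max y 0 / (max y 0 + e) = (smooth_pos e y - smooth_pos e 0) / (y - 0)"
        by (auto simp: eventually_at_filter smooth_pos_def max_def power2_eq_square)
    qed
    then show ?thesis using 3 assms by (simp add: has_field_derivative_iff)
  qed
qed

lemma smooth_pos_bounds:
  assumes "e > 0"
  shows "\<bar>smooth_pos e t\<bar> \<le> \<bar>t\<bar>" "\<bar>1 - (e / (max t 0 + e))\<^sup>2\<bar> \<le> 1" "\<bar>smooth_pos e t - max t 0\<bar> \<le> e"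
proof -
  have "0 \<le> e / (max t 0 + e)" "e / (max t 0 + e) \<le> 1" using assms by (auto simp: divide_simps)
  then show "\<bar>1 - (e / (max t 0 + e))\<^sup>2\<bar> \<le> 1" by (simp add: power_le_one)
  have s: "0 \<le> max t 0" by simp
  have "smooth_pos e t = max t 0 * (max t 0 / (max t 0 + e))" by (simp add: smooth_pos_def power2_eq_square)
  also have "\<dots> \<le> max t 0 * 1" using assms s by (intro mult_left_mono) auto
  finally show "\<bar>smooth_pos e t\<bar> \<le> \<bar>t\<bar>" using assms by (simp add: smooth_pos_def)
  have "max t 0 - smooth_pos e t = e * (max t 0 / (max t 0 + e))"
    using assms s by (simp add: smooth_pos_def power2_eq_square field_simps)
  moreover have "e * (max t 0 / (max t 0 + e)) \<le> e * 1" using assms s by (intro mult_left_mono) auto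
  moreover have "0 \<le> e * (max t 0 / (max t 0 + e))" using assms s by auto
  ultimately show "\<bar>smooth_pos e t - max t 0\<bar> \<le> e" by linarith
qed

text \<open>Because the approximating derivatives are exactly 0 where f \<le> 0, the limit has
  gradient 0 on the zero set of \<open>f\<close>, whatever \<open>g\<close> is there.\<close>

lemma has_weak_gradient_pos_part:
  fixes f :: "'a::euclidean_space \<Rightarrow> real"
  assumes \<Omega>: "open \<Omega>" and cf: "continuous_on \<Omega> f" and w: "has_weak_gradient \<Omega> f g"
  shows "has_weak_gradient \<Omega> (\<lambda>x. max (f x) 0) (\<lambda>x. if f x > 0 then g x else 0)"
proof (rule has_weak_gradientI)
  have lf: "locally_integrable \<Omega> f" and lg: "locally_integrable \<Omega> g" using w by (auto simp: has_weak_gradient_def)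
  define S where "S = {x \<in> \<Omega>. f x > 0}"
  have "open (f -` {0<..} \<inter> \<Omega>)" using continuous_on_open_vimage[OF \<Omega>] cf by (metis open_greaterThan)
  moreover have "f -` {0<..} \<inter> \<Omega> = S" by (auto simp: S_def)
  ultimately have oS: "open S" by simp
  show "locally_integrable \<Omega> (\<lambda>x. max (f x) 0)"
    by (intro continuous_on_locally_integrable continuous_intros cf)
  have ls: "locally_integrable \<Omega> (\<lambda>x. indicator S x *\<^sub>R g x)"
    by (rule locally_integrable_indicator[OF lg lebesgue_open[OF oS]])
  show "locally_integrable \<Omega> (\<lambda>x. if f x > 0 then g x else 0)"
    unfolding locally_integrable_def set_integrable_def
  proof (intro allI impI, elim conjE)
    fix K assume K: "compact K" "K \<subseteq> \<Omega>"
    have "integrable lebesgue (\<lambda>x. indicator K x *\<^sub>R (indicator S x *\<^sub>R g x))"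
      using ls K by (auto simp: locally_integrable_def set_integrable_def)
    moreover have "indicator K x *\<^sub>R (indicator S x *\<^sub>R g x) = indicator K x *\<^sub>R (if f x > 0 then g x else 0)" for x
      using K(2) by (auto simp: indicator_def S_def)
    ultimately show "integrable lebesgue (\<lambda>x. indicator K x *\<^sub>R (if f x > 0 then g x else 0))" by simp
  qed
  fix \<eta> :: "'a \<Rightarrow> real" and K
  assume \<eta>: "Cinf_on \<eta> UNIV" and K: "compact K" "K \<subseteq> \<Omega>" and \<eta>z: "\<And>x. x \<notin> K \<Longrightarrow> \<eta> x = 0"
    and gz: "\<And>x. x \<notin> K \<Longrightarrow> gradient \<eta> x = 0"
  define e where "e n = inverse (real (Suc n))" for n
  have e: "e n > 0" for n by (simp add: e_def)
  have elim': "e \<longlonglongrightarrow> 0" unfolding e_def by (rule LIMSEQ_inverse_real_of_nat)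
  define p where "p n t = 1 - (e n / (max t 0 + e n))\<^sup>2" for n t
  have wn: "has_weak_gradient \<Omega> (\<lambda>x. smooth_pos (e n) (f x)) (\<lambda>x. p n (f x) *\<^sub>R g x)" for n
  proof (rule has_weak_gradient_chain[OF \<Omega> cf w])
    show "(smooth_pos (e n) has_real_derivative p n t) (at t)" for t
      unfolding p_def by (rule smooth_pos_deriv[OF e])
    have "max t 0 + e n \<noteq> 0" for t using e[of n] by linarith
    then show "continuous_on UNIV (p n)" unfolding p_def by (intro continuous_intros) auto
  qed
  note iv = has_weak_gradient_integrable[OF wn \<eta> K \<eta>z] and iw = has_weak_gradient_integrable[OF w \<eta> K \<eta>z]
  have id: "(\<integral>x. smooth_pos (e n) (f x) *\<^sub>R gradient \<eta> x \<partial>lebesgue) = - (\<integral>x. \<eta> x *\<^sub>R (p n (f x) *\<^sub>R g x) \<partial>lebesgue)" for n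
    by (rule weak_gradient_test[OF wn \<eta> K \<eta>z])
  have "(\<lambda>n. \<integral>x. smooth_pos (e n) (f x) *\<^sub>R gradient \<eta> x \<partial>lebesgue) \<longlonglongrightarrow> (\<integral>x. max (f x) 0 *\<^sub>R gradient \<eta> x \<partial>lebesgue)"
  proof (rule integral_dominated_convergence[where w = "\<lambda>x. norm (f x *\<^sub>R gradient \<eta> x)"])
    have lim: "(\<lambda>n. smooth_pos (e n) (f x) *\<^sub>R gradient \<eta> x) \<longlonglongrightarrow> max (f x) 0 *\<^sub>R gradient \<eta> x" for x
    proof -
      have "(\<lambda>n. smooth_pos (e n) (f x)) \<longlonglongrightarrow> max (f x) 0"
        by (rule Lim_transform2[OF tendsto_const], rule Lim_null_comparison[OF _ elim'])
          (use smooth_pos_bounds(3)[OF e] in \<open>auto simp: abs_minus_commute\<close>)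
      then show ?thesis by (intro tendsto_intros)
    qed
    then show "AE x in lebesgue. (\<lambda>n. smooth_pos (e n) (f x) *\<^sub>R gradient \<eta> x) \<longlonglongrightarrow> max (f x) 0 *\<^sub>R gradient \<eta> x" by simp
    show m: "(\<lambda>x. smooth_pos (e n) (f x) *\<^sub>R gradient \<eta> x) \<in> borel_measurable lebesgue" for n
      using iv(1) by (rule borel_measurable_integrable)
    show "(\<lambda>x. max (f x) 0 *\<^sub>R gradient \<eta> x) \<in> borel_measurable lebesgue"
      by (rule borel_measurable_LIMSEQ_metric[OF m lim])
    show "integrable lebesgue (\<lambda>x. norm (f x *\<^sub>R gradient \<eta> x))" by (rule integrable_norm[OF iw(1)])
    show "AE x in lebesgue. norm (smooth_pos (e n) (f x) *\<^sub>R gradient \<eta> x) \<le> norm (f x *\<^sub>R gradient \<eta> x)" for n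
      unfolding norm_scaleR using smooth_pos_bounds(1)[OF e[of n]] by (intro AE_I2 mult_right_mono) auto
  qed
  moreover have "(\<lambda>n. \<integral>x. \<eta> x *\<^sub>R (p n (f x) *\<^sub>R g x) \<partial>lebesgue) \<longlonglongrightarrow> (\<integral>x. \<eta> x *\<^sub>R (if f x > 0 then g x else 0) \<partial>lebesgue)"
  proof (rule integral_dominated_convergence[where w = "\<lambda>x. norm (\<eta> x *\<^sub>R g x)"])
    have lim: "(\<lambda>n. \<eta> x *\<^sub>R (p n (f x) *\<^sub>R g x)) \<longlonglongrightarrow> \<eta> x *\<^sub>R (if f x > 0 then g x else 0)" for x
    proof (cases "f x > 0")
      case True
      have "(\<lambda>n. p n (f x)) \<longlonglongrightarrow> 1 - (0 / (max (f x) 0 + 0))\<^sup>2"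
        unfolding p_def by (intro tendsto_intros elim') (use True in auto)
      then have "(\<lambda>n. p n (f x)) \<longlonglongrightarrow> 1" by simp
      then have "(\<lambda>n. \<eta> x *\<^sub>R (p n (f x) *\<^sub>R g x)) \<longlonglongrightarrow> \<eta> x *\<^sub>R (1 *\<^sub>R g x)" by (intro tendsto_intros)
      then show ?thesis using True by simp
    next
      case False
      then have "p n (f x) = 0" for n using e[of n] by (simp add: p_def max_def)
      then show ?thesis using False by simp
    qed
    then show "AE x in lebesgue. (\<lambda>n. \<eta> x *\<^sub>R (p n (f x) *\<^sub>R g x)) \<longlonglongrightarrow> \<eta> x *\<^sub>R (if f x > 0 then g x else 0)" by simp
    show m: "(\<lambda>x. \<eta> x *\<^sub>R (p n (f x) *\<^sub>R g x)) \<in> borel_measurable lebesgue" for n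
      using iv(2) by (rule borel_measurable_integrable)
    show "(\<lambda>x. \<eta> x *\<^sub>R (if f x > 0 then g x else 0)) \<in> borel_measurable lebesgue"
      by (rule borel_measurable_LIMSEQ_metric[OF m lim])
    show "integrable lebesgue (\<lambda>x. norm (\<eta> x *\<^sub>R g x))" by (rule integrable_norm[OF iw(2)])
    show "AE x in lebesgue. norm (\<eta> x *\<^sub>R (p n (f x) *\<^sub>R g x)) \<le> norm (\<eta> x *\<^sub>R g x)" for n
    proof (rule AE_I2)
      fix x
      have "\<bar>p n (f x)\<bar> * norm (g x) \<le> 1 * norm (g x)"
        unfolding p_def by (rule mult_right_mono[OF smooth_pos_bounds(2)[OF e]]) simp
      then show "norm (\<eta> x *\<^sub>R (p n (f x) *\<^sub>R g x)) \<le> norm (\<eta> x *\<^sub>R g x)"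
        unfolding norm_scaleR by (intro mult_left_mono) auto
    qed
  qed
  ultimately show "(\<integral>x. max (f x) 0 *\<^sub>R gradient \<eta> x \<partial>lebesgue) = - (\<integral>x. \<eta> x *\<^sub>R (if f x > 0 then g x else 0) \<partial>lebesgue)"
    unfolding id using LIMSEQ_unique tendsto_minus by blast
qed

section \<open>Compactly supported Sobolev functions\<close>

lemma borel_measurable_lebesgue_AE:
  fixes f g :: "'a::euclidean_space \<Rightarrow> 'b::euclidean_space"
  assumes "f \<in> borel_measurable lebesgue" "AE x in lebesgue. f x = g x"
  shows "g \<in> borel_measurable lebesgue" "integral\<^sup>L lebesgue f = integral\<^sup>L lebesgue g"
proof -
  show g: "g \<in> borel_measurable lebesgue"
    using borel_measurable_AE[OF assms] .
  show "integral\<^sup>L lebesgue f = integral\<^sup>L lebesgue g"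
    by (rule integral_cong_AE[OF assms(1) g assms(2)])
qed

lemma has_weak_gradient_cong:
  fixes v :: "'a::euclidean_space \<Rightarrow> real"
  assumes w: "has_weak_gradient \<Omega> v g" and v: "\<And>x. x \<in> \<Omega> \<Longrightarrow> v x = v' x" and g: "\<And>x. x \<in> \<Omega> \<Longrightarrow> g x = g' x"
  shows "has_weak_gradient \<Omega> v' g'"
proof (rule has_weak_gradientI)
  have "locally_integrable \<Omega> k'" if "locally_integrable \<Omega> k" "\<And>x. x \<in> \<Omega> \<Longrightarrow> k x = k' x" for k k' :: "'a \<Rightarrow> 'c::euclidean_space"
    unfolding locally_integrable_def set_integrable_def
  proof (intro allI impI, elim conjE)
    fix K assume K: "compact K" "K \<subseteq> \<Omega>"
    have "integrable lebesgue (\<lambda>x. indicator K x *\<^sub>R k x)"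
      using that(1) K by (auto simp: locally_integrable_def set_integrable_def)
    moreover have e: "indicator K x *\<^sub>R k' x = indicator K x *\<^sub>R k x" for x
      using that(2)[of x] K(2) by (cases "x \<in> K") auto
    ultimately show "integrable lebesgue (\<lambda>x. indicator K x *\<^sub>R k' x)" unfolding e by blast
  qed
  note * = this
  show "locally_integrable \<Omega> v'" "locally_integrable \<Omega> g'"
    using *[OF _ v] *[OF _ g] w by (auto simp: has_weak_gradient_def)
  fix \<eta> :: "'a \<Rightarrow> real" and K
  assume \<eta>: "Cinf_on \<eta> UNIV" "compact K" "K \<subseteq> \<Omega>" "\<And>x. x \<notin> K \<Longrightarrow> \<eta> x = 0"
    and gz: "\<And>x. x \<notin> K \<Longrightarrow> gradient \<eta> x = 0"
  have 1: "v' x *\<^sub>R gradient \<eta> x = v x *\<^sub>R gradient \<eta> x" for x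
    using v[of x] gz[of x] \<eta>(3) by (cases "x \<in> K") auto
  have 2: "\<eta> x *\<^sub>R g' x = \<eta> x *\<^sub>R g x" for x
    using g[of x] \<eta>(4)[of x] \<eta>(3) by (cases "x \<in> K") auto
  show "(\<integral>x. v' x *\<^sub>R gradient \<eta> x \<partial>lebesgue) = - (\<integral>x. \<eta> x *\<^sub>R g' x \<partial>lebesgue)"
    unfolding 1 2 by (rule weak_gradient_test[OF w \<eta>])
qed

lemma in_Lp_zero_outside:
  fixes f :: "'a::euclidean_space \<Rightarrow> 'b::euclidean_space"
  assumes "in_Lp p \<Omega> f" "K \<subseteq> \<Omega>" "\<And>x. x \<notin> K \<Longrightarrow> f x = 0"
  shows "f \<in> borel_measurable lebesgue" "integrable lebesgue (\<lambda>x. norm (f x) powr p)"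
proof -
  have e: "indicator \<Omega> x *\<^sub>R f x = f x" "indicator \<Omega> x *\<^sub>R (norm (f x) powr p) = norm (f x) powr p" for x
    using assms(2) assms(3)[of x] by (cases "x \<in> K"; auto)+
  show "f \<in> borel_measurable lebesgue" "integrable lebesgue (\<lambda>x. norm (f x) powr p)"
    using assms(1) unfolding in_Lp_def set_borel_measurable_def set_integrable_def e by blast+
qed

lemma weak_gradient_powr_integral:
  fixes v :: "'a::euclidean_space \<Rightarrow> real"
  assumes "open \<Omega>" and w: "has_weak_gradient \<Omega> v g" and m: "set_borel_measurable lebesgue \<Omega> g"
  shows "(LINT x:\<Omega>|lebesgue. norm (weak_gradient \<Omega> v x) powr p) = (LINT x:\<Omega>|lebesgue. norm (g x) powr p)"
  unfolding set_lebesgue_integral_def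
proof (rule borel_measurable_lebesgue_AE(2)[symmetric])
  have [measurable]: "(\<lambda>x. indicator \<Omega> x *\<^sub>R g x) \<in> borel_measurable lebesgue" "\<Omega> \<in> sets lebesgue"
    using m lebesgue_open[OF \<open>open \<Omega>\<close>] by (auto simp: set_borel_measurable_def)
  have "(\<lambda>x. indicator \<Omega> x *\<^sub>R norm (indicator \<Omega> x *\<^sub>R g x) powr p) \<in> borel_measurable lebesgue" by measurable
  moreover have e: "indicator \<Omega> x *\<^sub>R norm (indicator \<Omega> x *\<^sub>R g x) powr p = indicator \<Omega> x *\<^sub>R norm (g x) powr p" for x
    by (cases "x \<in> \<Omega>") auto
  ultimately show "(\<lambda>x. indicator \<Omega> x *\<^sub>R norm (g x) powr p) \<in> borel_measurable lebesgue"
    by (simp only: e)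
  have "AE x in lebesgue. x \<in> \<Omega> \<longrightarrow> g x = weak_gradient \<Omega> v x"
    by (rule weak_gradient_unique[OF assms(1) w has_weak_gradient_weak_gradient[OF w]])
  then show "AE x in lebesgue. indicator \<Omega> x *\<^sub>R norm (g x) powr p = indicator \<Omega> x *\<^sub>R norm (weak_gradient \<Omega> v x) powr p"
    by eventually_elim (auto simp: indicator_def)
qed

text \<open>Mollifications of a compactly supported function are test functions in \<Omega> once the
  radius is small, and their gradients are mollifications of \<open>G\<close>. The same mollifier
  approximates \<phi> and \<open>G\<close> in Lp.\<close>

lemma W1p_zeroI:
  fixes \<phi> :: "'a::euclidean_space \<Rightarrow> real"
  assumes p: "1 \<le> p" and \<Omega>: "open \<Omega>" and w: "has_weak_gradient \<Omega> \<phi> G"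
    and Lp: "in_Lp p \<Omega> \<phi>" "in_Lp p \<Omega> G"
    and K: "compact K" "K \<subseteq> \<Omega>" and \<phi>z: "\<And>x. x \<notin> K \<Longrightarrow> \<phi> x = 0" and Gz: "\<And>x. x \<notin> K \<Longrightarrow> G x = 0"
  shows "\<phi> \<in> W1p_zero p \<Omega>"
proof -
  note f = in_Lp_zero_outside[OF Lp(1) K(2) \<phi>z] and g = in_Lp_zero_outside[OF Lp(2) K(2) Gz]
  obtain \<epsilon> where \<epsilon>: "\<epsilon> > 0" "\<And>t. t \<le> \<epsilon> \<Longrightarrow> (\<Union>x\<in>K. cball x t) \<subseteq> \<Omega>" "\<And>t. compact (\<Union>x\<in>K. cball x t)"
    using compact_neighbourhood[OF K(1) \<Omega> K(2)] by blast
  \<comment> \<open>Two collars of \<open>K\<close>: the inner one, of width \<epsilon> / 2, carries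
    the mollified function; the outer one contains the mollification balls around points of the
    inner one.\<close>
  define L where "L = (\<Union>x\<in>K. cball x \<epsilon>)"
  define L' where "L' = (\<Union>x\<in>K. cball x (\<epsilon> / 2))"
  have L: "compact L" "L \<subseteq> \<Omega>" using \<epsilon> by (auto simp: L_def)
  have L': "compact L'" "L' \<subseteq> \<Omega>" using \<epsilon>(1,3) \<epsilon>(2)[of "\<epsilon> / 2"] by (auto simp: L'_def)
  have KL: "K \<subseteq> L" using \<epsilon>(1) by (force simp: L_def)
  obtain R0 where R0: "\<forall>x\<in>K. norm x \<le> R0" using compact_imp_bounded[OF K(1)] unfolding bounded_iff by blast
  define R where "R = max R0 0"
  have KR: "x \<in> cball 0 R" if "x \<in> K" for x using R0 that by (force simp: R_def)
  have \<phi>R: "\<phi> x = 0" and GR: "G x = 0" if "x \<notin> cball 0 R" for x using \<phi>z[of x] Gz[of x] KR[of x] that by auto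
  have R: "R \<ge> 0" by (simp add: R_def)
  have i\<phi>: "integrable lebesgue \<phi>" by (rule integrable_of_Lp_bounded_support[OF p f \<phi>R])
  have iG: "integrable lebesgue G" by (rule integrable_of_Lp_bounded_support[OF p g GR])
  have indL: "(\<lambda>y. indicator L y *\<^sub>R \<phi> y) = \<phi>" "(\<lambda>y. indicator L y *\<^sub>R G y) = G"
    using \<phi>z Gz KL by (auto simp: fun_eq_iff indicator_def)
  have main: "\<exists>\<eta>. test_function \<Omega> \<eta> \<and> 0 \<le> W1p_norm p \<Omega> (\<lambda>x. \<phi> x - \<eta> x) \<and> W1p_norm p \<Omega> (\<lambda>x. \<phi> x - \<eta> x) \<le> (2 * e) powr (1 / p)"
    if e: "e > 0" for e
  proof -
    obtain d1 where d1: "d1 > 0"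
      "\<And>\<delta> \<rho>. mollifier \<delta> \<rho> \<Longrightarrow> \<delta> < d1 \<Longrightarrow> integrable lebesgue (\<lambda>x. norm (mollify \<rho> \<phi> x - \<phi> x) powr p)"
      "\<And>\<delta> \<rho>. mollifier \<delta> \<rho> \<Longrightarrow> \<delta> < d1 \<Longrightarrow> (\<integral>x. norm (mollify \<rho> \<phi> x - \<phi> x) powr p \<partial>lebesgue) < e"
      using mollify_tendsto_Lp[OF p f \<phi>R e R] by blast
    obtain d2 where d2: "d2 > 0"
      "\<And>\<delta> \<rho>. mollifier \<delta> \<rho> \<Longrightarrow> \<delta> < d2 \<Longrightarrow> integrable lebesgue (\<lambda>x. norm (mollify \<rho> G x - G x) powr p)"
      "\<And>\<delta> \<rho>. mollifier \<delta> \<rho> \<Longrightarrow> \<delta> < d2 \<Longrightarrow> (\<integral>x. norm (mollify \<rho> G x - G x) powr p \<partial>lebesgue) < e"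
      using mollify_tendsto_Lp[OF p g GR e R] by blast
    define \<delta> where "\<delta> = min (min d1 d2) \<epsilon> / 2"
    have \<delta>: "\<delta> > 0" "\<delta> < d1" "\<delta> < d2" "\<delta> \<le> \<epsilon> / 2" using d1(1) d2(1) \<epsilon>(1) by (auto simp: \<delta>_def)
    obtain \<rho> :: "'a \<Rightarrow> real" where m: "mollifier \<delta> \<rho>" using mollifier_exists[OF \<delta>(1)] by blast
    have \<rho>z: "\<And>x. x \<notin> cball 0 \<delta> \<Longrightarrow> \<rho> x = 0" using m by (auto simp: mollifier_def)
    let ?\<eta> = "mollify \<rho> \<phi>"
    have C: "Cinf_on ?\<eta> UNIV" by (rule Cinf_on_mollify[OF _ \<rho>z i\<phi>]) (use m in \<open>auto simp: mollifier_def\<close>)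
    have out: "y \<notin> K" if x: "x \<notin> L'" and y: "y \<in> cball x \<delta>" for x y
    proof
      assume "y \<in> K"
      moreover have "x \<in> cball y (\<epsilon> / 2)" using y \<delta>(4) by (simp add: dist_commute)
      ultimately show False using x by (auto simp: L'_def)
    qed
    have \<eta>z: "?\<eta> x = 0" if x: "x \<notin> L'" for x
      by (rule mollify_eq_0[OF \<rho>z]) (use out[OF x] \<phi>z in auto)
    have tf: "test_function \<Omega> ?\<eta>"
    proof -
      have cl: "closure {x. ?\<eta> x \<noteq> 0} \<subseteq> L'"
        by (rule closure_minimal) (use \<eta>z compact_imp_closed[OF L'(1)] in auto)
      then have "compact (closure {x. ?\<eta> x \<noteq> 0})"
        using compact_Int_closed[OF L'(1), of "closure {x. ?\<eta> x \<noteq> 0}"] by (simp add: Int_absorb1)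
      then show ?thesis unfolding test_function_def using C L'(2) cl by auto
    qed
    have grad: "gradient ?\<eta> x = mollify \<rho> G x" for x
    proof (cases "x \<in> L'")
      case True
      have "cball x \<delta> \<subseteq> L"
      proof
        fix z assume z: "z \<in> cball x \<delta>"
        obtain y where y: "y \<in> K" "dist y x \<le> \<epsilon> / 2" using True by (auto simp: L'_def)
        have "dist y z \<le> \<epsilon>" using dist_triangle[of y z x] y(2) z \<delta>(4) by simp
        then show "z \<in> L" using y(1) by (auto simp: L_def)
      qed
      from GDERIV_mollify[OF w L m this] show ?thesis unfolding indL by (rule gradient_eq)
    next
      case False
      have "mollify \<rho> G x = 0" by (rule mollify_eq_0[OF \<rho>z]) (use out[OF False] Gz in auto)
      then show ?thesis
        using gradient_zero_outside[OF compact_imp_closed[OF L'(1)] \<eta>z False] by simp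
    qed
    have wg: "has_weak_gradient \<Omega> ?\<eta> (mollify \<rho> G)"
    proof (rule has_weak_gradient_classical[OF \<Omega>])
      show "GDERIV ?\<eta> x :> mollify \<rho> G x" for x using Cinf_on_GDERIV[OF C, of x] grad by simp
      show "continuous_on \<Omega> (mollify \<rho> G)" using mollify_measurable[OF m iG] continuous_on_subset by blast
    qed
    have wd: "has_weak_gradient \<Omega> (\<lambda>x. \<phi> x - ?\<eta> x) (\<lambda>x. G x - mollify \<rho> G x)"
      by (rule has_weak_gradient_diff[OF w wg])
    have mm: "set_borel_measurable lebesgue \<Omega> (\<lambda>x. G x - mollify \<rho> G x)"
      unfolding set_borel_measurable_def
      using lebesgue_open[OF \<Omega>] g(1) measurable_lebesgue_continuous[OF mollify_measurable[OF m iG]] by measurable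
    have le: "(LINT x:\<Omega>|lebesgue. norm (k x) powr p) \<le> e"
      if "integrable lebesgue (\<lambda>x. norm (k x) powr p)" "(\<integral>x. norm (k x) powr p \<partial>lebesgue) < e" for k :: "'a \<Rightarrow> 'c::euclidean_space"
    proof -
      have "(LINT x:\<Omega>|lebesgue. norm (k x) powr p) \<le> (\<integral>x. norm (k x) powr p \<partial>lebesgue)"
        unfolding set_lebesgue_integral_def
        by (rule integral_mono[OF integrable_mult_indicator[OF lebesgue_open[OF \<Omega>] that(1)] that(1)])
          (auto simp: indicator_def)
      then show ?thesis using that(2) by simp
    qed
    have 1: "(LINT x:\<Omega>|lebesgue. \<bar>\<phi> x - ?\<eta> x\<bar> powr p) \<le> e"
      using le[of "\<lambda>x. \<phi> x - ?\<eta> x"] d1(2,3)[OF m \<delta>(2)] by (simp add: abs_minus_commute)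
    have 2: "(LINT x:\<Omega>|lebesgue. norm (G x - mollify \<rho> G x) powr p) \<le> e"
      using le[of "\<lambda>x. G x - mollify \<rho> G x"] d2(2,3)[OF m \<delta>(3)] by (simp add: norm_minus_commute)
    have n: "(LINT x:\<Omega>|lebesgue. \<bar>\<phi> x - ?\<eta> x\<bar> powr p) \<ge> 0" "(LINT x:\<Omega>|lebesgue. norm (G x - mollify \<rho> G x) powr p) \<ge> 0"
      unfolding set_lebesgue_integral_def by auto
    have eq: "W1p_norm p \<Omega> (\<lambda>x. \<phi> x - ?\<eta> x) = ((LINT x:\<Omega>|lebesgue. \<bar>\<phi> x - ?\<eta> x\<bar> powr p)
        + (LINT x:\<Omega>|lebesgue. norm (G x - mollify \<rho> G x) powr p)) powr (1 / p)"
      unfolding W1p_norm_def weak_gradient_powr_integral[OF \<Omega> wd mm] ..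
    have "W1p_norm p \<Omega> (\<lambda>x. \<phi> x - ?\<eta> x) \<le> (2 * e) powr (1 / p)"
      unfolding eq by (rule powr_mono2) (use p n 1 2 in auto)
    moreover have "0 \<le> W1p_norm p \<Omega> (\<lambda>x. \<phi> x - ?\<eta> x)" unfolding eq by simp
    ultimately show ?thesis using tf by blast
  qed
  have "\<forall>n. \<exists>\<eta>. test_function \<Omega> \<eta> \<and> 0 \<le> W1p_norm p \<Omega> (\<lambda>x. \<phi> x - \<eta> x) \<and>
      W1p_norm p \<Omega> (\<lambda>x. \<phi> x - \<eta> x) \<le> (2 * inverse (real (Suc n))) powr (1 / p)"
    using main by simp
  then obtain \<eta> where \<eta>: "\<And>n. test_function \<Omega> (\<eta> n)" "\<And>n. 0 \<le> W1p_norm p \<Omega> (\<lambda>x. \<phi> x - \<eta> n x)"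
    "\<And>n. W1p_norm p \<Omega> (\<lambda>x. \<phi> x - \<eta> n x) \<le> (2 * inverse (real (Suc n))) powr (1 / p)"
    by metis
  have "(\<lambda>n. (2 * inverse (real (Suc n))) powr (1 / p)) \<longlonglongrightarrow> 0"
  proof (rule tendsto_zero_powrI[OF _ tendsto_const])
    show "(\<lambda>n. 2 * inverse (real (Suc n))) \<longlonglongrightarrow> 0"
      using tendsto_mult_left[OF LIMSEQ_inverse_real_of_nat, of 2] by simp
  qed (use p in auto)
  then have "(\<lambda>n. W1p_norm p \<Omega> (\<lambda>x. \<phi> x - \<eta> n x)) \<longlonglongrightarrow> 0"
    by (rule tendsto_sandwich[OF always_eventually always_eventually tendsto_const, rotated 2])
      (use \<eta> in auto)
  moreover have "\<phi> \<in> W1p p \<Omega>" using w Lp by (auto simp: W1p_def)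
  ultimately show ?thesis using \<eta>(1) by (auto simp: W1p_zero_def)
qed

section \<open>The minimality inequality\<close>

definition phase_energy :: "real \<Rightarrow> real \<Rightarrow> real \<Rightarrow> real \<Rightarrow> real" where
  "phase_energy p l1 l2 t = (p - 1) * l1 powr p * (if t > 0 then 1 else 0) + (p - 1) * l2 powr p * (if t < 0 then 1 else 0)"

text \<open>Frees the rest from the choice in \<open>weak_gradient\<close> and from the
  approximation in \<open>W1p_zero\<close>: one explicit gradient represents \<open>u\<close>, and
  competitors are compactly supported perturbations with explicit gradients.\<close>

definition minimality ::
  "real \<Rightarrow> real \<Rightarrow> real \<Rightarrow> 'a::euclidean_space set \<Rightarrow> ('a \<Rightarrow> real) \<Rightarrow> ('a \<Rightarrow> 'a) \<Rightarrow> bool" where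
  "minimality p l1 l2 B u g \<longleftrightarrow> has_weak_gradient B u g \<and> in_Lp p B g \<and>
    (\<forall>\<phi> G K. has_weak_gradient B \<phi> G \<and> in_Lp p B \<phi> \<and> in_Lp p B G \<and> compact K \<and> K \<subseteq> B \<and>
       (\<forall>x. x \<notin> K \<longrightarrow> \<phi> x = 0 \<and> G x = 0) \<longrightarrow>
       (LINT x:B|lebesgue. norm (g x) powr p + phase_energy p l1 l2 (u x))
        \<le> (LINT x:B|lebesgue. norm (g x + G x) powr p + phase_energy p l1 l2 (u x + \<phi> x)))"

text \<open>The chosen weak gradient and \<open>g\<close> agree almost everywhere. Measurability is
  known on \<Omega> only, so indicators are placed inside the functions before composing.\<close>

lemma J_TP_eq:
  fixes v :: "'a::euclidean_space \<Rightarrow> real"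
  assumes \<Omega>: "open \<Omega>" and w: "has_weak_gradient \<Omega> v g" and m: "set_borel_measurable lebesgue \<Omega> g"
    and v: "set_borel_measurable lebesgue \<Omega> v"
  shows "J_TP p l1 l2 v \<Omega> = (LINT x:\<Omega>|lebesgue. norm (g x) powr p + phase_energy p l1 l2 (v x))"
  unfolding J_TP_def set_lebesgue_integral_def
proof (rule borel_measurable_lebesgue_AE(2)[symmetric])
  have [measurable]: "(\<lambda>x. indicator \<Omega> x *\<^sub>R g x) \<in> borel_measurable lebesgue" "\<Omega> \<in> sets lebesgue"
    "(\<lambda>x. indicator \<Omega> x *\<^sub>R v x) \<in> borel_measurable lebesgue"
    using m v lebesgue_open[OF \<Omega>] by (auto simp: set_borel_measurable_def)
  have [measurable]: "phase_energy p l1 l2 \<in> borel_measurable borel"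
    unfolding phase_energy_def by measurable
  have "(\<lambda>x. indicator \<Omega> x *\<^sub>R (norm (indicator \<Omega> x *\<^sub>R g x) powr p + phase_energy p l1 l2 (indicator \<Omega> x *\<^sub>R v x)))
      \<in> borel_measurable lebesgue" by measurable
  moreover have e: "indicator \<Omega> x *\<^sub>R (norm (indicator \<Omega> x *\<^sub>R g x) powr p + phase_energy p l1 l2 (indicator \<Omega> x *\<^sub>R v x))
    = indicator \<Omega> x *\<^sub>R (norm (g x) powr p + phase_energy p l1 l2 (v x))" for x
    by (cases "x \<in> \<Omega>") auto
  ultimately show "(\<lambda>x. indicator \<Omega> x *\<^sub>R (norm (g x) powr p + phase_energy p l1 l2 (v x))) \<in> borel_measurable lebesgue"
    by (simp only: e)
  have "AE x in lebesgue. x \<in> \<Omega> \<longrightarrow> g x = weak_gradient \<Omega> v x"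
    by (rule weak_gradient_unique[OF \<Omega> w has_weak_gradient_weak_gradient[OF w]])
  then show "AE x in lebesgue. indicator \<Omega> x *\<^sub>R (norm (g x) powr p + phase_energy p l1 l2 (v x)) =
      indicator \<Omega> x *\<^sub>R (norm (weak_gradient \<Omega> v x) powr p + (p - 1) * l1 powr p * indicator {x. 0 < v x} x
        + (p - 1) * l2 powr p * indicator {x. v x < 0} x)"
    by eventually_elim (auto simp: indicator_def phase_energy_def)
qed

text \<open>Balls are admissible subdomains, and compactly supported Sobolev perturbations belong to
  \<open>W1p_zero\<close>.\<close>

lemma local_minimizer_minimality:
  fixes u :: "'a::euclidean_space \<Rightarrow> real"
  assumes p: "1 < p" and lm: "local_minimizer p l1 l2 D u" and r: "r > 0" "cball c r \<subseteq> D"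
  shows "\<exists>g. minimality p l1 l2 (ball c r) u g"
proof -
  let ?B = "ball c r"
  have "closure ?B \<subseteq> D" using r by simp
  then have uW: "u \<in> W1p p ?B" and
    min: "\<And>v. (\<lambda>x. v x - u x) \<in> W1p_zero p ?B \<Longrightarrow> J_TP p l1 l2 u ?B \<le> J_TP p l1 l2 v ?B"
    using lm smooth_open_set_ball[OF r(1), of c] by (auto simp: local_minimizer_def)
  obtain g where g: "has_weak_gradient ?B u g" "in_Lp p ?B g" and uL: "in_Lp p ?B u"
    using uW by (auto simp: W1p_def)
  have "(LINT x:?B|lebesgue. norm (g x) powr p + phase_energy p l1 l2 (u x))
        \<le> (LINT x:?B|lebesgue. norm (g x + G x) powr p + phase_energy p l1 l2 (u x + \<phi> x))"
    if a: "has_weak_gradient ?B \<phi> G" "in_Lp p ?B \<phi>" "in_Lp p ?B G" "compact K" "K \<subseteq> ?B"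
      "\<forall>x. x \<notin> K \<longrightarrow> \<phi> x = 0 \<and> G x = 0" for \<phi> G K
  proof -
    have "\<phi> \<in> W1p_zero p ?B"
      by (rule W1p_zeroI[OF _ open_ball a(1-5)]) (use p a(6) in auto)
    then have "J_TP p l1 l2 u ?B \<le> J_TP p l1 l2 (\<lambda>x. u x + \<phi> x) ?B"
      by (intro min) simp
    moreover have "J_TP p l1 l2 u ?B = (LINT x:?B|lebesgue. norm (g x) powr p + phase_energy p l1 l2 (u x))"
      by (rule J_TP_eq[OF open_ball g(1)]) (use g uL in \<open>auto simp: in_Lp_def\<close>)
    moreover have "J_TP p l1 l2 (\<lambda>x. u x + \<phi> x) ?B
        = (LINT x:?B|lebesgue. norm (g x + G x) powr p + phase_energy p l1 l2 (u x + \<phi> x))"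
    proof (rule J_TP_eq[OF open_ball has_weak_gradient_add[OF g(1) a(1)]])
      show "set_borel_measurable lebesgue ?B (\<lambda>x. g x + G x)"
        using g(2) a(3) by (auto simp: in_Lp_def set_borel_measurable_def scaleR_add_right)
      show "set_borel_measurable lebesgue ?B (\<lambda>x. u x + \<phi> x)"
        using uL a(2) by (auto simp: in_Lp_def set_borel_measurable_def distrib_left)
    qed
    ultimately show ?thesis by simp
  qed
  then have "minimality p l1 l2 ?B u g" using g unfolding minimality_def by blast
  then show ?thesis by blast
qed

lemma in_Lp_minus: "in_Lp p B (\<lambda>x. - f x) = in_Lp p B f"
  by (auto simp: in_Lp_def set_borel_measurable_def)

lemma minimality_minus:
  assumes "minimality p l1 l2 B u g"
  shows "minimality p l2 l1 B (\<lambda>x. - u x) (\<lambda>x. - g x)"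
proof -
  have pe: "phase_energy p l2 l1 (- t) = phase_energy p l1 l2 t" for t by (auto simp: phase_energy_def)
  have m: "has_weak_gradient B u g" "in_Lp p B g"
    and min: "\<And>\<phi> G K. has_weak_gradient B \<phi> G \<and> in_Lp p B \<phi> \<and> in_Lp p B G \<and> compact K \<and> K \<subseteq> B \<and>
       (\<forall>x. x \<notin> K \<longrightarrow> \<phi> x = 0 \<and> G x = 0) \<Longrightarrow>
       (LINT x:B|lebesgue. norm (g x) powr p + phase_energy p l1 l2 (u x))
        \<le> (LINT x:B|lebesgue. norm (g x + G x) powr p + phase_energy p l1 l2 (u x + \<phi> x))"
    using assms unfolding minimality_def by auto
  have "(LINT x:B|lebesgue. norm (- g x) powr p + phase_energy p l2 l1 (- u x))
        \<le> (LINT x:B|lebesgue. norm (- g x + G x) powr p + phase_energy p l2 l1 (- u x + \<phi> x))"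
    if a: "has_weak_gradient B \<phi> G \<and> in_Lp p B \<phi> \<and> in_Lp p B G \<and> compact K \<and> K \<subseteq> B \<and>
       (\<forall>x. x \<notin> K \<longrightarrow> \<phi> x = 0 \<and> G x = 0)" for \<phi> G K
  proof -
    have "(LINT x:B|lebesgue. norm (g x) powr p + phase_energy p l1 l2 (u x))
        \<le> (LINT x:B|lebesgue. norm (g x + - G x) powr p + phase_energy p l1 l2 (u x + - \<phi> x))"
    proof (rule min[where K = K])
      show "has_weak_gradient B (\<lambda>x. - \<phi> x) (\<lambda>x. - G x) \<and> in_Lp p B (\<lambda>x. - \<phi> x) \<and> in_Lp p B (\<lambda>x. - G x) \<and>
        compact K \<and> K \<subseteq> B \<and> (\<forall>x. x \<notin> K \<longrightarrow> - \<phi> x = 0 \<and> - G x = 0)"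
        using a has_weak_gradient_minus[of B \<phi> G] by (simp add: in_Lp_minus)
    qed
    moreover have e1: "norm (- g x + G x) = norm (g x + - G x)" for x
      using norm_minus_commute[of "G x" "g x"] by simp
    moreover have e2: "phase_energy p l2 l1 (- u x + \<phi> x) = phase_energy p l1 l2 (u x + - \<phi> x)" for x
      using pe[of "u x + - \<phi> x"] by (simp only: minus_add_distrib minus_minus)
    ultimately show ?thesis unfolding e1 e2 pe norm_minus_cancel by blast
  qed
  then have "\<forall>\<phi> G K. has_weak_gradient B \<phi> G \<and> in_Lp p B \<phi> \<and> in_Lp p B G \<and> compact K \<and> K \<subseteq> B \<and>
       (\<forall>x. x \<notin> K \<longrightarrow> \<phi> x = 0 \<and> G x = 0) \<longrightarrow>
       (LINT x:B|lebesgue. norm (- g x) powr p + phase_energy p l2 l1 (- u x))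
        \<le> (LINT x:B|lebesgue. norm (- g x + G x) powr p + phase_energy p l2 l1 (- u x + \<phi> x))"
    by (intro allI impI)
  moreover have "has_weak_gradient B (\<lambda>x. - u x) (\<lambda>x. - g x)" by (rule has_weak_gradient_minus[OF m(1)])
  moreover have "in_Lp p B (\<lambda>x. - g x)" by (simp only: in_Lp_minus m(2))
  ultimately show ?thesis unfolding minimality_def by (intro conjI)
qed

section \<open>The comparison principle\<close>

definition divergence :: "('a::euclidean_space \<Rightarrow> 'a) \<Rightarrow> 'a \<Rightarrow> real" where
  "divergence F x = (\<Sum>b\<in>Basis. frechet_derivative F (at x) b \<bullet> b)"

lemma compact_subset_ball:
  fixes c :: "'a::euclidean_space"
  assumes "compact K" "K \<subseteq> ball c r" "r > 0"
  obtains a where "0 \<le> a" "a < r" "K \<subseteq> cball c a"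
proof (cases "K = {}")
  case True
  then show ?thesis using that[of 0] assms by auto
next
  case False
  have "continuous_on K (\<lambda>x. dist c x)" by (intro continuous_intros)
  then obtain y where y: "y \<in> K" "\<And>x. x \<in> K \<Longrightarrow> dist c x \<le> dist c y"
    using continuous_attains_sup[OF assms(1) False] by blast
  show ?thesis
    by (rule that[of "dist c y"]) (use y assms(2) in auto)
qed

text \<open>Each component F \<bullet> b times a cutoff is a test function. The b-th component of
  the weak gradient identity for it, summed over b, produces the trace of the derivative of
  \<open>F\<close>.\<close>

lemma weak_gradient_divergence:
  fixes \<phi> :: "'a::euclidean_space \<Rightarrow> real" and F :: "'a \<Rightarrow> 'a"
  assumes w: "has_weak_gradient (ball c r) \<phi> G" and r: "r > 0"
    and K: "compact K" "K \<subseteq> ball c r" and \<phi>z: "\<And>x. x \<notin> K \<Longrightarrow> \<phi> x = 0" and Gz: "\<And>x. x \<notin> K \<Longrightarrow> G x = 0"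
    and F: "Cinf_on F N" and N: "cball c r \<subseteq> N"
  shows "integrable lebesgue (\<lambda>x. F x \<bullet> G x)" "integrable lebesgue (\<lambda>x. divergence F x * \<phi> x)"
    "(\<integral>x. F x \<bullet> G x \<partial>lebesgue) = - (\<integral>x. divergence F x * \<phi> x \<partial>lebesgue)"
proof -
  obtain a where a: "0 \<le> a" "a < r" "K \<subseteq> cball c a" using compact_subset_ball[OF K r] by blast
  \<comment> \<open>Thirds of the gap between \<open>K\<close> and the sphere: the cutoff is 1 on a
    neighbourhood of \<open>K\<close>, so it leaves \<open>F\<close> and its derivative unchanged
    there, and its support stays inside the ball.\<close>
  define a1 where "a1 = (2 * a + r) / 3"
  define a2 where "a2 = (a + 2 * r) / 3"
  have a12: "a < a1" "0 \<le> a1" "a1 < a2" "a2 < r" using a by (auto simp: a1_def a2_def)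
  obtain \<zeta> :: "'a \<Rightarrow> real" where \<zeta>: "Cinf_on \<zeta> UNIV" "\<And>x. dist x c \<le> a1 \<Longrightarrow> \<zeta> x = 1"
    "\<And>x. dist x c \<ge> a2 \<Longrightarrow> \<zeta> x = 0" "\<And>x. 0 \<le> \<zeta> x \<and> \<zeta> x \<le> 1"
    using smooth_cutoff_exists[OF a12(2,3), of c] by blast
  define \<eta> where "\<eta> b x = \<zeta> x * (F x \<bullet> b)" for b x
  have oN: "open N" by (rule Cinf_on_open[OF F])
  have C: "Cinf_on (\<eta> b) UNIV" for b
  proof -
    have "Cinf_on (\<eta> b) N" unfolding \<eta>_def
      by (intro Cinf_on_mult Cinf_on_inner F Cinf_on_const Cinf_on_subset[OF \<zeta>(1)] oN) auto
    moreover have "Cinf_on (\<eta> b) (- cball c a2)"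
      by (rule Cinf_on_cong[OF Cinf_on_const[of "- cball c a2" 0]]) (auto simp: \<eta>_def \<zeta>(3) dist_commute open_Compl)
    ultimately have "Cinf_on (\<eta> b) (N \<union> - cball c a2)" by (rule Cinf_on_Un)
    moreover have "cball c a2 \<subseteq> N" using N a12(4) by (meson less_imp_le order_trans subset_cball)
    then have "N \<union> - cball c a2 = UNIV" by auto
    ultimately show ?thesis by simp
  qed
  have \<eta>z: "\<eta> b x = 0" if "x \<notin> cball c a2" for b x
    using \<zeta>(3)[of x] that by (simp add: \<eta>_def dist_commute)
  have a2r: "cball c a2 \<subseteq> ball c r" using a12(4) by auto
  have in1: "\<zeta> x = 1" "x \<in> N" "x \<in> ball c a1" if "x \<in> K" for x
    using that a(3) a12 N \<zeta>(2)[of x] by (auto simp: dist_commute subset_iff)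
  have g\<eta>: "gradient (\<eta> b) x \<bullet> d = frechet_derivative F (at x) d \<bullet> b" if x: "x \<in> K" for b d x
  proof -
    have FD: "(F has_derivative frechet_derivative F (at x)) (at x)"
      by (rule Cinf_on_has_derivative[OF F in1(2)[OF x]])
    have "((\<lambda>x. F x \<bullet> b) has_derivative (\<lambda>d. frechet_derivative F (at x) d \<bullet> b)) (at x)"
      by (rule has_derivative_inner_left[OF FD])
    then have "(\<eta> b has_derivative (\<lambda>d. frechet_derivative F (at x) d \<bullet> b)) (at x)"
      by (rule has_derivative_transform_within_open[OF _ open_ball in1(3)[OF x]])
        (simp add: \<eta>_def \<zeta>(2) dist_commute)
    moreover have "(\<eta> b has_derivative (\<lambda>d. d \<bullet> gradient (\<eta> b) x)) (at x)"
      using Cinf_on_GDERIV[OF C, of x b] by (simp add: gderiv_def)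
    ultimately have "(\<lambda>d. frechet_derivative F (at x) d \<bullet> b) = (\<lambda>d. d \<bullet> gradient (\<eta> b) x)"
      by (rule has_derivative_unique)
    then show ?thesis by (metis inner_commute)
  qed
  note iv = has_weak_gradient_integrable[OF w C compact_cball a2r \<eta>z]
  have T: "(\<integral>x. \<phi> x *\<^sub>R gradient (\<eta> b) x \<partial>lebesgue) = - (\<integral>x. \<eta> b x *\<^sub>R G x \<partial>lebesgue)" for b
    by (rule weak_gradient_test[OF w C compact_cball a2r \<eta>z])
  have e1: "(\<Sum>b\<in>Basis. (\<phi> x *\<^sub>R gradient (\<eta> b) x) \<bullet> b) = divergence F x * \<phi> x" for x
  proof (cases "x \<in> K")
    case True
    then show ?thesis by (simp add: divergence_def g\<eta> sum_distrib_left mult.commute)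
  qed (simp add: \<phi>z)
  have e2: "(\<Sum>b\<in>Basis. (\<eta> b x *\<^sub>R G x) \<bullet> b) = F x \<bullet> G x" for x
  proof (cases "x \<in> K")
    case True
    then show ?thesis using in1(1)[OF True] by (simp add: \<eta>_def euclidean_inner[of "F x" "G x"])
  qed (simp add: Gz)
  have i1: "integrable lebesgue (\<lambda>x. (\<phi> x *\<^sub>R gradient (\<eta> b) x) \<bullet> b)" for b
    by (rule integrable_inner_left[OF iv(1)])
  have i2: "integrable lebesgue (\<lambda>x. (\<eta> b x *\<^sub>R G x) \<bullet> b)" for b
    by (rule integrable_inner_left[OF iv(2)])
  have "integrable lebesgue (\<lambda>x. \<Sum>b\<in>Basis. (\<eta> b x *\<^sub>R G x) \<bullet> b)"
    by (rule Bochner_Integration.integrable_sum[OF i2])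
  then show "integrable lebesgue (\<lambda>x. F x \<bullet> G x)" unfolding e2 .
  have "integrable lebesgue (\<lambda>x. \<Sum>b\<in>Basis. (\<phi> x *\<^sub>R gradient (\<eta> b) x) \<bullet> b)"
    by (rule Bochner_Integration.integrable_sum[OF i1])
  then show "integrable lebesgue (\<lambda>x. divergence F x * \<phi> x)" unfolding e1 .
  have "(\<integral>x. F x \<bullet> G x \<partial>lebesgue) = (\<Sum>b\<in>Basis. \<integral>x. (\<eta> b x *\<^sub>R G x) \<bullet> b \<partial>lebesgue)"
    unfolding e2[symmetric] by (rule Bochner_Integration.integral_sum[OF i2])
  also have "\<dots> = (\<Sum>b\<in>Basis. (\<integral>x. \<eta> b x *\<^sub>R G x \<partial>lebesgue) \<bullet> b)"
    using iv(2) by (intro sum.cong refl integral_inner_left) auto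
  also have "\<dots> = - (\<Sum>b\<in>Basis. (\<integral>x. \<phi> x *\<^sub>R gradient (\<eta> b) x \<partial>lebesgue) \<bullet> b)"
    unfolding T by (simp add: sum_negf)
  also have "(\<Sum>b\<in>Basis. (\<integral>x. \<phi> x *\<^sub>R gradient (\<eta> b) x \<partial>lebesgue) \<bullet> b)
      = (\<Sum>b\<in>Basis. \<integral>x. (\<phi> x *\<^sub>R gradient (\<eta> b) x) \<bullet> b \<partial>lebesgue)"
    using iv(1) by (intro sum.cong refl integral_inner_left[symmetric]) auto
  also have "\<dots> = (\<integral>x. divergence F x * \<phi> x \<partial>lebesgue)"
    unfolding e1[symmetric] by (rule Bochner_Integration.integral_sum[OF i1, symmetric])
  finally show "(\<integral>x. F x \<bullet> G x \<partial>lebesgue) = - (\<integral>x. divergence F x * \<phi> x \<partial>lebesgue)" .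
qed

text \<open>Young's inequality multiplied by p. The factor p - 1 it produces is the one in the phase
  weights, so fluxes and the constants l1, l2 become directly comparable.\<close>

lemma young_inner:
  fixes F g :: "'a::real_inner"
  assumes "1 < p"
  shows "p * (F \<bullet> g) \<le> norm g powr p + (p - 1) * norm F powr (p / (p - 1))"
proof -
  have "norm g * norm F \<le> norm g powr p / p + norm F powr (p / (p - 1)) / (p / (p - 1))"
    by (rule Youngs_inequality) (use assms in \<open>auto simp: divide_simps\<close>)
  then have "p * (norm g * norm F) \<le> p * (norm g powr p / p + norm F powr (p / (p - 1)) / (p / (p - 1)))"
    using assms by (intro mult_left_mono) auto
  also have "\<dots> = norm g powr p + (p - 1) * norm F powr (p / (p - 1))"
    using assms by (simp add: field_simps)
  finally have "p * (norm g * norm F) \<le> norm g powr p + (p - 1) * norm F powr (p / (p - 1))" .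
  moreover have "p * (F \<bullet> g) \<le> p * (norm g * norm F)"
    using assms norm_cauchy_schwarz[of F g] by (simp add: mult.commute)
  ultimately show ?thesis by linarith
qed

text \<open>Pointwise form of the calibration argument: the energy density of a competitor below \<open>w\<close>
  exceeds that of \<open>w\<close> by an exact divergence plus a positive term.\<close>

lemma calibration_pointwise:
  fixes g h F1 F2 :: "'a::real_inner" and u w d1 d2 :: real
  assumes p: "1 < p" and uw: "u < w"
    and h0: "w = 0 \<Longrightarrow> h = 0"
    and c1: "w > 0 \<Longrightarrow> F1 = norm h powr (p - 2) *\<^sub>R h \<and> d1 > 0"
    and c2: "w < 0 \<Longrightarrow> F2 = norm h powr (p - 2) *\<^sub>R h \<and> d2 > 0"
    and c3: "w > 0 \<Longrightarrow> u = 0 \<Longrightarrow> l1 powr p \<le> norm h powr p"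
    and c4: "w > 0 \<Longrightarrow> u < 0 \<Longrightarrow>
      p * d2 * (- u) + (p - 1) * (norm h powr p - l1 powr p + l2 powr p - norm F2 powr (p / (p - 1))) \<ge> 0"
    and c5: "w = 0 \<Longrightarrow> u < 0 \<Longrightarrow> p * d2 * (- u) + (p - 1) * (l2 powr p - norm F2 powr (p / (p - 1))) > 0"
  shows "0 < (norm g powr p + phase_energy p l1 l2 u) - (norm h powr p + phase_energy p l1 l2 w)
    + p * (F1 \<bullet> ((if w > 0 then h else 0) - (if u > 0 then g else 0)))
    + p * (F2 \<bullet> ((if - u > 0 then - g else 0) - (if - w > 0 then - h else 0)))
    + p * (d1 * (max w 0 - max u 0)) + p * (d2 * (max (- u) 0 - max (- w) 0))"
proof -
  have hh: "norm h powr (p - 2) * (h \<bullet> h) = norm h powr p"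
  proof (cases "h = 0")
    case False
    have "norm h powr (p - 2) * (norm h)\<^sup>2 = norm h powr p"
      using False powr_add[of "norm h" "p - 2" 2] by simp
    then show ?thesis by (simp add: power2_norm_eq_inner)
  qed (use p in auto)
  have tan: "norm h powr p + p * (F \<bullet> (g - h)) \<le> norm g powr p" if "F = norm h powr (p - 2) *\<^sub>R h" for F
    using norm_powr_tangent[of p h g] p that by (simp add: mult.assoc)
  have Y: "p * (F2 \<bullet> g) \<le> norm g powr p + (p - 1) * norm F2 powr (p / (p - 1))"
    by (rule young_inner[OF p])
  \<comment> \<open>In the first and the last case the phases agree and the tangent inequality
    applies. In the others \<open>F1\<close> is paired at most with \<open>h\<close> and
    \<open>F2\<close> at most with \<open>g\<close>: p * (F1 \<bullet> h) - |h|^p leaves (p - 1) *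
    |h|^p, and for u < 0 Young's inequality absorbs p * (F2 \<bullet> g).\<close>
  consider "w > 0" "u > 0" | "w > 0" "u = 0" | "w > 0" "u < 0" | "w = 0" | "w < 0" using uw by linarith
  then show ?thesis
  proof cases
    case 1
    have "p * (d1 * (w - u)) > 0" using c1[OF 1(1)] p uw by auto
    moreover have "p * (F1 \<bullet> (h - g)) = - (p * (F1 \<bullet> (g - h)))" by (simp add: inner_diff_right right_diff_distrib)
    ultimately show ?thesis using 1 tan[OF conjunct1[OF c1[OF 1(1)]]] by (simp add: phase_energy_def)
  next
    case 2
    have "F1 \<bullet> h = norm h powr p" using c1[OF 2(1)] hh by simp
    moreover have "p * (d1 * w) > 0" using c1[OF 2(1)] p 2 by auto
    moreover have "(p - 1) * l1 powr p \<le> (p - 1) * norm h powr p"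
      using c3[OF 2] p by (intro mult_left_mono) auto
    moreover obtain s where s: "s = norm g powr p" "0 \<le> s" by simp
    ultimately show ?thesis using 2 unfolding s(1)[symmetric]
      by (simp add: phase_energy_def algebra_simps)
  next
    case 3
    have "F1 \<bullet> h = norm h powr p" using c1[OF 3(1)] hh by simp
    moreover have "p * (d1 * w) > 0" using c1[OF 3(1)] p 3 by auto
    ultimately show ?thesis using 3 c4[OF 3] Y
      by (simp add: phase_energy_def algebra_simps)
  next
    case 4
    then have u: "u < 0" using uw by simp
    show ?thesis using 4 u h0[OF 4] c5[OF 4 u] Y p
      by (simp add: phase_energy_def algebra_simps)
  next
    case 5
    have "p * (d2 * (w - u)) > 0" using c2[OF 5] p uw by auto
    moreover have "p * (F2 \<bullet> (h - g)) = - (p * (F2 \<bullet> (g - h)))" by (simp add: inner_diff_right right_diff_distrib)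
    ultimately show ?thesis using 5 uw tan[OF conjunct1[OF c2[OF 5]]] by (simp add: phase_energy_def)
  qed
qed

lemma in_Lp_cong:
  assumes "in_Lp p \<Omega> f" "\<And>x. x \<in> \<Omega> \<Longrightarrow> f x = f' x"
  shows "in_Lp p \<Omega> f'"
proof -
  have 1: "indicator \<Omega> x *\<^sub>R f' x = indicator \<Omega> x *\<^sub>R f x"
    "indicator \<Omega> x *\<^sub>R (norm (f' x) powr p) = indicator \<Omega> x *\<^sub>R (norm (f x) powr p)" for x
    using assms(2)[of x] by (cases "x \<in> \<Omega>"; auto)+
  show ?thesis
    using assms(1) unfolding in_Lp_def set_borel_measurable_def set_integrable_def 1 .
qed

lemma in_Lp_indicator_diff:
  fixes f g :: "'a::euclidean_space \<Rightarrow> 'b::euclidean_space"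
  assumes p: "0 \<le> p" and f: "in_Lp p \<Omega> f" and g: "in_Lp p \<Omega> g" and S: "S \<in> sets lebesgue"
  shows "in_Lp p \<Omega> (\<lambda>x. indicator S x *\<^sub>R (f x - g x))"
  unfolding in_Lp_def
proof
  have [measurable]: "(\<lambda>x. indicator \<Omega> x *\<^sub>R f x) \<in> borel_measurable lebesgue"
    "(\<lambda>x. indicator \<Omega> x *\<^sub>R g x) \<in> borel_measurable lebesgue" "S \<in> sets lebesgue"
    using f g S by (auto simp: in_Lp_def set_borel_measurable_def)
  have e: "indicator \<Omega> x *\<^sub>R (indicator S x *\<^sub>R (f x - g x)) = indicator S x *\<^sub>R (indicator \<Omega> x *\<^sub>R f x - indicator \<Omega> x *\<^sub>R g x)" for x
    by (simp add: scaleR_diff_right mult.commute)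
  have m: "(\<lambda>x. indicator \<Omega> x *\<^sub>R (indicator S x *\<^sub>R (f x - g x))) \<in> borel_measurable lebesgue"
    unfolding e by measurable
  then show "set_borel_measurable lebesgue \<Omega> (\<lambda>x. indicator S x *\<^sub>R (f x - g x))"
    by (simp only: set_borel_measurable_def)
  let ?k = "\<lambda>x. indicator \<Omega> x *\<^sub>R (norm (indicator S x *\<^sub>R (f x - g x)) powr p)"
  have k: "?k x = indicator \<Omega> x *\<^sub>R (norm (indicator \<Omega> x *\<^sub>R (indicator S x *\<^sub>R (f x - g x))) powr p)"
    if "x \<in> \<Omega>" for x using that by simp
  \<comment> \<open>The indicator moves inside the norm because \<open>0 powr p = 0\<close>;
    measurability then follows from that of the function itself.\<close>
  have km: "?k = (\<lambda>x. (if \<Omega> = {} then 0 else 1) * (norm (indicator \<Omega> x *\<^sub>R (indicator S x *\<^sub>R (f x - g x))) powr p))"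
    by (auto simp: fun_eq_iff indicator_def)
  have km': "?k \<in> borel_measurable lebesgue"
    unfolding km using m by measurable
  let ?b = "\<lambda>x. 2 powr p * (indicator \<Omega> x *\<^sub>R (norm (f x) powr p) + indicator \<Omega> x *\<^sub>R (norm (g x) powr p))"
  have ib: "integrable lebesgue ?b"
    using f g unfolding in_Lp_def set_integrable_def
    by (intro integrable_mult_right Bochner_Integration.integrable_add) auto
  have "integrable lebesgue ?k"
  proof (rule Bochner_Integration.integrable_bound[OF ib km'])
    show "AE x in lebesgue. norm (?k x) \<le> norm (?b x)"
    proof (rule AE_I2)
      fix x
      show "norm (?k x) \<le> norm (?b x)"
      proof (cases "x \<in> \<Omega> \<inter> S")
        case True
        have "norm (f x - g x) powr p \<le> 2 powr p * (norm (f x) powr p + norm (g x) powr p)"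
          using norm_add_powr_le[OF p, of "f x" "- g x"] by simp
        then show ?thesis using True by simp
      next
        case False
        then have "norm (?k x) = 0" by (auto simp: indicator_def)
        then show ?thesis by (metis norm_ge_zero)
      qed
    qed
  qed
  then show "set_integrable lebesgue \<Omega> (\<lambda>x. norm (indicator S x *\<^sub>R (f x - g x)) powr p)"
    by (simp only: set_integrable_def)
qed

lemma in_Lp_continuous_cball:
  fixes f :: "'a::euclidean_space \<Rightarrow> 'b::euclidean_space"
  assumes p: "0 \<le> p" and f: "continuous_on (cball c r) f"
  shows "in_Lp p (ball c r) f"
  unfolding in_Lp_def set_borel_measurable_def set_integrable_def
proof
  obtain M where M: "\<forall>x\<in>cball c r. norm (f x) \<le> M"
    using compact_imp_bounded[OF compact_continuous_image[OF f compact_cball]] by (auto simp: bounded_iff)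
  have "(\<lambda>x. indicator (ball c r) x *\<^sub>R f x) \<in> borel_measurable borel"
    by (intro borel_measurable_continuous_on_indicator continuous_on_subset[OF f]) auto
  then show m[measurable]: "(\<lambda>x. indicator (ball c r) x *\<^sub>R f x) \<in> borel_measurable lebesgue"
    by (intro measurable_completion) simp
  have e: "indicator (ball c r) x *\<^sub>R (norm (f x) powr p)
    = indicator (ball c r) x *\<^sub>R (norm (indicator (ball c r) x *\<^sub>R f x) powr p)" for x
    by (simp add: indicator_def)
  show "integrable lebesgue (\<lambda>x. indicator (ball c r) x *\<^sub>R (norm (f x) powr p))"
  proof (rule Bochner_Integration.integrable_bound)
    show "integrable lebesgue (\<lambda>x. M powr p * indicator (ball c r) x :: real)"
      using lmeasurable_ball[of c r] by (intro integrable_mult_right integrable_real_indicator) (auto simp: fmeasurable_def)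
    have "ball c r \<in> sets lebesgue" by simp
    then show "(\<lambda>x. indicator (ball c r) x *\<^sub>R (norm (f x) powr p)) \<in> borel_measurable lebesgue"
      unfolding e by measurable
    show "AE x in lebesgue. norm (indicator (ball c r) x *\<^sub>R (norm (f x) powr p)) \<le> norm (M powr p * indicator (ball c r) x :: real)"
      using M p by (intro AE_I2) (auto simp: indicator_def intro!: powr_mono2)
  qed
qed

lemma phase_energy_integrable:
  fixes f :: "'a::euclidean_space \<Rightarrow> real"
  assumes f: "continuous_on (cball c r) f"
  shows "integrable lebesgue (\<lambda>x. indicator (ball c r) x *\<^sub>R phase_energy p l1 l2 (f x))"
proof (rule Bochner_Integration.integrable_bound)
  let ?M = "\<bar>(p - 1) * l1 powr p\<bar> + \<bar>(p - 1) * l2 powr p\<bar>"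
  show "integrable lebesgue (\<lambda>x. ?M * indicator (ball c r) x :: real)"
    using lmeasurable_ball[of c r] by (intro integrable_mult_right integrable_real_indicator) (auto simp: fmeasurable_def)
  have "(\<lambda>x. indicator (ball c r) x *\<^sub>R f x) \<in> borel_measurable borel"
    by (intro borel_measurable_continuous_on_indicator continuous_on_subset[OF f]) auto
  then have [measurable]: "(\<lambda>x. indicator (ball c r) x *\<^sub>R f x) \<in> borel_measurable lebesgue"
    by (intro measurable_completion) simp
  have [measurable]: "phase_energy p l1 l2 \<in> borel_measurable borel"
    unfolding phase_energy_def by measurable
  have e: "indicator (ball c r) x *\<^sub>R phase_energy p l1 l2 (f x)
    = indicator (ball c r) x *\<^sub>R phase_energy p l1 l2 (indicator (ball c r) x *\<^sub>R f x)" for x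
    by (simp add: indicator_def)
  have "ball c r \<in> sets lebesgue" by simp
  then show "(\<lambda>x. indicator (ball c r) x *\<^sub>R phase_energy p l1 l2 (f x)) \<in> borel_measurable lebesgue"
    unfolding e by measurable
  show "AE x in lebesgue. norm (indicator (ball c r) x *\<^sub>R phase_energy p l1 l2 (f x)) \<le> norm (?M * indicator (ball c r) x :: real)"
    by (intro AE_I2) (auto simp: indicator_def phase_energy_def)
qed

text \<open>The pointwise calibration is strict, so integrating it over {u < w} against minimality
  makes that open set null, hence empty. \<open>Z\<close> is meant for a hypersurface of zeros of
  \<open>w\<close>, where no strict inequality is at hand.\<close>

lemma comparison_principle:
  fixes u w :: "'a::euclidean_space \<Rightarrow> real"
  assumes p: "1 < p" and r: "r > 0" and min: "minimality p l1 l2 (ball c r) u g"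
    and cu: "continuous_on (cball c r) u" and cw: "continuous_on (cball c r) w"
    and ww: "has_weak_gradient (ball c r) w h" and hL: "in_Lp p (ball c r) h"
    and bd: "\<And>x. x \<in> sphere c r \<Longrightarrow> \<forall>\<^sub>F y in nhds x. y \<in> ball c r \<longrightarrow> w y \<le> u y"
    and F1: "Cinf_on F1 N1" "cball c r \<subseteq> N1" and F2: "Cinf_on F2 N2" "cball c r \<subseteq> N2"
    and h0: "\<And>x. x \<in> ball c r \<Longrightarrow> w x = 0 \<Longrightarrow> h x = 0"
    and c1: "\<And>x. x \<in> ball c r \<Longrightarrow> u x < w x \<Longrightarrow> w x > 0 \<Longrightarrow> F1 x = norm (h x) powr (p - 2) *\<^sub>R h x \<and> divergence F1 x > 0"
    and c2: "\<And>x. x \<in> ball c r \<Longrightarrow> u x < w x \<Longrightarrow> w x < 0 \<Longrightarrow> F2 x = norm (h x) powr (p - 2) *\<^sub>R h x \<and> divergence F2 x > 0"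
    and c3: "\<And>x. x \<in> ball c r \<Longrightarrow> w x > 0 \<Longrightarrow> u x = 0 \<Longrightarrow> l1 powr p \<le> norm (h x) powr p"
    and c4: "\<And>x. x \<in> ball c r \<Longrightarrow> w x > 0 \<Longrightarrow> u x < 0 \<Longrightarrow> p * divergence F2 x * (- u x)
      + (p - 1) * (norm (h x) powr p - l1 powr p + l2 powr p - norm (F2 x) powr (p / (p - 1))) \<ge> 0"
    and Z: "negligible Z"
    and c5: "\<And>x. x \<in> ball c r - Z \<Longrightarrow> w x = 0 \<Longrightarrow> u x < 0 \<Longrightarrow> p * divergence F2 x * (- u x)
      + (p - 1) * (l2 powr p - norm (F2 x) powr (p / (p - 1))) > 0"
    and x: "x \<in> ball c r"
  shows "w x \<le> u x"
proof (rule ccontr)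
  assume neg: "\<not> w x \<le> u x"
  let ?B = "ball c r"
  define E where "E = {x \<in> ?B. u x < w x}"
  have xE: "x \<in> E" using neg x by (simp add: E_def)
  have cuB: "continuous_on ?B u" and cwB: "continuous_on ?B w"
    using cu cw continuous_on_subset ball_subset_cball by blast+
  have ug: "has_weak_gradient ?B u g" and gL: "in_Lp p ?B g"
    using min by (auto simp: minimality_def)
  have oE: "open E"
  proof -
    have "open ((\<lambda>x. w x - u x) -` {0<..} \<inter> ?B)"
      using continuous_on_open_vimage[OF open_ball] continuous_on_diff[OF cwB cuB] open_greaterThan by metis
    moreover have "(\<lambda>x. w x - u x) -` {0<..} \<inter> ?B = E" by (auto simp: E_def)
    ultimately show ?thesis by simp
  qed
  have Es: "E \<in> sets lebesgue" by (rule lebesgue_open[OF oE])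
  have EB: "E \<subseteq> ?B" by (auto simp: E_def)
  define K where "K = closure E"
  have Kc: "compact K" unfolding K_def using EB bounded_subset[OF bounded_ball] by (simp add: compact_closure)
  have EK: "E \<subseteq> K" by (simp add: K_def closure_subset)
  \<comment> \<open>The boundary condition holds in a neighbourhood of each point of the sphere, so
    limit points of \<open>E\<close> avoid the sphere as well. An inequality on the sphere alone
    would not make the perturbation compactly supported.\<close>
  have KB: "K \<subseteq> ?B"
  proof
    fix y assume y: "y \<in> K"
    have "y \<in> closure ?B" using y closure_mono[OF EB] by (auto simp: K_def)
    then have yc: "y \<in> cball c r" using r by simp
    show "y \<in> ?B"
    proof (rule ccontr)
      assume "y \<notin> ?B"
      then have "y \<in> sphere c r" using yc by auto
      from bd[OF this] obtain T where T: "open T" "y \<in> T" "\<forall>z\<in>T. z \<in> ?B \<longrightarrow> w z \<le> u z"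
        unfolding eventually_nhds by blast
      then have "T \<inter> E = {}" by (force simp: E_def)
      then have "T \<inter> K = {}" using open_Int_closure_eq_empty[OF T(1)] by (simp add: K_def)
      then show False using T(2) y by blast
    qed
  qed
  define \<phi> where "\<phi> x = (if x \<in> E then w x - u x else 0)" for x
  define G where "G x = (if x \<in> E then h x - g x else 0)" for x
  \<comment> \<open>\<phi> = \<phi>1 + \<phi>2 separates the positive from the negative parts of
    \<open>u\<close> and \<open>w\<close>, so that each difference can be tested against its own
    smooth field. Each has the sign of w - u or is 0, hence is again a positive part with a known
    weak gradient.\<close>
  define \<phi>1 where "\<phi>1 x = (if x \<in> E then max (w x) 0 - max (u x) 0 else 0)" for x
  define G1 where "G1 x = (if x \<in> E then (if w x > 0 then h x else 0) - (if u x > 0 then g x else 0) else 0)" for x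
  define \<phi>2 where "\<phi>2 x = (if x \<in> E then max (- u x) 0 - max (- w x) 0 else 0)" for x
  define G2 where "G2 x = (if x \<in> E then (if - u x > 0 then - g x else 0) - (if - w x > 0 then - h x else 0) else 0)" for x
  have z: "\<phi> x = 0" "G x = 0" "\<phi>1 x = 0" "G1 x = 0" "\<phi>2 x = 0" "G2 x = 0" if "x \<notin> K" for x
    using that EK by (auto simp: \<phi>_def G_def \<phi>1_def G1_def \<phi>2_def G2_def)
  have w0: "has_weak_gradient ?B \<phi> G"
    by (rule has_weak_gradient_cong[OF has_weak_gradient_pos_part[OF open_ball continuous_on_diff[OF cwB cuB]
            has_weak_gradient_diff[OF ww ug]]])
      (auto simp: \<phi>_def G_def E_def)
  have cm: "continuous_on ?B (\<lambda>x. max (w x) 0 - max (u x) 0)" "continuous_on ?B (\<lambda>x. max (- u x) 0 - max (- w x) 0)"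
    by (intro continuous_intros cuB cwB)+
  have w1: "has_weak_gradient ?B \<phi>1 G1"
    by (rule has_weak_gradient_cong[OF has_weak_gradient_pos_part[OF open_ball cm(1)
            has_weak_gradient_diff[OF has_weak_gradient_pos_part[OF open_ball cwB ww] has_weak_gradient_pos_part[OF open_ball cuB ug]]]])
      (auto simp: \<phi>1_def G1_def E_def max_def)
  have cn: "continuous_on ?B (\<lambda>x. - u x)" "continuous_on ?B (\<lambda>x. - w x)" by (intro continuous_intros cuB cwB)+
  have w2: "has_weak_gradient ?B \<phi>2 G2"
    by (rule has_weak_gradient_cong[OF has_weak_gradient_pos_part[OF open_ball cm(2)
            has_weak_gradient_diff[OF has_weak_gradient_pos_part[OF open_ball cn(1) has_weak_gradient_minus[OF ug]]
              has_weak_gradient_pos_part[OF open_ball cn(2) has_weak_gradient_minus[OF ww]]]]])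
      (auto simp: \<phi>2_def G2_def E_def max_def)
  have p0: "0 \<le> p" using p by simp
  have L\<phi>: "in_Lp p ?B \<phi>"
    by (rule in_Lp_cong[OF in_Lp_indicator_diff[OF p0 in_Lp_continuous_cball[OF p0 cw] in_Lp_continuous_cball[OF p0 cu] Es]])
      (simp add: \<phi>_def indicator_def)
  have LG: "in_Lp p ?B G"
    by (rule in_Lp_cong[OF in_Lp_indicator_diff[OF p0 hL gL Es]]) (simp add: G_def indicator_def)
  define fu where "fu x = norm (g x) powr p + phase_energy p l1 l2 (u x)" for x
  define fw where "fw x = norm (h x) powr p + phase_energy p l1 l2 (w x)" for x
  have iu: "integrable lebesgue (\<lambda>x. indicator ?B x *\<^sub>R fu x)"
    unfolding fu_def scaleR_add_right using gL phase_energy_integrable[OF cu]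
    by (intro Bochner_Integration.integrable_add) (auto simp: in_Lp_def set_integrable_def)
  have iw: "integrable lebesgue (\<lambda>x. indicator ?B x *\<^sub>R fw x)"
    unfolding fw_def scaleR_add_right using hL phase_energy_integrable[OF cw]
    by (intro Bochner_Integration.integrable_add) (auto simp: in_Lp_def set_integrable_def)
  have iD: "integrable lebesgue (\<lambda>x. indicator E x *\<^sub>R (indicator ?B x *\<^sub>R fu x - indicator ?B x *\<^sub>R fw x))"
    by (rule integrable_mult_indicator[OF Es Bochner_Integration.integrable_diff[OF iu iw]])
  have "(LINT x:?B|lebesgue. norm (g x) powr p + phase_energy p l1 l2 (u x))
        \<le> (LINT x:?B|lebesgue. norm (g x + G x) powr p + phase_energy p l1 l2 (u x + \<phi> x))"
    using min w0 L\<phi> LG Kc KB z(1,2) unfolding minimality_def by blast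
  moreover have "(LINT x:?B|lebesgue. norm (g x + G x) powr p + phase_energy p l1 l2 (u x + \<phi> x))
     = (\<integral>x. indicator ?B x *\<^sub>R fu x - indicator E x *\<^sub>R (indicator ?B x *\<^sub>R fu x - indicator ?B x *\<^sub>R fw x) \<partial>lebesgue)"
    unfolding set_lebesgue_integral_def
    by (rule Bochner_Integration.integral_cong[OF refl]) (use EB in \<open>auto simp: fu_def fw_def \<phi>_def G_def indicator_def\<close>)
  moreover have "(LINT x:?B|lebesgue. norm (g x) powr p + phase_energy p l1 l2 (u x)) = (\<integral>x. indicator ?B x *\<^sub>R fu x \<partial>lebesgue)"
    by (simp add: set_lebesgue_integral_def fu_def)
  ultimately have D: "(\<integral>x. indicator E x *\<^sub>R (indicator ?B x *\<^sub>R fu x - indicator ?B x *\<^sub>R fw x) \<partial>lebesgue) \<le> 0"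
    by (simp only: Bochner_Integration.integral_diff[OF iu iD])
  have a1: "integrable lebesgue (\<lambda>x. F1 x \<bullet> G1 x)"
    by (rule weak_gradient_divergence(1)[OF w1 r Kc KB z(3) z(4) F1])
  have b1: "integrable lebesgue (\<lambda>x. divergence F1 x * \<phi>1 x)"
    by (rule weak_gradient_divergence(2)[OF w1 r Kc KB z(3) z(4) F1])
  have I1: "(\<integral>x. F1 x \<bullet> G1 x \<partial>lebesgue) = - (\<integral>x. divergence F1 x * \<phi>1 x \<partial>lebesgue)"
    by (rule weak_gradient_divergence(3)[OF w1 r Kc KB z(3) z(4) F1])
  have a2: "integrable lebesgue (\<lambda>x. F2 x \<bullet> G2 x)"
    by (rule weak_gradient_divergence(1)[OF w2 r Kc KB z(5) z(6) F2])
  have b2: "integrable lebesgue (\<lambda>x. divergence F2 x * \<phi>2 x)"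
    by (rule weak_gradient_divergence(2)[OF w2 r Kc KB z(5) z(6) F2])
  have I2: "(\<integral>x. F2 x \<bullet> G2 x \<partial>lebesgue) = - (\<integral>x. divergence F2 x * \<phi>2 x \<partial>lebesgue)"
    by (rule weak_gradient_divergence(3)[OF w2 r Kc KB z(5) z(6) F2])
  \<comment> \<open>By \<open>I1\<close> and \<open>I2\<close> the added terms cancel after
    integration, so T has the integral of the energy difference over \<open>E\<close>, which
    minimality makes nonpositive. Pointwise it is positive on E - Z and zero outside
    \<open>E\<close>.\<close>
  define T where "T x = indicator E x *\<^sub>R (indicator ?B x *\<^sub>R fu x - indicator ?B x *\<^sub>R fw x)
     + (p * (F1 x \<bullet> G1 x) + p * (F2 x \<bullet> G2 x) + (p * (divergence F1 x * \<phi>1 x) + p * (divergence F2 x * \<phi>2 x)))" for x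
  have i1: "integrable lebesgue (\<lambda>x. p * (F1 x \<bullet> G1 x))" "integrable lebesgue (\<lambda>x. p * (divergence F1 x * \<phi>1 x))"
    by (intro integrable_mult_right a1 b1)+
  have i2: "integrable lebesgue (\<lambda>x. p * (F2 x \<bullet> G2 x))" "integrable lebesgue (\<lambda>x. p * (divergence F2 x * \<phi>2 x))"
    by (intro integrable_mult_right a2 b2)+
  note j1 = Bochner_Integration.integrable_add[OF i1(1) i2(1)] and j2 = Bochner_Integration.integrable_add[OF i1(2) i2(2)]
  note j = Bochner_Integration.integrable_add[OF j1 j2]
  have iT: "integrable lebesgue T" unfolding T_def by (rule Bochner_Integration.integrable_add[OF iD j])
  have "integral\<^sup>L lebesgue T = (\<integral>x. indicator E x *\<^sub>R (indicator ?B x *\<^sub>R fu x - indicator ?B x *\<^sub>R fw x) \<partial>lebesgue)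
     + ((p * (\<integral>x. F1 x \<bullet> G1 x \<partial>lebesgue) + p * (\<integral>x. F2 x \<bullet> G2 x \<partial>lebesgue))
     + (p * (\<integral>x. divergence F1 x * \<phi>1 x \<partial>lebesgue) + p * (\<integral>x. divergence F2 x * \<phi>2 x \<partial>lebesgue)))"
    unfolding T_def Bochner_Integration.integral_add[OF iD j] Bochner_Integration.integral_add[OF j1 j2]
      Bochner_Integration.integral_add[OF i1(1) i2(1)] Bochner_Integration.integral_add[OF i1(2) i2(2)]
      integral_mult_right_zero ..
  then have le: "integral\<^sup>L lebesgue T \<le> 0" using D unfolding I1 I2 by simp
  have pos: "T x > 0" if xE: "x \<in> E" and xZ: "x \<notin> Z" for x
  proof -
    have xB: "x \<in> ?B" and xBZ: "x \<in> ?B - Z" and uw: "u x < w x" using xE xZ by (auto simp: E_def)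
    have a0: "0 < (norm (g x) powr p + phase_energy p l1 l2 (u x)) - (norm (h x) powr p + phase_energy p l1 l2 (w x))
      + p * (F1 x \<bullet> ((if w x > 0 then h x else 0) - (if u x > 0 then g x else 0)))
      + p * (F2 x \<bullet> ((if - u x > 0 then - g x else 0) - (if - w x > 0 then - h x else 0)))
      + p * (divergence F1 x * (max (w x) 0 - max (u x) 0)) + p * (divergence F2 x * (max (- u x) 0 - max (- w x) 0))"
      by (rule calibration_pointwise[OF p uw h0[OF xB] c1[OF xB uw] c2[OF xB uw] c3[OF xB] c4[OF xB] c5[OF xBZ]])
    have e: "G1 x = (if w x > 0 then h x else 0) - (if u x > 0 then g x else 0)"
      "G2 x = (if - u x > 0 then - g x else 0) - (if - w x > 0 then - h x else 0)"
      "\<phi>1 x = max (w x) 0 - max (u x) 0" "\<phi>2 x = max (- u x) 0 - max (- w x) 0"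
      using xE by (simp_all only: G1_def G2_def \<phi>1_def \<phi>2_def if_True)
    have "indicator E x *\<^sub>R (indicator ?B x *\<^sub>R fu x - indicator ?B x *\<^sub>R fw x) = fu x - fw x"
      using xE xB by simp
    then show ?thesis using a0 unfolding T_def e[symmetric] by (simp add: fu_def fw_def add.assoc)
  qed
  have T0: "T x = 0" if "x \<notin> E" for x
    using that by (simp add: T_def \<phi>1_def G1_def \<phi>2_def G2_def)
  have AZ: "AE x in lebesgue. x \<notin> Z" using Z by (metis AE_not_in negligible_iff_null_sets)
  have nn: "AE x in lebesgue. T x \<ge> 0"
    using AZ by eventually_elim (use pos T0 in \<open>metis less_imp_le order_refl\<close>)
  have "integral\<^sup>L lebesgue T \<ge> 0" by (rule integral_nonneg_AE[OF nn])
  with le have "integral\<^sup>L lebesgue T = 0" by linarith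
  then have "AE x in lebesgue. T x = 0"
    by (subst (asm) integral_nonneg_eq_0_iff_AE[OF iT nn])
  with AZ have "AE x in lebesgue. x \<notin> E"
    by eventually_elim (use pos in force)
  then have "E \<in> null_sets lebesgue" by (subst (asm) AE_iff_null_sets[OF Es, symmetric])
  then have "negligible E" by (simp add: negligible_iff_null_sets)
  then show False using open_not_negligible[OF oE] xE by auto
qed

section \<open>Radial barriers\<close>

text \<open>Normalised to vanish with unit slope on the sphere of radius R about y. It decreases
  with the distance, so the positive phase is the inside; \<open>radial_slope\<close> is minus its
  radial derivative.\<close>

definition radial_potential :: "real \<Rightarrow> real \<Rightarrow> 'a::euclidean_space \<Rightarrow> 'a \<Rightarrow> real" where
  "radial_potential R m y x = (R / m) * ((R / dist x y) powr m - 1)"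

definition radial_slope :: "real \<Rightarrow> real \<Rightarrow> 'a::euclidean_space \<Rightarrow> 'a \<Rightarrow> real" where
  "radial_slope R m y x = (R / dist x y) powr (m + 1)"

text \<open>This is - C |x - y|^(-k) (x - y), written through the inner product so that smoothness
  away from y is evident. For k = (m + 1)(p - 1) + 1 and suitable C it is the flux |\<nabla>w|^(p-2)
  \<nabla>w of a positive multiple of the potential.\<close>

definition radial_field :: "real \<Rightarrow> real \<Rightarrow> 'a::euclidean_space \<Rightarrow> 'a \<Rightarrow> 'a" where
  "radial_field C k y x = (- C * ((x - y) \<bullet> (x - y)) powr (- k / 2)) *\<^sub>R (x - y)"

lemma radial_potential_GDERIV:
  assumes "x \<noteq> y" "R > 0" "m > 0"
  shows "GDERIV (radial_potential R m y) x :> (- radial_slope R m y x) *\<^sub>R sgn (x - y)"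
proof -
  have n: "GDERIV (\<lambda>x. dist x y) x :> sgn (x - y)"
  proof -
    have "((\<lambda>x. x - y) has_derivative (\<lambda>h. h)) (at x)" by (auto intro!: derivative_eq_intros)
    from has_derivative_compose[OF this, of norm "\<lambda>h. h \<bullet> sgn (x - y)"] GDERIV_norm[of "x - y"] assms(1)
    show ?thesis by (simp add: gderiv_def dist_norm)
  qed
  have pos: "dist x y > 0" using assms(1) by simp
  have "((\<lambda>t. (R / m) * ((R / t) powr m - 1)) has_real_derivative - radial_slope R m y x) (at (dist x y))"
  proof -
    have "((\<lambda>t. (R / m) * (R powr m * t powr (- m) - 1)) has_real_derivative
        (R / m) * (R powr m * (- m * dist x y powr (- m - 1)))) (at (dist x y))"
      using pos by (auto intro!: derivative_eq_intros)
    moreover have "(R / m) * (R powr m * (- m * dist x y powr (- m - 1))) = - radial_slope R m y x"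
    proof -
      define D where "D = dist x y powr (- m - 1)"
      have "(R / m) * (R powr m * (- m * D)) = - (R powr m * R) * D"
        using assms by simp
      also have "R powr m * R = R powr (m + 1)" using assms(2) by (simp add: powr_add)
      also have De: "D = inverse (dist x y powr (m + 1))"
        unfolding D_def powr_minus[symmetric] by (rule arg_cong[of _ _ "\<lambda>t. dist x y powr t"]) simp
      also have "- (R powr (m + 1)) * inverse (dist x y powr (m + 1)) = - radial_slope R m y x"
        using assms pos unfolding radial_slope_def by (subst powr_divide) (auto simp: divide_inverse)
      finally show ?thesis unfolding D_def[symmetric] De .
    qed
    ultimately have "((\<lambda>t. (R / m) * (R powr m * t powr (- m) - 1)) has_real_derivative
        - radial_slope R m y x) (at (dist x y))" by simp
    then show ?thesis
      by (rule has_field_derivative_transform_within_open[where S = "{0<..}"])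
        (use pos assms in \<open>auto simp: powr_divide powr_minus_divide\<close>)
  qed
  from GDERIV_DERIV_compose[OF n this]
  show ?thesis by (simp add: radial_potential_def[abs_def])
qed

lemma radial_slope_pos: "x \<noteq> y \<Longrightarrow> R > 0 \<Longrightarrow> radial_slope R m y x > 0"
  by (simp add: radial_slope_def)

lemma continuous_radial_gradient:
  assumes "R > 0"
  shows "continuous_on (- {y}) (\<lambda>x. (- radial_slope R m y x) *\<^sub>R sgn (x - y))"
  unfolding radial_slope_def
  by (intro continuous_intros) (use assms in auto)

lemma Cinf_on_radial_field: "Cinf_on (radial_field C k y) (- {y})"
  unfolding radial_field_def
  by (intro Cinf_on_scaleR Cinf_on_mult Cinf_on_const Cinf_on_diff Cinf_on_ident
      Cinf_on_compose[OF _ Cinf_on_powr] Cinf_on_inner) auto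

lemma divergence_has_derivative:
  assumes "(F has_derivative F') (at x)"
  shows "divergence F x = (\<Sum>b\<in>Basis. F' b \<bullet> b)"
  using frechet_derivative_at[OF assms] by (simp add: divergence_def)

text \<open>The identity part of the derivative contributes - DIM and the radial power + k. Thus k =
  DIM is the divergence-free case of the fundamental solution, and a larger k gives a strict
  subsolution for C > 0.\<close>

lemma divergence_radial_field:
  fixes x :: "'a::euclidean_space"
  assumes "x \<noteq> y"
  shows "divergence (radial_field C k y) x = C * (k - real DIM('a)) * dist x y powr (- k)"
proof -
  let ?z = "x - y" let ?s = "(x - y) \<bullet> (x - y)"
  have s: "?s > 0" using assms by simp
  have D: "(radial_field C k y has_derivative
     (\<lambda>d. (- C * ?s powr (- k / 2)) *\<^sub>R d + (- C * ((- k / 2) * ?s powr (- k / 2 - 1) * (2 * (?z \<bullet> d)))) *\<^sub>R ?z)) (at x)"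
  proof -
    have 1: "((\<lambda>x. (x - y) \<bullet> (x - y)) has_derivative (\<lambda>d. 2 * (?z \<bullet> d))) (at x)"
      by (auto intro!: derivative_eq_intros simp: inner_commute)
    have 2: "((\<lambda>t. t powr (- k / 2)) has_derivative (\<lambda>h. h * ((- k / 2) * ?s powr (- k / 2 - 1)))) (at ?s)"
    proof -
      have "((\<lambda>t. t powr (- k / 2)) has_real_derivative (- k / 2) * ?s powr (- k / 2 - 1)) (at ?s)"
        using s by (auto intro!: derivative_eq_intros)
      then show ?thesis unfolding has_field_derivative_def mult_commute_abs .
    qed
    have 3: "((\<lambda>x. - C * ((x - y) \<bullet> (x - y)) powr (- k / 2)) has_derivative
       (\<lambda>d. - C * ((- k / 2) * ?s powr (- k / 2 - 1) * (2 * (?z \<bullet> d))))) (at x)"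
      using has_derivative_mult_right[OF has_derivative_compose[OF 1 2], of "- C"] by (simp add: mult_ac)
    have 4: "((\<lambda>x. x - y) has_derivative (\<lambda>d. d)) (at x)" by (auto intro!: derivative_eq_intros)
    show ?thesis unfolding radial_field_def[abs_def]
      using has_derivative_scaleR[OF 3 4] by simp
  qed
  have sb: "(\<Sum>b\<in>Basis. (?z \<bullet> b) * (?z \<bullet> b)) = ?s" by (simp add: euclidean_inner[of ?z ?z])
  have sp: "?s powr (- k / 2 - 1) * ?s = ?s powr (- k / 2)"
    using s powr_add[of ?s "- k / 2 - 1" 1] by simp
  have "divergence (radial_field C k y) x = (\<Sum>b\<in>(Basis::'a set). - C * ?s powr (- k / 2) + C * k * ?s powr (- k / 2 - 1) * ((?z \<bullet> b) * (?z \<bullet> b)))"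
    unfolding divergence_has_derivative[OF D]
  proof (rule sum.cong[OF refl])
    have *: "((- C * P) *\<^sub>R b + (- C * ((- k / 2) * Q * (2 * (z \<bullet> b)))) *\<^sub>R z) \<bullet> b = - C * P + C * k * Q * ((z \<bullet> b) * (z \<bullet> b))"
      if "b \<in> Basis" for P Q and z b :: 'a
      using that by (simp add: inner_add_left inner_diff_left mult_ac)
    show "((- C * ?s powr (- k / 2)) *\<^sub>R b + (- C * ((- k / 2) * ?s powr (- k / 2 - 1) * (2 * (?z \<bullet> b)))) *\<^sub>R ?z) \<bullet> b
      = - C * ?s powr (- k / 2) + C * k * ?s powr (- k / 2 - 1) * ((?z \<bullet> b) * (?z \<bullet> b))" if "b \<in> Basis" for b
      by (rule *[OF that])
  qed
  also have "\<dots> = real DIM('a) * (- C * ?s powr (- k / 2)) + C * k * ?s powr (- k / 2 - 1) * ?s"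
    unfolding sum.distrib sum_distrib_left[symmetric] sb by simp
  also have "\<dots> = real DIM('a) * (- C * ?s powr (- k / 2)) + C * k * (?s powr (- k / 2 - 1) * ?s)"
    by (simp add: mult.assoc)
  also have "\<dots> = C * (k - real DIM('a)) * ?s powr (- k / 2)"
    unfolding sp by (simp add: algebra_simps)
  also have "?s powr (- k / 2) = dist x y powr (- k)"
  proof -
    have "?s = dist x y powr 2" using assms by (simp add: dist_norm power2_norm_eq_inner)
    then show ?thesis by (simp only: powr_powr) simp
  qed
  finally show ?thesis .
qed

lemma radial_field_eq:
  assumes "x \<noteq> y" "R > 0" "p > 1" "\<alpha> > 0"
  shows "radial_field (\<alpha> powr (p - 1) * R powr ((m + 1) * (p - 1))) ((m + 1) * (p - 1) + 1) y x
    = norm (\<alpha> *\<^sub>R ((- radial_slope R m y x) *\<^sub>R sgn (x - y))) powr (p - 2)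
        *\<^sub>R (\<alpha> *\<^sub>R ((- radial_slope R m y x) *\<^sub>R sgn (x - y)))"
    "norm (radial_field (\<alpha> powr (p - 1) * R powr ((m + 1) * (p - 1))) ((m + 1) * (p - 1) + 1) y x)
      = (\<alpha> * radial_slope R m y x) powr (p - 1)"
proof -
  let ?\<theta> = "radial_slope R m y x" let ?\<rho> = "dist x y" let ?K = "(m + 1) * (p - 1)"
  have \<rho>: "?\<rho> > 0" using assms by simp
  have \<theta>: "?\<theta> > 0" by (rule radial_slope_pos[OF assms(1,2)])
  have n: "norm (\<alpha> *\<^sub>R ((- ?\<theta>) *\<^sub>R sgn (x - y))) = \<alpha> * ?\<theta>"
    using assms \<theta> by (simp add: norm_sgn)
  have "(\<alpha> * ?\<theta>) powr (p - 2) * (\<alpha> * ?\<theta>) = (\<alpha> * ?\<theta>) powr (p - 1)"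
    using powr_add[of "\<alpha> * ?\<theta>" "p - 2" 1] \<theta> assms by simp
  also have "\<dots> = \<alpha> powr (p - 1) * (?\<theta> powr (p - 1))" using \<theta> assms by (simp add: powr_mult)
  also have "?\<theta> powr (p - 1) = R powr ?K * ?\<rho> powr (- ?K)"
    using \<rho> assms by (simp add: radial_slope_def powr_powr powr_divide powr_minus_divide)
  finally have e: "(\<alpha> * ?\<theta>) powr (p - 2) * (\<alpha> * ?\<theta>) = \<alpha> powr (p - 1) * R powr ?K * ?\<rho> powr (- ?K)" by simp
  have s: "((x - y) \<bullet> (x - y)) powr (- (?K + 1) / 2) = ?\<rho> powr (- ?K) / ?\<rho>"
  proof -
    have "(x - y) \<bullet> (x - y) = ?\<rho> powr 2" using assms by (simp add: dist_norm power2_norm_eq_inner)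
    then have "((x - y) \<bullet> (x - y)) powr (- (?K + 1) / 2) = ?\<rho> powr (2 * (- (?K + 1) / 2))" by (simp only: powr_powr)
    also have "?\<rho> powr (2 * (- (?K + 1) / 2)) = ?\<rho> powr (- ?K + - 1)"
      by (rule arg_cong[of _ _ "\<lambda>t. ?\<rho> powr t"]) simp
    also have "\<dots> = ?\<rho> powr (- ?K) / ?\<rho>" using \<rho> by (simp only: powr_add) (simp add: powr_minus_divide)
    finally show ?thesis .
  qed
  have 1: "radial_field (\<alpha> powr (p - 1) * R powr ?K) (?K + 1) y x = - ((\<alpha> * ?\<theta>) powr (p - 2) * (\<alpha> * ?\<theta>)) *\<^sub>R sgn (x - y)"
    unfolding radial_field_def s e by (simp add: sgn_div_norm dist_norm divide_inverse)
  show "radial_field (\<alpha> powr (p - 1) * R powr ?K) (?K + 1) y x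
    = norm (\<alpha> *\<^sub>R ((- ?\<theta>) *\<^sub>R sgn (x - y))) powr (p - 2) *\<^sub>R (\<alpha> *\<^sub>R ((- ?\<theta>) *\<^sub>R sgn (x - y)))"
    unfolding 1 n by simp
  have "norm (radial_field (\<alpha> powr (p - 1) * R powr ?K) (?K + 1) y x) = (\<alpha> * ?\<theta>) powr (p - 2) * (\<alpha> * ?\<theta>)"
    unfolding 1 using assms \<theta> by (simp add: norm_sgn)
  also have "\<dots> = (\<alpha> * ?\<theta>) powr (p - 1)"
    using powr_add[of "\<alpha> * ?\<theta>" "p - 2" 1] \<theta> assms by simp
  finally show "norm (radial_field (\<alpha> powr (p - 1) * R powr ?K) (?K + 1) y x) = (\<alpha> * ?\<theta>) powr (p - 1)" .
qed

lemma radial_potential_sign: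
  assumes "x \<noteq> y" "R > 0" "m > 0"
  shows "radial_potential R m y x > 0 \<longleftrightarrow> dist x y < R" "radial_potential R m y x < 0 \<longleftrightarrow> dist x y > R"
    "radial_potential R m y x = 0 \<longleftrightarrow> dist x y = R"
proof -
  have \<rho>: "dist x y > 0" using assms by simp
  have q: "R / dist x y > 0" using \<rho> assms by simp
  have "(R / dist x y) powr m > 1 \<longleftrightarrow> R / dist x y > 1"
    using powr_less_mono2[of m 1 "R / dist x y"]
      powr_mono2[of m "R / dist x y" 1] q assms(3)
    by (cases "R / dist x y > 1") (auto simp: not_less)
  then show 1: "radial_potential R m y x > 0 \<longleftrightarrow> dist x y < R"
    using assms \<rho> by (simp add: radial_potential_def zero_less_mult_iff zero_less_divide_iff)
  have "(R / dist x y) powr m < 1 \<longleftrightarrow> R / dist x y < 1"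
    using powr_less_mono2[of m "R / dist x y" 1]
      powr_mono2[of m 1 "R / dist x y"] q assms(3)
    by (cases "R / dist x y < 1") (auto simp: not_less)
  then show 2: "radial_potential R m y x < 0 \<longleftrightarrow> dist x y > R"
    using assms \<rho> by (simp add: radial_potential_def mult_less_0_iff divide_less_0_iff)
  show "radial_potential R m y x = 0 \<longleftrightarrow> dist x y = R"
    using 1 2 by (metis less_irrefl linorder_less_linear)
qed

text \<open>Convexity of the profile in the distance: its tangent at \<open>dist x y\<close>,
  evaluated at R, lies below the value 0 taken there. The proof reduces this to ln q \<le> q -
  1.\<close>

lemma radial_potential_le:
  assumes "x \<noteq> y" "R > 0" "m > 0"
  shows "radial_potential R m y x \<le> radial_slope R m y x * (R - dist x y)"
proof -
  let ?q = "R / dist x y"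
  have \<rho>: "dist x y > 0" using assms by simp
  have q: "?q > 0" using \<rho> assms by simp
  have "1 - m * (?q - 1) \<le> exp (- m * ln ?q)"
  proof -
    have "m * ln ?q \<le> m * (?q - 1)" using assms q ln_le_minus_one[OF q] by (intro mult_left_mono) auto
    then have "1 - m * (?q - 1) \<le> 1 + (- m * ln ?q)" by simp
    also have "\<dots> \<le> exp (- m * ln ?q)" by (rule exp_ge_add_one_self)
    finally show ?thesis .
  qed
  also have "\<dots> = ?q powr (- m)" using q assms by (simp add: powr_def)
  finally have "?q powr m * (1 - m * (?q - 1)) \<le> ?q powr m * ?q powr (- m)" by (rule mult_left_mono) simp
  also have "\<dots> = 1" using q by (metis powr_add add.right_inverse powr_zero_eq_one less_irrefl)
  finally have "?q powr m - 1 \<le> m * (?q powr m * (?q - 1))" by (simp add: algebra_simps)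
  then have "(R / m) * (?q powr m - 1) \<le> (R / m) * (m * (?q powr m * (?q - 1)))"
    using assms by (intro mult_left_mono) auto
  also have "\<dots> = ?q powr m * (R * (?q - 1))" using assms by simp
  also have "R * (?q - 1) = ?q * (R - dist x y)" using \<rho> by (simp add: field_simps)
  also have "?q powr m * (?q * (R - dist x y)) = ?q powr (m + 1) * (R - dist x y)" using q assms by (simp add: powr_add)
  finally show ?thesis by (simp add: radial_potential_def radial_slope_def)
qed

text \<open>The gradient is set to 0 on the zero set of \<psi>, as the truncation rule for weak
  gradients delivers it. Slope \<alpha> = 0 is allowed and gives barriers that vanish on an open
  set.\<close>

lemma two_slope_function:
  fixes \<psi> :: "'a::euclidean_space \<Rightarrow> real" and \<alpha> \<beta> :: real
  assumes N: "open N" "cball c r \<subseteq> N" and \<psi>: "\<And>x. x \<in> N \<Longrightarrow> GDERIV \<psi> x :> H x" and cH: "continuous_on N H"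
    and p: "0 \<le> p"
  defines "w \<equiv> \<lambda>x. \<alpha> * max (\<psi> x) 0 - \<beta> * max (- \<psi> x) 0"
    and "h \<equiv> \<lambda>x. if \<psi> x > 0 then \<alpha> *\<^sub>R H x else if \<psi> x < 0 then \<beta> *\<^sub>R H x else 0"
  shows "continuous_on (cball c r) w" "has_weak_gradient (ball c r) w h" "in_Lp p (ball c r) h"
proof -
  have bN: "ball c r \<subseteq> N" using N(2) ball_subset_cball by blast
  have c\<psi>N: "continuous_on N \<psi>" by (rule continuous_on_GDERIV[OF \<psi>])
  note c\<psi> = continuous_on_subset[OF c\<psi>N N(2)] and c\<psi>b = continuous_on_subset[OF c\<psi>N bN]
  show "continuous_on (cball c r) w" unfolding w_def by (intro continuous_intros c\<psi>)
  have W: "has_weak_gradient (ball c r) \<psi> H"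
    by (rule has_weak_gradient_classical[OF open_ball]) (use \<psi> bN continuous_on_subset[OF cH bN] in auto)
  have c\<psi>m: "continuous_on (ball c r) (\<lambda>x. - \<psi> x)" by (intro continuous_intros c\<psi>b)
  have W2: "has_weak_gradient (ball c r) (\<lambda>x. \<alpha> * max (\<psi> x) 0 - \<beta> * max (- \<psi> x) 0)
     (\<lambda>x. \<alpha> *\<^sub>R (if \<psi> x > 0 then H x else 0) - \<beta> *\<^sub>R (if - \<psi> x > 0 then - H x else 0))"
    by (intro has_weak_gradient_diff has_weak_gradient_scale has_weak_gradient_pos_part[OF open_ball c\<psi>b W]
        has_weak_gradient_pos_part[OF open_ball c\<psi>m has_weak_gradient_minus[OF W]])
  show "has_weak_gradient (ball c r) w h"
    by (rule has_weak_gradient_cong[OF W2]) (auto simp: w_def h_def)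
  define S1 where "S1 = {x \<in> ball c r. \<psi> x > 0}"
  define S2 where "S2 = {x \<in> ball c r. \<psi> x < 0}"
  have "open (\<psi> -` {0<..} \<inter> ball c r)"
    using continuous_on_open_vimage[OF open_ball] c\<psi>b open_greaterThan by metis
  moreover have "open (\<psi> -` {..<0} \<inter> ball c r)"
    using continuous_on_open_vimage[OF open_ball] c\<psi>b open_lessThan by metis
  moreover have "\<psi> -` {0<..} \<inter> ball c r = S1" "\<psi> -` {..<0} \<inter> ball c r = S2" by (auto simp: S1_def S2_def)
  ultimately have S: "S1 \<in> sets lebesgue" "S2 \<in> sets lebesgue" by (auto intro: lebesgue_open)
  have L: "in_Lp p (ball c r) (\<lambda>x. \<gamma> *\<^sub>R H x)" for \<gamma>
    by (rule in_Lp_continuous_cball[OF p]) (intro continuous_intros continuous_on_subset[OF cH N(2)])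
  have L0: "in_Lp p (ball c r) (\<lambda>x. 0 :: 'a)"
    by (rule in_Lp_continuous_cball[OF p]) simp
  note L1 = in_Lp_indicator_diff[OF p L[of \<alpha>] L0 S(1)] and L2 = in_Lp_indicator_diff[OF p L0 L[of \<beta>] S(2)]
  have U: "UNIV \<in> sets (lebesgue :: 'a measure)" by simp
  show "in_Lp p (ball c r) h"
    by (rule in_Lp_cong[OF in_Lp_indicator_diff[OF p L1 L2 U]]) (auto simp: h_def S1_def S2_def indicator_def)
qed

text \<open>One statement for two barriers. If \<alpha> > 0, the zero set of \<open>w\<close> is a
  null sphere and \<open>A\<close> handles points of the positive phase of \<open>w\<close> with u
  \<le> 0. If \<alpha> = 0, \<open>w\<close> vanishes on the whole inside, and \<open>B\<close>
  makes a negative \<open>u\<close> there expensive.\<close>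

lemma radial_comparison:
  fixes u :: "'a::euclidean_space \<Rightarrow> real" and \<alpha> \<beta> R m p r l1 l2 :: real and y c :: 'a
  assumes p: "1 < p" and r: "r > 0" and R: "R > 0" and m: "m > 0"
    and K: "real DIM('a) < (m + 1) * (p - 1) + 1"
    and min: "minimality p l1 l2 (ball c r) u g" and cu: "continuous_on (cball c r) u"
    and yc: "y \<notin> cball c r" and \<alpha>: "\<alpha> \<ge> 0" and \<beta>: "\<beta> > 0" and l: "l1 \<ge> 0" "l2 > 0"
  defines "w \<equiv> \<lambda>x. \<alpha> * max (radial_potential R m y x) 0 - \<beta> * max (- radial_potential R m y x) 0"
  assumes bd: "\<And>x. x \<in> sphere c r \<Longrightarrow> \<forall>\<^sub>F z in nhds x. z \<in> ball c r \<longrightarrow> w z \<le> u z"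
    and A: "\<And>x. \<alpha> > 0 \<Longrightarrow> x \<in> ball c r \<Longrightarrow> dist x y < R \<Longrightarrow> l1 \<le> \<alpha> * radial_slope R m y x \<and>
      l1 powr p - l2 powr p \<le> (\<alpha> * radial_slope R m y x) powr p - (\<beta> * radial_slope R m y x) powr p"
    and B: "\<And>x. \<alpha> = 0 \<Longrightarrow> x \<in> ball c r \<Longrightarrow> dist x y \<le> R \<Longrightarrow> \<beta> * radial_slope R m y x < l2"
    and x: "x \<in> ball c r"
  shows "w x \<le> u x"
proof -
  let ?\<psi> = "radial_potential R m y" and ?\<theta> = "radial_slope R m y"
  define H where "H = (\<lambda>x. (- ?\<theta> x) *\<^sub>R sgn (x - y))"
  define h where "h = (\<lambda>x. if ?\<psi> x > 0 then \<alpha> *\<^sub>R H x else if ?\<psi> x < 0 then \<beta> *\<^sub>R H x else 0)"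
  let ?K = "(m + 1) * (p - 1)"
  define F where "F = (\<lambda>\<gamma>. radial_field (\<gamma> powr (p - 1) * R powr ?K) (?K + 1) y)"
  have N: "open (- {y})" "cball c r \<subseteq> - {y}" using yc by auto
  have p0: "0 \<le> p" using p by simp
  have ny: "x \<noteq> y" if "x \<in> ball c r" for x using that yc by auto
  have \<psi>D: "GDERIV ?\<psi> x :> H x" if "x \<in> - {y}" for x
    unfolding H_def using radial_potential_GDERIV[of x y R m] that R m by simp
  have cH: "continuous_on (- {y}) H" unfolding H_def by (rule continuous_radial_gradient[OF R])
  note tw = two_slope_function[OF N \<psi>D cH p0, of \<alpha> \<beta>, folded w_def h_def]
  have CF: "Cinf_on (F \<gamma>) (- {y})" for \<gamma> unfolding F_def by (rule Cinf_on_radial_field)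
  have \<theta>: "?\<theta> x > 0" if "x \<in> ball c r" for x by (rule radial_slope_pos[OF ny[OF that] R])
  have FE: "F \<gamma> x = norm (\<gamma> *\<^sub>R H x) powr (p - 2) *\<^sub>R (\<gamma> *\<^sub>R H x)"
    "norm (F \<gamma> x) = (\<gamma> * ?\<theta> x) powr (p - 1)" "divergence (F \<gamma>) x > 0" if "x \<in> ball c r" "\<gamma> > 0" for \<gamma> x
  proof -
    note * = radial_field_eq[OF ny[OF that(1)] R p that(2), of m]
    show "F \<gamma> x = norm (\<gamma> *\<^sub>R H x) powr (p - 2) *\<^sub>R (\<gamma> *\<^sub>R H x)" unfolding F_def H_def by (rule *(1))
    show "norm (F \<gamma> x) = (\<gamma> * ?\<theta> x) powr (p - 1)" unfolding F_def by (rule *(2))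
    have "dist x y > 0" using ny[OF that(1)] by simp
    then show "divergence (F \<gamma>) x > 0"
      unfolding F_def divergence_radial_field[OF ny[OF that(1)]] using that(2) R K by simp
  qed
  have nF: "norm (F \<beta> x) powr (p / (p - 1)) = (\<beta> * ?\<theta> x) powr p" if "x \<in> ball c r" for x
    unfolding FE(2)[OF that \<beta>] using p by (simp add: powr_powr)
  have nH: "norm (\<gamma> *\<^sub>R H x) = \<gamma> * ?\<theta> x" if "x \<in> ball c r" "\<gamma> > 0" for x \<gamma>
    using \<theta>[OF that(1)] ny[OF that(1)] that(2) by (simp add: H_def norm_sgn)
  have wpos: "?\<psi> x > 0 \<and> \<alpha> > 0" if "w x > 0" for x
  proof -
    have "\<alpha> * max (?\<psi> x) 0 > 0" using that \<beta> by (simp add: w_def) (smt (verit) mult_nonneg_nonneg)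
    then show ?thesis using \<alpha> by (auto simp: zero_less_mult_iff)
  qed
  have wneg: "?\<psi> x < 0" if "w x < 0" for x
  proof (rule ccontr)
    assume "\<not> ?\<psi> x < 0"
    then have "w x = \<alpha> * max (?\<psi> x) 0" by (simp add: w_def max_def)
    then show False using that \<alpha> by (simp add: mult_less_0_iff)
  qed
  have wz: "?\<psi> x = 0 \<or> (\<alpha> = 0 \<and> ?\<psi> x \<ge> 0)" if "w x = 0" for x
    using that \<alpha> \<beta> by (cases "?\<psi> x" "0::real" rule: linorder_cases) (auto simp: w_def max_def)
  note sgn = radial_potential_sign[OF ny R m]
  show ?thesis
  proof (rule comparison_principle[OF p r min cu tw bd CF N(2) CF N(2), of \<alpha> \<beta> "sphere y R"])
    show "negligible (sphere y R)" by (rule negligible_sphere)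
    fix x assume x: "x \<in> ball c r"
    show "h x = 0" if "w x = 0"
      using wz[OF that] by (auto simp: h_def)
    show "F \<alpha> x = norm (h x) powr (p - 2) *\<^sub>R h x \<and> divergence (F \<alpha>) x > 0" if "w x > 0"
      using wpos[OF that] FE[OF x, of \<alpha>] by (simp add: h_def)
    show "F \<beta> x = norm (h x) powr (p - 2) *\<^sub>R h x \<and> divergence (F \<beta>) x > 0" if "w x < 0"
      using wneg[OF that] FE[OF x \<beta>] by (simp add: h_def)
    have hp: "norm (h x) = \<alpha> * ?\<theta> x" "\<alpha> > 0" "dist x y < R" if "w x > 0"
      using wpos[OF that] nH[OF x, of \<alpha>] sgn(1)[OF x] by (auto simp: h_def)
    show "l1 powr p \<le> norm (h x) powr p" if "w x > 0"
      unfolding hp(1)[OF that] using A[OF hp(2)[OF that] x hp(3)[OF that]] p l by (intro powr_mono2) auto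
    show "p * divergence (F \<beta>) x * (- u x)
      + (p - 1) * (norm (h x) powr p - l1 powr p + l2 powr p - norm (F \<beta> x) powr (p / (p - 1))) \<ge> 0"
      if "w x > 0" "u x < 0"
    proof -
      have "(p - 1) * (norm (h x) powr p - l1 powr p + l2 powr p - norm (F \<beta> x) powr (p / (p - 1))) \<ge> 0"
        unfolding nF[OF x] hp(1)[OF that(1)] using A[OF hp(2)[OF that(1)] x hp(3)[OF that(1)]] p
        by (intro mult_nonneg_nonneg) auto
      moreover have "p * divergence (F \<beta>) x * (- u x) \<ge> 0"
        using FE(3)[OF x \<beta>] that(2) p by (intro mult_nonneg_nonneg) auto
      ultimately show ?thesis by linarith
    qed
  next
    \<comment> \<open>Away from the sphere, w x = 0 is possible only for the barrier with \<alpha> =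
      0, at points inside the sphere.\<close>
    fix x assume x: "x \<in> ball c r - sphere y R" and w0: "w x = 0" and ux: "u x < 0"
    have xb: "x \<in> ball c r" using x by simp
    have "?\<psi> x \<noteq> 0" using sgn(3)[OF xb] x by (auto simp: dist_commute)
    then have \<alpha>0: "\<alpha> = 0" and "?\<psi> x > 0" using wz[OF w0] by auto
    then have "\<beta> * ?\<theta> x < l2" using B[OF \<alpha>0 xb] sgn(1)[OF xb] by simp
    then have "(\<beta> * ?\<theta> x) powr p < l2 powr p"
      using p \<beta> \<theta>[OF xb] by (intro powr_less_mono2) auto
    then have "(p - 1) * (l2 powr p - norm (F \<beta> x) powr (p / (p - 1))) > 0"
      unfolding nF[OF xb] using p by simp
    moreover have "p * divergence (F \<beta>) x * (- u x) \<ge> 0"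
      using FE(3)[OF xb \<beta>] ux p by (intro mult_nonneg_nonneg) auto
    ultimately show "p * divergence (F \<beta>) x * (- u x) + (p - 1) * (l2 powr p - norm (F \<beta> x) powr (p / (p - 1))) > 0"
      by linarith
  qed (use x in auto)
qed

section \<open>Comparing the barrier with linear bounds on a small sphere\<close>

lemma eventually_le_of_less:
  fixes u w :: "'a::metric_space \<Rightarrow> real"
  assumes "continuous_on S u" "continuous_on S w" "x \<in> S" "w x < u x" "T \<subseteq> S"
  shows "\<forall>\<^sub>F z in nhds x. z \<in> T \<longrightarrow> w z \<le> u z"
proof -
  have "continuous_on S (\<lambda>z. u z - w z)" using assms by (intro continuous_intros)
  then have "((\<lambda>z. u z - w z) \<longlongrightarrow> u x - w x) (at x within S)" using assms(3) by (simp add: continuous_on_def)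
  then have "\<forall>\<^sub>F z in at x within S. 0 < u z - w z" by (rule order_tendstoD(1)) (use assms(4) in simp)
  then have "\<forall>\<^sub>F z in nhds x. z \<noteq> x \<longrightarrow> z \<in> S \<longrightarrow> 0 < u z - w z" by (simp add: eventually_at_filter)
  then show ?thesis by eventually_elim (use assms(4,5) in fastforce)
qed

text \<open>The barrier centre lies at distance \<open>M r - r / (16 M)\<close> from \<open>x0\<close> in direction \<open>e\<close>, so that the zero
  sphere of radius \<open>M r\<close> passes slightly below \<open>x0\<close> but, by its curvature, above the points of
  \<open>sphere x0 r\<close> near the equator.\<close>

lemma barrier_geometry:
  fixes x0 e :: "'a::euclidean_space" and M r :: real
  assumes e: "norm e = 1" and r: "r > 0" and M: "M \<ge> 4"
  defines "\<eta> \<equiv> r / (16 * M)"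
  defines "y \<equiv> x0 + (M * r - \<eta>) *\<^sub>R e"
  shows "y \<notin> cball x0 r" "dist x0 y < M * r" "\<eta> > 0" "\<eta> \<le> r / 8"
    "x \<in> cball x0 r \<Longrightarrow> (M - 2) * r \<le> dist x y \<and> dist x y \<le> (M + 2) * r"
    "x \<in> sphere x0 r \<Longrightarrow> M * r - dist x y \<le> (x - x0) \<bullet> e + \<eta>"
    "x \<in> sphere x0 r \<Longrightarrow> \<bar>(x - x0) \<bullet> e\<bar> \<le> r / 2 \<Longrightarrow> M * r - dist x y \<le> (x - x0) \<bullet> e - 2 * \<eta>"
proof -
  show \<eta>: "\<eta> > 0" using r M by (simp add: \<eta>_def)
  have "16 * M \<ge> 8" using M by simp
  then show \<eta>8: "\<eta> \<le> r / 8" unfolding \<eta>_def using r by (intro divide_left_mono) auto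
  have Mr: "M * r \<ge> 4 * r" using M r by (intro mult_right_mono) auto
  have L: "M * r - \<eta> > 0" using Mr \<eta>8 r by linarith
  have d0: "dist x0 y = M * r - \<eta>" using L e by (simp add: y_def dist_norm)
  show "dist x0 y < M * r" unfolding d0 using \<eta> by simp
  have "r < dist x0 y" unfolding d0 using Mr \<eta>8 r by linarith
  then show "y \<notin> cball x0 r" by simp
  show "(M - 2) * r \<le> dist x y \<and> dist x y \<le> (M + 2) * r" if "x \<in> cball x0 r"
  proof -
    have "dist x0 y \<le> dist x0 x + dist x y" "dist x y \<le> dist x x0 + dist x0 y" by (rule dist_triangle)+
    then show ?thesis using that d0 \<eta> \<eta>8 r by (auto simp: dist_commute algebra_simps)
  qed
  define t where "t = (x - x0) \<bullet> e"
  \<comment> \<open>The gain in \<open>dist x y\<close> through curvature. Since dist^2 = (M r -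
    \<eta> - t)^2 + (r^2 - t^2), it is about (r^2 - t^2) / (2 M r); only half of this is claimed,
    and that leaves room for the error made in squaring.\<close>
  define q where "q = (r\<^sup>2 - t\<^sup>2) / (4 * (M * r))"
  have main: "M * r - dist x y \<le> t + \<eta> - q \<and> 0 \<le> q" if xs: "x \<in> sphere x0 r"
  proof -
    have xn: "norm (x - x0) = r" using xs by (simp add: dist_norm norm_minus_commute)
    have tr: "\<bar>t\<bar> \<le> r" unfolding t_def using Cauchy_Schwarz_ineq2[of "x - x0" e] xn e by simp
    then have t2: "t\<^sup>2 \<le> r\<^sup>2" using abs_le_square_iff[of t r] r by simp
    then have q0: "0 \<le> q" using r M by (simp add: q_def)
    have "r * r \<le> (M * r) * r" using Mr r by (intro mult_right_mono) linarith+
    then have "r\<^sup>2 - t\<^sup>2 \<le> (M * r) * r" using zero_le_power2[of t] unfolding power2_eq_square[of r] by linarith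
    also have "\<dots> \<le> (M * r) * (4 * (M * r))" using Mr r by (intro mult_left_mono) auto
    finally have q1: "q \<le> M * r" using r M by (simp add: q_def divide_le_eq)
    have qe: "4 * (M * r) * q = r\<^sup>2 - t\<^sup>2" using r M by (simp add: q_def)
    have d2: "(dist x y)\<^sup>2 = (M * r - \<eta> - t)\<^sup>2 + (r\<^sup>2 - t\<^sup>2)"
    proof -
      have "(dist x y)\<^sup>2 = ((x - x0) - (M * r - \<eta>) *\<^sub>R e) \<bullet> ((x - x0) - (M * r - \<eta>) *\<^sub>R e)"
        by (simp add: dist_norm power2_norm_eq_inner y_def algebra_simps)
      also have "\<dots> = (x - x0) \<bullet> (x - x0) - 2 * (M * r - \<eta>) * t + (M * r - \<eta>)\<^sup>2 * (e \<bullet> e)"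
        unfolding t_def by (simp add: inner_diff_left inner_diff_right inner_commute power2_eq_square algebra_simps)
      also have "(x - x0) \<bullet> (x - x0) = r\<^sup>2" using xn by (simp add: power2_norm_eq_inner[symmetric])
      also have "e \<bullet> e = 1" using e by (simp add: norm_eq_1)
      finally show ?thesis by (simp add: power2_eq_square algebra_simps)
    qed
    have "(M * r - \<eta> - t + q)\<^sup>2 = (M * r - \<eta> - t)\<^sup>2 + q * (2 * (M * r - \<eta> - t) + q)"
      by (simp add: power2_eq_square algebra_simps)
    also have "q * (2 * (M * r - \<eta> - t) + q) \<le> q * (4 * (M * r))"
    proof (rule mult_left_mono[OF _ q0])
      have "- t \<le> r" using tr by linarith
      have "2 * (P - \<eta> - t) + q \<le> 4 * P" if "q \<le> P" "4 * r \<le> P" for P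
        using that \<open>- t \<le> r\<close> \<eta> r by simp
      then show "2 * (M * r - \<eta> - t) + q \<le> 4 * (M * r)" using q1 Mr by blast
    qed
    also have "q * (4 * (M * r)) = r\<^sup>2 - t\<^sup>2" using qe by (simp add: mult.commute)
    finally have "(M * r - \<eta> - t + q)\<^sup>2 \<le> (dist x y)\<^sup>2" unfolding d2 by simp
    then have "M * r - \<eta> - t + q \<le> dist x y" by (rule power2_le_imp_le) simp
    then show ?thesis using q0 by simp
  qed
  show "M * r - dist x y \<le> (x - x0) \<bullet> e + \<eta>" if "x \<in> sphere x0 r"
    using main[OF that] unfolding t_def by linarith
  show "M * r - dist x y \<le> (x - x0) \<bullet> e - 2 * \<eta>" if "x \<in> sphere x0 r" "\<bar>(x - x0) \<bullet> e\<bar> \<le> r / 2"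
  proof -
    have "t\<^sup>2 \<le> (r / 2)\<^sup>2" using that(2) r abs_le_square_iff[of t "r / 2"] unfolding t_def by simp
    then have "3 / 4 * r\<^sup>2 \<le> r\<^sup>2 - t\<^sup>2" by (simp add: power2_eq_square)
    then have "3 / 4 * r\<^sup>2 / (4 * (M * r)) \<le> q" unfolding q_def using r M by (intro divide_right_mono) auto
    \<comment> \<open>This identity explains the 16 in \<eta>: near the equator the curvature lowers
      the signed distance by 3 \<eta>, the shift of the centre raises it by \<eta>, and 2 \<eta>
      remain.\<close>
    moreover have "3 / 4 * r\<^sup>2 / (4 * (M * r)) = 3 * \<eta>" using r M by (simp add: \<eta>_def power2_eq_square field_simps)
    ultimately show ?thesis using main[OF that(1)] unfolding t_def by linarith
  qed
qed

text \<open>Over the ball the ratio of R = M r to the distance from y lies between M / (M + 2) and M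
  / (M - 2). A zero sphere that is large compared with the ball thus keeps the slope within a factor
  \<tau> of 1.\<close>

lemma slope_scale_exists:
  fixes \<tau> m :: real
  assumes "\<tau> > 1" "m > 0"
  obtains M0 where "M0 \<ge> 4" "\<And>M. M \<ge> M0 \<Longrightarrow> (M / (M - 2)) powr (m + 1) \<le> \<tau>"
proof -
  define \<kappa> where "\<kappa> = \<tau> powr (1 / (m + 1))"
  have \<kappa>: "\<kappa> > 1" using assms by (simp add: \<kappa>_def)
  have \<kappa>m: "\<kappa> powr (m + 1) = \<tau>" using assms by (simp add: \<kappa>_def powr_powr)
  have "(M / (M - 2)) powr (m + 1) \<le> \<tau>" if M: "M \<ge> max 4 (2 * \<kappa> / (\<kappa> - 1))" for M
  proof -
    have "2 * \<kappa> \<le> M * (\<kappa> - 1)" using M \<kappa> by (simp add: divide_le_eq)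
    then have "M / (M - 2) \<le> \<kappa>" using M by (simp add: divide_le_eq algebra_simps)
    then have "(M / (M - 2)) powr (m + 1) \<le> \<kappa> powr (m + 1)"
      using M assms by (intro powr_mono2) auto
    then show ?thesis by (simp add: \<kappa>m)
  qed
  then show ?thesis by (intro that[of "max 4 (2 * \<kappa> / (\<kappa> - 1))"]) auto
qed

lemma radial_slope_bounds:
  assumes M: "M \<ge> 4" and r: "r > 0" and m: "m > 0" and \<tau>: "(M / (M - 2)) powr (m + 1) \<le> \<tau>" "\<tau> > 1"
    and d: "(M - 2) * r \<le> dist x y" "dist x y \<le> (M + 2) * r"
  shows "radial_slope (M * r) m y x \<le> \<tau>" "1 / \<tau> \<le> radial_slope (M * r) m y x"
proof -
  have pos: "(M - 2) * r > 0" "(M + 2) * r > 0" using M r by auto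
  have \<rho>: "dist x y > 0" using d pos by linarith
  have "M * r / dist x y \<le> M * r / ((M - 2) * r)" using d pos M r \<rho> by (intro divide_left_mono) auto
  also have "\<dots> = M / (M - 2)" using r by simp
  finally have "radial_slope (M * r) m y x \<le> (M / (M - 2)) powr (m + 1)"
    unfolding radial_slope_def using M r m \<rho> by (intro powr_mono2) auto
  then show "radial_slope (M * r) m y x \<le> \<tau>" using \<tau> by linarith
  \<comment> \<open>Since (M - 2)(M + 2) \<le> M^2, the estimate for the nearest distance also
    controls the farthest one, and one threshold for M serves both bounds.\<close>
  have "(M - 2) / M \<le> M / (M + 2)" using M by (simp add: field_simps)
  also have "\<dots> = M * r / ((M + 2) * r)" using r by simp
  also have "\<dots> \<le> M * r / dist x y" using d pos M r \<rho> by (intro divide_left_mono) auto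
  finally have "((M - 2) / M) powr (m + 1) \<le> radial_slope (M * r) m y x"
    unfolding radial_slope_def using M m by (intro powr_mono2) auto
  moreover have "((M - 2) / M) powr (m + 1) = 1 / (M / (M - 2)) powr (m + 1)"
    using M by (simp add: powr_divide)
  moreover have "1 / \<tau> \<le> 1 / (M / (M - 2)) powr (m + 1)"
    using \<tau> M by (intro divide_left_mono) auto
  ultimately show "1 / \<tau> \<le> radial_slope (M * r) m y x" by linarith
qed

text \<open>Compares the potential with slope times signed distance R - dist. Where the latter is
  negative, an upper bound needs the smallest slope, so \<beta> is divided by \<tau> while \<alpha>
  is multiplied by it.\<close>

lemma two_slope_bound:
  assumes "x \<noteq> y" "R > 0" "m > 0" "radial_slope R m y x \<le> \<tau>" "1 / \<tau> \<le> radial_slope R m y x" "\<tau> > 1" "\<alpha> \<ge> 0" "\<beta> \<ge> 0"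
  shows "\<alpha> * max (radial_potential R m y x) 0 - \<beta> * max (- radial_potential R m y x) 0
    \<le> (if R - dist x y \<ge> 0 then \<alpha> * \<tau> * (R - dist x y) else \<beta> / \<tau> * (R - dist x y))"
proof (cases "R - dist x y \<ge> 0")
  case True
  then have "radial_potential R m y x \<ge> 0" using radial_potential_sign(2)[OF assms(1-3)] by linarith
  then have "\<alpha> * max (radial_potential R m y x) 0 - \<beta> * max (- radial_potential R m y x) 0 = \<alpha> * radial_potential R m y x"
    by simp
  also have "\<dots> \<le> \<alpha> * (\<tau> * (R - dist x y))"
  proof (intro mult_left_mono)
    have "radial_slope R m y x * (R - dist x y) \<le> \<tau> * (R - dist x y)" using assms(4) True by (rule mult_right_mono)
    then show "radial_potential R m y x \<le> \<tau> * (R - dist x y)" using radial_potential_le[OF assms(1-3)] by linarith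
  qed (use assms in auto)
  finally show ?thesis using True by (simp add: mult.assoc)
next
  case False
  then have "radial_potential R m y x < 0" using radial_potential_sign(2)[OF assms(1-3)] by linarith
  then have "\<alpha> * max (radial_potential R m y x) 0 - \<beta> * max (- radial_potential R m y x) 0 = \<beta> * radial_potential R m y x"
    by simp
  also have "\<dots> \<le> \<beta> * (1 / \<tau> * (R - dist x y))"
  proof (intro mult_left_mono)
    have "radial_slope R m y x * (R - dist x y) \<le> 1 / \<tau> * (R - dist x y)"
      using assms(5) False by (intro mult_right_mono_neg) auto
    then show "radial_potential R m y x \<le> 1 / \<tau> * (R - dist x y)" using radial_potential_le[OF assms(1-3)] by linarith
  qed (use assms in auto)
  finally show ?thesis using False by simp
qed

text \<open>Here t is the height of a boundary point and s its signed distance to the zero sphere;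
  A, B are the slopes of the lower bound for \<open>u\<close>, A1, B1 those of the barrier, E the
  error. For |t| \<le> r / 2 the drop 2 \<eta> beats E. Otherwise the slope gap \<sigma> acts over a
  height of at least r / 2 and beats shift and error. If s < 0 \<le> t, either s \<le> - \<eta> or A
  * t alone exceeds E.\<close>

lemma boundary_slopes:
  fixes A A1 B B1 s t r \<eta> E \<sigma> :: real
  assumes A: "0 < A1" "\<sigma> \<le> A - A1" and B: "0 < B" "\<sigma> \<le> B1 - B" and \<sigma>: "\<sigma> > 0" and r: "r > 0" "\<eta> > 0" "\<eta> \<le> r / 8"
    and \<eta>: "A1 * \<eta> \<le> \<sigma> * r / 4" "B1 * \<eta> \<le> \<sigma> * r / 4"
    and E: "E < A1 * \<eta>" "E < B1 * \<eta>" "E \<le> \<sigma> * r / 8" "0 < E"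
    and s: "s \<le> t + \<eta>" "\<bar>t\<bar> \<le> r / 2 \<Longrightarrow> s \<le> t - 2 * \<eta>"
  shows "(if s \<ge> 0 then A1 * s else B1 * s) < A * max t 0 - B * max (- t) 0 - E"
proof -
  have B1: "B1 > 0" and A0: "A > 0" using A B \<sigma> by auto
  have neg: "B1 * s < B * t - E" if "t < 0" "s < 0"
  proof (cases "\<bar>t\<bar> \<le> r / 2")
    case True
    have "B1 * s \<le> B1 * (t - 2 * \<eta>)" using s(2)[OF True] B1 by (intro mult_left_mono) auto
    also have "\<dots> = B1 * t - 2 * (B1 * \<eta>)" by (simp add: algebra_simps)
    also have "B1 * t \<le> B * t" using that B \<sigma> by (intro mult_right_mono_neg) auto
    finally show ?thesis using E by linarith
  next
    case False
    then have t: "t \<le> - (r / 2)" using that by linarith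
    have "B1 * s \<le> B1 * (t + \<eta>)" using s(1) B1 by (intro mult_left_mono) auto
    also have "\<dots> = B * t + (B1 - B) * t + B1 * \<eta>" by (simp add: algebra_simps)
    also have "(B1 - B) * t \<le> (B1 - B) * (- (r / 2))" using t B \<sigma> by (intro mult_left_mono) auto
    also have "(B1 - B) * (- (r / 2)) \<le> \<sigma> * (- (r / 2))" using B r by (intro mult_right_mono_neg) auto
    finally have "B1 * s \<le> B * t + \<sigma> * (- (r / 2)) + B1 * \<eta>" by simp
    moreover have "\<sigma> * r > 0" using \<sigma> r by simp
    ultimately show ?thesis using \<eta>(2) E(3) by simp
  qed
  show ?thesis
  proof (cases "t < 0")
    case True
    have "s < 0"
    proof (cases "\<bar>t\<bar> \<le> r / 2")
      case True
      then show ?thesis using s(2) r \<open>t < 0\<close> by linarith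
    qed (use s(1) r True in linarith)
    then show ?thesis using neg True by simp
  next
    case t: False
    show ?thesis
    proof (cases "s \<ge> 0")
      case True
      show ?thesis
      proof (cases "\<bar>t\<bar> \<le> r / 2")
        case tr: True
        have "A1 * s \<le> A1 * (t - 2 * \<eta>)" using s(2)[OF tr] A by (intro mult_left_mono) auto
        also have "\<dots> = A1 * t - 2 * (A1 * \<eta>)" by (simp add: algebra_simps)
        also have "A1 * t \<le> A * t" using t A \<sigma> by (intro mult_right_mono) auto
        finally show ?thesis using E True t by simp
      next
        case False
        then have tr: "r / 2 \<le> t" using t by linarith
        have "A1 * s \<le> A1 * (t + \<eta>)" using s(1) A by (intro mult_left_mono) auto
        also have "\<dots> = A * t - (A - A1) * t + A1 * \<eta>" by (simp add: algebra_simps)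
        finally have 1: "A1 * s \<le> A * t - (A - A1) * t + A1 * \<eta>" .
        have "\<sigma> * (r / 2) \<le> (A - A1) * t" using tr A r \<sigma> by (intro mult_mono) auto
        moreover have "\<sigma> * r > 0" using \<sigma> r by simp
        ultimately show ?thesis using 1 \<eta>(1) E(3) True t by simp
      qed
    next
      case False
      have "B1 * s < A * t - E"
      proof (cases "t < \<eta>")
        case True
        have "\<bar>t\<bar> \<le> r / 2" using True t r by linarith
        then have "s \<le> - \<eta>" using s(2) True by linarith
        then have "B1 * s \<le> B1 * (- \<eta>)" using B1 by (intro mult_left_mono) auto
        moreover have "A * t \<ge> 0" using A0 t by simp
        ultimately show ?thesis using E(2) by simp
      next
        case te: False
        have "B1 * s < 0" using False B1 by (simp add: mult_pos_neg)
        moreover have "A1 * \<eta> \<le> A * t" using te A \<sigma> r by (intro mult_mono) auto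
        ultimately show ?thesis using E(1) by linarith
      qed
      then show ?thesis using False t by simp
    qed
  qed
qed

section \<open>Excluded linear bounds\<close>

definition locally_minimal :: "real \<Rightarrow> real \<Rightarrow> real \<Rightarrow> 'a::euclidean_space set \<Rightarrow> ('a \<Rightarrow> real) \<Rightarrow> bool" where
  "locally_minimal p l1 l2 D u \<longleftrightarrow> open D \<and> continuous_on D u \<and>
    (\<forall>c r. r > 0 \<longrightarrow> cball c r \<subseteq> D \<longrightarrow> (\<exists>g. minimality p l1 l2 (ball c r) u g))"

lemma eventually_nhds_cball:
  fixes x0 :: "'a::euclidean_space"
  assumes "\<forall>\<^sub>F x in nhds x0. P x" "open D" "x0 \<in> D"
  obtains r where "r > 0" "cball x0 r \<subseteq> D" "\<And>x. x \<in> cball x0 r \<Longrightarrow> P x"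
proof -
  obtain d where d: "d > 0" "\<And>x. dist x x0 < d \<Longrightarrow> P x"
    using assms(1) unfolding eventually_nhds_metric by blast
  obtain d' where d': "d' > 0" "cball x0 d' \<subseteq> D" using assms(2,3) open_contains_cball by blast
  show ?thesis
    by (rule that[of "min (d / 2) d'"]) (use d d' in \<open>auto simp: dist_commute\<close>)
qed

lemma half_min_bounds:
  fixes a b :: real
  assumes "0 < a" "0 < b"
  shows "0 < min a b / 2" "min a b / 2 < a" "min a b / 2 \<le> b"
  using assms by (auto simp: min_def)

text \<open>A barrier with slopes slightly below A and slightly above B still meets the calibration
  conditions and lies below \<open>u\<close> on a small sphere, hence also inside. But its zero
  sphere leaves \<open>x0\<close> on the positive side, against u x0 = 0.\<close>

lemma steep_bound_excluded:
  fixes u :: "'a::euclidean_space \<Rightarrow> real" and e x0 :: 'a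
  assumes p: "1 < p" and l: "l1 > 0" "l2 > 0" and lm: "locally_minimal p l1 l2 D u"
    and x0: "x0 \<in> D" "u x0 = 0" and e: "norm e = 1"
    and A: "l1 < A" and B: "0 < B" and AB: "l1 powr p - l2 powr p < A powr p - B powr p"
    and low: "\<And>\<epsilon>. \<epsilon> > 0 \<Longrightarrow> \<forall>\<^sub>F x in nhds x0.
       A * max ((x - x0) \<bullet> e) 0 - B * max (- ((x - x0) \<bullet> e)) 0 - \<epsilon> * dist x x0 \<le> u x"
  shows False
proof -
  have A0: "A > 0" using A l by linarith
  \<comment> \<open>Both inequalities for the slopes are strict, so they survive a factor \<tau>
    slightly above 1, of which four powers are spent.\<close>
  have "((\<lambda>\<tau>. A / \<tau> ^ 4) \<longlongrightarrow> A / 1 ^ 4) (at_right (1::real))" by (intro tendsto_intros) auto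
  then have e1: "\<forall>\<^sub>F \<tau> in at_right 1. l1 < A / \<tau> ^ 4" by (rule order_tendstoD(1)) (use A in simp)
  have "((\<lambda>\<tau>. (A / \<tau> ^ 4) powr p - (B * \<tau> ^ 4) powr p) \<longlongrightarrow> (A / 1 ^ 4) powr p - (B * 1 ^ 4) powr p) (at_right (1::real))"
    by (intro tendsto_intros) (use A0 B in auto)
  then have e2: "\<forall>\<^sub>F \<tau> in at_right 1. l1 powr p - l2 powr p < (A / \<tau> ^ 4) powr p - (B * \<tau> ^ 4) powr p"
    by (rule order_tendstoD(1)) (use AB in simp)
  have "\<forall>\<^sub>F \<tau> in at_right (1::real). 1 < \<tau>" by (rule eventually_at_right_less)
  with e1 e2 have "\<forall>\<^sub>F \<tau> in at_right 1. 1 < \<tau> \<and> l1 < A / \<tau> ^ 4 \<and>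
      l1 powr p - l2 powr p < (A / \<tau> ^ 4) powr p - (B * \<tau> ^ 4) powr p"
    by eventually_elim auto
  then obtain \<tau> where \<tau>: "1 < \<tau>" "l1 < A / \<tau> ^ 4"
    "l1 powr p - l2 powr p < (A / \<tau> ^ 4) powr p - (B * \<tau> ^ 4) powr p"
    using eventually_happens'[OF trivial_limit_at_right_real] by blast
  \<comment> \<open>One power of \<tau> on either side absorbs the variation of the slope: \<alpha>
    * \<tau> = A1 is still below A, as the boundary comparison requires, and \<alpha> / \<tau> = A /
    \<tau>^4 still satisfies the strict inequalities inside. For \<beta> the roles of product and
    quotient are exchanged.\<close>
  define \<alpha> where "\<alpha> = A / \<tau> ^ 3"
  define \<beta> where "\<beta> = B * \<tau> ^ 3"
  define A1 where "A1 = A / \<tau>\<^sup>2"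
  define B1 where "B1 = B * \<tau>\<^sup>2"
  have t2: "\<tau>\<^sup>2 > 1" using \<tau>(1) by simp
  have \<alpha>\<beta>: "\<alpha> > 0" "\<beta> > 0" "\<alpha> * \<tau> = A1" "\<beta> / \<tau> = B1" "\<alpha> / \<tau> = A / \<tau> ^ 4" "\<beta> * \<tau> = B * \<tau> ^ 4"
    using A0 B \<tau>(1) by (auto simp: \<alpha>_def \<beta>_def A1_def B1_def power2_eq_square power3_eq_cube power4_eq_xxxx)
  have A1: "0 < A1" "A1 < A" using A0 t2 \<tau>(1) by (auto simp: A1_def divide_less_eq)
  have B1: "B < B1" using B t2 by (auto simp: B1_def)
  define \<sigma> where "\<sigma> = min (A - A1) (B1 - B)"
  have \<sigma>: "\<sigma> > 0" "\<sigma> \<le> A - A1" "\<sigma> \<le> B1 - B" using A1 B1 by (auto simp: \<sigma>_def)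
  \<comment> \<open>Makes the exponent (m + 1)(p - 1) + 1 equal to DIM + p, above the
    divergence-free value DIM.\<close>
  define m where "m = real DIM('a) / (p - 1)"
  have m: "m > 0" using p by (simp add: m_def)
  have K: "real DIM('a) < (m + 1) * (p - 1) + 1"
  proof -
    have "(m + 1) * (p - 1) = real DIM('a) + (p - 1)" using p by (simp add: m_def field_simps)
    then show ?thesis using p by linarith
  qed
  obtain M0 where M0: "M0 \<ge> 4" "\<And>M. M \<ge> M0 \<Longrightarrow> (M / (M - 2)) powr (m + 1) \<le> \<tau>"
    using slope_scale_exists[OF \<tau>(1) m] by blast
  \<comment> \<open>Besides controlling the slope, M must keep the loss A1 * \<eta> = A1 * r / (16
    M) caused by the shift within \<sigma> * r / 4, and likewise for B1.\<close>
  define M where "M = max M0 (max (A1 / (4 * \<sigma>)) (B1 / (4 * \<sigma>)))"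
  have M: "M \<ge> 4" "(M / (M - 2)) powr (m + 1) \<le> \<tau>" using M0 by (auto simp: M_def)
  have MAB: "A1 \<le> M * (4 * \<sigma>)" "B1 \<le> M * (4 * \<sigma>)"
  proof -
    have "A1 / (4 * \<sigma>) \<le> M" "B1 / (4 * \<sigma>) \<le> M" by (auto simp: M_def)
    then show "A1 \<le> M * (4 * \<sigma>)" "B1 \<le> M * (4 * \<sigma>)" using \<sigma> by (auto simp: divide_le_eq)
  qed
  \<comment> \<open>Chosen before the radius: all quantities entering \<open>boundary_slopes\<close>
    are proportional to r, so r only has to make the error of the expansion at most \<epsilon> *
    r.\<close>
  define \<epsilon> where "\<epsilon> = min (min A1 B1 / (16 * M)) (\<sigma> / 8) / 2"
  have \<epsilon>: "\<epsilon> > 0" "\<epsilon> < A1 / (16 * M)" "\<epsilon> < B1 / (16 * M)" "\<epsilon> \<le> \<sigma> / 8"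
  proof -
    have "min A1 B1 / (16 * M) > 0" using A1 B1 B M by auto
    moreover have "min A1 B1 / (16 * M) \<le> A1 / (16 * M)" "min A1 B1 / (16 * M) \<le> B1 / (16 * M)"
      using M by (auto intro!: divide_right_mono)
    ultimately show "\<epsilon> > 0" "\<epsilon> < A1 / (16 * M)" "\<epsilon> < B1 / (16 * M)" "\<epsilon> \<le> \<sigma> / 8"
      using half_min_bounds[of "min A1 B1 / (16 * M)" "\<sigma> / 8"] \<sigma>(1) unfolding \<epsilon>_def by auto
  qed
  have D: "open D" "continuous_on D u" using lm by (auto simp: locally_minimal_def)
  obtain r where r: "r > 0" "cball x0 r \<subseteq> D" and ulow: "\<And>x. x \<in> cball x0 r \<Longrightarrow>
      A * max ((x - x0) \<bullet> e) 0 - B * max (- ((x - x0) \<bullet> e)) 0 - \<epsilon> * dist x x0 \<le> u x"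
    using eventually_nhds_cball[OF low[OF \<epsilon>(1)] D(1) x0(1)] by blast
  obtain g where min: "minimality p l1 l2 (ball x0 r) u g" using lm r unfolding locally_minimal_def by blast
  have cu: "continuous_on (cball x0 r) u" using D(2) r(2) continuous_on_subset by blast
  define \<eta> where "\<eta> = r / (16 * M)"
  define y where "y = x0 + (M * r - \<eta>) *\<^sub>R e"
  have geo: "y \<notin> cball x0 r" "dist x0 y < M * r" "\<eta> > 0" "\<eta> \<le> r / 8"
    unfolding y_def \<eta>_def by (rule barrier_geometry[OF e r(1) M(1)])+
  have geo5: "(M - 2) * r \<le> dist x y \<and> dist x y \<le> (M + 2) * r" if "x \<in> cball x0 r" for x
    unfolding y_def \<eta>_def by (rule barrier_geometry(5)[OF e r(1) M(1) that])
  have geo6: "M * r - dist x y \<le> (x - x0) \<bullet> e + \<eta>" if "x \<in> sphere x0 r" for x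
    unfolding y_def \<eta>_def by (rule barrier_geometry(6)[OF e r(1) M(1) that])
  have geo7: "M * r - dist x y \<le> (x - x0) \<bullet> e - 2 * \<eta>" if "x \<in> sphere x0 r" "\<bar>(x - x0) \<bullet> e\<bar> \<le> r / 2" for x
    unfolding y_def \<eta>_def by (rule barrier_geometry(7)[OF e r(1) M(1) that])
  have R: "M * r > 0" using M r by simp
  let ?w = "\<lambda>x. \<alpha> * max (radial_potential (M * r) m y x) 0 - \<beta> * max (- radial_potential (M * r) m y x) 0"
  have ny: "x \<noteq> y" if "x \<in> cball x0 r" for x using geo(1) that by blast
  note sl = radial_slope_bounds[OF M(1) r(1) m M(2) \<tau>(1)]
  have slo: "radial_slope (M * r) m y x \<le> \<tau>" "1 / \<tau> \<le> radial_slope (M * r) m y x" if "x \<in> cball x0 r" for x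
    using sl[of x y] geo5[OF that] by auto
  have bd: "?w x < u x" if xs: "x \<in> sphere x0 r" for x
  proof -
    let ?t = "(x - x0) \<bullet> e"
    have xc: "x \<in> cball x0 r" using xs by auto
    have "?w x \<le> (if M * r - dist x y \<ge> 0 then \<alpha> * \<tau> * (M * r - dist x y) else \<beta> / \<tau> * (M * r - dist x y))"
      by (rule two_slope_bound[OF ny[OF xc] R m slo[OF xc] \<tau>(1)]) (use \<alpha>\<beta> in auto)
    also have "\<dots> = (if M * r - dist x y \<ge> 0 then A1 * (M * r - dist x y) else B1 * (M * r - dist x y))"
      unfolding \<alpha>\<beta>(3,4) ..
    also have "\<dots> < A * max ?t 0 - B * max (- ?t) 0 - \<epsilon> * r"
    proof (rule boundary_slopes[OF A1(1) \<sigma>(2) B \<sigma>(3,1) r(1) geo(3,4)])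
      show "A1 * \<eta> \<le> \<sigma> * r / 4" "B1 * \<eta> \<le> \<sigma> * r / 4"
        using MAB M r by (auto simp: \<eta>_def divide_simps mult_ac)
      show "\<epsilon> * r < A1 * \<eta>" "\<epsilon> * r < B1 * \<eta>"
        using mult_strict_right_mono[OF \<epsilon>(2) r(1)] mult_strict_right_mono[OF \<epsilon>(3) r(1)] by (auto simp: \<eta>_def)
      show "\<epsilon> * r \<le> \<sigma> * r / 8" using mult_right_mono[OF \<epsilon>(4), of r] r by simp
      show "0 < \<epsilon> * r" using \<epsilon> r by simp
    qed (use geo6[OF xs] geo7[OF xs] in auto)
    also have "\<dots> \<le> u x" using ulow[OF xc] xs by (simp add: dist_commute)
    finally show ?thesis .
  qed
  have cw: "continuous_on (cball x0 r) ?w"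
  proof -
    have "continuous_on (cball x0 r) (radial_potential (M * r) m y)"
      by (rule continuous_on_GDERIV[where G = "\<lambda>x. (- radial_slope (M * r) m y x) *\<^sub>R sgn (x - y)"])
        (use radial_potential_GDERIV ny R m in blast)
    then show ?thesis by (intro continuous_intros)
  qed
  have "?w x0 \<le> u x0"
  proof (rule radial_comparison[OF p r(1) R m K min cu geo(1)])
    show "\<forall>\<^sub>F z in nhds x. z \<in> ball x0 r \<longrightarrow> ?w z \<le> u z" if "x \<in> sphere x0 r" for x
      by (rule eventually_le_of_less[OF cu cw _ bd[OF that]]) (use that in auto)
    fix x assume "x \<in> ball x0 r"
    then have xc: "x \<in> cball x0 r" by auto
    let ?\<theta> = "radial_slope (M * r) m y x"
    have a: "A / \<tau> ^ 4 \<le> \<alpha> * ?\<theta>"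
      using mult_left_mono[OF slo(2)[OF xc], of \<alpha>] \<alpha>\<beta> by simp
    have b: "\<beta> * ?\<theta> \<le> B * \<tau> ^ 4"
      using mult_left_mono[OF slo(1)[OF xc], of \<beta>] \<alpha>\<beta> by simp
    have "(A / \<tau> ^ 4) powr p \<le> (\<alpha> * ?\<theta>) powr p" using a A0 \<tau>(1) p by (intro powr_mono2) auto
    moreover have "(\<beta> * ?\<theta>) powr p \<le> (B * \<tau> ^ 4) powr p"
      using b \<alpha>\<beta>(2) p by (intro powr_mono2) (auto simp: radial_slope_def)
    ultimately show "l1 \<le> \<alpha> * ?\<theta> \<and> l1 powr p - l2 powr p \<le> (\<alpha> * ?\<theta>) powr p - (\<beta> * ?\<theta>) powr p"
      using a \<tau> by linarith
  qed (use \<alpha>\<beta> l r in auto)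
  moreover have "radial_potential (M * r) m y x0 > 0"
    using radial_potential_sign(1)[OF ny R m, of x0] geo(2) r by simp
  then have "?w x0 > 0" using \<alpha>\<beta> by (simp add: max_def)
  ultimately show False using x0(2) by simp
qed

text \<open>With positive slope 0 the barrier vanishes near \<open>x0\<close>, so comparison gives u
  \<ge> 0 there, against \<open>freq\<close>. Where the barrier is 0 on the boundary sphere,
  \<open>low\<close> yields only u \<ge> - \<epsilon> * r, which is too weak; \<open>cone\<close>
  supplies the sign.\<close>

lemma flat_bound_excluded:
  fixes u :: "'a::euclidean_space \<Rightarrow> real" and e x0 :: 'a
  assumes p: "1 < p" and l: "l1 > 0" "l2 > 0" and lm: "locally_minimal p l1 l2 D u"
    and x0: "x0 \<in> D" and freq: "\<exists>\<^sub>F x in nhds x0. u x < 0" and e: "norm e = 1"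
    and B: "0 < B" "B < l2"
    and low: "\<And>\<epsilon>. \<epsilon> > 0 \<Longrightarrow> \<forall>\<^sub>F x in nhds x0. - B * max (- ((x - x0) \<bullet> e)) 0 - \<epsilon> * dist x x0 \<le> u x"
    and cone: "\<And>\<epsilon>. \<epsilon> > 0 \<Longrightarrow> \<forall>\<^sub>F x in nhds x0. \<epsilon> * dist x x0 \<le> (x - x0) \<bullet> e \<longrightarrow> 0 \<le> u x"
  shows False
proof -
  have "((\<lambda>\<tau>. B * \<tau> ^ 3) \<longlongrightarrow> B * 1 ^ 3) (at_right (1::real))" by (intro tendsto_intros)
  then have e1: "\<forall>\<^sub>F \<tau> in at_right 1. B * \<tau> ^ 3 < l2" by (rule order_tendstoD(2)) (use B in simp)
  have "\<forall>\<^sub>F \<tau> in at_right (1::real). 1 < \<tau>" by (rule eventually_at_right_less)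
  with e1 have "\<forall>\<^sub>F \<tau> in at_right 1. 1 < \<tau> \<and> B * \<tau> ^ 3 < l2"
    by eventually_elim auto
  then obtain \<tau> where \<tau>: "1 < \<tau>" "B * \<tau> ^ 3 < l2"
    using eventually_happens'[OF trivial_limit_at_right_real] by blast
  \<comment> \<open>On the boundary \<beta> / \<tau> = B * \<tau> has to exceed B, while inside
    \<beta> * \<tau> = B * \<tau>^3 has to stay below l2.\<close>
  define \<beta> where "\<beta> = B * \<tau>\<^sup>2"
  define B1 where "B1 = B * \<tau>"
  have \<beta>: "\<beta> > 0" "\<beta> / \<tau> = B1" "\<beta> * \<tau> < l2"
    using B \<tau> by (auto simp: \<beta>_def B1_def power2_eq_square power3_eq_cube)
  define \<sigma> where "\<sigma> = B1 - B"
  have \<sigma>: "\<sigma> > 0" using B \<tau> by (simp add: \<sigma>_def B1_def)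
  have B1: "B1 > 0" using B \<tau> by (simp add: B1_def)
  define m where "m = real DIM('a) / (p - 1)"
  have m: "m > 0" using p by (simp add: m_def)
  have K: "real DIM('a) < (m + 1) * (p - 1) + 1"
  proof -
    have "(m + 1) * (p - 1) = real DIM('a) + (p - 1)" using p by (simp add: m_def field_simps)
    then show ?thesis using p by linarith
  qed
  obtain M0 where M0: "M0 \<ge> 4" "\<And>M. M \<ge> M0 \<Longrightarrow> (M / (M - 2)) powr (m + 1) \<le> \<tau>"
    using slope_scale_exists[OF \<tau>(1) m] by blast
  define M where "M = max M0 (B1 / (4 * \<sigma>))"
  have M: "M \<ge> 4" "(M / (M - 2)) powr (m + 1) \<le> \<tau>" using M0 by (auto simp: M_def)
  have MB: "B1 \<le> M * (4 * \<sigma>)"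
  proof -
    have "B1 / (4 * \<sigma>) \<le> M" by (auto simp: M_def)
    then show ?thesis using \<sigma> by (auto simp: divide_le_eq)
  qed
  define \<epsilon> where "\<epsilon> = min (B1 / (16 * M)) (\<sigma> / 8) / 2"
  have \<epsilon>: "\<epsilon> > 0" "\<epsilon> < B1 / (16 * M)" "\<epsilon> \<le> \<sigma> / 8"
  proof -
    have "B1 / (16 * M) > 0" using B1 M by auto
    then show "\<epsilon> > 0" "\<epsilon> < B1 / (16 * M)" "\<epsilon> \<le> \<sigma> / 8"
      using half_min_bounds[of "B1 / (16 * M)" "\<sigma> / 8"] \<sigma>(1) unfolding \<epsilon>_def by auto
  qed
  have D: "open D" "continuous_on D u" using lm by (auto simp: locally_minimal_def)
  \<comment> \<open>Gives \<mu> * r = \<eta>, so that on the sphere \<open>cone\<close> takes over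
    at the height \<eta> where the strict inequality \<open>bd\<close> ends.\<close>
  define \<mu> where "\<mu> = 1 / (16 * M)"
  have \<mu>: "\<mu> > 0" using M by (simp add: \<mu>_def)
  have ev: "\<forall>\<^sub>F x in nhds x0. (- B * max (- ((x - x0) \<bullet> e)) 0 - \<epsilon> * dist x x0 \<le> u x) \<and>
      (\<mu> * dist x x0 \<le> (x - x0) \<bullet> e \<longrightarrow> 0 \<le> u x)"
    using low[OF \<epsilon>(1)] cone[OF \<mu>] by eventually_elim auto
  obtain r where r: "r > 0" "cball x0 r \<subseteq> D" and ulow: "\<And>x. x \<in> cball x0 r \<Longrightarrow>
      (- B * max (- ((x - x0) \<bullet> e)) 0 - \<epsilon> * dist x x0 \<le> u x) \<and> (\<mu> * dist x x0 \<le> (x - x0) \<bullet> e \<longrightarrow> 0 \<le> u x)"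
    using eventually_nhds_cball[OF ev D(1) x0(1)] by blast
  obtain g where min: "minimality p l1 l2 (ball x0 r) u g" using lm r unfolding locally_minimal_def by blast
  have cu: "continuous_on (cball x0 r) u" using D(2) r(2) continuous_on_subset by blast
  define \<eta> where "\<eta> = r / (16 * M)"
  have \<mu>\<eta>: "\<mu> * r = \<eta>" by (simp add: \<mu>_def \<eta>_def)
  define y where "y = x0 + (M * r - \<eta>) *\<^sub>R e"
  have geo: "y \<notin> cball x0 r" "dist x0 y < M * r" "\<eta> > 0" "\<eta> \<le> r / 8"
    unfolding y_def \<eta>_def by (rule barrier_geometry[OF e r(1) M(1)])+
  have geo5: "(M - 2) * r \<le> dist x y \<and> dist x y \<le> (M + 2) * r" if "x \<in> cball x0 r" for x
    unfolding y_def \<eta>_def by (rule barrier_geometry(5)[OF e r(1) M(1) that])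
  have geo6: "M * r - dist x y \<le> (x - x0) \<bullet> e + \<eta>" if "x \<in> sphere x0 r" for x
    unfolding y_def \<eta>_def by (rule barrier_geometry(6)[OF e r(1) M(1) that])
  have geo7: "M * r - dist x y \<le> (x - x0) \<bullet> e - 2 * \<eta>" if "x \<in> sphere x0 r" "\<bar>(x - x0) \<bullet> e\<bar> \<le> r / 2" for x
    unfolding y_def \<eta>_def by (rule barrier_geometry(7)[OF e r(1) M(1) that])
  have R: "M * r > 0" using M r by simp
  let ?w = "\<lambda>x. 0 * max (radial_potential (M * r) m y x) 0 - \<beta> * max (- radial_potential (M * r) m y x) 0"
  have ny: "x \<noteq> y" if "x \<in> cball x0 r" for x using geo(1) that by blast
  note sl = radial_slope_bounds[OF M(1) r(1) m M(2) \<tau>(1)]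
  have slo: "radial_slope (M * r) m y x \<le> \<tau>" "1 / \<tau> \<le> radial_slope (M * r) m y x" if "x \<in> cball x0 r" for x
    using sl[of x y] geo5[OF that] by auto
  have w0: "?w x \<le> 0" for x using \<beta>(1) by simp
  have bd: "?w x < u x" if xs: "x \<in> sphere x0 r" and tx: "(x - x0) \<bullet> e \<le> \<eta>" for x
  proof -
    let ?t = "(x - x0) \<bullet> e"
    let ?s = "M * r - dist x y"
    have xc: "x \<in> cball x0 r" using xs by auto
    have s: "?s \<le> ?t + \<eta>" "\<bar>?t\<bar> \<le> r / 2 \<Longrightarrow> ?s \<le> ?t - 2 * \<eta>" using geo6[OF xs] geo7[OF xs] by auto
    have sneg: "?s < 0"
    proof (cases "\<bar>?t\<bar> \<le> r / 2")
      case True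
      then show ?thesis using s(2) tx geo(3) by linarith
    next
      case False
      then show ?thesis using s(1) tx geo(3,4) r by linarith
    qed
    have "?w x \<le> (if ?s \<ge> 0 then 0 * \<tau> * ?s else \<beta> / \<tau> * ?s)"
      by (rule two_slope_bound[OF ny[OF xc] R m slo[OF xc] \<tau>(1)]) (use \<beta> in auto)
    also have "\<dots> = B1 * ?s" using sneg \<beta>(2) by simp
    also have "B1 * ?s < - B * max (- ?t) 0 - \<epsilon> * r"
    proof -
      have E1: "\<epsilon> * r < B1 * \<eta>" using mult_strict_right_mono[OF \<epsilon>(2) r(1)] by (auto simp: \<eta>_def)
      show ?thesis
      proof (cases "?t < 0")
        case True
        \<comment> \<open>Both ?t and ?s are negative, so the comparison concerns the slopes B and
          B1. The positive slopes B1 + \<sigma> and B1 are filled in to satisfy the gap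
          condition.\<close>
        have "(if ?s \<ge> 0 then B1 * ?s else B1 * ?s) < (B1 + \<sigma>) * max ?t 0 - B * max (- ?t) 0 - \<epsilon> * r"
        proof (rule boundary_slopes[OF B1 _ B(1) _ \<sigma> r(1) geo(3,4)])
          show "B1 * \<eta> \<le> \<sigma> * r / 4" "B1 * \<eta> \<le> \<sigma> * r / 4"
            using MB M r by (auto simp: \<eta>_def divide_simps mult_ac)
          show "\<epsilon> * r \<le> \<sigma> * r / 8" using mult_right_mono[OF \<epsilon>(3), of r] r by simp
          show "0 < \<epsilon> * r" using \<epsilon> r by simp
        qed (use s E1 in \<open>auto simp: \<sigma>_def\<close>)
        then show ?thesis using True by simp
      next
        case False
        have "\<bar>?t\<bar> \<le> r / 2" using False tx geo(4) r by linarith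
        then have "?s \<le> - \<eta>" using s(2) tx by linarith
        then have "B1 * ?s \<le> B1 * (- \<eta>)" using B1 by (intro mult_left_mono) auto
        then show ?thesis using E1 False by simp
      qed
    qed
    also have "\<dots> \<le> u x" using ulow[OF xc] xs by (simp add: dist_commute)
    finally show ?thesis .
  qed
  have c\<psi>: "continuous_on (cball x0 r) (radial_potential (M * r) m y)"
    by (rule continuous_on_GDERIV[where G = "\<lambda>x. (- radial_slope (M * r) m y x) *\<^sub>R sgn (x - y)"])
      (use radial_potential_GDERIV ny R m in blast)
  have cw: "continuous_on (cball x0 r) ?w"
    by (intro continuous_intros c\<psi>)
  have comp: "?w x \<le> u x" if "x \<in> ball x0 r" for x
  proof (rule radial_comparison[OF p r(1) R m K min cu geo(1)])
    show "\<forall>\<^sub>F z in nhds x. z \<in> ball x0 r \<longrightarrow> ?w z \<le> u z" if xs: "x \<in> sphere x0 r" for x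
    proof (cases "(x - x0) \<bullet> e \<le> \<eta>")
      case True
      show ?thesis by (rule eventually_le_of_less[OF cu cw _ bd[OF xs True]]) (use xs in auto)
    next
      case False
      have "((\<lambda>z. (z - x0) \<bullet> e - \<mu> * dist z x0) \<longlongrightarrow> (x - x0) \<bullet> e - \<mu> * dist x x0) (nhds x)"
        by (intro tendsto_intros filterlim_ident)
      moreover have "(x - x0) \<bullet> e - \<mu> * dist x x0 > 0" using False xs \<mu>\<eta> by (simp add: dist_commute)
      ultimately have "\<forall>\<^sub>F z in nhds x. 0 < (z - x0) \<bullet> e - \<mu> * dist z x0" by (rule order_tendstoD(1))
      then show ?thesis
      proof eventually_elim
        case (elim z)
        show ?case
        proof
          assume "z \<in> ball x0 r"
          then have "0 \<le> u z" using ulow[of z] elim by auto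
          then show "?w z \<le> u z" using w0[of z] by linarith
        qed
      qed
    qed
    show "\<beta> * radial_slope (M * r) m y x < l2" if "x \<in> ball x0 r" for x
    proof -
      have "x \<in> cball x0 r" using that by auto
      then have "\<beta> * radial_slope (M * r) m y x \<le> \<beta> * \<tau>" using slo(1) \<beta>(1) by (intro mult_left_mono) auto
      then show ?thesis using \<beta>(3) by linarith
    qed
  qed (use \<beta> l r that in auto)
  \<comment> \<open>\<open>x0\<close> lies strictly inside the zero sphere, so the barrier vanishes
    on a whole neighbourhood of it.\<close>
  have "0 < M * r - dist x0 y" using geo(2) by simp
  then obtain d where d: "d > 0" "d \<le> r" "dist x0 y + d < M * r"
    using r(1) by (intro that[of "min r ((M * r - dist x0 y) / 2)"]) (auto simp: min_def field_simps)
  have "\<forall>\<^sub>F x in nhds x0. x \<in> ball x0 d" using d(1) by (intro eventually_nhds_in_open) auto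
  then have "\<forall>\<^sub>F x in nhds x0. \<not> u x < 0"
  proof eventually_elim
    case (elim x)
    then have xb: "x \<in> ball x0 r" using d(2) by auto
    then have "x \<noteq> y" using ny[of x] by auto
    moreover have "dist x y < M * r" using elim d(3) dist_triangle[of x y x0] by (auto simp: dist_commute)
    ultimately have "radial_potential (M * r) m y x > 0" using radial_potential_sign(1)[of x y "M * r" m] R m by simp
    then have wz: "?w x = 0" by simp
    have "0 \<le> u x" using comp[OF xb] unfolding wz .
    then show ?case by simp
  qed
  then show False using freq by (simp add: frequently_def)
qed

section \<open>A barrier centred at the contact point\<close>

lemma Cinf_on_radial_potential:
  assumes "R > 0"
  shows "Cinf_on (radial_potential R m y) (- {y})"
proof (rule Cinf_on_cong)
  show "Cinf_on (\<lambda>x. (R / m) * (R powr m * ((x - y) \<bullet> (x - y)) powr (- m / 2) - 1)) (- {y})"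
    by (intro Cinf_on_mult Cinf_on_const Cinf_on_diff Cinf_on_ident
      Cinf_on_compose[OF _ Cinf_on_powr] Cinf_on_inner) auto
  fix x assume "x \<in> - {y}"
  then have \<rho>: "dist x y > 0" by simp
  have "(x - y) \<bullet> (x - y) = dist x y powr 2" using \<rho> by (simp add: dist_norm power2_norm_eq_inner)
  then have "((x - y) \<bullet> (x - y)) powr (- m / 2) = dist x y powr (- m)" by (simp only: powr_powr) simp
  then show "(R / m) * (R powr m * ((x - y) \<bullet> (x - y)) powr (- m / 2) - 1) = radial_potential R m y x"
    using \<rho> assms by (simp add: radial_potential_def powr_divide powr_minus_divide)
qed

lemma divergence_scaleR:
  assumes f: "GDERIV f x :> g" and F: "(F has_derivative F') (at x)"
  shows "divergence (\<lambda>x. f x *\<^sub>R F x) x = f x * divergence F x + g \<bullet> F x"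
proof -
  have "((\<lambda>x. f x *\<^sub>R F x) has_derivative (\<lambda>d. f x *\<^sub>R F' d + (d \<bullet> g) *\<^sub>R F x)) (at x)"
    using has_derivative_scaleR[OF f[unfolded gderiv_def] F] .
  from divergence_has_derivative[OF this]
  have "divergence (\<lambda>x. f x *\<^sub>R F x) x = (\<Sum>b\<in>Basis. (f x *\<^sub>R F' b + (b \<bullet> g) *\<^sub>R F x) \<bullet> b)" .
  also have "\<dots> = (\<Sum>b\<in>Basis. f x * (F' b \<bullet> b) + (g \<bullet> b) * (F x \<bullet> b))"
    by (intro sum.cong refl) (simp add: inner_add_left inner_commute[of g])
  also have "\<dots> = f x * (\<Sum>b\<in>Basis. F' b \<bullet> b) + g \<bullet> F x"
    unfolding sum.distrib euclidean_inner[of g "F x"] sum_distrib_left ..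
  finally show ?thesis by (simp add: divergence_has_derivative[OF F])
qed

lemma divergence_zero_open:
  assumes "open S" "x \<in> S" "\<And>y. y \<in> S \<Longrightarrow> F y = 0"
  shows "divergence F x = 0"
proof -
  have "(F has_derivative (\<lambda>d. 0)) (at x)"
    by (rule has_derivative_transform_within_open[OF has_derivative_const assms(1,2), of 0]) (simp add: assms(3))
  from divergence_has_derivative[OF this] show ?thesis by simp
qed

text \<open>A barrier vanishing on a ball around \<open>x0\<close> cannot be calibrated by a field of nonnegative
  divergence. Inside the ball the field is cut off; the resulting negative divergence is
  compensated by the phase energy because \<open>u\<close> is small there.\<close>

lemma small_bound_excluded:
  fixes u :: "'a::euclidean_space \<Rightarrow> real" and x0 :: 'a
  assumes p: "1 < p" and l: "l2 > 0" and lm: "locally_minimal p l1 l2 D u"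
    and x0: "x0 \<in> D" and freq: "\<exists>\<^sub>F x in nhds x0. u x < 0"
    and low: "\<And>\<epsilon>. \<epsilon> > 0 \<Longrightarrow> \<forall>\<^sub>F x in nhds x0. - \<epsilon> * dist x x0 \<le> u x"
  shows False
proof -
  define m where "m = real DIM('a) / (p - 1)"
  have m: "m > 0" using p by (simp add: m_def)
  define K where "K = (m + 1) * (p - 1)"
  have K: "real DIM('a) < K + 1"
  proof -
    have "K = real DIM('a) + (p - 1)" using p by (simp add: K_def m_def field_simps)
    then show ?thesis using p by linarith
  qed
  \<comment> \<open>Bounds the slope at distance at least r / 8 from \<open>x0\<close>: the zero
    sphere has radius R = r / 2, so R / dist \<le> 4. The choice of \<beta> then keeps the slope of
    the barrier at most l2 / 2 there.\<close>
  define \<Theta> :: real where "\<Theta> = 4 powr (m + 1)"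
  have \<Theta>: "\<Theta> > 0" by (simp add: \<Theta>_def)
  define \<beta> where "\<beta> = l2 / (2 * \<Theta>)"
  have \<beta>: "\<beta> > 0" "\<beta> * \<Theta> = l2 / 2" using l \<Theta> by (auto simp: \<beta>_def)
  have q1: "(0::real) \<le> 1/8" "(1/8::real) < 1/4" by auto
  obtain \<zeta>1 :: "'a \<Rightarrow> real" where \<zeta>1: "Cinf_on \<zeta>1 UNIV" "\<And>x. dist x 0 \<le> 1/8 \<Longrightarrow> \<zeta>1 x = 1"
    "\<And>x. dist x 0 \<ge> 1/4 \<Longrightarrow> \<zeta>1 x = 0" "\<And>x. 0 \<le> \<zeta>1 x \<and> \<zeta>1 x \<le> 1"
    using smooth_cutoff_exists[OF q1, of 0] by blast
  have \<zeta>1z: "\<zeta>1 x = 0" if "x \<notin> cball 0 (1/4)" for x using \<zeta>1(3)[of x] that by simp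
  have g\<zeta>1z: "gradient \<zeta>1 x = 0" if "x \<notin> cball 0 (1/4)" for x
    by (rule gradient_zero_outside_cball[OF \<zeta>1z that])
  obtain C1 where C1: "C1 \<ge> 0" "\<And>x. norm (gradient \<zeta>1 x) \<le> C1"
    using compact_support_bounded[OF continuous_gradient[OF \<zeta>1(1)] compact_cball g\<zeta>1z] by blast
  define \<Lambda> where "\<Lambda> = (l2 / 2) powr (p - 1)"
  \<comment> \<open>Balance where u < 0 = w. A flux of norm at most \<Lambda> leaves a gain of at
    least a from the phase energy. The cutoff costs at most p * (C1 / r) * \<Lambda> * |u|, and |u|
    \<le> \<epsilon> * r turns this into b * \<epsilon>, independent of r.\<close>
  define a where "a = (p - 1) * (l2 powr p - (l2 / 2) powr p)"
  define b where "b = p * C1 * \<Lambda>"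
  \<comment> \<open>The barrier has the value - c0 * r on the boundary sphere.\<close>
  define c0 where "c0 = \<beta> * (1 - (1 / 2) powr m) / (2 * m)"
  have a: "a > 0" unfolding a_def using p l powr_less_mono2[of p "l2 / 2" l2] by (intro mult_pos_pos) auto
  have b: "b \<ge> 0" using p C1 by (simp add: b_def \<Lambda>_def)
  have c0: "c0 > 0"
  proof -
    have "(1 / 2 :: real) powr m < 1 powr m" using m by (intro powr_less_mono2) auto
    then show ?thesis using \<beta> m by (simp add: c0_def)
  qed
  define \<epsilon> where "\<epsilon> = min (a / (b + 1)) c0 / 2"
  have \<epsilon>: "\<epsilon> > 0" "b * \<epsilon> < a" "\<epsilon> < c0"
  proof -
    have ab: "a / (b + 1) > 0" using a b by simp
    note h = half_min_bounds[OF ab c0, folded \<epsilon>_def] half_min_bounds[OF c0 ab]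
    show "\<epsilon> > 0" by (rule h(1))
    show "\<epsilon> < c0" using h(5) by (simp add: \<epsilon>_def min.commute)
    have "\<epsilon> * (b + 1) < a" using h(2) b by (simp add: less_divide_eq)
    then show "b * \<epsilon> < a" using h(1) by (simp add: algebra_simps)
  qed
  have D: "open D" "continuous_on D u" using lm by (auto simp: locally_minimal_def)
  obtain r where r: "r > 0" "cball x0 r \<subseteq> D" and ulow: "\<And>x. x \<in> cball x0 r \<Longrightarrow> - \<epsilon> * dist x x0 \<le> u x"
    using eventually_nhds_cball[OF low[OF \<epsilon>(1)] D(1) x0(1)] by blast
  obtain g where min: "minimality p l1 l2 (ball x0 r) u g" using lm r unfolding locally_minimal_def by blast
  have cu: "continuous_on (cball x0 r) u" using D(2) r(2) continuous_on_subset by blast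
  define R where "R = r / 2"
  have R: "R > 0" using r by (simp add: R_def)
  let ?\<psi> = "radial_potential R m x0" and ?\<theta> = "radial_slope R m x0"
  define \<zeta> where "\<zeta> x = \<zeta>1 (inverse r *\<^sub>R (x - x0))" for x
  have dz: "dist (inverse r *\<^sub>R (x - x0)) 0 = dist x x0 / r" for x
    using r by (simp add: dist_norm divide_inverse mult.commute)
  have \<zeta>one: "\<zeta> x = 1" if "dist x x0 \<le> r / 8" for x
    unfolding \<zeta>_def by (rule \<zeta>1(2)) (use that r dz[of x] in \<open>simp add: divide_le_eq\<close>)
  have \<zeta>zero: "\<zeta> x = 0" if "dist x x0 \<ge> r / 4" for x
    unfolding \<zeta>_def by (rule \<zeta>1(3)) (use that r dz[of x] in \<open>simp add: le_divide_eq\<close>)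
  have \<zeta>01: "0 \<le> \<zeta> x" "\<zeta> x \<le> 1" for x using \<zeta>1(4) by (auto simp: \<zeta>_def)
  have C\<zeta>: "Cinf_on \<zeta> UNIV" unfolding \<zeta>_def
    by (intro Cinf_on_compose[OF _ \<zeta>1(1)] Cinf_on_scaleR Cinf_on_const Cinf_on_diff Cinf_on_ident) auto
  have C\<chi>: "Cinf_on (\<lambda>x. 1 - \<zeta> x) UNIV" by (intro Cinf_on_diff Cinf_on_const C\<zeta>) simp
  define G\<zeta> where "G\<zeta> x = inverse r *\<^sub>R gradient \<zeta>1 (inverse r *\<^sub>R (x - x0))" for x
  have G\<zeta>: "GDERIV \<zeta> x :> G\<zeta> x" for x
  proof -
    have 1: "((\<lambda>x. inverse r *\<^sub>R (x - x0)) has_derivative (\<lambda>d. inverse r *\<^sub>R d)) (at x)"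
      by (auto intro!: derivative_eq_intros)
    have 2: "(\<zeta>1 has_derivative (\<lambda>d. d \<bullet> gradient \<zeta>1 (inverse r *\<^sub>R (x - x0)))) (at (inverse r *\<^sub>R (x - x0)))"
      using Cinf_on_GDERIV[OF \<zeta>1(1)] by (simp add: gderiv_def)
    show ?thesis using has_derivative_compose[OF 1 2] by (simp add: gderiv_def G\<zeta>_def[abs_def] \<zeta>_def[abs_def])
  qed
  have G\<zeta>b: "norm (G\<zeta> x) \<le> C1 / r" for x
    using C1(2)[of "inverse r *\<^sub>R (x - x0)"] r by (simp add: G\<zeta>_def divide_inverse mult.commute mult_left_mono)
  have U: "UNIV = - {x0} \<union> ball x0 (r / 8)" using r by auto
  \<comment> \<open>The centre is now inside the ball, where the potential is singular. Replacing it
    by 1 near \<open>x0\<close> removes the singularity and changes nothing in the negative phase,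
    which begins at distance R = r / 2.\<close>
  define \<psi> where "\<psi> x = (1 - \<zeta> x) * ?\<psi> x + \<zeta> x" for x
  have C\<psi>: "Cinf_on \<psi> UNIV" unfolding U
  proof (rule Cinf_on_Un)
    show "Cinf_on \<psi> (- {x0})" unfolding \<psi>_def
      by (intro Cinf_on_add Cinf_on_mult Cinf_on_radial_potential R Cinf_on_subset[OF C\<zeta>] Cinf_on_subset[OF C\<chi>]) auto
    show "Cinf_on \<psi> (ball x0 (r / 8))"
      by (rule Cinf_on_cong[OF Cinf_on_const[of _ 1]]) (auto simp: \<psi>_def \<zeta>one dist_commute)
  qed
  define A where "A = radial_field (\<beta> powr (p - 1) * R powr K) (K + 1) x0"
  have CA: "Cinf_on A (- {x0})" unfolding A_def by (rule Cinf_on_radial_field)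
  \<comment> \<open>The cutoff acts within distance r / 4 only, so \<open>F\<close> is still the
    exact flux where the barrier is negative.\<close>
  define F where "F x = (1 - \<zeta> x) *\<^sub>R A x" for x
  have CF: "Cinf_on F UNIV" unfolding U
  proof (rule Cinf_on_Un)
    show "Cinf_on F (- {x0})" unfolding F_def
      by (intro Cinf_on_scaleR CA Cinf_on_subset[OF C\<chi>]) auto
    show "Cinf_on F (ball x0 (r / 8))"
      by (rule Cinf_on_cong[OF Cinf_on_const[of _ 0]]) (auto simp: F_def \<zeta>one dist_commute)
  qed
  have divF: "divergence F x = (1 - \<zeta> x) * divergence A x - G\<zeta> x \<bullet> A x" if "x \<noteq> x0" for x
  proof -
    have "GDERIV (\<lambda>x. 1 - \<zeta> x) x :> 0 - G\<zeta> x" by (rule GDERIV_diff[OF GDERIV_const G\<zeta>])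
    from divergence_scaleR[OF this Cinf_on_has_derivative[OF CA]] that
    show ?thesis by (simp add: F_def[abs_def])
  qed
  have divA: "divergence A x > 0" if "x \<noteq> x0" for x
  proof -
    have "dist x x0 > 0" using that by simp
    then show ?thesis unfolding A_def divergence_radial_field[OF that] using K \<beta>(1) R by simp
  qed
  note Aeq = radial_field_eq[OF _ R p \<beta>(1), of _ x0 m, folded K_def, folded A_def]
  have \<psi>neg: "dist x x0 > R" if "\<psi> x < 0" for x
  proof (rule ccontr)
    assume n: "\<not> dist x x0 > R"
    have "\<psi> x \<ge> 0"
    proof (cases "x = x0")
      case True
      then show ?thesis using \<zeta>one[of x] r by (simp add: \<psi>_def)
    next
      case False
      then have "?\<psi> x \<ge> 0" using radial_potential_sign(2)[OF False R m] n by linarith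
      then show ?thesis using \<zeta>01[of x] by (simp add: \<psi>_def)
    qed
    then show False using that by simp
  qed
  have far: "\<zeta> x = 0" "G\<zeta> x = 0" "\<psi> x = ?\<psi> x" "x \<noteq> x0" "gradient \<psi> x = (- ?\<theta> x) *\<^sub>R sgn (x - x0)" if "dist x x0 > r / 4" for x
  proof -
    show z: "\<zeta> x = 0" using \<zeta>zero that by simp
    show xn: "x \<noteq> x0" using that r by auto
    show "\<psi> x = ?\<psi> x" by (simp add: \<psi>_def z)
    have oS: "open (- cball x0 (r / 4))" "x \<in> - cball x0 (r / 4)" using that by (auto simp: dist_commute)
    have "gradient \<zeta> x = 0"
      by (rule gradient_eq[OF GDERIV_transform_open[OF GDERIV_const oS, of 0]]) (simp add: \<zeta>zero dist_commute)
    then show "G\<zeta> x = 0" using gradient_eq[OF G\<zeta>] by simp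
    show "gradient \<psi> x = (- ?\<theta> x) *\<^sub>R sgn (x - x0)"
      by (rule gradient_eq[OF GDERIV_transform_open[OF radial_potential_GDERIV[OF xn R m] oS]])
        (simp add: \<psi>_def \<zeta>zero dist_commute)
  qed
  let ?w = "\<lambda>x. 0 * max (\<psi> x) 0 - \<beta> * max (- \<psi> x) 0"
  let ?h = "\<lambda>x. if \<psi> x > 0 then 0 *\<^sub>R gradient \<psi> x else if \<psi> x < 0 then \<beta> *\<^sub>R gradient \<psi> x else 0"
  have p0: "0 \<le> p" using p by simp
  have \<psi>D: "GDERIV \<psi> x :> gradient \<psi> x" for x by (rule Cinf_on_GDERIV[OF C\<psi>]) simp
  have cG: "continuous_on UNIV (gradient \<psi>)" by (rule continuous_gradient[OF C\<psi>])
  note tw = two_slope_function[OF open_UNIV subset_UNIV \<psi>D cG p0, of x0 r 0 \<beta>]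
  have w0: "?w x \<le> 0" for x using \<beta>(1) by simp
  have wneg: "\<psi> x < 0" if "?w x < 0" for x using that by (auto simp: max_def split: if_splits)
  have wz: "\<psi> x \<ge> 0" if "?w x = 0" for x using that \<beta>(1) by (auto simp: max_def split: if_splits)
  have bd: "?w x < u x" if xs: "x \<in> sphere x0 r" for x
  proof -
    have d: "dist x x0 = r" using xs by (simp add: dist_commute)
    then have f: "dist x x0 > r / 4" using r by simp
    have "\<psi> x = (r / 2 / m) * ((1 / 2) powr m - 1)"
      unfolding far(3)[OF f] radial_potential_def d using r by (simp add: R_def)
    moreover have "(r / 2 / m) * ((1 / 2) powr m - 1) \<le> 0"
    proof -
      have "(1 / 2 :: real) powr m \<le> 1 powr m" using m by (intro powr_mono2) auto
      then show ?thesis using r m by (intro mult_nonneg_nonpos) auto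
    qed
    ultimately have "?w x = \<beta> * ((r / 2 / m) * ((1 / 2) powr m - 1))" by simp
    also have "\<dots> = - c0 * r" using m by (simp add: c0_def field_simps)
    also have "\<dots> < - \<epsilon> * r" using \<epsilon>(3) r by simp
    also have "\<dots> \<le> u x" using ulow[of x] xs d by auto
    finally show ?thesis .
  qed
  have comp: "?w x \<le> u x" if xb: "x \<in> ball x0 r" for x
  \<comment> \<open>The barrier is never positive, so the field for the positive phase is taken to
    be 0.\<close>
  proof (rule comparison_principle[OF p r(1) min cu tw _ Cinf_on_const[OF open_UNIV, of 0] subset_UNIV CF subset_UNIV, of "{}"])
    show "\<forall>\<^sub>F z in nhds x. z \<in> ball x0 r \<longrightarrow> ?w z \<le> u z" if "x \<in> sphere x0 r" for x
      by (rule eventually_le_of_less[OF cu tw(1) _ bd[OF that]]) (use that in auto)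
    show "?h x = 0" if "?w x = 0" for x using wz[OF that] by auto
    show "F x = norm (?h x) powr (p - 2) *\<^sub>R ?h x \<and> divergence F x > 0" if "?w x < 0" for x
    proof -
      note n = wneg[OF that]
      have f: "dist x x0 > r / 4" using \<psi>neg[OF n] r by (simp add: R_def)
      have "F x = A x" by (simp add: F_def far(1)[OF f])
      moreover have "?h x = \<beta> *\<^sub>R ((- ?\<theta> x) *\<^sub>R sgn (x - x0))" using n far(5)[OF f] by simp
      moreover have "divergence F x = divergence A x" by (simp add: divF[OF far(4)[OF f]] far(1,2)[OF f])
      ultimately show ?thesis using Aeq(1)[OF far(4)[OF f]] divA[OF far(4)[OF f]] by simp
    qed
    show "p * divergence F x * (- u x) + (p - 1) * (l2 powr p - norm (F x) powr (p / (p - 1))) > 0"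
      if x: "x \<in> ball x0 r - {}" and ux: "u x < 0" for x
    proof (cases "dist x x0 < r / 8")
      case True
      have "divergence F x = 0"
        by (rule divergence_zero_open[of "ball x0 (r / 8)"]) (use True in \<open>auto simp: F_def \<zeta>one dist_commute\<close>)
      moreover have "F x = 0" using True by (simp add: F_def \<zeta>one)
      ultimately show ?thesis using p l by simp
    next
      case False
      then have xn: "x \<noteq> x0" using r by auto
      have "R / dist x x0 \<le> R / (r / 8)" using False r R xn by (intro divide_left_mono mult_pos_pos) auto
      then have "R / dist x x0 \<le> 4" using r by (simp add: R_def)
      then have \<theta>: "?\<theta> x \<le> \<Theta>" unfolding radial_slope_def \<Theta>_def using R m by (intro powr_mono2) auto
      have \<theta>0: "?\<theta> x \<ge> 0" by (simp add: radial_slope_def)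
      have bt: "\<beta> * ?\<theta> x \<le> l2 / 2" using mult_left_mono[OF \<theta>, of \<beta>] \<beta> by simp
      have nA: "norm (A x) \<le> \<Lambda>"
        unfolding Aeq(2)[OF xn] \<Lambda>_def using bt \<beta>(1) \<theta>0 p by (intro powr_mono2) auto
      have nF: "norm (F x) \<le> \<Lambda>"
      proof -
        have "norm (F x) = (1 - \<zeta> x) * norm (A x)" using \<zeta>01[of x] by (simp add: F_def)
        also have "\<dots> \<le> 1 * norm (A x)" using \<zeta>01[of x] by (intro mult_right_mono) auto
        finally show ?thesis using nA by simp
      qed
      have "norm (F x) powr (p / (p - 1)) \<le> \<Lambda> powr (p / (p - 1))" using nF p by (intro powr_mono2) auto
      also have "\<dots> = (l2 / 2) powr p" using p by (simp add: \<Lambda>_def powr_powr)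
      finally have "a \<le> (p - 1) * (l2 powr p - norm (F x) powr (p / (p - 1)))"
        unfolding a_def using p by (intro mult_left_mono) auto
      moreover have "p * divergence F x * (- u x) \<ge> - (b * \<epsilon>)"
      proof -
        have "G\<zeta> x \<bullet> A x \<le> norm (G\<zeta> x) * norm (A x)" by (rule norm_cauchy_schwarz)
        also have "\<dots> \<le> (C1 / r) * \<Lambda>" using G\<zeta>b nA C1(1) r by (intro mult_mono) auto
        finally have "- ((C1 / r) * \<Lambda>) \<le> divergence F x"
          unfolding divF[OF xn] using divA[OF xn] \<zeta>01[of x] by (smt (verit) mult_nonneg_nonneg)
        then have "p * (- u x) * (- ((C1 / r) * \<Lambda>)) \<le> p * (- u x) * divergence F x"
          using p ux by (intro mult_left_mono mult_nonneg_nonneg) auto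
        moreover have "p * (- u x) * ((C1 / r) * \<Lambda>) \<le> p * (\<epsilon> * r) * ((C1 / r) * \<Lambda>)"
        proof (intro mult_right_mono mult_left_mono)
          have "\<epsilon> * dist x x0 \<le> \<epsilon> * r" using x \<epsilon>(1) by (intro mult_left_mono) (auto simp: dist_commute)
          then show "- u x \<le> \<epsilon> * r" using ulow[of x] x by (auto simp: less_imp_le)
        qed (use p C1 r in \<open>auto simp: \<Lambda>_def\<close>)
        moreover have "p * (\<epsilon> * r) * ((C1 / r) * \<Lambda>) = b * \<epsilon>" using r by (simp add: b_def)
        moreover have "p * (- u x) * (- ((C1 / r) * \<Lambda>)) = - (p * (- u x) * ((C1 / r) * \<Lambda>))" by simp
        moreover have "p * divergence F x * (- u x) = p * (- u x) * divergence F x" by simp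
        ultimately show ?thesis by linarith
      qed
      ultimately show ?thesis using \<epsilon>(2) by linarith
    qed
    show "?w x > 0 \<Longrightarrow> P" for x P using w0[of x] by simp
  qed (use xb w0 in \<open>auto simp: not_less[symmetric]\<close>)
  have "\<forall>\<^sub>F x in nhds x0. x \<in> ball x0 (r / 8)" using r(1) by (intro eventually_nhds_in_open) auto
  then have "\<forall>\<^sub>F x in nhds x0. \<not> u x < 0"
  proof eventually_elim
    case (elim x)
    then have "\<psi> x = 1" using \<zeta>one[of x] by (simp add: \<psi>_def dist_commute)
    then show ?case using comp[of x] elim r by simp
  qed
  then show False using freq by (simp add: frequently_def)
qed

section \<open>First-order expansion of comparison functions\<close>

text \<open>The gradient is known inside \<open>P\<close> only, so the mean value theorem can be
  used along a segment just until its first exit. There \<open>f\<close> is 0, and this value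
  replaces information on the rest of the segment.\<close>

lemma segment_exit:
  fixes x v :: "'a::euclidean_space" and f :: "'a \<Rightarrow> real"
  assumes P: "open P" "x \<in> P" and D: "\<And>s. 0 \<le> s \<Longrightarrow> s \<le> 1 \<Longrightarrow> x + s *\<^sub>R v \<in> D"
    and f: "continuous_on (closure P \<inter> D) f" "\<forall>y\<in>P. f y > 0" "\<forall>y\<in>D - P. f y \<le> 0"
  obtains "\<And>s. 0 \<le> s \<Longrightarrow> s \<le> 1 \<Longrightarrow> x + s *\<^sub>R v \<in> P"
    | s where "0 < s" "s \<le> 1" "\<And>t. 0 \<le> t \<Longrightarrow> t < s \<Longrightarrow> x + t *\<^sub>R v \<in> P" "f (x + s *\<^sub>R v) = 0" "x + s *\<^sub>R v \<in> closure P"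
proof (cases "\<forall>s\<in>{0..1}. x + s *\<^sub>R v \<in> P")
  case True
  then show ?thesis using that(1) by auto
next
  case False
  define S where "S = {s \<in> {0..1}. x + s *\<^sub>R v \<notin> P}"
  have "S = {0..1} \<inter> (\<lambda>s. x + s *\<^sub>R v) -` (- P)" by (auto simp: S_def)
  moreover have "closed ({0..1} \<inter> (\<lambda>s. x + s *\<^sub>R v) -` (- P))"
    by (intro continuous_closed_preimage continuous_intros) (use P(1) in auto)
  ultimately have "closed S" by simp
  moreover have "bounded S" by (rule bounded_subset[of "{0..1}"]) (auto simp: S_def)
  ultimately have "compact S" by (simp add: compact_eq_bounded_closed)
  moreover have "S \<noteq> {}" using False by (auto simp: S_def)
  ultimately have "\<exists>s\<in>S. \<forall>t\<in>S. s \<le> t" by (rule compact_attains_inf)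
  then obtain s where s: "s \<in> S" "\<forall>t\<in>S. s \<le> t" by blast
  have s01: "0 \<le> s" "s \<le> 1" and sP: "x + s *\<^sub>R v \<notin> P" using s(1) by (auto simp: S_def)
  have "s \<noteq> 0" using sP P(2) by auto
  then have s0: "0 < s" using s01 by simp
  have before: "x + t *\<^sub>R v \<in> P" if "0 \<le> t" "t < s" for t
  proof (rule ccontr)
    assume "x + t *\<^sub>R v \<notin> P"
    then have "t \<in> S" using that s01 by (simp add: S_def)
    then show False using s(2) that by fastforce
  qed
  let ?z = "x + s *\<^sub>R v"
  define k where "k n = x + (s * (1 - inverse (real (Suc n)))) *\<^sub>R v" for n
  have kP: "k n \<in> P" for n unfolding k_def
  proof (rule before)
    have i: "0 < inverse (real (Suc n))" "inverse (real (Suc n)) \<le> 1" by (auto simp: divide_simps)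
    show "0 \<le> s * (1 - inverse (real (Suc n)))" using i s0 by (intro mult_nonneg_nonneg) auto
    have "s * (1 - inverse (real (Suc n))) < s * 1" using i s0 by (intro mult_strict_left_mono) auto
    then show "s * (1 - inverse (real (Suc n))) < s" by simp
  qed
  have "k \<longlonglongrightarrow> x + (s * (1 - 0)) *\<^sub>R v" unfolding k_def
    by (intro tendsto_intros LIMSEQ_inverse_real_of_nat)
  then have kl: "k \<longlonglongrightarrow> ?z" by simp
  have zc: "?z \<in> closure P" unfolding closure_sequential
    by (intro exI[of _ k] conjI allI kP kl)
  have zD: "?z \<in> D" using D s01 by simp
  have kD: "k n \<in> D" for n unfolding k_def
  proof (rule D)
    have i: "0 < inverse (real (Suc n))" "inverse (real (Suc n)) \<le> 1" by (auto simp: divide_simps)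
    show "0 \<le> s * (1 - inverse (real (Suc n)))" using i s0 by (intro mult_nonneg_nonneg) auto
    have "s * (1 - inverse (real (Suc n))) \<le> 1 * 1" using i s01 by (intro mult_mono) auto
    then show "s * (1 - inverse (real (Suc n))) \<le> 1" by simp
  qed
  have "(\<lambda>n. f (k n)) \<longlonglongrightarrow> f ?z"
    by (rule continuous_on_tendsto_compose[OF f(1) kl])
      (use zc zD kD kP closure_subset in \<open>auto intro!: always_eventually\<close>)
  then have "0 \<le> f ?z" by (rule LIMSEQ_le_const) (use f(2) kP in \<open>auto intro: less_imp_le\<close>)
  moreover have "f ?z \<le> 0" using f(3) zD sP by blast
  ultimately have "f ?z = 0" by simp
  then show ?thesis using that(2)[OF s0 s01(2) before _ zc] by blast
qed

lemma segment_mean_value: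
  fixes x v a :: "'a::euclidean_space" and f :: "'a \<Rightarrow> real"
  assumes s: "0 < s" and P: "\<And>t. 0 \<le> t \<Longrightarrow> t < s \<Longrightarrow> x + t *\<^sub>R v \<in> P"
    and e: "\<And>t. 0 \<le> t \<Longrightarrow> t \<le> s \<Longrightarrow> x + t *\<^sub>R v \<in> closure P \<inter> D"
    and f: "continuous_on (closure P \<inter> D) f" "\<forall>y\<in>P. GDERIV f y :> G y"
    and G: "\<And>t. 0 \<le> t \<Longrightarrow> t < s \<Longrightarrow> norm (G (x + t *\<^sub>R v) - a) \<le> \<epsilon>"
  shows "\<bar>f (x + s *\<^sub>R v) - f x - s * (v \<bullet> a)\<bar> \<le> \<epsilon> * (s * norm v)"
proof -
  have "\<exists>t\<in>{0<..<s}. f (x + s *\<^sub>R v) - f (x + 0 *\<^sub>R v) = (\<lambda>h. (h *\<^sub>R v) \<bullet> G (x + t *\<^sub>R v)) (s - 0)"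
  proof (rule mvt[OF s])
    show "continuous_on {0..s} (\<lambda>t. f (x + t *\<^sub>R v))"
      by (rule continuous_on_compose2[OF f(1)]) (use e in \<open>auto intro!: continuous_intros\<close>)
    fix t assume t: "0 < t" "t < s"
    have 1: "((\<lambda>t. x + t *\<^sub>R v) has_derivative (\<lambda>h. h *\<^sub>R v)) (at t)" by (auto intro!: derivative_eq_intros)
    have 2: "(f has_derivative (\<lambda>h. h \<bullet> G (x + t *\<^sub>R v))) (at (x + t *\<^sub>R v))"
      using f(2) P[of t] t by (simp add: gderiv_def)
    show "((\<lambda>t. f (x + t *\<^sub>R v)) has_derivative (\<lambda>h. (h *\<^sub>R v) \<bullet> G (x + t *\<^sub>R v))) (at t)"
      by (rule has_derivative_compose[OF 1 2])
  next
    fix \<xi> assume "0 < \<xi>" "\<xi> < s"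
      "f (x + s *\<^sub>R v) - f (x + 0 *\<^sub>R v) = (\<lambda>h. (h *\<^sub>R v) \<bullet> G (x + \<xi> *\<^sub>R v)) (s - 0)"
    then show "\<exists>t\<in>{0<..<s}. f (x + s *\<^sub>R v) - f (x + 0 *\<^sub>R v) = (\<lambda>h. (h *\<^sub>R v) \<bullet> G (x + t *\<^sub>R v)) (s - 0)"
      by (intro bexI[of _ \<xi>]) auto
  qed
  then obtain t where t: "0 < t" "t < s" "f (x + s *\<^sub>R v) - f x = s * (v \<bullet> G (x + t *\<^sub>R v))" by auto
  have "f (x + s *\<^sub>R v) - f x - s * (v \<bullet> a) = s * (v \<bullet> (G (x + t *\<^sub>R v) - a))"
    unfolding t(3) by (simp add: inner_diff_right right_diff_distrib)
  then have "\<bar>f (x + s *\<^sub>R v) - f x - s * (v \<bullet> a)\<bar> = s * \<bar>v \<bullet> (G (x + t *\<^sub>R v) - a)\<bar>"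
    using s by (simp add: abs_mult)
  also have "\<dots> \<le> s * (norm v * \<epsilon>)"
  proof (intro mult_left_mono)
    have "\<bar>v \<bullet> (G (x + t *\<^sub>R v) - a)\<bar> \<le> norm v * norm (G (x + t *\<^sub>R v) - a)" by (rule Cauchy_Schwarz_ineq2)
    also have "\<dots> \<le> norm v * \<epsilon>" using G[of t] t by (intro mult_left_mono) auto
    finally show "\<bar>v \<bullet> (G (x + t *\<^sub>R v) - a)\<bar> \<le> norm v * \<epsilon>" .
  qed (use s in simp)
  finally show ?thesis by (simp add: mult_ac)
qed

text \<open>Expands the positive part alone, so that \<open>f\<close> and \<open>- f\<close> may
  have unrelated gradients. The second clause is a sign, which an error of size \<epsilon> * dist in
  the first cannot give; it is the source of the cone condition in
  \<open>flat_bound_excluded\<close>.\<close>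

definition phase_expansion :: "('a::euclidean_space \<Rightarrow> real) \<Rightarrow> 'a \<Rightarrow> 'a \<Rightarrow> bool" where
  "phase_expansion f x0 a \<longleftrightarrow> (\<forall>\<epsilon>>0. \<forall>\<^sub>F x in nhds x0.
     \<bar>max (f x) 0 - max ((x - x0) \<bullet> a) 0\<bar> \<le> \<epsilon> * dist x x0 \<and> ((x - x0) \<bullet> a \<le> - \<epsilon> * dist x x0 \<longrightarrow> f x \<le> 0))"

text \<open>No regularity of the phase boundary enters here: if the limiting gradient \<open>a\<close> is nonzero, the
  function increases along directions close to \<open>a\<close>, so the phase contains a cone at \<open>x0\<close> and misses
  the opposite one.\<close>

lemma phase_expansion_closure:
  fixes f :: "'a::euclidean_space \<Rightarrow> real"
  assumes D: "open D" and P: "P = pos_phase D f" "open P" and f: "continuous_on (closure P \<inter> D) f"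
    and G: "continuous_on (closure P \<inter> D) G" "\<And>y. y \<in> P \<Longrightarrow> GDERIV f y :> G y"
    and x0: "x0 \<in> D" "f x0 = 0" "x0 \<in> closure P"
  shows "phase_expansion f x0 (G x0)"
  unfolding phase_expansion_def
proof (intro allI impI)
  fix \<epsilon> :: real assume \<epsilon>: "\<epsilon> > 0"
  let ?a = "G x0"
  have fP: "\<forall>y\<in>P. f y > 0" and fN: "\<forall>y\<in>D - P. f y \<le> 0" by (auto simp: P pos_phase_def)
  have G2: "\<forall>y\<in>P. GDERIV f y :> G y" using G(2) by blast
  obtain d1 where d1: "d1 > 0" "\<And>y. y \<in> closure P \<inter> D \<Longrightarrow> dist y x0 < d1 \<Longrightarrow> dist (G y) ?a < \<epsilon>"
    using G(1) x0 \<epsilon> unfolding continuous_on_iff by (metis IntI)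
  obtain d2 where d2: "d2 > 0" "ball x0 d2 \<subseteq> D" using D x0(1) open_contains_ball by blast
  define d where "d = min d1 d2"
  have d: "d > 0" "ball x0 d \<subseteq> D" using d1 d2 by (auto simp: d_def)
  have Ga: "norm (G y - ?a) \<le> \<epsilon>" if "y \<in> P" "y \<in> ball x0 d" for y
    using d1(2)[of y] that d(2) closure_subset by (fastforce simp: d_def dist_norm norm_minus_commute)
  have mv: "\<bar>f (x + s *\<^sub>R v) - f x - s * (v \<bullet> ?a)\<bar> \<le> \<epsilon> * (s * norm v)"
    if s: "0 < s" "s \<le> 1" and b: "\<And>t. 0 \<le> t \<Longrightarrow> t \<le> 1 \<Longrightarrow> x + t *\<^sub>R v \<in> ball x0 d"
      and P': "\<And>t. 0 \<le> t \<Longrightarrow> t < s \<Longrightarrow> x + t *\<^sub>R v \<in> P" and e: "x + s *\<^sub>R v \<in> closure P" for x v s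
  proof (rule segment_mean_value[OF s(1) P' _ f G2])
    show "x + t *\<^sub>R v \<in> closure P \<inter> D" if "0 \<le> t" "t \<le> s" for t
    proof (cases "t = s")
      case True
      then show ?thesis using e b[of s] s d(2) by auto
    next
      case False
      then have "x + t *\<^sub>R v \<in> P" using P' that by simp
      then show ?thesis using closure_subset b[of t] that s d(2) by (meson IntI order_trans subsetD)
    qed
    show "norm (G (x + t *\<^sub>R v) - ?a) \<le> \<epsilon>" if "0 \<le> t" "t < s" for t
      by (rule Ga[OF P'[OF that] b]) (use that s in auto)
  qed
  have toward: "x + t *\<^sub>R (x0 - x) \<in> ball x0 d" if "x \<in> ball x0 d" "0 \<le> t" "t \<le> 1" for x t
  proof -
    have "x0 - (x + t *\<^sub>R (x0 - x)) = (1 - t) *\<^sub>R (x0 - x)" by (simp add: algebra_simps)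
    then have "dist x0 (x + t *\<^sub>R (x0 - x)) = (1 - t) * dist x0 x" using that by (simp add: dist_norm)
    also have "\<dots> \<le> 1 * dist x0 x" using that by (intro mult_right_mono) auto
    finally show ?thesis using that by simp
  qed
  \<comment> \<open>Moving from a point of \<open>P\<close> towards \<open>x0\<close> must leave
    \<open>P\<close>, as f x0 = 0. Exit at the fraction s of the way shows that f x is s times the
    linear term, up to the error. Then s \<le> 1 gives the upper bound, and f x > 0 excludes the
    cone opposite to the gradient.\<close>
  have inward: "\<exists>s. 0 < s \<and> s \<le> 1 \<and> \<bar>f x - s * ((x - x0) \<bullet> ?a)\<bar> \<le> \<epsilon> * (s * dist x x0)"
    if x: "x \<in> P" "x \<in> ball x0 d" for x
  proof (rule segment_exit[OF P(2) x(1) _ f fP fN, of "x0 - x"])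
    show "x + s *\<^sub>R (x0 - x) \<in> D" if "0 \<le> s" "s \<le> 1" for s using toward[OF x(2) that] d(2) by blast
  next
    assume "\<And>s. 0 \<le> s \<Longrightarrow> s \<le> 1 \<Longrightarrow> x + s *\<^sub>R (x0 - x) \<in> P"
    from this[of 1] have "x0 \<in> P" by simp
    then show ?thesis using fP x0(2) by force
  next
    fix s assume s: "0 < s" "s \<le> 1" and s3: "\<And>t. 0 \<le> t \<Longrightarrow> t < s \<Longrightarrow> x + t *\<^sub>R (x0 - x) \<in> P"
      and s4: "f (x + s *\<^sub>R (x0 - x)) = 0" "x + s *\<^sub>R (x0 - x) \<in> closure P"
    have "\<bar>f (x + s *\<^sub>R (x0 - x)) - f x - s * ((x0 - x) \<bullet> ?a)\<bar> \<le> \<epsilon> * (s * norm (x0 - x))"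
      by (rule mv[OF s toward[OF x(2)] s3 s4(2)])
    moreover have "(x0 - x) \<bullet> ?a = - ((x - x0) \<bullet> ?a)" by (simp add: inner_diff_left)
    ultimately have "\<bar>f x - s * ((x - x0) \<bullet> ?a)\<bar> \<le> \<epsilon> * (s * dist x x0)"
      using s4(1) by (simp add: dist_norm norm_minus_commute abs_minus_commute)
    then show ?thesis using s by blast
  qed
  \<comment> \<open>\<open>x\<close> is not known to lie in \<open>P\<close>. Points
    \<open>k n\<close> of \<open>P\<close> tending to \<open>x0\<close> are moved by x - x0: along
    this segment the mean value theorem rules out a return to the value 0, so it stays in
    \<open>P\<close>, and the limit gives the lower bound at \<open>x\<close>.\<close>
  have outward: "(x - x0) \<bullet> ?a - \<epsilon> * dist x x0 \<le> max (f x) 0"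
    if x: "x \<in> ball x0 (d / 2)" for x
  proof (cases "(x - x0) \<bullet> ?a \<le> \<epsilon> * dist x x0")
    case True
    then show ?thesis by simp
  next
    case False
    let ?v = "x - x0"
    obtain k where k: "\<And>n. k n \<in> P" "k \<longlonglongrightarrow> x0" using x0(3) closure_sequential by metis
    have key: "y + ?v \<in> P \<and> ?v \<bullet> ?a - \<epsilon> * norm ?v \<le> f (y + ?v)" if y: "y \<in> P" "y \<in> ball x0 (d / 2)" for y
    proof -
      have b: "y + t *\<^sub>R ?v \<in> ball x0 d" if "0 \<le> t" "t \<le> 1" for t
      proof -
        have "dist x0 (y + t *\<^sub>R ?v) \<le> dist x0 y + dist y (y + t *\<^sub>R ?v)" by (rule dist_triangle)
        also have "dist y (y + t *\<^sub>R ?v) = t * norm ?v" using that by (simp add: dist_norm)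
        also have "t * norm ?v \<le> 1 * norm ?v" using that by (intro mult_right_mono) auto
        finally show ?thesis using y(2) x by (simp add: dist_norm norm_minus_commute)
      qed
      have seg: "\<And>s. 0 \<le> s \<Longrightarrow> s \<le> 1 \<Longrightarrow> y + s *\<^sub>R ?v \<in> P"
      proof (rule segment_exit[OF P(2) y(1) _ f fP fN, of ?v])
        show "y + s *\<^sub>R ?v \<in> D" if "0 \<le> s" "s \<le> 1" for s using b[OF that] d(2) by blast
      next
        fix s t :: real assume "\<And>s. 0 \<le> s \<Longrightarrow> s \<le> 1 \<Longrightarrow> y + s *\<^sub>R ?v \<in> P" "0 \<le> t" "t \<le> 1"
        then show "y + t *\<^sub>R ?v \<in> P" by blast
      next
        fix s t :: real assume s: "0 < s" "s \<le> 1" and s3: "\<And>t. 0 \<le> t \<Longrightarrow> t < s \<Longrightarrow> y + t *\<^sub>R ?v \<in> P"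
          and s4: "f (y + s *\<^sub>R ?v) = 0" "y + s *\<^sub>R ?v \<in> closure P"
        have "\<bar>f (y + s *\<^sub>R ?v) - f y - s * (?v \<bullet> ?a)\<bar> \<le> \<epsilon> * (s * norm ?v)"
          by (rule mv[OF s b s3 s4(2)])
        then have "f y + s * (?v \<bullet> ?a) \<le> \<epsilon> * (s * norm ?v)" using s4(1) by simp
        moreover have "s * (\<epsilon> * norm ?v) < s * (?v \<bullet> ?a)"
          using False s(1) by (intro mult_strict_left_mono) (auto simp: dist_norm)
        ultimately have False using bspec[OF fP y(1)] by (simp add: mult_ac)
        then show "y + t *\<^sub>R ?v \<in> P" ..
      qed
      have one: "y + 1 *\<^sub>R ?v \<in> P" by (rule seg) auto
      have "\<bar>f (y + 1 *\<^sub>R ?v) - f y - 1 * (?v \<bullet> ?a)\<bar> \<le> \<epsilon> * (1 * norm ?v)"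
        by (rule mv[OF _ _ b seg]) (use one closure_subset in auto)
      then have "?v \<bullet> ?a - \<epsilon> * norm ?v \<le> f (y + ?v)" using bspec[OF fP y(1)] by simp
      then show ?thesis using one by simp
    qed
    have "\<forall>\<^sub>F n in sequentially. k n \<in> ball x0 (d / 2)"
      using k(2) d(1) by (intro topological_tendstoD) auto
    then obtain N where N: "\<And>n. n \<ge> N \<Longrightarrow> k n \<in> ball x0 (d / 2)" by (auto simp: eventually_sequentially)
    define z where "z n = k (n + N) + ?v" for n
    have zP: "z n \<in> P" "?v \<bullet> ?a - \<epsilon> * norm ?v \<le> f (z n)" for n
      using key[OF k(1) N[of "n + N"]] by (auto simp: z_def)
    have "z \<longlonglongrightarrow> x0 + ?v" unfolding z_def by (intro tendsto_intros LIMSEQ_ignore_initial_segment k(2))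
    then have zl: "z \<longlonglongrightarrow> x" by simp
    have xc: "x \<in> closure P" using zP(1) zl closure_sequential by blast
    have xD: "x \<in> D" using x d by auto
    have PD: "P \<subseteq> D" by (auto simp: P pos_phase_def)
    have "(\<lambda>n. f (z n)) \<longlonglongrightarrow> f x"
      by (rule continuous_on_tendsto_compose[OF f zl])
        (use xc xD zP(1) PD closure_subset in \<open>auto intro!: always_eventually\<close>)
    then have "?v \<bullet> ?a - \<epsilon> * norm ?v \<le> f x" by (rule LIMSEQ_le_const) (use zP(2) in auto)
    then show ?thesis by (simp add: dist_norm)
  qed
  have "\<forall>\<^sub>F x in nhds x0. x \<in> ball x0 (d / 2)" using d(1) by (intro eventually_nhds_in_open) auto
  then show "\<forall>\<^sub>F x in nhds x0. \<bar>max (f x) 0 - max ((x - x0) \<bullet> ?a) 0\<bar> \<le> \<epsilon> * dist x x0 \<and>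
      ((x - x0) \<bullet> ?a \<le> - \<epsilon> * dist x x0 \<longrightarrow> f x \<le> 0)"
  proof eventually_elim
    case (elim x)
    then have xd: "x \<in> ball x0 d" using d(1) by auto
    have lo: "max ((x - x0) \<bullet> ?a) 0 - \<epsilon> * dist x x0 \<le> max (f x) 0"
    proof -
      have "0 \<le> \<epsilon> * dist x x0" using \<epsilon> by simp
      then show ?thesis using outward[OF elim] by linarith
    qed
    have e0: "0 \<le> \<epsilon> * dist x x0" using \<epsilon> by simp
    show ?case
    proof (cases "x \<in> P")
      case False
      then have "f x \<le> 0" using fN d(2) xd by blast
      then have "\<bar>max (f x) 0 - max ((x - x0) \<bullet> ?a) 0\<bar> \<le> \<epsilon> * dist x x0"
        using lo e0 by linarith
      then show ?thesis using \<open>f x \<le> 0\<close> by blast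
    next
      case True
      obtain s where s: "0 < s" "s \<le> 1" "\<bar>f x - s * ((x - x0) \<bullet> ?a)\<bar> \<le> \<epsilon> * (s * dist x x0)"
        using inward[OF True xd] by blast
      have "s * ((x - x0) \<bullet> ?a) \<le> max ((x - x0) \<bullet> ?a) 0"
      proof (cases "(x - x0) \<bullet> ?a \<ge> 0")
        case t: True
        then show ?thesis using s mult_right_mono[OF s(2) t] by simp
      next
        case f: False
        then have "s * ((x - x0) \<bullet> ?a) \<le> 0" using s by (intro mult_nonneg_nonpos) auto
        then show ?thesis by simp
      qed
      moreover have "\<epsilon> * (s * dist x x0) \<le> \<epsilon> * (1 * dist x x0)"
        using s \<epsilon> by (intro mult_left_mono mult_right_mono) auto
      ultimately have up: "f x \<le> max ((x - x0) \<bullet> ?a) 0 + \<epsilon> * dist x x0" using s(3) by linarith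
      have "\<not> (x - x0) \<bullet> ?a \<le> - \<epsilon> * dist x x0"
      proof
        assume "(x - x0) \<bullet> ?a \<le> - \<epsilon> * dist x x0"
        then have "s * ((x - x0) \<bullet> ?a) \<le> s * (- \<epsilon> * dist x x0)" using s by (intro mult_left_mono) auto
        then have "f x \<le> 0" using s(3) by (simp add: mult_ac)
        then show False using bspec[OF fP True] by simp
      qed
      moreover have "max (f x) 0 = f x" using bspec[OF fP True] by simp
      ultimately have "\<bar>max (f x) 0 - max ((x - x0) \<bullet> ?a) 0\<bar> \<le> \<epsilon> * dist x x0"
        using lo up by linarith
      then show ?thesis using \<open>\<not> (x - x0) \<bullet> ?a \<le> - \<epsilon> * dist x x0\<close> by blast
    qed
  qed
qed

text \<open>Unless the positive part vanishes near \<open>x0\<close>, the point is a limit point of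
  the phase, and the limit of gradients within the phase is the value of their continuous extension.
  In the exceptional case the gradient is 0 by convention and the expansion is trivial.\<close>

lemma phase_expansion_inner_gradient:
  fixes Q :: "'a::euclidean_space \<Rightarrow> real"
  assumes D: "open D" and C1: "C1_up_to_boundary Q (pos_phase D Q) D" and P: "open (pos_phase D Q)"
    and x0: "x0 \<in> D" "Q x0 = 0"
  shows "phase_expansion Q x0 (inner_gradient D (pos_part Q) x0)"
proof (cases "\<forall>\<^sub>F x in nhds x0. pos_part Q x = 0")
  case True
  then have a: "inner_gradient D (pos_part Q) x0 = 0" by (simp add: inner_gradient_def)
  show ?thesis unfolding phase_expansion_def a
  proof (intro allI impI)
    fix \<epsilon> :: real assume \<epsilon>: "\<epsilon> > 0"
    from True show "\<forall>\<^sub>F x in nhds x0. \<bar>max (Q x) 0 - max ((x - x0) \<bullet> 0) 0\<bar> \<le> \<epsilon> * dist x x0 \<and>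
        ((x - x0) \<bullet> 0 \<le> - \<epsilon> * dist x x0 \<longrightarrow> Q x \<le> 0)"
      by eventually_elim (use \<epsilon> in \<open>auto simp: pos_part_def max_def split: if_splits\<close>)
  qed
next
  case False
  let ?P = "pos_phase D Q"
  obtain G where f: "continuous_on (closure ?P \<inter> D) Q" and G: "continuous_on (closure ?P \<inter> D) G"
    "\<And>x. x \<in> ?P \<Longrightarrow> GDERIV Q x :> G x"
    using C1 by (auto simp: C1_up_to_boundary_def)
  have x0c: "x0 \<in> closure ?P"
  proof (rule ccontr)
    assume "x0 \<notin> closure ?P"
    then have "\<forall>\<^sub>F x in nhds x0. x \<in> - closure ?P \<inter> D" using D x0(1) by (intro eventually_nhds_in_open) auto
    then have "\<forall>\<^sub>F x in nhds x0. pos_part Q x = 0"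
    proof eventually_elim
      case (elim x)
      then have "x \<notin> ?P" "x \<in> D" using closure_subset by blast+
      then show ?case by (simp add: pos_part_def pos_phase_def)
    qed
    then show False using False by simp
  qed
  have x0P: "x0 \<notin> ?P" using x0(2) by (simp add: pos_phase_def)
  have wP: "pos_phase D (pos_part Q) = ?P" by (auto simp: pos_phase_def pos_part_def)
  have gw: "gradient (pos_part Q) x = G x" if "x \<in> ?P" for x
    by (rule gradient_eq[OF GDERIV_transform_open[OF G(2)[OF that] P that]])
      (auto simp: pos_phase_def pos_part_def)
  have "(G \<longlongrightarrow> G x0) (at x0 within closure ?P \<inter> D)"
    using G(1) x0c x0(1) by (simp add: continuous_on_def)
  moreover have "?P \<subseteq> closure ?P \<inter> D"
    using closure_subset[of ?P] by (auto simp: pos_phase_def)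
  ultimately have "(G \<longlongrightarrow> G x0) (at x0 within ?P)" by (rule tendsto_within_subset)
  moreover have "\<forall>\<^sub>F x in at x0 within ?P. G x = gradient (pos_part Q) x"
    by (simp add: eventually_at_filter gw)
  ultimately have "(gradient (pos_part Q) \<longlongrightarrow> G x0) (at x0 within ?P)" by (rule Lim_transform_eventually)
  moreover have "at x0 within ?P \<noteq> bot"
    using x0c x0P by (simp add: trivial_limit_within islimpt_in_closure)
  ultimately have "Lim (at x0 within ?P) (gradient (pos_part Q)) = G x0" by (intro tendsto_Lim) auto
  then have "inner_gradient D (pos_part Q) x0 = G x0" using False by (simp add: inner_gradient_def wP)
  then show ?thesis
    using phase_expansion_closure[OF D refl P f G x0 x0c] by simp
qed

lemma phase_expansion_ray:
  fixes f :: "'a::euclidean_space \<Rightarrow> real"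
  assumes f: "phase_expansion f x0 a" and e: "e \<bullet> a > 0"
  shows "\<forall>\<^sub>F s in at_right 0. f (x0 + s *\<^sub>R e) > 0"
proof -
  have e0: "norm e > 0" using e by auto
  define \<epsilon> where "\<epsilon> = (e \<bullet> a) / (2 * norm e)"
  have \<epsilon>: "\<epsilon> > 0" "\<epsilon> * norm e = (e \<bullet> a) / 2" using e e0 by (auto simp: \<epsilon>_def)
  have "((\<lambda>s. x0 + s *\<^sub>R e) \<longlongrightarrow> x0 + 0 *\<^sub>R e) (at_right 0)" by (intro tendsto_intros)
  then have lim: "((\<lambda>s. x0 + s *\<^sub>R e) \<longlongrightarrow> x0) (at_right 0)" by simp
  have "\<forall>\<^sub>F x in nhds x0. \<bar>max (f x) 0 - max ((x - x0) \<bullet> a) 0\<bar> \<le> \<epsilon> * dist x x0"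
    using f[unfolded phase_expansion_def, rule_format, OF \<epsilon>(1)] by eventually_elim blast
  then have "\<forall>\<^sub>F s in at_right 0. \<bar>max (f (x0 + s *\<^sub>R e)) 0 - max ((x0 + s *\<^sub>R e - x0) \<bullet> a) 0\<bar>
      \<le> \<epsilon> * dist (x0 + s *\<^sub>R e) x0"
    using lim by (rule eventually_compose_filterlim)
  then show ?thesis using eventually_at_right_less[of "0::real"]
  proof eventually_elim
    case (elim s)
    have "\<epsilon> * dist (x0 + s *\<^sub>R e) x0 = s * (\<epsilon> * norm e)" using elim(2) by (simp add: dist_norm)
    moreover have "max ((x0 + s *\<^sub>R e - x0) \<bullet> a) 0 = s * (e \<bullet> a)" using elim(2) e by simp
    ultimately have "s * (e \<bullet> a) - s * ((e \<bullet> a) / 2) \<le> max (f (x0 + s *\<^sub>R e)) 0"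
      using elim(1) unfolding \<epsilon>(2) by linarith
    moreover have "0 < s * (e \<bullet> a)" using elim(2) e by simp
    ultimately show ?case by (simp add: max_def split: if_splits)
  qed
qed

text \<open>If the unit vectors were not opposite, their sum would have positive inner product with
  both gradients, and \<open>f\<close> and \<open>- f\<close> would both be positive along that ray.
  This gives the two phases a common normal direction.\<close>

lemma phase_expansion_opposite:
  fixes f :: "'a::euclidean_space \<Rightarrow> real"
  assumes f: "phase_expansion f x0 a" "phase_expansion (\<lambda>x. - f x) x0 b" and ne: "a \<noteq> 0" "b \<noteq> 0"
  shows "b /\<^sub>R norm b = - (a /\<^sub>R norm a)"
proof (rule ccontr)
  define \<alpha> \<beta> where ab: "\<alpha> = a /\<^sub>R norm a" "\<beta> = b /\<^sub>R norm b"
  assume "b /\<^sub>R norm b \<noteq> - (a /\<^sub>R norm a)"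
  then have "\<alpha> + \<beta> \<noteq> 0" by (simp add: ab add_eq_0_iff)
  then have "0 < (\<alpha> + \<beta>) \<bullet> (\<alpha> + \<beta>)" by simp
  moreover have n: "\<alpha> \<bullet> \<alpha> = 1" "\<beta> \<bullet> \<beta> = 1"
    using ne by (simp_all add: ab dot_square_norm power2_eq_square)
  ultimately have pos: "0 < 1 + \<alpha> \<bullet> \<beta>" by (simp add: inner_add inner_commute)
  have "a = norm a *\<^sub>R \<alpha>" "b = norm b *\<^sub>R \<beta>" using ne by (simp_all add: ab)
  then have "(\<alpha> + \<beta>) \<bullet> a = norm a * (1 + \<alpha> \<bullet> \<beta>)" "(\<alpha> + \<beta>) \<bullet> b = norm b * (1 + \<alpha> \<bullet> \<beta>)"
    using n by (metis inner_add_left inner_commute inner_scaleR_right,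
      metis inner_add_left add.commute inner_scaleR_right)
  then have "(\<alpha> + \<beta>) \<bullet> a > 0" "(\<alpha> + \<beta>) \<bullet> b > 0" using pos ne by simp_all
  from phase_expansion_ray[OF f(1) this(1)] phase_expansion_ray[OF f(2) this(2)]
  have "\<forall>\<^sub>F s::real in at_right 0. False" by eventually_elim simp
  then show False by simp
qed

section \<open>From touching functions to excluded bounds\<close>

lemma max_inner_unit:
  fixes a y :: "'a::real_inner"
  assumes "a \<noteq> 0"
  shows "norm a * max (y \<bullet> (a /\<^sub>R norm a)) 0 = max (y \<bullet> a) 0"
  using assms by (simp add: max_mult_distrib_left mult.assoc[symmetric])

text \<open>As u \<ge> 0 near \<open>x0\<close>, any negative slope may be put into the lower bound.
  With l2 the balance condition reduces to norm a > l1.\<close>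

lemma touching_below_steep:
  fixes u :: "'a::euclidean_space \<Rightarrow> real"
  assumes p: "1 < p" and l: "l1 > 0" "l2 > 0" and lm: "locally_minimal p l1 l2 D u"
    and x0: "x0 \<in> D" "u x0 = 0" and Q: "\<forall>\<^sub>F x in nhds x0. Q x \<le> u x"
    and a: "phase_expansion Q x0 a" and u: "\<forall>\<^sub>F x in nhds x0. u x \<ge> 0"
  shows "norm a \<le> l1"
proof (rule ccontr)
  assume "\<not> norm a \<le> l1"
  then have A: "l1 < norm a" by simp
  then have a0: "a \<noteq> 0" using l by auto
  have pw: "l1 powr p < norm a powr p" using A l p by (intro powr_less_mono2) auto
  show False
  proof (rule steep_bound_excluded[OF p l lm x0 _ A l(2)])
    show "norm (a /\<^sub>R norm a) = 1" using a0 by simp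
    show "l1 powr p - l2 powr p < norm a powr p - l2 powr p" using pw by simp
    fix \<epsilon> :: real assume "\<epsilon> > 0"
    then have "\<forall>\<^sub>F x in nhds x0. \<bar>max (Q x) 0 - max ((x - x0) \<bullet> a) 0\<bar> \<le> \<epsilon> * dist x x0 \<and>
        ((x - x0) \<bullet> a \<le> - \<epsilon> * dist x x0 \<longrightarrow> Q x \<le> 0)"
      using a by (simp add: phase_expansion_def)
    then show "\<forall>\<^sub>F x in nhds x0. norm a * max ((x - x0) \<bullet> (a /\<^sub>R norm a)) 0
        - l2 * max (- ((x - x0) \<bullet> (a /\<^sub>R norm a))) 0 - \<epsilon> * dist x x0 \<le> u x"
      using Q u
    proof eventually_elim
      case (elim x)
      have "0 \<le> l2 * max (- ((x - x0) \<bullet> (a /\<^sub>R norm a))) 0" using l by simp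
      then show ?case unfolding max_inner_unit[OF a0] using elim by linarith
    qed
  qed
qed

text \<open>A nonzero \<open>b\<close> points into the negative phase of Q, so - b / |b| is the
  direction for the flat barrier. If b = 0, there is no such direction and the centred barrier takes
  over.\<close>

lemma touching_below_flat:
  fixes u :: "'a::euclidean_space \<Rightarrow> real"
  assumes p: "1 < p" and l: "l1 > 0" "l2 > 0" and lm: "locally_minimal p l1 l2 D u"
    and x0: "x0 \<in> D" and Q: "\<forall>\<^sub>F x in nhds x0. Q x \<le> u x"
    and b: "phase_expansion (\<lambda>x. - Q x) x0 b" and u: "\<exists>\<^sub>F x in nhds x0. u x < 0"
  shows "l2 \<le> norm b"
proof (rule ccontr)
  assume "\<not> l2 \<le> norm b"
  then have B: "norm b < l2" by simp
  have ex: "\<forall>\<^sub>F x in nhds x0. \<bar>max (- Q x) 0 - max ((x - x0) \<bullet> b) 0\<bar> \<le> \<epsilon> * dist x x0 \<and>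
      ((x - x0) \<bullet> b \<le> - \<epsilon> * dist x x0 \<longrightarrow> - Q x \<le> 0)" if "\<epsilon> > 0" for \<epsilon>
    using b that by (simp add: phase_expansion_def)
  show False
  proof (cases "b = 0")
    case True
    show False
    proof (rule small_bound_excluded[OF p l(2) lm x0 u])
      fix \<epsilon> :: real assume "\<epsilon> > 0"
      from ex[OF this] Q show "\<forall>\<^sub>F x in nhds x0. - \<epsilon> * dist x x0 \<le> u x"
      proof eventually_elim
        case (elim x)
        have "max ((x - x0) \<bullet> b) 0 = 0" by (simp add: True)
        then show ?case using elim by linarith
      qed
    qed
  next
    case False
    define e where "e = - (b /\<^sub>R norm b)"
    have be: "y \<bullet> e = - (y \<bullet> (b /\<^sub>R norm b))" for y by (simp add: e_def)
    have bd: "norm b * (y \<bullet> e) = - (y \<bullet> b)" for y using False by (simp add: e_def)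
    show False
    proof (rule flat_bound_excluded[OF p l lm x0 u _ _ B])
      show "norm e = 1" "0 < norm b" using False by (simp_all add: e_def)
      fix \<epsilon> :: real assume \<epsilon>: "\<epsilon> > 0"
      from ex[OF this] Q
      show "\<forall>\<^sub>F x in nhds x0. - norm b * max (- ((x - x0) \<bullet> e)) 0 - \<epsilon> * dist x x0 \<le> u x"
      proof eventually_elim
        case (elim x)
        have "norm b * max (- ((x - x0) \<bullet> e)) 0 = max ((x - x0) \<bullet> b) 0"
          unfolding be minus_minus by (rule max_inner_unit[OF False])
        then show ?case using elim by linarith
      qed
      \<comment> \<open>The cone is measured with the unit vector \<open>e\<close>, the expansion
        with \<open>b\<close>; hence the factor \<open>norm b\<close>.\<close>
      have "\<epsilon> * norm b > 0" using \<epsilon> False by simp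
      from ex[OF this] Q
      show "\<forall>\<^sub>F x in nhds x0. \<epsilon> * dist x x0 \<le> (x - x0) \<bullet> e \<longrightarrow> 0 \<le> u x"
      proof eventually_elim
        case (elim x)
        show ?case
        proof
          assume "\<epsilon> * dist x x0 \<le> (x - x0) \<bullet> e"
          then have "norm b * (\<epsilon> * dist x x0) \<le> norm b * ((x - x0) \<bullet> e)" by (rule mult_left_mono) simp
          then have "(x - x0) \<bullet> b \<le> - (\<epsilon> * norm b) * dist x x0" unfolding bd by (simp add: mult_ac)
          then have "- Q x \<le> 0" using elim(1) by blast
          then show "0 \<le> u x" using elim(2) by linarith
        qed
      qed
    qed
  qed
qed

text \<open>The bound \<open>lb\<close> makes \<open>b\<close> nonzero and turns a failing balance
  into l1 < norm a. Both gradients are then nonzero and opposite, and the two expansions add up to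
  one two-slope lower bound, each with half of the error.\<close>

lemma touching_below_balance:
  fixes u :: "'a::euclidean_space \<Rightarrow> real"
  assumes p: "1 < p" and l: "l1 > 0" "l2 > 0" and lm: "locally_minimal p l1 l2 D u"
    and x0: "x0 \<in> D" "u x0 = 0" and Q: "\<forall>\<^sub>F x in nhds x0. Q x \<le> u x"
    and a: "phase_expansion Q x0 a" and b: "phase_expansion (\<lambda>x. - Q x) x0 b" and lb: "l2 \<le> norm b"
  shows "norm a powr p - norm b powr p \<le> l1 powr p - l2 powr p"
proof (rule ccontr)
  assume "\<not> norm a powr p - norm b powr p \<le> l1 powr p - l2 powr p"
  then have AB: "l1 powr p - l2 powr p < norm a powr p - norm b powr p" by simp
  have "l2 powr p \<le> norm b powr p" using lb l p by (intro powr_mono2) auto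
  then have lt: "l1 powr p < norm a powr p" using AB by linarith
  have A: "l1 < norm a"
  proof (rule ccontr)
    assume "\<not> l1 < norm a"
    then have "norm a powr p \<le> l1 powr p" using p by (intro powr_mono2) auto
    then show False using lt by simp
  qed
  then have a0: "a \<noteq> 0" using l by auto
  have b0: "b \<noteq> 0" using lb l by auto
  define e where "e = a /\<^sub>R norm a"
  have be: "b /\<^sub>R norm b = - e" unfolding e_def by (rule phase_expansion_opposite[OF a b a0 b0])
  show False
  proof (rule steep_bound_excluded[OF p l lm x0 _ A _ AB])
    show "norm e = 1" "0 < norm b" using a0 b0 by (simp_all add: e_def)
    fix \<epsilon> :: real assume "\<epsilon> > 0"
    then have \<epsilon>: "\<epsilon> / 2 > 0" by simp
    from a[unfolded phase_expansion_def, rule_format, OF \<epsilon>]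
      b[unfolded phase_expansion_def, rule_format, OF \<epsilon>] Q
    show "\<forall>\<^sub>F x in nhds x0. norm a * max ((x - x0) \<bullet> e) 0 - norm b * max (- ((x - x0) \<bullet> e)) 0
        - \<epsilon> * dist x x0 \<le> u x"
    proof eventually_elim
      case (elim x)
      have "norm a * max ((x - x0) \<bullet> e) 0 = max ((x - x0) \<bullet> a) 0"
        unfolding e_def by (rule max_inner_unit[OF a0])
      moreover have "norm b * max (- ((x - x0) \<bullet> e)) 0 = max ((x - x0) \<bullet> b) 0"
        using max_inner_unit[OF b0, of "x - x0"] unfolding be by simp
      moreover have "\<epsilon> * dist x x0 = \<epsilon> / 2 * dist x x0 + \<epsilon> / 2 * dist x x0" by simp
      moreover have "Q x = max (Q x) 0 - max (- Q x) 0" by simp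
      ultimately show ?case using elim by linarith
    qed
  qed
qed

section \<open>Specialisation to comparison functions and free boundary points\<close>

lemma comparison_function_minus:
  fixes Q :: "'a::euclidean_space \<Rightarrow> real"
  assumes "C1_up_to_boundary Q A D"
  shows "C1_up_to_boundary (\<lambda>x. - Q x) A D"
proof -
  obtain G where "continuous_on (closure A \<inter> D) Q" "continuous_on (closure A \<inter> D) G"
    "\<And>x. x \<in> A \<Longrightarrow> GDERIV Q x :> G x"
    using assms by (auto simp: C1_up_to_boundary_def)
  then show ?thesis unfolding C1_up_to_boundary_def
    by (intro conjI exI[of _ "\<lambda>x. - G x"] ballI continuous_on_minus GDERIV_minus) auto
qed

lemma comparison_function_expansions:
  fixes Q :: "'a::euclidean_space \<Rightarrow> real"
  assumes D: "open D" and Q: "comparison_function D Q" and x0: "x0 \<in> D" "Q x0 = 0"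
  shows "phase_expansion Q x0 (inner_gradient D (pos_part Q) x0)"
    and "phase_expansion (\<lambda>x. - Q x) x0 (inner_gradient D (neg_part Q) x0)"
proof -
  have c: "C1_up_to_boundary Q (pos_phase D Q) D" "C1_up_to_boundary Q (neg_phase D Q) D"
    "open (pos_phase D Q)" "open (neg_phase D Q)"
    using Q by (auto simp: comparison_function_def Ck_on_def)
  show "phase_expansion Q x0 (inner_gradient D (pos_part Q) x0)"
    by (rule phase_expansion_inner_gradient[OF D c(1,3) x0])
  have n: "pos_phase D (\<lambda>x. - Q x) = neg_phase D Q" by (simp add: pos_phase_def neg_phase_def)
  have m: "pos_part (\<lambda>x. - Q x) = neg_part Q" by (simp add: pos_part_def neg_part_def fun_eq_iff)
  show "phase_expansion (\<lambda>x. - Q x) x0 (inner_gradient D (neg_part Q) x0)"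
    using phase_expansion_inner_gradient[of D "\<lambda>x. - Q x" x0] D comparison_function_minus[OF c(2)] c(4) x0
    unfolding n m by simp
qed

lemma local_minimizer_locally_minimal:
  assumes "1 < p" "open D" "local_minimizer p l1 l2 D u"
  shows "locally_minimal p l1 l2 D u"
  unfolding locally_minimal_def
proof (intro conjI allI impI)
  show "continuous_on D u" using assms(3) by (simp add: local_minimizer_def)
qed (rule assms(2), rule local_minimizer_minimality[OF assms(1,3)])

lemma locally_minimal_minus:
  assumes "locally_minimal p l1 l2 D u"
  shows "locally_minimal p l2 l1 D (\<lambda>x. - u x)"
proof -
  have "open D" "continuous_on D (\<lambda>x. - u x)"
    using assms by (auto simp: locally_minimal_def intro: continuous_on_minus)
  moreover have "\<exists>g. minimality p l2 l1 (ball c r) (\<lambda>x. - u x) g" if "r > 0" "cball c r \<subseteq> D" for c r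
    using assms that minimality_minus unfolding locally_minimal_def by blast
  ultimately show ?thesis by (simp add: locally_minimal_def)
qed

lemma free_boundary_zero:
  assumes "open D" "continuous_on D u" "x0 \<in> free_boundary D u"
  shows "u x0 = 0"
proof (rule ccontr)
  assume ne: "u x0 \<noteq> 0"
  have x0: "x0 \<in> D" using assms(3) by (simp add: free_boundary_def)
  have opp: "open (pos_phase D u)" "open (neg_phase D u)"
    using continuous_open_preimage[OF assms(2,1), of "{0<..}"]
      continuous_open_preimage[OF assms(2,1), of "{..<0}"]
    by (simp_all add: pos_phase_def neg_phase_def vimage_def Int_def)
  have dis: "pos_phase D u \<inter> neg_phase D u = {}" by (auto simp: pos_phase_def neg_phase_def)
  have "x0 \<in> pos_phase D u \<or> x0 \<in> neg_phase D u"
    using ne x0 by (auto simp: pos_phase_def neg_phase_def)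
  then have "x0 \<notin> frontier (pos_phase D u)" "x0 \<notin> frontier (neg_phase D u)"
    using opp dis by (auto simp: frontier_def interior_open open_Int_closure_eq_empty)
      (metis IntI disjoint_iff empty_iff inf_commute open_Int_closure_eq_empty)+
  then show False using assms(3) by (auto simp: free_boundary_def)
qed

lemma frontier_phase_frequently:
  fixes u :: "'a::euclidean_space \<Rightarrow> real"
  assumes x0: "x0 \<in> frontier {x \<in> D. P x}"
  shows "\<exists>\<^sub>F x in nhds x0. P x"
proof -
  have "x0 \<in> closure {x \<in> D. P x}" using x0 by (simp add: frontier_def)
  then show ?thesis
    unfolding frequently_def eventually_nhds closure_iff_nhds_not_empty by blast
qed

lemma not_frontier_phase_eventually:
  fixes x0 :: "'a::euclidean_space"
  assumes D: "open D" "x0 \<in> D" and x0: "x0 \<notin> frontier {x \<in> D. P x}" and n: "\<not> P x0"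
  shows "\<forall>\<^sub>F x in nhds x0. \<not> P x"
proof -
  have "x0 \<notin> closure {x \<in> D. P x}" using x0 n interior_subset by (fastforce simp: frontier_def)
  then have "\<forall>\<^sub>F x in nhds x0. x \<in> - closure {x \<in> D. P x} \<inter> D"
    using D by (intro eventually_nhds_in_open) auto
  then show ?thesis
  proof eventually_elim
    case (elim x)
    then have "x \<in> D" "x \<notin> {x \<in> D. P x}" using subsetD[OF closure_subset[of "{x \<in> D. P x}"]] by auto
    then show ?case by simp
  qed
qed

theorem lemma3p1:
  fixes D :: "'a::euclidean_space set" and u :: "'a \<Rightarrow> real"
    and p lam_pos lam_neg :: real
  assumes "1 < p" and "lam_pos > 0" and "lam_neg > 0"
    and "open D"
    and "local_minimizer p lam_pos lam_neg D u"
  shows "\<forall>x0 \<in> free_boundary D u. \<forall>Q. comparison_function D Q \<longrightarrow>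
    (touches_from_below D Q u x0 \<longrightarrow>
       (x0 \<in> Gamma_OP_pos D u \<longrightarrow>
          norm (inner_gradient D (pos_part Q) x0) \<le> lam_pos) \<and>
       (x0 \<in> Gamma_OP_neg D u \<longrightarrow>
          (\<forall>\<^sub>F x in nhds x0. pos_part Q x = 0) \<and>
          norm (inner_gradient D (neg_part Q) x0) \<ge> lam_neg) \<and>
       (x0 \<in> Gamma_TP D u \<longrightarrow>
          norm (inner_gradient D (neg_part Q) x0) \<ge> lam_neg \<and>
          norm (inner_gradient D (pos_part Q) x0) powr p
            - norm (inner_gradient D (neg_part Q) x0) powr p
            \<le> lam_pos powr p - lam_neg powr p)) \<and>
    (touches_from_above D Q u x0 \<longrightarrow>
       (x0 \<in> Gamma_OP_pos D u \<longrightarrow>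
          (\<forall>\<^sub>F x in nhds x0. neg_part Q x = 0) \<and>
          norm (inner_gradient D (pos_part Q) x0) \<ge> lam_pos) \<and>
       (x0 \<in> Gamma_OP_neg D u \<longrightarrow>
          norm (inner_gradient D (neg_part Q) x0) \<le> lam_neg) \<and>
       (x0 \<in> Gamma_TP D u \<longrightarrow>
          norm (inner_gradient D (pos_part Q) x0) \<ge> lam_pos \<and>
          norm (inner_gradient D (pos_part Q) x0) powr p
            - norm (inner_gradient D (neg_part Q) x0) powr p
            \<ge> lam_pos powr p - lam_neg powr p))"
proof (intro ballI allI impI, goal_cases)
  case (1 x0 Q)
  note fb = 1(1) and Q = 1(2)
  note p = assms(1) and lp = assms(2) and ln = assms(3) and D = assms(4)
  have lm: "locally_minimal p lam_pos lam_neg D u"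
    by (rule local_minimizer_locally_minimal[OF p D assms(5)])
  note lm' = locally_minimal_minus[OF lm]
  have x0: "x0 \<in> D" using fb by (simp add: free_boundary_def)
  have u0: "u x0 = 0"
    using lm by (intro free_boundary_zero[OF D _ fb]) (simp add: locally_minimal_def)
  then have u0': "- u x0 = 0" by simp
  define a b where "a = inner_gradient D (pos_part Q) x0" and "b = inner_gradient D (neg_part Q) x0"
  have exp: "phase_expansion Q x0 a" "phase_expansion (\<lambda>x. - Q x) x0 b" if "Q x0 = 0"
    unfolding a_def b_def by (rule comparison_function_expansions[OF D Q x0 that])+
  have pos: "\<exists>\<^sub>F x in nhds x0. u x > 0" if "x0 \<in> frontier (pos_phase D u)"
    using frontier_phase_frequently[of x0 D "\<lambda>x. u x > 0"] that by (simp add: pos_phase_def)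
  have neg: "\<exists>\<^sub>F x in nhds x0. u x < 0" if "x0 \<in> frontier (neg_phase D u)"
    using frontier_phase_frequently[of x0 D "\<lambda>x. u x < 0"] that by (simp add: neg_phase_def)
  have npos: "\<forall>\<^sub>F x in nhds x0. u x \<le> 0" if "x0 \<notin> frontier (pos_phase D u)"
    using not_frontier_phase_eventually[OF D x0, of "\<lambda>x. u x > 0"] that u0
    by (simp add: pos_phase_def not_less)
  have nneg: "\<forall>\<^sub>F x in nhds x0. u x \<ge> 0" if "x0 \<notin> frontier (neg_phase D u)"
    using not_frontier_phase_eventually[OF D x0, of "\<lambda>x. u x < 0"] that u0
    by (simp add: neg_phase_def not_less)
  have below: "(x0 \<in> Gamma_OP_pos D u \<longrightarrow> norm a \<le> lam_pos) \<and>
      (x0 \<in> Gamma_OP_neg D u \<longrightarrow> (\<forall>\<^sub>F x in nhds x0. pos_part Q x = 0) \<and> norm b \<ge> lam_neg) \<and>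
      (x0 \<in> Gamma_TP D u \<longrightarrow> norm b \<ge> lam_neg \<and>
        norm a powr p - norm b powr p \<le> lam_pos powr p - lam_neg powr p)"
    if t: "touches_from_below D Q u x0"
  proof -
    have Q0: "Q x0 = 0" and le: "\<forall>\<^sub>F x in nhds x0. Q x \<le> u x"
      using t u0 by (simp_all add: touches_from_below_def)
    note ex = exp[OF Q0]
    \<comment> \<open>This requires only points with u < 0 arbitrarily close to \<open>x0\<close>,
      so it serves both \<open>Gamma_OP_neg\<close> and \<open>Gamma_TP\<close>.\<close>
    note flat = touching_below_flat[OF p lp ln lm x0 le ex(2) neg]
    note bal = touching_below_balance[OF p lp ln lm x0 u0 le ex]
    have "norm a \<le> lam_pos" if "x0 \<in> Gamma_OP_pos D u"
      by (rule touching_below_steep[OF p lp ln lm x0 u0 le ex(1) nneg])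
        (use that in \<open>simp add: Gamma_OP_pos_def\<close>)
    moreover have "\<forall>\<^sub>F x in nhds x0. pos_part Q x = 0" if "x0 \<in> Gamma_OP_neg D u"
    proof -
      have "x0 \<notin> frontier (pos_phase D u)" using that by (simp add: Gamma_OP_neg_def)
      from npos[OF this] le show ?thesis by eventually_elim (simp add: pos_part_def)
    qed
    ultimately show ?thesis using flat bal by (auto simp: Gamma_OP_neg_def Gamma_TP_def)
  qed
  have above: "(x0 \<in> Gamma_OP_pos D u \<longrightarrow> (\<forall>\<^sub>F x in nhds x0. neg_part Q x = 0) \<and> norm a \<ge> lam_pos) \<and>
      (x0 \<in> Gamma_OP_neg D u \<longrightarrow> norm b \<le> lam_neg) \<and>
      (x0 \<in> Gamma_TP D u \<longrightarrow> norm a \<ge> lam_pos \<and>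
        norm a powr p - norm b powr p \<ge> lam_pos powr p - lam_neg powr p)"
    if t: "touches_from_above D Q u x0"
  proof -
    have Q0: "Q x0 = 0" and le: "\<forall>\<^sub>F x in nhds x0. - Q x \<le> - u x"
      using t u0 by (simp_all add: touches_from_above_def)
    \<comment> \<open>For \<open>- Q\<close> the gradients trade places: \<open>b\<close> now
      belongs to the positive part and \<open>a\<close> to the negative part, along with the
      exchange of the two constants. This reverses the balance inequality.\<close>
    have ex: "phase_expansion (\<lambda>x. - (- Q x)) x0 a" "phase_expansion (\<lambda>x. - Q x) x0 b"
      using exp[OF Q0] by simp_all
    have flat: "lam_pos \<le> norm a" if "x0 \<in> frontier (pos_phase D u)"
      using touching_below_flat[OF p ln lp lm' x0 le ex(1)] pos[OF that] by simp
    have bal: "norm b powr p - norm a powr p \<le> lam_neg powr p - lam_pos powr p" if "lam_pos \<le> norm a"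
      by (rule touching_below_balance[OF p ln lp lm' x0 u0' le ex(2,1) that])
    have "norm b \<le> lam_neg" if "x0 \<in> Gamma_OP_neg D u"
    proof -
      have "x0 \<notin> frontier (pos_phase D u)" using that by (simp add: Gamma_OP_neg_def)
      from npos[OF this] have "\<forall>\<^sub>F x in nhds x0. - u x \<ge> 0" by simp
      then show ?thesis by (rule touching_below_steep[OF p ln lp lm' x0 u0' le ex(2)])
    qed
    moreover have "\<forall>\<^sub>F x in nhds x0. neg_part Q x = 0" if "x0 \<in> Gamma_OP_pos D u"
    proof -
      have "x0 \<notin> frontier (neg_phase D u)" using that by (simp add: Gamma_OP_pos_def)
      from nneg[OF this] le show ?thesis by eventually_elim (simp add: neg_part_def)
    qed
    moreover have "lam_pos \<le> norm a" if "x0 \<in> Gamma_OP_pos D u \<or> x0 \<in> Gamma_TP D u"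
      by (rule flat) (use that in \<open>auto simp: Gamma_OP_pos_def Gamma_TP_def\<close>)
    ultimately show ?thesis using bal by force
  qed
  from below above show ?case unfolding a_def b_def by blast
qed

end
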